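(* Let $k$ be an algebraically closed field of characteristic $p>0$. Consider pointed Hopf algebras $H$ over $k$ of dimension $p^3$ whose associated graded Hopf algebra $\operatorname{gr}H$ (with respect to the coradical filtration) is isomorphic to $$k\langle a,b,g\rangle/(g^p=1,\ a^p=b^p=0,\ ab=ba,\ ga=ag,\ gb=bg)$$ with $\Delta(g)=g\otimes g$, $\Delta(a)=a\otimes 1+1\otimes a$, $\Delta(b)=b\otimes 1+1\otimes b$. There are five isomorphism classes of such $H$, given by the quotients of the free algebra $k\langle x,y,g\rangle$ by the following relations (where $[u,v]=uv-vu$): (a) $g^p=1$, $x^p=0$, $y^p=0$, $[g,x]=[g,y]=0$, $[x,y]=0$; (b) $g^p=1$, $x^p=x$, $y^p=0$, $[g,x]=[g,y]=0$, $[x,y]=0$; (c) $g^p=1$, $x^p=y$, $y^p=0$, $[g,x]=[g,y]=0$, $[x,y]=0$; (d) $g^p=1$, $x^p=x$, $y^p=y$, $[g,x]=[g,y]=0$, $[x,y]=0$; (e) $g^p=1$, $x^p=x$, $y^p=0$, $[g,x]=[g,y]=0$, $[x,y]=y$; each with coalgebra structure $\Delta(g)=g\otimes g$, $\Delta(x)=x\otimes1+1\otimes x$, $\Delta(y)=y\otimes 1+1\otimes y$.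
   Context: A Hopf algebra $H$ is pointed if its coradical $H_0$ (the sum of all simple subcoalgebras) is the group algebra of its group $G(H)$ of grouplike elements. The coradical filtration is $H_0\subseteq H_1\subseteq\cdots$ with $H_n=\Delta^{-1}(H\otimes H_{n-1}+H_0\otimes H)$, and $\operatorname{gr}H=\bigoplus_{n\ge0}H_n/H_{n-1}$ (with $H_{-1}=0$), a graded Hopf algebra when $H$ is pointed. Counits are given by $\varepsilon(g)=1$ and $\varepsilon=0$ on the other generators; antipodes are then determined. *)

theory Defs
  imports
    "HOL-Library.Poly_Mapping"
    "HOL-Computational_Algebra.Polynomial"
    "Jordan_Normal_Form.VS_Connect"
    "HOL-Algebra.QuotRing"
begin

text \<open>
  The ground field is a type \<open>'k\<close> of class \<open>field\<close>, used as the scalar ring \<open>class_ring\<close>.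
  An algebra over it is a record of type \<^typ>\<open>('k, 'a) module\<close>, which carries a multiplication
  and a unit besides the vector space structure.
\<close>

section \<open>Algebras\<close>

definition k_algebra :: "('k::field, 'a, 'm) module_scheme \<Rightarrow> bool" where
  "k_algebra A \<longleftrightarrow> ring A \<and> vectorspace class_ring A \<and>
     (\<forall>c. \<forall>x\<in>carrier A. \<forall>y\<in>carrier A.
        (c \<odot>\<^bsub>A\<^esub> x) \<otimes>\<^bsub>A\<^esub> y = c \<odot>\<^bsub>A\<^esub> (x \<otimes>\<^bsub>A\<^esub> y) \<and>
        x \<otimes>\<^bsub>A\<^esub> (c \<odot>\<^bsub>A\<^esub> y) = c \<odot>\<^bsub>A\<^esub> (x \<otimes>\<^bsub>A\<^esub> y))"

definition alg_hom ::
  "('k::field, 'a, 'm) module_scheme \<Rightarrow> ('k, 'b, 'n) module_scheme \<Rightarrow> ('a \<Rightarrow> 'b) set" where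
  "alg_hom A B = Ring.ring_hom A B \<inter> LinearCombinations.module_hom class_ring A B"

definition base_alg :: "('k::field, 'k) module" where
  "base_alg = \<lparr>carrier = UNIV, mult = (*), one = 1, zero = 0, add = (+), smult = (*)\<rparr>"

definition monoid_alg :: "('s, 'm) monoid_scheme \<Rightarrow> ('k::field, 's \<Rightarrow>\<^sub>0 'k) module" where
  "monoid_alg M =
     \<lparr>carrier = {f. Poly_Mapping.keys f \<subseteq> carrier M},
      mult = (\<lambda>f g. \<Sum>u\<in>Poly_Mapping.keys f. \<Sum>v\<in>Poly_Mapping.keys g.
                Poly_Mapping.single (u \<otimes>\<^bsub>M\<^esub> v) (Poly_Mapping.lookup f u * Poly_Mapping.lookup g v)),
      one = Poly_Mapping.single \<one>\<^bsub>M\<^esub> 1,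
      zero = 0,
      add = (+),
      smult = (\<lambda>c. Poly_Mapping.map ((*) c))\<rparr>"

text \<open>The library's factor ring, with the induced scalar multiplication.\<close>

definition quot_alg ::
  "('k::field, 'a, 'm) module_scheme \<Rightarrow> 'a set \<Rightarrow> ('k, 'a set) module" where
  "quot_alg A I =
     \<lparr>carrier = carrier (A Quot I), mult = mult (A Quot I), one = one (A Quot I),
      zero = zero (A Quot I), add = add (A Quot I),
      smult = (\<lambda>c S. \<Union>x\<in>S. I +>\<^bsub>A\<^esub> (c \<odot>\<^bsub>A\<^esub> x))\<rparr>"


section \<open>Tensor products\<close>

text \<open>
  The tensor product is the free vector space on pairs modulo the span of the bilinearity
  relators. Since \<open>(v, w) (v', w') = (v v', w w')\<close> in the monoid algebra of the product monoid
  \<open>V \<times>\<times> W\<close>, and the product of a relator with a pair is again a relator, the quotient has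
  the usual multiplication \<open>(v \<otimes> w) (v' \<otimes> w') = v v' \<otimes> w w'\<close>.
\<close>

definition bilinear_relators ::
  "('k::field, 'a, 'm) module_scheme \<Rightarrow> ('k, 'b, 'n) module_scheme \<Rightarrow> ('a \<times> 'b \<Rightarrow>\<^sub>0 'k) set" where
  "bilinear_relators V W =
     {Poly_Mapping.single (v \<oplus>\<^bsub>V\<^esub> v', w) 1 - Poly_Mapping.single (v, w) 1
        - Poly_Mapping.single (v', w) 1 |
        v v' w. v \<in> carrier V \<and> v' \<in> carrier V \<and> w \<in> carrier W} \<union>
     {Poly_Mapping.single (v, w \<oplus>\<^bsub>W\<^esub> w') 1 - Poly_Mapping.single (v, w) 1
        - Poly_Mapping.single (v, w') 1 |
        v w w'. v \<in> carrier V \<and> w \<in> carrier W \<and> w' \<in> carrier W} \<union>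
     {Poly_Mapping.single (c \<odot>\<^bsub>V\<^esub> v, w) 1 - Poly_Mapping.single (v, w) c |
        c v w. v \<in> carrier V \<and> w \<in> carrier W} \<union>
     {Poly_Mapping.single (v, c \<odot>\<^bsub>W\<^esub> w) 1 - Poly_Mapping.single (v, w) c |
        c v w. v \<in> carrier V \<and> w \<in> carrier W}"

definition tensor_null ::
  "('k::field, 'a, 'm) module_scheme \<Rightarrow> ('k, 'b, 'n) module_scheme \<Rightarrow> ('a \<times> 'b \<Rightarrow>\<^sub>0 'k) set" where
  "tensor_null V W =
     LinearCombinations.module.span class_ring (monoid_alg (V \<times>\<times> W)) (bilinear_relators V W)"

definition tensor ::
  "('k::field, 'a, 'm) module_scheme \<Rightarrow> ('k, 'b, 'n) module_scheme \<Rightarrow>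
     ('k, ('a \<times> 'b \<Rightarrow>\<^sub>0 'k) set) module" where
  "tensor V W = quot_alg (monoid_alg (V \<times>\<times> W)) (tensor_null V W)"

definition tensor_class ::
  "('k::field, 'a, 'm) module_scheme \<Rightarrow> ('k, 'b, 'n) module_scheme \<Rightarrow>
     ('a \<times> 'b \<Rightarrow>\<^sub>0 'k) \<Rightarrow> ('a \<times> 'b \<Rightarrow>\<^sub>0 'k) set" where
  "tensor_class V W u = tensor_null V W +>\<^bsub>monoid_alg (V \<times>\<times> W)\<^esub> u"

definition tens ::
  "('k::field, 'a, 'm) module_scheme \<Rightarrow> ('k, 'b, 'n) module_scheme \<Rightarrow>
     'a \<Rightarrow> 'b \<Rightarrow> ('a \<times> 'b \<Rightarrow>\<^sub>0 'k) set" where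
  "tens V W v w = tensor_class V W (Poly_Mapping.single (v, w) 1)"

text \<open>
  The linear map out of a tensor product induced by a bilinear map \<open>\<beta>\<close> with values in \<open>U\<close>.
  All representatives of a tensor give the same value when \<open>\<beta>\<close> is bilinear, so the image
  of a coset is a singleton.
\<close>

definition tensor_lift ::
  "('k::field, 'u, 'm) module_scheme \<Rightarrow> ('a \<Rightarrow> 'b \<Rightarrow> 'u) \<Rightarrow> ('a \<times> 'b \<Rightarrow>\<^sub>0 'k) set \<Rightarrow> 'u" where
  "tensor_lift U \<beta> T =
     the_elem ((\<lambda>t. \<Oplus>\<^bsub>U\<^esub>z\<in>Poly_Mapping.keys t.
                 Poly_Mapping.lookup t z \<odot>\<^bsub>U\<^esub> \<beta> (fst z) (snd z)) ` T)"

text \<open>\<open>f \<otimes> g\<close> with values in \<open>V \<otimes> W\<close>.\<close>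

definition tensor_map ::
  "('k::field, 'c, 'm) module_scheme \<Rightarrow> ('k, 'd, 'n) module_scheme \<Rightarrow>
     ('a \<Rightarrow> 'c) \<Rightarrow> ('b \<Rightarrow> 'd) \<Rightarrow> ('a \<times> 'b \<Rightarrow>\<^sub>0 'k) set \<Rightarrow> ('c \<times> 'd \<Rightarrow>\<^sub>0 'k) set" where
  "tensor_map V W f g = tensor_lift (tensor V W) (\<lambda>a b. tens V W (f a) (g b))"

text \<open>The canonical isomorphism \<open>(U \<otimes> V) \<otimes> W \<rightarrow> U \<otimes> (V \<otimes> W)\<close>.\<close>

definition tensor_assoc ::
  "('k::field, 'a, 'l) module_scheme \<Rightarrow> ('k, 'b, 'm) module_scheme \<Rightarrow> ('k, 'c, 'n) module_scheme \<Rightarrow>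
     (('a \<times> 'b \<Rightarrow>\<^sub>0 'k) set \<times> 'c \<Rightarrow>\<^sub>0 'k) set \<Rightarrow> ('a \<times> ('b \<times> 'c \<Rightarrow>\<^sub>0 'k) set \<Rightarrow>\<^sub>0 'k) set" where
  "tensor_assoc U V W =
     tensor_lift (tensor U (tensor V W))
       (\<lambda>T w. tensor_lift (tensor U (tensor V W))
                (\<lambda>u v. tens U (tensor V W) u (tens V W v w)) T)"


section \<open>Hopf algebras\<close>

record (overloaded) ('k::zero, 'a) hopf = "('k, 'a) module" +
  comult :: "'a \<Rightarrow> ('a \<times> 'a \<Rightarrow>\<^sub>0 'k) set"
  counit :: "'a \<Rightarrow> 'k"

definition bialgebra :: "('k::field, 'a, 'm) hopf_scheme \<Rightarrow> bool" where
  "bialgebra H \<longleftrightarrow> k_algebra H \<and>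
     comult H \<in> alg_hom H (tensor H H) \<and>
     counit H \<in> alg_hom H base_alg \<and>
     (\<forall>c\<in>carrier H.
        tensor_assoc H H H (tensor_map (tensor H H) H (comult H) (\<lambda>b. b) (comult H c))
          = tensor_map H (tensor H H) (\<lambda>a. a) (comult H) (comult H c) \<and>
        tensor_lift H (\<lambda>a b. counit H a \<odot>\<^bsub>H\<^esub> b) (comult H c) = c \<and>
        tensor_lift H (\<lambda>a b. counit H b \<odot>\<^bsub>H\<^esub> a) (comult H c) = c)"

definition antipode :: "('k::field, 'a, 'm) hopf_scheme \<Rightarrow> ('a \<Rightarrow> 'a) \<Rightarrow> bool" where
  "antipode H S \<longleftrightarrow> S \<in> LinearCombinations.module_hom class_ring H H \<and>
     (\<forall>c\<in>carrier H.
        tensor_lift H (\<lambda>a b. S a \<otimes>\<^bsub>H\<^esub> b) (comult H c) = counit H c \<odot>\<^bsub>H\<^esub> \<one>\<^bsub>H\<^esub> \<and>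
        tensor_lift H (\<lambda>a b. a \<otimes>\<^bsub>H\<^esub> S b) (comult H c) = counit H c \<odot>\<^bsub>H\<^esub> \<one>\<^bsub>H\<^esub>)"

text \<open>The antipode of a bialgebra is unique if it exists, so it is not part of the structure.\<close>

definition hopf_algebra :: "('k::field, 'a, 'm) hopf_scheme \<Rightarrow> bool" where
  "hopf_algebra H \<longleftrightarrow> bialgebra H \<and> (\<exists>S. antipode H S)"

text \<open>A bialgebra isomorphism between Hopf algebras automatically preserves the antipodes.\<close>

definition hopf_isomorphic ::
  "('k::field, 'a, 'm) hopf_scheme \<Rightarrow> ('k, 'b, 'n) hopf_scheme \<Rightarrow> bool" where
  "hopf_isomorphic H L \<longleftrightarrow>
     (\<exists>f. f \<in> alg_hom H L \<and> bij_betw f (carrier H) (carrier L) \<and>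
        (\<forall>x\<in>carrier H. comult L (f x) = tensor_map L L f f (comult H x) \<and>
                        counit L (f x) = counit H x))"


section \<open>The coradical filtration and pointedness\<close>

text \<open>The image of \<open>U \<otimes> V\<close> in \<open>H \<otimes> H\<close>, for subspaces \<open>U\<close> and \<open>V\<close> of \<open>H\<close>.\<close>

definition tensor_sub ::
  "('k::field, 'a, 'm) hopf_scheme \<Rightarrow> 'a set \<Rightarrow> 'a set \<Rightarrow> ('a \<times> 'a \<Rightarrow>\<^sub>0 'k) set set" where
  "tensor_sub H U V =
     LinearCombinations.module.span class_ring (tensor H H) {tens H H u v | u v. u \<in> U \<and> v \<in> V}"

definition subcoalgebra :: "('k::field, 'a, 'm) hopf_scheme \<Rightarrow> 'a set \<Rightarrow> bool" where
  "subcoalgebra H C \<longleftrightarrow> VectorSpace.subspace class_ring C H \<and> comult H ` C \<subseteq> tensor_sub H C C"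

definition simple_subcoalgebra :: "('k::field, 'a, 'm) hopf_scheme \<Rightarrow> 'a set \<Rightarrow> bool" where
  "simple_subcoalgebra H C \<longleftrightarrow> subcoalgebra H C \<and> C \<noteq> {\<zero>\<^bsub>H\<^esub>} \<and>
     (\<forall>D. subcoalgebra H D \<and> D \<subseteq> C \<longrightarrow> D = {\<zero>\<^bsub>H\<^esub>} \<or> D = C)"

definition coradical :: "('k::field, 'a, 'm) hopf_scheme \<Rightarrow> 'a set" where
  "coradical H = LinearCombinations.module.span class_ring H (\<Union>{C. simple_subcoalgebra H C})"

definition grouplikes :: "('k::field, 'a, 'm) hopf_scheme \<Rightarrow> 'a set" where
  "grouplikes H = {x \<in> carrier H. comult H x = tens H H x x \<and> counit H x = 1}"

text \<open>
  Grouplike elements are linearly independent, so their span is the group algebra of \<open>G(H)\<close>.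
\<close>

definition pointed :: "('k::field, 'a, 'm) hopf_scheme \<Rightarrow> bool" where
  "pointed H \<longleftrightarrow> coradical H = LinearCombinations.module.span class_ring H (grouplikes H)"

primrec corad_filt :: "('k::field, 'a, 'm) hopf_scheme \<Rightarrow> nat \<Rightarrow> 'a set" where
  "corad_filt H 0 = coradical H"
| "corad_filt H (Suc n) =
     {x \<in> carrier H. comult H x \<in>
        tensor_sub H (carrier H) (corad_filt H n)
          <+>\<^bsub>tensor H H\<^esub> tensor_sub H (coradical H) (carrier H)}"

text \<open>\<open>H\<^bsub>n-1\<^esub>\<close>, with the convention \<open>H\<^bsub>-1\<^esub> = 0\<close>.\<close>

definition filt_below :: "('k::field, 'a, 'm) hopf_scheme \<Rightarrow> nat \<Rightarrow> 'a set" where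
  "filt_below H n = (case n of 0 \<Rightarrow> {\<zero>\<^bsub>H\<^esub>} | Suc m \<Rightarrow> corad_filt H m)"


section \<open>The associated graded Hopf algebra\<close>

text \<open>
  An element of the direct sum of the \<open>H\<^bsub>n\<^esub> / H\<^bsub>n-1\<^esub>\<close> is a family of cosets, all but finitely
  many of which are zero (that is, equal to \<open>H\<^bsub>n-1\<^esub>\<close>).
\<close>

definition gr_class :: "('k::field, 'a, 'm) hopf_scheme \<Rightarrow> nat \<Rightarrow> 'a \<Rightarrow> nat \<Rightarrow> 'a set" where
  "gr_class H n x = (filt_below H)(n := filt_below H n +>\<^bsub>H\<^esub> x)"

definition gr_alg :: "('k::field, 'a, 'm) hopf_scheme \<Rightarrow> ('k, nat \<Rightarrow> 'a set) module" where
  "gr_alg H =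
     \<lparr>carrier = {F. (\<forall>n. F n \<in> (\<lambda>x. filt_below H n +>\<^bsub>H\<^esub> x) ` corad_filt H n) \<and>
                     finite {n. F n \<noteq> filt_below H n}},
      mult = (\<lambda>F F' n. \<Union>x\<in>Pi UNIV F. \<Union>y\<in>Pi UNIV F'.
                filt_below H n +>\<^bsub>H\<^esub> (\<Oplus>\<^bsub>H\<^esub>i\<in>{..n}. x i \<otimes>\<^bsub>H\<^esub> y (n - i))),
      one = gr_class H 0 \<one>\<^bsub>H\<^esub>,
      zero = filt_below H,
      add = (\<lambda>F F' n. F n <+>\<^bsub>H\<^esub> F' n),
      smult = (\<lambda>c F n. \<Union>x\<in>F n. filt_below H n +>\<^bsub>H\<^esub> (c \<odot>\<^bsub>H\<^esub> x))\<rparr>"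

text \<open>
  For \<open>c \<in> H\<^bsub>n\<^esub>\<close> one has \<open>\<Delta>(c) = \<Sum>\<^bsub>i\<le>n\<^esub> t\<^bsub>i\<^esub>\<close> with \<open>t\<^bsub>i\<^esub> \<in> H\<^bsub>i\<^esub> \<otimes> H\<^bsub>n-i\<^esub>\<close>. The comultiplication of
  the graded algebra sends the class of \<open>c\<close> in degree \<open>n\<close> to the sum of the images of the
  \<open>t\<^bsub>i\<^esub>\<close> in \<open>H\<^bsub>i\<^esub>/H\<^bsub>i-1\<^esub> \<otimes> H\<^bsub>n-i\<^esub>/H\<^bsub>n-i-1\<^esub>\<close>. The result depends neither on the chosen decomposition
  nor on the representative \<open>c\<close>, so the set below is a singleton.
\<close>

definition gr_comult_values ::
  "('k::field, 'a, 'm) hopf_scheme \<Rightarrow> nat \<Rightarrow> 'a \<Rightarrow>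
     ((nat \<Rightarrow> 'a set) \<times> (nat \<Rightarrow> 'a set) \<Rightarrow>\<^sub>0 'k) set set" where
  "gr_comult_values H n c =
     {\<Oplus>\<^bsub>tensor (gr_alg H) (gr_alg H)\<^esub>i\<in>{..n}.
        \<Oplus>\<^bsub>tensor (gr_alg H) (gr_alg H)\<^esub>z\<in>Poly_Mapping.keys (t i).
          Poly_Mapping.lookup (t i) z \<odot>\<^bsub>tensor (gr_alg H) (gr_alg H)\<^esub>
            tens (gr_alg H) (gr_alg H) (gr_class H i (fst z)) (gr_class H (n - i) (snd z)) |
      t :: nat \<Rightarrow> ('a \<times> 'a \<Rightarrow>\<^sub>0 'k).
        (\<forall>i\<le>n. Poly_Mapping.keys (t i) \<subseteq> corad_filt H i \<times> corad_filt H (n - i)) \<and>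
        comult H c = tensor_class H H (\<Sum>i\<le>n. t i)}"

definition gr_hopf :: "('k::field, 'a, 'm) hopf_scheme \<Rightarrow> ('k, nat \<Rightarrow> 'a set) hopf" where
  "gr_hopf H =
     \<lparr>carrier = carrier (gr_alg H), mult = mult (gr_alg H), one = one (gr_alg H),
      zero = zero (gr_alg H), add = add (gr_alg H), smult = smult (gr_alg H),
      comult = (\<lambda>F. \<Oplus>\<^bsub>tensor (gr_alg H) (gr_alg H)\<^esub>n\<in>{n. F n \<noteq> filt_below H n}.
                  the_elem (\<Union>c\<in>F n. gr_comult_values H n c)),
      counit = (\<lambda>F. the_elem (counit H ` F 0))\<rparr>"


section \<open>Hopf algebras presented by generators and relations\<close>

datatype gen = Gen_x | Gen_y | Gen_g

definition free_alg :: "('k::field, gen list \<Rightarrow>\<^sub>0 'k) module" where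
  "free_alg = monoid_alg \<lparr>carrier = UNIV, mult = (@), one = []\<rparr>"

definition var :: "gen \<Rightarrow> (gen list \<Rightarrow>\<^sub>0 'k::field)" where
  "var a = Poly_Mapping.single [a] 1"

text \<open>The algebra homomorphism from the free algebra to \<open>B\<close> extending \<open>\<phi>\<close>.\<close>

definition free_eval ::
  "('k::field, 'b, 'm) module_scheme \<Rightarrow> (gen \<Rightarrow> 'b) \<Rightarrow> (gen list \<Rightarrow>\<^sub>0 'k) \<Rightarrow> 'b" where
  "free_eval B \<phi> f =
     (\<Oplus>\<^bsub>B\<^esub>w\<in>Poly_Mapping.keys f.
        Poly_Mapping.lookup f w \<odot>\<^bsub>B\<^esub> foldr (\<lambda>a b. \<phi> a \<otimes>\<^bsub>B\<^esub> b) w \<one>\<^bsub>B\<^esub>)"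

definition pres_alg :: "(gen list \<Rightarrow>\<^sub>0 'k::field) set \<Rightarrow> ('k, (gen list \<Rightarrow>\<^sub>0 'k) set) module" where
  "pres_alg R = quot_alg free_alg (Idl\<^bsub>free_alg\<^esub> R)"

definition pres_var :: "(gen list \<Rightarrow>\<^sub>0 'k::field) set \<Rightarrow> gen \<Rightarrow> (gen list \<Rightarrow>\<^sub>0 'k) set" where
  "pres_var R a = (Idl\<^bsub>free_alg\<^esub> R) +>\<^bsub>free_alg\<^esub> var a"

fun gen_comult ::
  "(gen list \<Rightarrow>\<^sub>0 'k::field) set \<Rightarrow> gen \<Rightarrow>
     ((gen list \<Rightarrow>\<^sub>0 'k) set \<times> (gen list \<Rightarrow>\<^sub>0 'k) set \<Rightarrow>\<^sub>0 'k) set" where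
  "gen_comult R Gen_g = tens (pres_alg R) (pres_alg R) (pres_var R Gen_g) (pres_var R Gen_g)"
| "gen_comult R a =
     tens (pres_alg R) (pres_alg R) (pres_var R a) \<one>\<^bsub>pres_alg R\<^esub>
       \<oplus>\<^bsub>tensor (pres_alg R) (pres_alg R)\<^esub>
     tens (pres_alg R) (pres_alg R) \<one>\<^bsub>pres_alg R\<^esub> (pres_var R a)"

fun gen_counit :: "gen \<Rightarrow> 'k::field" where
  "gen_counit Gen_g = 1"
| "gen_counit a = 0"

text \<open>
  The comultiplication and the counit are the algebra maps with the above values on generators.
  They are evaluated on a representative in the free algebra, and the value does not depend
  on it when the relators in \<open>R\<close> are respected.
\<close>

definition pres_hopf :: "(gen list \<Rightarrow>\<^sub>0 'k::field) set \<Rightarrow> ('k, (gen list \<Rightarrow>\<^sub>0 'k) set) hopf" where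
  "pres_hopf R =
     \<lparr>carrier = carrier (pres_alg R), mult = mult (pres_alg R), one = one (pres_alg R),
      zero = zero (pres_alg R), add = add (pres_alg R), smult = smult (pres_alg R),
      comult = (\<lambda>\<xi>. the_elem (free_eval (tensor (pres_alg R) (pres_alg R)) (gen_comult R) ` \<xi>)),
      counit = (\<lambda>\<xi>. the_elem (free_eval base_alg gen_counit ` \<xi>))\<rparr>"

definition commutator ::
  "(gen list \<Rightarrow>\<^sub>0 'k::field) \<Rightarrow> (gen list \<Rightarrow>\<^sub>0 'k) \<Rightarrow> (gen list \<Rightarrow>\<^sub>0 'k)" where
  "commutator u v = u \<otimes>\<^bsub>free_alg\<^esub> v - v \<otimes>\<^bsub>free_alg\<^esub> u"

text \<open>A relation \<open>u = v\<close> is encoded by the relator \<open>u - v\<close>.\<close>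

definition graded_relators :: "nat \<Rightarrow> (gen list \<Rightarrow>\<^sub>0 'k::field) set" where
  "graded_relators p = (let a = var Gen_x; b = var Gen_y; g = var Gen_g in
     {g [^]\<^bsub>free_alg\<^esub> p - \<one>\<^bsub>free_alg\<^esub>, a [^]\<^bsub>free_alg\<^esub> p, b [^]\<^bsub>free_alg\<^esub> p,
      commutator a b, commutator g a, commutator g b})"

datatype label = Case_a | Case_b | Case_c | Case_d | Case_e

fun relators :: "nat \<Rightarrow> label \<Rightarrow> (gen list \<Rightarrow>\<^sub>0 'k::field) set" where
  "relators p Case_a = (let x = var Gen_x; y = var Gen_y; g = var Gen_g in
     {g [^]\<^bsub>free_alg\<^esub> p - \<one>\<^bsub>free_alg\<^esub>, x [^]\<^bsub>free_alg\<^esub> p, y [^]\<^bsub>free_alg\<^esub> p,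
      commutator g x, commutator g y, commutator x y})"
| "relators p Case_b = (let x = var Gen_x; y = var Gen_y; g = var Gen_g in
     {g [^]\<^bsub>free_alg\<^esub> p - \<one>\<^bsub>free_alg\<^esub>, x [^]\<^bsub>free_alg\<^esub> p - x, y [^]\<^bsub>free_alg\<^esub> p,
      commutator g x, commutator g y, commutator x y})"
| "relators p Case_c = (let x = var Gen_x; y = var Gen_y; g = var Gen_g in
     {g [^]\<^bsub>free_alg\<^esub> p - \<one>\<^bsub>free_alg\<^esub>, x [^]\<^bsub>free_alg\<^esub> p - y, y [^]\<^bsub>free_alg\<^esub> p,
      commutator g x, commutator g y, commutator x y})"
| "relators p Case_d = (let x = var Gen_x; y = var Gen_y; g = var Gen_g in
     {g [^]\<^bsub>free_alg\<^esub> p - \<one>\<^bsub>free_alg\<^esub>, x [^]\<^bsub>free_alg\<^esub> p - x, y [^]\<^bsub>free_alg\<^esub> p - y,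
      commutator g x, commutator g y, commutator x y})"
| "relators p Case_e = (let x = var Gen_x; y = var Gen_y; g = var Gen_g in
     {g [^]\<^bsub>free_alg\<^esub> p - \<one>\<^bsub>free_alg\<^esub>, x [^]\<^bsub>free_alg\<^esub> p - x, y [^]\<^bsub>free_alg\<^esub> p,
      commutator g x, commutator g y, commutator x y - y})"

definition in_family :: "nat \<Rightarrow> ('k::field, 'a, 'm) hopf_scheme \<Rightarrow> bool" where
  "in_family p H \<longleftrightarrow>
     hopf_algebra H \<and> pointed H \<and>
     vectorspace.fin_dim class_ring H \<and> vectorspace.dim class_ring H = p ^ 3 \<and>
     hopf_isomorphic (gr_hopf H) (pres_hopf (graded_relators p))"

end

(*
  All five families are of the form u(L) \<otimes> k[C_p], with L a restricted Lie algebra of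
  dimension two. If gr H is the given algebra, then its grouplike generator lifts to a central
  grouplike g of H, and its primitive generators lift to primitive elements: a lift x of degree
  one has \<Delta>(x) = x \<otimes> 1 + 1 \<otimes> x + t with t in H_0 \<otimes> H_0, and convolution
  with a functional e that is 1 at the unit and 0 at the other grouplikes replaces x by a
  primitive element of the same class. The products g^s x^j y^l (s, j, l < p) then form a basis,
  the primitive elements are the span of x and y, and it remains to classify restricted Lie
  algebras of dimension two over an algebraically closed field.

  Identities in tensor products are checked by evaluating bilinear forms: for functionals f and h
  the convolution (f \<otimes> h) \<Delta> is again a functional, and in finite dimension
  the products f \<otimes> h separate the points of H \<otimes> H.
*)
theory Submission
 imports Defs
begin

section \<open>Functionals on vector spaces\<close>

text \<open>The obstacle is linear independence of the \<open>p ^ 3\<close> monomials: the presented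
  algebras are quotients of a free algebra, and for the lifts to H the relations are at first
  unknown. No rewriting system is used; the coalgebra does the work. In characteristic p,
  functionals dual to \<open>g^s\<close>, \<open>g^s x\<close> and \<open>g^s y\<close> convolve to
  nonzero multiples of functionals dual to all monomials with exponents below p, modulo monomials of
  higher degree. So two facts suffice: the powers of g are distinct, and x, y are linearly
  independent. Two small representations show them for the presented algebras, and H inherits them
  from gr H. Once the basis is there, \<Delta> and the filtration depend on exponents alone, so one
  computation serves the five families and every H. On the dual side the filtration is given by
  powers of the ideal of functionals that vanish on grouplike elements; this makes product and
  coproduct of gr H well defined. Algebraic closedness enters through roots of polynomials that
  rescale primitive elements, and the families are told apart by commutativity and by when the p-th
  power map, or its square, vanishes or has trivial kernel.\<close>

definition dual :: "('k::field, 'a, 'm) module_scheme => ('a => 'k) set" where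
 "dual V = {\<phi>. (\<forall>x\<in>carrier V. \<forall>y\<in>carrier V. \<phi> (x \<oplus>\<^bsub>V\<^esub> y) = \<phi> x + \<phi> y) &
        (\<forall>c. \<forall>x\<in>carrier V. \<phi> (c \<odot>\<^bsub>V\<^esub> x) = c * \<phi> x)}"

definition subsp :: "('k::field, 'a, 'm) module_scheme => 'a set => bool" where
 "subsp V U \<longleftrightarrow> U <= carrier V & \<zero>\<^bsub>V\<^esub> \<in> U & (\<forall>x\<in>U. \<forall>y\<in>U. x \<oplus>\<^bsub>V\<^esub> y \<in> U) & (\<forall>c. \<forall>x\<in>U. c \<odot>\<^bsub>V\<^esub> x \<in> U)"

definition ann :: "('k::field, 'a, 'm) module_scheme => 'a set => ('a => 'k) set" where
 "ann V U = {\<phi> \<in> dual V. \<forall>u\<in>U. \<phi> u = 0}"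

lemma dual_add: "\<phi> \<in> dual V ==> x \<in> carrier V ==> y \<in> carrier V ==> \<phi> (x \<oplus>\<^bsub>V\<^esub> y) = \<phi> x + \<phi> y"
 by (simp add: dual_def)

lemma dual_smult: "\<phi> \<in> dual V ==> x \<in> carrier V ==> \<phi> (c \<odot>\<^bsub>V\<^esub> x) = c * \<phi> x"
 by (simp add: dual_def)

lemma annD: "\<phi> \<in> ann V U ==> \<phi> \<in> dual V" "\<phi> \<in> ann V U ==> u \<in> U ==> \<phi> u = 0"
 by (auto simp: ann_def)

abbreviation vsp :: "('k::field, 'a, 'm) module_scheme => bool" where
 "vsp V \<equiv> vectorspace class_ring V"

abbreviation lspan :: "('k::field, 'a, 'm) module_scheme => 'a set => 'a set" where
 "lspan V S \<equiv> LinearCombinations.module.span class_ring V S"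

text \<open>The scalar ring is the record \<open>class_ring\<close>; the rewrites replace its
  operations by those of the type class, so that scalars are handled by ordinary field
  arithmetic.\<close>

locale vspace =
 fixes V :: "('k::field, 'a, 'm) module_scheme" (structure)
 assumes vs: "vsp V"
begin

sublocale vectorspace class_ring V
 rewrites "carrier class_ring = UNIV"
  and "mult class_ring = (*)"
  and "add class_ring = (+)"
  and "one class_ring = 1"
  and "zero class_ring = 0"
 by (rule vs) simp_all

lemma dual_zero: "\<phi> \<in> dual V ==> \<phi> \<zero> = 0"
 using dual_smult[of \<phi> V \<zero> 0] by (simp add: smult_l_null)

lemma dual_neg: "\<phi> \<in> dual V ==> x \<in> carrier V ==> \<phi> (\<ominus> x) = - \<phi> x"
 using dual_add[of \<phi> V x "\<ominus> x"] by (simp add: r_neg dual_zero eq_neg_iff_add_eq_0 add.commute)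

lemma dual_minus: "\<phi> \<in> dual V ==> x \<in> carrier V ==> y \<in> carrier V ==> \<phi> (x \<ominus> y) = \<phi> x - \<phi> y"
 by (simp add: a_minus_def dual_add dual_neg)

lemma dual_finsum:
 assumes "\<phi> \<in> dual V" "f \<in> A \<rightarrow> carrier V"
 shows "\<phi> (finsum V f A) = (\<Sum>a\<in>A. \<phi> (f a))"
 using assms(2)
proof (induction A rule: infinite_finite_induct)
 case (infinite A)
 then show ?case by (simp add: dual_zero assms(1) finsum_infinite)
qed (auto simp: dual_zero assms(1) dual_add finsum_closed Pi_iff)

lemma subspace_iff: "VectorSpace.subspace class_ring U V \<longleftrightarrow> subsp V U"
 using vs is_module vectorspace.axioms(1)[OF vs]
 unfolding VectorSpace.subspace_def submodule_def subsp_def by auto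

lemma subsp_span: "S <= carrier V ==> subsp V (lspan V S)"
 using span_is_subspace subspace_iff by blast

lemma span_base: "S <= carrier V ==> x \<in> S ==> x \<in> lspan V S"
 using in_own_span by auto

lemma subsp_finsum:
 assumes "subsp V U" "f \<in> A \<rightarrow> U"
 shows "finsum V f A \<in> U"
 using assms(2)
proof (induction A rule: infinite_finite_induct)
 case (infinite A)
 then show ?case using assms by (simp add: finsum_infinite subsp_def)
next
 case empty
 then show ?case using assms by (simp add: subsp_def)
next
 case (insert a F)
 moreover have "f \<in> F \<rightarrow> carrier V" "f a \<in> carrier V" using insert assms by (auto simp: subsp_def)
 ultimately show ?case using assms by (auto simp: subsp_def finsum_insert)
qed

lemma span_least: "subsp V U ==> S \<subseteq> U ==> lspan V S \<subseteq> U"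
 by (auto simp: span_def lincomb_def intro!: subsp_finsum) (auto simp: subsp_def)

lemma subspD:
 assumes "subsp V U"
 shows "x \<in> U ==> x \<in> carrier V" "\<zero> \<in> U" "x \<in> U ==> y \<in> U ==> x \<oplus> y \<in> U" "x \<in> U ==> c \<odot> x \<in> U"
 using assms by (auto simp: subsp_def)

lemma neg_smult: "x \<in> carrier V ==> \<ominus> x = (-1) \<odot> x"
 using smult_l_minus[of 1 x] by (simp add: class_ring_simps)

lemma subsp_neg: "subsp V U ==> x \<in> U ==> \<ominus> x \<in> U"
 by (metis neg_smult subspD(1) subspD(4))

lemma subsp_minus: "subsp V U ==> x \<in> U ==> y \<in> U ==> x \<ominus> y \<in> U"
 by (simp add: a_minus_def subsp_neg subspD(3))

lemma span_induct [consumes 2, case_names base zero add smult]: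
 assumes "x \<in> lspan V S" "S <= carrier V"
  and "!!x. x \<in> S ==> P x" "P \<zero>"
  and "!!x y. x \<in> carrier V ==> y \<in> carrier V ==> P x ==> P y ==> P (x \<oplus> y)"
  and "!!c x. x \<in> carrier V ==> P x ==> P (c \<odot> x)"
 shows "P x"
proof -
 have "lspan V S \<subseteq> {x \<in> carrier V. P x}"
  using assms(2-) by (intro span_least) (auto simp: subsp_def)
 then show ?thesis using assms(1) by auto
qed

lemma dual_span_zero:
 assumes "\<phi> \<in> dual V" "S <= carrier V" "!!s. s \<in> S ==> \<phi> s = 0" "x \<in> lspan V S"
 shows "\<phi> x = 0"
 using assms(4,2) by (induction rule: span_induct) (auto simp: assms dual_zero dual_add dual_smult)

lemma dual_span_eq:
 assumes "\<phi> \<in> dual V" "\<psi> \<in> dual V" "S <= carrier V" "!!s. s \<in> S ==> \<phi> s = \<psi> s" "x \<in> lspan V S"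
 shows "\<phi> x = \<psi> x"
 using assms(5,3) by (induction rule: span_induct) (auto simp: assms dual_zero dual_add dual_smult)

lemma ann_span: "S <= carrier V ==> ann V (lspan V S) = ann V S"
 using span_base dual_span_zero by (fastforce simp: ann_def)

lemma subsp_zero: "subsp V {\<zero>}"
 by (auto simp: subsp_def smult_r_null)

lemma subsp_carrier: "subsp V (carrier V)"
 by (auto simp: subsp_def)

lemma dual_closed:
 "\<phi> \<in> dual V ==> \<psi> \<in> dual V ==> (%x. \<phi> x + \<psi> x) \<in> dual V"
 "\<phi> \<in> dual V ==> \<psi> \<in> dual V ==> (%x. \<phi> x - \<psi> x) \<in> dual V"
 "\<phi> \<in> dual V ==> (%x. c * \<phi> x) \<in> dual V"
 "\<phi> \<in> dual V ==> (%x. \<phi> x * c) \<in> dual V"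
 "(%x. 0) \<in> dual V"
 by (auto simp: dual_def algebra_simps)

lemma dual_sum: "(!!a. a \<in> A ==> f a \<in> dual V) ==> (%x. \<Sum>a\<in>A. f a x) \<in> dual V"
 by (auto simp: dual_def sum.distrib sum_distrib_left)

end

lemma dual_comp:
 assumes "f \<in> carrier V \<rightarrow> carrier W" "!!x y. x \<in> carrier V ==> y \<in> carrier V ==> f (x \<oplus>\<^bsub>V\<^esub> y) = f x \<oplus>\<^bsub>W\<^esub> f y"
  "!!c x. x \<in> carrier V ==> f (c \<odot>\<^bsub>V\<^esub> x) = c \<odot>\<^bsub>W\<^esub> f x" "\<phi> \<in> dual W"
 shows "(%x. \<phi> (f x)) \<in> dual V"
 using assms by (auto simp: dual_def Pi_iff)

abbreviation lin_maps :: "('k::field, 'a, 'm) module_scheme => ('k, 'b, 'n) module_scheme => ('a => 'b) set" where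
 "lin_maps V W \<equiv> LinearCombinations.module_hom class_ring V W"

lemma lin_maps_iff: "f \<in> lin_maps V W \<longleftrightarrow> f \<in> carrier V \<rightarrow> carrier W &
  (\<forall>x\<in>carrier V. \<forall>y\<in>carrier V. f (x \<oplus>\<^bsub>V\<^esub> y) = f x \<oplus>\<^bsub>W\<^esub> f y) & (\<forall>c. \<forall>x\<in>carrier V. f (c \<odot>\<^bsub>V\<^esub> x) = c \<odot>\<^bsub>W\<^esub> f x)"
 unfolding LinearCombinations.module_hom_def by auto

lemma lin_mapsD:
 assumes "f \<in> lin_maps V W"
 shows "x \<in> carrier V ==> f x \<in> carrier W" "x \<in> carrier V ==> y \<in> carrier V ==> f (x \<oplus>\<^bsub>V\<^esub> y) = f x \<oplus>\<^bsub>W\<^esub> f y"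
  "x \<in> carrier V ==> f (c \<odot>\<^bsub>V\<^esub> x) = c \<odot>\<^bsub>W\<^esub> f x"
 using assms by (auto simp: lin_maps_iff)

lemma dual_lin: "f \<in> lin_maps V W ==> \<phi> \<in> dual W ==> (%x. \<phi> (f x)) \<in> dual V"
 by (rule dual_comp) (auto simp: lin_maps_iff)

lemma lin_maps_comp: "f \<in> lin_maps V W ==> g \<in> lin_maps W X ==> (%x. g (f x)) \<in> lin_maps V X"
 by (auto simp: lin_maps_iff Pi_iff)

lemma lin_maps_zero:
 assumes "vsp V" "vsp W" "f \<in> lin_maps V W"
 shows "f \<zero>\<^bsub>V\<^esub> = \<zero>\<^bsub>W\<^esub>"
proof -
 interpret V: vspace V by (rule vspace.intro) fact
 interpret W: vspace W by (rule vspace.intro) fact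
 show ?thesis using lin_mapsD(3)[OF assms(3), of "\<zero>\<^bsub>V\<^esub>" 0] lin_mapsD(1)[OF assms(3)]
  by (simp add: V.smult_l_null W.smult_l_null)
qed

text \<open>Tensor products, the endomorphism algebra of sequences and the graded algebra are used
  without a bound on their dimension. Separation of points by functionals is what the equational
  arguments ask for, and it is shown for each of these spaces directly.\<close>

locale sep_space = vspace +
 assumes sep: "x \<in> carrier V ==> y \<in> carrier V ==> (!!\<phi>. \<phi> \<in> dual V ==> \<phi> x = \<phi> y) ==> x = y"

lemma lin_mapsI_sep:
 assumes "vsp V" "sep_space W" "f \<in> carrier V \<rightarrow> carrier W" "!!\<phi>. \<phi> \<in> dual W ==> (%x. \<phi> (f x)) \<in> dual V"
 shows "f \<in> lin_maps V W"
proof -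
 interpret V: vspace V by (rule vspace.intro) fact
 interpret W: sep_space W by fact
 show ?thesis
  unfolding lin_maps_iff
 proof (intro conjI ballI allI)
  fix x y assume xy: "x \<in> carrier V" "y \<in> carrier V"
  show "f (x \<oplus>\<^bsub>V\<^esub> y) = f x \<oplus>\<^bsub>W\<^esub> f y"
   using xy assms(3) dual_add[OF assms(4)] by (intro W.sep) (auto simp: dual_add[of _ W] Pi_iff)
  fix c show "f (c \<odot>\<^bsub>V\<^esub> x) = c \<odot>\<^bsub>W\<^esub> f x"
   using xy assms(3) dual_smult[OF assms(4)] by (intro W.sep) (auto simp: dual_smult[of _ W] Pi_iff)
 qed (use assms in auto)
qed

subsection \<open>Finite dimension\<close>

locale fd_space = vspace +
 assumes fd: fin_dim
begin

text \<open>A complement of a subspace is obtained by extending a basis of the subspace.\<close>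

lemma adapted_basis:
 assumes U: "subsp V U"
 obtains A B where "finite B" "A \<subseteq> B" "basis B" "A \<subseteq> U" "U <= lspan V A"
proof -
 have UV: "U <= carrier V" using U by (auto simp: subsp_def)
 have fin: "finite S & card S \<le> dim" if "S <= carrier V" "lin_indpt S" for S
  using li_le_dim[OF fd] that by auto
 have e: "lin_indpt {}" by (auto simp: lin_dep_def)
 obtain A where A: "maximal A (%S. S \<subseteq> U & lin_indpt S)"
  using maximal_exists[of "%S. S \<subseteq> U & lin_indpt S" dim "{}"] e UV fin by (metis (no_types, lifting) empty_subsetI order_trans)
 then have A': "A \<subseteq> U" "lin_indpt A" by (auto simp: maximal_def)
 have fA: "finite A" using fin A' UV by auto
 have sp: "U <= lspan V A"
 proof
  fix u assume u: "u \<in> U"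
  show "u \<in> lspan V A"
  proof (rule ccontr)
   assume n: "u \<notin> lspan V A"
   have nA: "u \<notin> A" using n span_base[of A u] A' UV by auto
   have "lin_indpt (insert u A)"
    using lin_dep_iff_in_span[of A u] A' UV u n nA by auto
   then have "insert u A = A" using A A' u by (auto simp: maximal_def)
   then show False using nA by auto
  qed
 qed
 obtain B where B: "maximal B (%S. A \<subseteq> S & S <= carrier V & lin_indpt S)"
  using maximal_exists[of "%S. A \<subseteq> S & S <= carrier V & lin_indpt S" dim A] A' UV fin by blast
 have "maximal B (%S. S <= carrier V & lin_indpt S)"
 proof -
  have B1: "A \<subseteq> B" "B <= carrier V" "lin_indpt B" using B by (simp_all add: maximal_def)
  have B2: "C = B" if "B \<subseteq> C" "A \<subseteq> C" "C <= carrier V" "lin_indpt C" for C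
   using B that unfolding maximal_def by simp
  have "C = B" if "B \<subseteq> C" "C <= carrier V" "lin_indpt C" for C
   using B2[of C] that B1(1) by simp
  then show ?thesis using B1 unfolding maximal_def by simp
 qed
 then have "basis B" by (rule max_li_is_basis)
 moreover have "A \<subseteq> B" "finite B" using B fin[of B] by (simp_all add: maximal_def)
 ultimately show ?thesis using that[of B A] A' sp by simp
qed

text \<open>Coordinates are read off from the unique coefficient function of a vector; uniqueness
  makes them additive and homogeneous.\<close>

lemma coordinates:
 assumes "basis B" "finite B"
 obtains \<delta> where "!!b. b \<in> B ==> \<delta> b \<in> dual V" "!!b b'. b \<in> B ==> b' \<in> B ==> \<delta> b b' = (if b = b' then 1 else 0)"
  "!!v. v \<in> carrier V ==> v = (\<Oplus>b\<in>B. \<delta> b v \<odot> b)"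
proof -
 have Bc: "B <= carrier V" using assms by (auto simp: basis_def)
 have ex1: "\<exists>!a. a \<in> B \<rightarrow>\<^sub>E UNIV & lincomb a B = v" if "v \<in> carrier V" for v
  using basis_criterion[OF assms(2) Bc] assms(1) that by simp
 define cr where "cr v = (THE a. a \<in> B \<rightarrow>\<^sub>E UNIV & lincomb a B = v)" for v
 have cr: "cr v \<in> B \<rightarrow>\<^sub>E UNIV" "lincomb (cr v) B = v" if "v \<in> carrier V" for v
  using theI'[OF ex1[OF that]] by (auto simp: cr_def)
 have cru: "cr v b = a b" if "v \<in> carrier V" "lincomb a B = v" "b \<in> B" for a v b
 proof -
  \<comment> \<open>The uniqueness criterion speaks of coefficient functions that are
    \<open>undefined\<close> off \<open>B\<close>, hence the passage to the restriction.\<close>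
  have "lincomb (restrict a B) B = v" using that(2) Bc lincomb_cong[of B B "restrict a B" a] by auto
  then have "cr v = restrict a B"
   using ex1[OF that(1)] cr[OF that(1)] by (auto simp: PiE_def)
  then show ?thesis using that by auto
 qed
 define \<delta> where "\<delta> b v = cr v b" for b v
 have lc: "lincomb a B = (\<Oplus>b\<in>B. a b \<odot> b)" for a by (simp add: lincomb_def)
 show ?thesis
 proof
  fix b assume b: "b \<in> B"
  show "\<delta> b \<in> dual V"
   unfolding dual_def
  proof (safe)
   fix x y assume xy: "x \<in> carrier V" "y \<in> carrier V"
   have "lincomb (%b. cr x b + cr y b) B = x \<oplus> y"
    using lincomb_sum[OF assms(2) Bc, of "cr x" "cr y"] cr xy by simp
   then show "\<delta> b (x \<oplus> y) = \<delta> b x + \<delta> b y" using cru[OF _ _ b, of "x \<oplus> y"] xy by (auto simp: \<delta>_def)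
   fix c
   have "lincomb (%b. c * cr x b) B = c \<odot> x"
    using lincomb_smult[OF Bc, of "cr x" c] cr xy by simp
   then show "\<delta> b (c \<odot> x) = c * \<delta> b x" using cru[OF _ _ b, of "c \<odot> x"] xy by (auto simp: \<delta>_def)
  qed
 next
  fix b b' assume b: "b \<in> B" "b' \<in> B"
  have "lincomb (%b. if b = b' then 1 else 0) B = (\<Oplus>b\<in>B. if b' = b then b else \<zero>)"
   unfolding lc using Bc by (intro finsum_cong') (auto simp: smult_l_null)
  also have "... = b'" using finsum_singleton[OF b(2) assms(2), of "%b. b"] Bc by auto
  finally show "\<delta> b b' = (if b = b' then 1 else 0)" using cru[of b' _ b] b Bc by (auto simp: \<delta>_def)
 next
  fix v assume "v \<in> carrier V"
  then show "v = (\<Oplus>b\<in>B. \<delta> b v \<odot> b)" using cr(2) unfolding lc \<delta>_def by simp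
 qed
qed

lemma dual_basis:
 obtains B \<delta> where "finite B" "B <= carrier V" "!!b. b \<in> B ==> \<delta> b \<in> dual V"
  "!!b b'. b \<in> B ==> b' \<in> B ==> \<delta> b b' = (if b = b' then 1 else 0)"
  "!!v. v \<in> carrier V ==> v = (\<Oplus>b\<in>B. \<delta> b v \<odot> b)"
  "!!v \<phi>. v \<in> carrier V ==> \<phi> \<in> dual V ==> \<phi> v = (\<Sum>b\<in>B. \<delta> b v * \<phi> b)"
proof -
 obtain B where B: "finite B" "basis B" using finite_basis_exists[OF fd] by auto
 obtain \<delta> where d: "!!b. b \<in> B ==> \<delta> b \<in> dual V" "!!b b'. b \<in> B ==> b' \<in> B ==> \<delta> b b' = (if b = b' then 1 else 0)"
  "!!v. v \<in> carrier V ==> v = (\<Oplus>b\<in>B. \<delta> b v \<odot> b)" using coordinates[OF B(2,1)] by blast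
 have Bc: "B <= carrier V" using B by (auto simp: basis_def)
 have "\<phi> v = (\<Sum>b\<in>B. \<delta> b v * \<phi> b)" if "v \<in> carrier V" "\<phi> \<in> dual V" for v \<phi>
 proof -
  have "\<phi> v = \<phi> (\<Oplus>b\<in>B. \<delta> b v \<odot> b)" by (rule arg_cong[OF d(3)[OF that(1)]])
  also have "... = (\<Sum>b\<in>B. \<phi> (\<delta> b v \<odot> b))" using Bc that by (intro dual_finsum) auto
  also have "... = (\<Sum>b\<in>B. \<delta> b v * \<phi> b)" using Bc that by (intro sum.cong) (auto simp: dual_smult)
  finally show ?thesis .
 qed
 then show ?thesis using that[OF B(1) Bc d] by blast
qed

text \<open>In a basis that extends a basis \<open>A\<close> of \<open>U\<close>, keep the
  coordinates at \<open>A\<close> and drop the others.\<close>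

lemma projection:
 assumes U: "subsp V U"
 obtains P where "P \<in> lin_maps V V" "!!v. v \<in> carrier V ==> P v \<in> U" "!!u. u \<in> U ==> P u = u"
proof -
 obtain A B where AB: "finite B" "A \<subseteq> B" "basis B" "A \<subseteq> U" "U <= lspan V A"
  by (rule adapted_basis[OF U])
 obtain \<delta> where d: "!!b. b \<in> B ==> \<delta> b \<in> dual V" "!!b b'. b \<in> B ==> b' \<in> B ==> \<delta> b b' = (if b = b' then 1 else 0)"
  "!!v. v \<in> carrier V ==> v = (\<Oplus>b\<in>B. \<delta> b v \<odot> b)" using coordinates[OF AB(3,1)] by blast
 have Bc: "B <= carrier V" and UV: "U <= carrier V" using AB(3) U by (auto simp: basis_def subsp_def)
 define P where "P v = (\<Oplus>b\<in>A. \<delta> b v \<odot> b)" for v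
 have fA: "finite A" by (rule finite_subset[OF AB(2,1)])
 have dA: "\<delta> b \<in> dual V" "b \<in> carrier V" if "b \<in> A" for b using that d(1) AB(2) Bc by auto
 have PU: "P v \<in> U" for v unfolding P_def using AB(4) U by (intro subsp_finsum) (auto simp: subsp_def)
 have Plin: "P \<in> lin_maps V V"
  unfolding lin_maps_iff
 proof (intro conjI ballI allI)
  fix x y assume xy: "x \<in> carrier V" "y \<in> carrier V"
  have "P (x \<oplus> y) = (\<Oplus>b\<in>A. \<delta> b x \<odot> b \<oplus> \<delta> b y \<odot> b)"
   unfolding P_def using dA xy by (intro finsum_cong') (auto simp: dual_add smult_l_distr)
  also have "... = P x \<oplus> P y" unfolding P_def using dA by (intro finsum_addf) auto
  finally show "P (x \<oplus> y) = P x \<oplus> P y" .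
  fix c
  have "P (c \<odot> x) = (\<Oplus>b\<in>A. c \<odot> (\<delta> b x \<odot> b))"
   unfolding P_def using dA xy by (intro finsum_cong') (auto simp: dual_smult smult_assoc1)
  also have "... = c \<odot> P x" unfolding P_def using dA fA by (intro finsum_smult[symmetric]) auto
  finally show "P (c \<odot> x) = c \<odot> P x" .
 qed (use PU UV in auto)
 have Pu: "P u = u" if u: "u \<in> U" for u
 proof -
  \<comment> \<open>The coordinates outside \<open>A\<close> vanish on the span of \<open>A\<close>,
    so the sum may be extended to the whole basis.\<close>
  have "P u = (\<Oplus>b\<in>B. \<delta> b u \<odot> b)"
   unfolding P_def
  proof (rule add.finprod_mono_neutral_cong_left[OF AB(1,2)])
   fix b assume b: "b \<in> B - A"
   have "\<delta> b a = 0" if "a \<in> A" for a using d(2)[of b a] b AB(2) that by auto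
   moreover have "u \<in> lspan V A" "A <= carrier V" "\<delta> b \<in> dual V" using AB(2,5) u Bc b d(1) by auto
   ultimately have "\<delta> b u = 0" using dual_span_zero[of "\<delta> b" A u] by blast
   then show "\<delta> b u \<odot> b = \<zero>" using b Bc by (simp add: smult_l_null subset_iff)
  qed (use Bc in auto)
  then show ?thesis using d(3)[of u, symmetric] u UV by (simp add: subset_iff)
 qed
 show ?thesis using that Plin PU Pu by blast
qed

sublocale sep_space
proof
 fix x y assume xy: "x \<in> carrier V" "y \<in> carrier V" "!!\<phi>. \<phi> \<in> dual V ==> \<phi> x = \<phi> y"
 obtain B \<delta> where B: "B <= carrier V" "!!b. b \<in> B ==> \<delta> b \<in> dual V" "!!v. v \<in> carrier V ==> v = (\<Oplus>b\<in>B. \<delta> b v \<odot> b)"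
  by (rule dual_basis) blast
 have e: "\<delta> b x = \<delta> b y" if "b \<in> B" for b using xy(3) B(2) that by blast
 have "x = (\<Oplus>b\<in>B. \<delta> b x \<odot> b)" by (rule B(3)[OF xy(1)])
 also have "... = (\<Oplus>b\<in>B. \<delta> b y \<odot> b)" using B(1) by (intro finsum_cong') (auto simp: e)
 also have "... = y" by (rule B(3)[OF xy(2), symmetric])
 finally show "x = y" .
qed

text \<open>With P a projection onto U, the functional \<psi> - \<psi> P kills U; take \<psi> that
  distinguishes v from P v and rescale.\<close>

lemma separating_functional:
 assumes "subsp V U" "v \<in> carrier V" "v \<notin> U"
 obtains \<phi> where "\<phi> \<in> ann V U" "\<phi> v = 1"
proof -
 obtain P where P: "P \<in> lin_maps V V" "!!v. v \<in> carrier V ==> P v \<in> U" "!!u. u \<in> U ==> P u = u"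
  by (rule projection[OF assms(1)]) blast
 have "P v ~= v" using P assms by metis
 then obtain \<psi> where \<psi>: "\<psi> \<in> dual V" "\<psi> (P v) ~= \<psi> v"
  using sep assms lin_mapsD(1)[OF P(1)] by blast
 define \<phi> where "\<phi> x = (\<psi> x - \<psi> (P x)) / (\<psi> v - \<psi> (P v))" for x
 have "\<phi> \<in> dual V" using dual_closed(4)[OF dual_closed(2)[OF \<psi>(1) dual_lin[OF P(1) \<psi>(1)]]]
  unfolding \<phi>_def by (simp add: divide_inverse)
 then have "\<phi> \<in> ann V U" "\<phi> v = 1" using \<psi> P by (auto simp: ann_def \<phi>_def)
 then show ?thesis using that by auto
qed

text \<open>The double annihilator of a subspace is the subspace itself. Membership proofs below are
  turned into vanishing statements about functionals.\<close>

lemma in_subsp_iff: "subsp V U ==> v \<in> carrier V ==> v \<in> U \<longleftrightarrow> (\<forall>\<phi>\<in>ann V U. \<phi> v = 0)"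
 by (metis annD(2) separating_functional zero_neq_one)

text \<open>Independence is phrased through functionals, the form in which relations arise below. A
  functional that kills the other vectors and is 1 at \<open>b i\<close> exists unless
  \<open>b i\<close> lies in their span, and that would be a relation with coefficient -1 at
  \<open>i\<close>.\<close>

lemma functional_on_family:
 assumes I: "finite I" "!!i. i \<in> I ==> b i \<in> carrier V"
  and indep: "!!c. (!!\<phi>. \<phi> \<in> dual V ==> (\<Sum>i\<in>I. c i * \<phi> (b i)) = 0) ==> \<forall>i\<in>I. c i = 0"
  and i: "i \<in> I"
 obtains \<phi> where "\<phi> \<in> dual V" "!!j. j \<in> I ==> \<phi> (b j) = (if j = i then 1 else 0)"
proof -
 let ?S = "b ` (I - {i})"
 have Sc: "?S <= carrier V" using I by auto
 have "b i \<notin> lspan V ?S"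
 proof
  assume a: "b i \<in> lspan V ?S"
  have "\<exists>c. \<forall>\<phi>\<in>dual V. \<phi> (b i) = (\<Sum>j\<in>I-{i}. c j * \<phi> (b j))"
   using a Sc
  proof (induction rule: span_induct)
   case (base x)
   then obtain j where "j \<in> I - {i}" "x = b j" by auto
   then have "\<forall>\<phi>\<in>dual V. \<phi> x = (\<Sum>k\<in>I-{i}. (if k = j then 1 else 0) * \<phi> (b k))"
    using I by (simp add: if_distrib[of "%c. c * _"] cong: if_cong)
   then show ?case by (intro exI[of _ "%k. if k = j then 1 else 0"])
  next
   case zero
   then show ?case by (intro exI[of _ "%_. 0"]) (simp add: dual_zero)
  next
   case (add x y)
   then obtain c d where cd: "\<forall>\<phi>\<in>dual V. \<phi> x = (\<Sum>j\<in>I-{i}. c j * \<phi> (b j))" "\<forall>\<phi>\<in>dual V. \<phi> y = (\<Sum>j\<in>I-{i}. d j * \<phi> (b j))"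
    by blast
   show ?case
    by (rule exI[of _ "%j. c j + d j"]) (use cd add in \<open>simp add: dual_add distrib_right sum.distrib\<close>)
  next
   case (smult c x)
   then obtain d where d: "\<forall>\<phi>\<in>dual V. \<phi> x = (\<Sum>j\<in>I-{i}. d j * \<phi> (b j))" by blast
   show ?case by (rule exI[of _ "%j. c * d j"]) (use d smult in \<open>simp add: dual_smult mult.assoc flip: sum_distrib_left\<close>)
  qed
  then obtain c where c: "!!\<phi>. \<phi> \<in> dual V ==> \<phi> (b i) = (\<Sum>j\<in>I-{i}. c j * \<phi> (b j))" by blast
  define d where "d j = (if j = i then -1 else c j)" for j
  have "(\<Sum>j\<in>I. d j * \<phi> (b j)) = 0" if "\<phi> \<in> dual V" for \<phi>
  proof -
   have "(\<Sum>j\<in>I. d j * \<phi> (b j)) = d i * \<phi> (b i) + (\<Sum>j\<in>I-{i}. d j * \<phi> (b j))"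
    using I(1) i by (simp add: sum.remove)
   also have "(\<Sum>j\<in>I-{i}. d j * \<phi> (b j)) = (\<Sum>j\<in>I-{i}. c j * \<phi> (b j))"
    by (intro sum.cong) (auto simp: d_def)
   finally show ?thesis using c[OF that] by (simp add: d_def)
  qed
  then have "d i = 0" using indep i by blast
  then show False by (simp add: d_def)
 qed
 then obtain \<phi> where \<phi>: "\<phi> \<in> ann V (lspan V ?S)" "\<phi> (b i) = 1"
  using separating_functional[OF subsp_span[OF Sc]] I i by metis
 then have "\<phi> \<in> ann V ?S" using ann_span[OF Sc] by simp
 then show ?thesis using that[of \<phi>] \<phi>(2) by (auto simp: ann_def)
qed

end

section \<open>Formal sums\<close>

text \<open>The linear extension of \<theta> to formal sums. Identities between formal sums are
  proved by applying it for an arbitrary \<theta>, which turns them into identities of finite sums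
  in the field.\<close>

definition klin :: "('z => 'k::field) => ('z \<Rightarrow>\<^sub>0 'k) => 'k" where
 "klin \<theta> t = (\<Sum>z\<in>Poly_Mapping.keys t. Poly_Mapping.lookup t z * \<theta> z)"

lemma klin_superset:
 "finite S ==> Poly_Mapping.keys t \<subseteq> S ==> klin \<theta> t = (\<Sum>z\<in>S. Poly_Mapping.lookup t z * \<theta> z)"
 unfolding klin_def by (rule sum.mono_neutral_left) (auto simp: in_keys_iff)

lemma klin_add: "klin \<theta> (s + t) = klin \<theta> s + klin \<theta> t"
proof -
 let ?S = "Poly_Mapping.keys s \<union> Poly_Mapping.keys t"
 have "klin \<theta> (s + t) = (\<Sum>z\<in>?S. Poly_Mapping.lookup (s + t) z * \<theta> z)"
  by (rule klin_superset) (use Poly_Mapping.keys_add[of s t] in auto)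
 then show ?thesis
  by (simp add: klin_superset[of ?S s] klin_superset[of ?S t] lookup_add distrib_right sum.distrib)
qed

lemma klin_single: "klin \<theta> (Poly_Mapping.single z c) = c * \<theta> z"
 by (simp add: klin_superset[of "{z}"])

lemma klin_zero [simp]: "klin \<theta> 0 = 0"
 by (simp add: klin_def)

lemma klin_uminus: "klin \<theta> (- t) = - klin \<theta> t"
 using klin_add[of \<theta> t "- t"] by (simp add: eq_neg_iff_add_eq_0 add.commute)

lemma klin_diff: "klin \<theta> (s - t) = klin \<theta> s - klin \<theta> t"
 using klin_add[of \<theta> s "- t"] by (simp add: klin_uminus)

lemma lookup_scale: "Poly_Mapping.lookup (Poly_Mapping.map ((*) (c::'k::field)) t) z = c * Poly_Mapping.lookup t z"
 by (simp add: Poly_Mapping.map.rep_eq when_def)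

lemma keys_scale: "Poly_Mapping.keys (Poly_Mapping.map ((*) (c::'k::field)) t) \<subseteq> Poly_Mapping.keys t"
 by (auto simp: in_keys_iff lookup_scale)

lemma klin_scale: "klin \<theta> (Poly_Mapping.map ((*) c) t) = c * klin \<theta> t"
proof -
 have "klin \<theta> (Poly_Mapping.map ((*) c) t) = (\<Sum>z\<in>Poly_Mapping.keys t. Poly_Mapping.lookup (Poly_Mapping.map ((*) c) t) z * \<theta> z)"
  by (rule klin_superset) (simp_all add: keys_scale)
 then show ?thesis by (simp add: lookup_scale klin_def[of \<theta> t] sum_distrib_left mult.assoc)
qed

lemma klin_sum: "klin \<theta> (\<Sum>a\<in>A. f a) = (\<Sum>a\<in>A. klin \<theta> (f a))"
 by (induction A rule: infinite_finite_induct) (auto simp: klin_add)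

lemma klin_cong: "(!!z. z \<in> Poly_Mapping.keys t ==> \<theta> z = \<theta>' z) ==> klin \<theta> t = klin \<theta>' t"
 by (simp add: klin_def)

lemma klin_fadd: "klin (%z. \<theta> z + \<theta>' z) t = klin \<theta> t + klin \<theta>' t"
 by (simp add: klin_def distrib_left sum.distrib)

lemma klin_fscale: "klin (%z. c * \<theta> z) t = c * klin \<theta> t"
 by (simp add: klin_def sum_distrib_left ac_simps)

lemma klin_fzero [simp]: "klin (%z. 0) t = 0"
 by (simp add: klin_def)

lemma klin_fsum: "klin (%z. \<Sum>a\<in>A. \<theta> a z) t = (\<Sum>a\<in>A. klin (\<theta> a) t)"
 unfolding klin_def sum_distrib_left by (rule sum.swap)

lemma formal_eqI:
 assumes "!!\<theta>. klin \<theta> s = klin \<theta> t"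
 shows "s = t"
proof (rule poly_mapping_eqI)
 fix z
 have "klin (%x. if x = z then 1 else 0) u = Poly_Mapping.lookup u z" for u :: "'a \<Rightarrow>\<^sub>0 'b"
  by (simp add: klin_superset[of "insert z (Poly_Mapping.keys u)"] subset_insertI if_distrib[of "%x. _ * x"] cong: if_cong)
 then show "Poly_Mapping.lookup s z = Poly_Mapping.lookup t z" using assms by metis
qed

lemma formal_decomp:
 fixes t :: "'z \<Rightarrow>\<^sub>0 'k::field"
 shows "t = (\<Sum>z\<in>Poly_Mapping.keys t. Poly_Mapping.single z (Poly_Mapping.lookup t z))"
 by (rule formal_eqI) (simp only: klin_sum klin_single, simp add: klin_def)

section \<open>Monoid algebras as spaces of formal sums\<close>

lemma monoid_alg_simps [simp]:
 "carrier (monoid_alg M) = {f. Poly_Mapping.keys f <= carrier M}"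
 "zero (monoid_alg M) = 0" "add (monoid_alg M) = (+)"
 "smult (monoid_alg M) c = Poly_Mapping.map ((*) c)"
 "one (monoid_alg M) = Poly_Mapping.single \<one>\<^bsub>M\<^esub> 1"
 by (simp_all add: monoid_alg_def)

lemma vsp_monoid_alg: "vsp (monoid_alg M :: ('k::field, 's \<Rightarrow>\<^sub>0 'k) module)"
proof (rule vs_criteria)
 let ?A = "monoid_alg M :: ('k, 's \<Rightarrow>\<^sub>0 'k) module"
 have k: "Poly_Mapping.keys (v + w) <= carrier M" if "Poly_Mapping.keys v <= carrier M" "Poly_Mapping.keys w <= carrier M"
  for v w :: "'s \<Rightarrow>\<^sub>0 'k" using that Poly_Mapping.keys_add[of v w] by blast
 show "\<forall>v w. v \<in> carrier (?A) & w \<in> carrier (?A) --> v \<oplus>\<^bsub>?A\<^esub> w \<in> carrier (?A)"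
  using k by simp
 show "\<forall>v\<in>carrier (?A). \<exists>w\<in>carrier (?A). v \<oplus>\<^bsub>?A\<^esub> w = \<zero>\<^bsub>?A\<^esub>"
 proof
  fix v assume "v \<in> carrier (?A)"
  then show "\<exists>w\<in>carrier (?A). v \<oplus>\<^bsub>?A\<^esub> w = \<zero>\<^bsub>?A\<^esub>"
   by (intro bexI[of _ "- v"]) (auto simp: in_keys_iff)
 qed
 show "\<forall>c v. c \<in> carrier class_ring & v \<in> carrier (?A) --> c \<odot>\<^bsub>?A\<^esub> v \<in> carrier (?A)"
  by (auto dest!: subsetD[OF keys_scale])
 show "\<forall>a b v. a \<in> carrier class_ring & b \<in> carrier class_ring & v \<in> carrier (?A) -->
  (a \<otimes>\<^bsub>class_ring\<^esub> b) \<odot>\<^bsub>?A\<^esub> v = a \<odot>\<^bsub>?A\<^esub> (b \<odot>\<^bsub>?A\<^esub> v)"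
  by (safe, rule formal_eqI) (simp add: klin_scale mult.assoc)
 show "\<forall>v\<in>carrier (?A). \<one>\<^bsub>class_ring\<^esub> \<odot>\<^bsub>?A\<^esub> v = v"
  by (safe, rule formal_eqI) (simp add: klin_scale)
 show "\<forall>a b v. a \<in> carrier class_ring & b \<in> carrier class_ring & v \<in> carrier (?A) -->
  (a \<oplus>\<^bsub>class_ring\<^esub> b) \<odot>\<^bsub>?A\<^esub> v = (a \<odot>\<^bsub>?A\<^esub> v) \<oplus>\<^bsub>?A\<^esub> (b \<odot>\<^bsub>?A\<^esub> v)"
  by (safe, rule formal_eqI) (simp add: klin_scale klin_add distrib_right)
 show "\<forall>a v w. a \<in> carrier class_ring & v \<in> carrier (?A) & w \<in> carrier (?A) -->
  a \<odot>\<^bsub>?A\<^esub> (v \<oplus>\<^bsub>?A\<^esub> w) = (a \<odot>\<^bsub>?A\<^esub> v) \<oplus>\<^bsub>?A\<^esub> (a \<odot>\<^bsub>?A\<^esub> w)"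
  by (safe, rule formal_eqI) (simp add: klin_scale klin_add distrib_left)
qed (simp_all add: class_field ac_simps)

lemma mult_monoid_alg: "f \<otimes>\<^bsub>monoid_alg M\<^esub> g = (\<Sum>u\<in>Poly_Mapping.keys f. \<Sum>v\<in>Poly_Mapping.keys g.
  Poly_Mapping.single (u \<otimes>\<^bsub>M\<^esub> v) (Poly_Mapping.lookup f u * Poly_Mapping.lookup g v))"
 by (simp add: monoid_alg_def)

text \<open>The product becomes an iterated sum; associativity and the unit laws of the monoid
  algebra then follow from those of the monoid inside \<theta>.\<close>

lemma klin_mult: "klin \<theta> (f \<otimes>\<^bsub>monoid_alg M\<^esub> g) = klin (%u. klin (%v. \<theta> (u \<otimes>\<^bsub>M\<^esub> v)) g) f"
 unfolding mult_monoid_alg klin_sum klin_single by (simp add: klin_def sum_distrib_left mult.assoc)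

lemma (in monoid) k_algebra_monoid_alg: "k_algebra (monoid_alg G :: ('k::field, 'a \<Rightarrow>\<^sub>0 'k) module)"
proof -
 let ?A = "monoid_alg G :: ('k, 'a \<Rightarrow>\<^sub>0 'k) module"
 interpret V: vspace ?A by (rule vspace.intro[OF vsp_monoid_alg])
 have mc: "f \<otimes>\<^bsub>?A\<^esub> g \<in> carrier ?A" if "f \<in> carrier ?A" "g \<in> carrier ?A" for f g
 proof -
  have "Poly_Mapping.keys (f \<otimes>\<^bsub>?A\<^esub> g) \<subseteq> (\<Union>u\<in>Poly_Mapping.keys f. \<Union>v\<in>Poly_Mapping.keys g. {u \<otimes> v})"
   unfolding mult_monoid_alg
   by (rule order_trans[OF keys_sum], rule UN_mono[OF order_refl], rule order_trans[OF keys_sum], rule UN_mono[OF order_refl]) simp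
  also have "... <= carrier G" using that by auto
  finally show ?thesis by simp
 qed
 have "ring ?A"
 proof (rule ringI)
  show "abelian_group ?A" by (rule V.abelian_group_axioms)
  show "monoid ?A"
  proof (rule monoidI)
   fix f g h assume fgh: "f \<in> carrier ?A" "g \<in> carrier ?A" "h \<in> carrier ?A"
   show "f \<otimes>\<^bsub>?A\<^esub> g \<otimes>\<^bsub>?A\<^esub> h = f \<otimes>\<^bsub>?A\<^esub> (g \<otimes>\<^bsub>?A\<^esub> h)"
    by (rule formal_eqI, simp only: klin_mult, intro klin_cong) (use fgh in \<open>auto simp: m_assoc subset_iff\<close>)
  next
   show "\<one>\<^bsub>?A\<^esub> \<otimes>\<^bsub>?A\<^esub> f = f" if "f \<in> carrier ?A" for f
    by (rule formal_eqI, simp add: klin_mult klin_single)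
     (use that in \<open>auto intro!: klin_cong simp: subset_iff\<close>)
   show "f \<otimes>\<^bsub>?A\<^esub> \<one>\<^bsub>?A\<^esub> = f" if "f \<in> carrier ?A" for f
    by (rule formal_eqI, simp add: klin_mult klin_single)
     (use that in \<open>auto intro!: klin_cong simp: subset_iff\<close>)
  qed (use mc in auto)
 qed (simp, rule formal_eqI, simp add: klin_mult klin_add klin_fadd)+
 moreover have "(c \<odot>\<^bsub>?A\<^esub> f) \<otimes>\<^bsub>?A\<^esub> g = c \<odot>\<^bsub>?A\<^esub> (f \<otimes>\<^bsub>?A\<^esub> g)" "f \<otimes>\<^bsub>?A\<^esub> (c \<odot>\<^bsub>?A\<^esub> g) = c \<odot>\<^bsub>?A\<^esub> (f \<otimes>\<^bsub>?A\<^esub> g)" for c f g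
  by (simp, rule formal_eqI, simp add: klin_mult klin_scale klin_fscale)+
 ultimately show ?thesis
  unfolding k_algebra_def using vsp_monoid_alg[of G] by blast
qed

lemma single_mult: "Poly_Mapping.single u a \<otimes>\<^bsub>monoid_alg M\<^esub> Poly_Mapping.single v b = Poly_Mapping.single (u \<otimes>\<^bsub>M\<^esub> v) (a * b)"
 by (rule formal_eqI) (simp add: klin_mult klin_single mult.assoc)

lemma dual_monoid_alg:
 assumes "\<phi> \<in> dual (monoid_alg M)" "Poly_Mapping.keys t <= carrier M"
 shows "\<phi> t = klin (%z. \<phi> (Poly_Mapping.single z 1)) t"
proof -
 interpret V: vspace "monoid_alg M" by (rule vspace.intro[OF vsp_monoid_alg])
 have s: "\<phi> (Poly_Mapping.single z c) = c * \<phi> (Poly_Mapping.single z 1)" if "z \<in> carrier M" for z c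
  using dual_smult[OF assms(1), of "Poly_Mapping.single z 1" c] that by simp
 have "Poly_Mapping.keys (\<Sum>z\<in>A. Poly_Mapping.single z (c z)) <= carrier M &
   \<phi> (\<Sum>z\<in>A. Poly_Mapping.single z (c z)) = (\<Sum>z\<in>A. c z * \<phi> (Poly_Mapping.single z 1))"
  if "finite A" "A <= carrier M" for A c
  using that
 proof (induction A)
  case empty
  then show ?case using V.dual_zero[OF assms(1)] by simp
 next
  case (insert a A)
  let ?S = "\<Sum>z\<in>A. Poly_Mapping.single z (c z)"
  have k: "Poly_Mapping.single a (c a) \<in> carrier (monoid_alg M)" "?S \<in> carrier (monoid_alg M)"
   using insert by auto
  show ?case using insert dual_add[OF assms(1) k] V.a_closed[OF k] by (simp add: s[of a "c a"])
 qed
 from this[of "Poly_Mapping.keys t" "Poly_Mapping.lookup t"] show ?thesis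
  using assms(2) formal_decomp[of t] by (simp add: klin_def)
qed

lemma klin_dual: "klin \<theta> \<in> dual (monoid_alg M)"
 by (simp add: dual_def klin_add klin_scale)

text \<open>Functionals on formal sums come from the type-based theory, where bases always exist.\<close>

lemma formal_separation:
 assumes "subsp (monoid_alg M) I" "I = lspan (monoid_alg M) R" "R <= carrier (monoid_alg M)"
  and "t \<in> carrier (monoid_alg M)" "t \<notin> I"
 obtains \<theta> where "klin \<theta> t = 1" "!!s. s \<in> I ==> klin \<theta> s = 0"
proof -
 interpret V: vspace "monoid_alg M" by (rule vspace.intro[OF vsp_monoid_alg])
 let ?sc = "%c. Poly_Mapping.map ((*) c) :: ('a \<Rightarrow>\<^sub>0 'b) => _"
 interpret pm: vector_space ?sc
  by unfold_locales (auto intro!: formal_eqI simp: klin_add klin_scale algebra_simps)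
 interpret kk: vector_space "(*) :: 'b => _"
  by unfold_locales (auto simp: algebra_simps)
 interpret pk: vector_space_pair ?sc "(*) :: 'b => _" ..
 have "pm.span R \<subseteq> I"
 proof (rule pm.span_minimal)
  show "R \<subseteq> I" using assms V.span_base by auto
  show "pm.subspace I" using assms(1) by (auto simp: pm.subspace_def subsp_def)
 qed
 then have t: "t \<notin> pm.span R" using assms by auto
 obtain B where B: "B \<subseteq> R" "pm.independent B" "R \<subseteq> pm.span B"
  by (rule pm.maximal_independent_subset)
 have tB: "t \<notin> pm.span B" using t pm.span_mono[OF B(1)] by auto
 then have "pm.independent (insert t B)" using pm.independent_insertI B by auto
 \<comment> \<open>\<open>B\<close> is a maximal independent subset of the generators of
   \<open>I\<close>, and \<open>t\<close> is independent of it. The functional that is 1 at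
   \<open>t\<close> and 0 on \<open>B\<close> extends to all formal sums.\<close>
 then obtain g where g: "Vector_Spaces.linear ?sc (*) g" "\<forall>x\<in>insert t B. g x = (if x = t then 1 else 0)"
  using pk.linear_independent_extend[of "insert t B" "%x. if x = t then 1 else 0"] by blast
 interpret g: Vector_Spaces.linear ?sc "(*)" g by fact
 have nt: "t \<notin> B" using tB pm.span_base by auto
 have g0: "g s = 0" if "s \<in> pm.span B" for s
  using that by (induction rule: pm.span_induct_alt) (use g(2) nt in \<open>auto simp: g.add g.scale g.zero\<close>)
 have gd: "g \<in> dual (monoid_alg M)" by (auto simp: dual_def g.add g.scale)
 define \<theta> where "\<theta> z = g (Poly_Mapping.single z 1)" for z
 have k: "klin \<theta> s = g s" if "s \<in> carrier (monoid_alg M)" for s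
  using dual_monoid_alg[OF gd] that unfolding \<theta>_def by auto
 have "klin \<theta> s = 0" if "s \<in> I" for s
 proof -
  have "klin \<theta> r = 0" if "r \<in> R" for r using k[OF subsetD[OF assms(3) that]] g0[OF subsetD[OF B(3) that]] by simp
  then show ?thesis using V.dual_span_zero[OF klin_dual assms(3), of \<theta> s] assms(2) that by blast
 qed
 moreover have "klin \<theta> t = 1" using k assms(4) g(2) by auto
 ultimately show ?thesis using that by blast
qed

section \<open>Quotients\<close>

context vspace
begin

lemma coset_mem: "y \<in> I +> x \<longleftrightarrow> (\<exists>i\<in>I. y = i \<oplus> x)"
 by (auto simp: a_r_coset_def')

context
 fixes I assumes I: "subsp V I"
begin

lemma subgroup_I: "subgroup I (add_monoid V)"
 using subspD[OF I] subsp_neg[OF I] by (auto intro!: add.subgroupI simp: a_inv_def)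

lemma abelian_subgroup_I: "abelian_subgroup I V"
 by (rule abelian_subgroupI3[OF additive_subgroup.intro[OF subgroup_I] abelian_group_axioms])

interpretation I: abelian_subgroup I V by (rule abelian_subgroup_I)

lemma coset_eq_iff:
 assumes "x \<in> carrier V" "y \<in> carrier V"
 shows "I +> x = I +> y \<longleftrightarrow> x \<ominus> y \<in> I"
proof -
 have "x \<in> I +> y \<longleftrightarrow> x \<ominus> y \<in> I"
 proof
  assume "x \<in> I +> y"
  then obtain i where i: "i \<in> I" "x = i \<oplus> y" by (auto simp: coset_mem)
  have "x \<ominus> y = i" using i assms subspD(1)[OF I i(1)] by (simp add: a_minus_def a_assoc r_neg)
  then show "x \<ominus> y \<in> I" using i by simp
 next
  assume a: "x \<ominus> y \<in> I"
  have "x = (x \<ominus> y) \<oplus> y" using assms by (simp add: a_minus_def a_assoc l_neg)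
  then show "x \<in> I +> y" using a by (auto simp: coset_mem)
 qed
 moreover have "x \<in> I +> y \<longleftrightarrow> I +> x = I +> y"
  using a_repr_independence[OF _ assms(2) subgroup_I, of x] I.a_rcos_self[OF assms(1)] by auto
 ultimately show ?thesis by simp
qed

lemma coset_self: "x \<in> carrier V ==> x \<in> I +> x"
 by (rule I.a_rcos_self)

lemma coset_memD:
 assumes "y \<in> I +> x" "x \<in> carrier V"
 shows "y \<in> carrier V" "I +> y = I +> x"
proof -
 show "y \<in> carrier V" using assms subspD(1)[OF I] by (auto simp: coset_mem)
 show "I +> y = I +> x" using a_repr_independence[OF assms subgroup_I] by simp
qed

lemma coset_zero: "I +> \<zero> = I"
 using subspD(1)[OF I] by (simp add: subsetI)

lemma coset_add: "x \<in> carrier V ==> y \<in> carrier V ==> (I +> x) <+> (I +> y) = I +> (x \<oplus> y)"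
 by (rule I.a_rcos_sum)

text \<open>The scalar multiplication of \<open>quot_alg\<close> is a union over all
  representatives; each of them gives the same coset, so the union collapses.\<close>

lemma coset_smult:
 assumes "x \<in> carrier V"
 shows "(\<Union>y\<in>I +> x. I +> (c \<odot> y)) = I +> (c \<odot> x)"
proof -
 have "I +> (c \<odot> y) = I +> (c \<odot> x)" if y: "y \<in> I +> x" for y
 proof -
  obtain i where i: "i \<in> I" "y = i \<oplus> x" using y by (auto simp: coset_mem)
  have "c \<odot> y \<in> I +> (c \<odot> x)" using i assms subspD[OF I] by (auto simp: coset_mem smult_r_distr)
  then show ?thesis using coset_memD(2) assms by simp
 qed
 then show ?thesis using coset_self[OF assms] by blast
qed

lemma quot_alg_simps:
 "carrier (quot_alg V I) = (%x. I +> x) ` carrier V"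
 "\<zero>\<^bsub>quot_alg V I\<^esub> = I"
 "one (quot_alg V I) = I +> \<one>"
 "x \<in> carrier V ==> y \<in> carrier V ==> (I +> x) \<oplus>\<^bsub>quot_alg V I\<^esub> (I +> y) = I +> (x \<oplus> y)"
 "x \<in> carrier V ==> c \<odot>\<^bsub>quot_alg V I\<^esub> (I +> x) = I +> (c \<odot> x)"
 by (auto simp: quot_alg_def FactRing_def A_RCOSETS_def' coset_add coset_smult)

lemma vsp_quot: "vsp (quot_alg V I)"
proof (rule vs_criteria)
 show "\<zero>\<^bsub>quot_alg V I\<^esub> \<in> carrier (quot_alg V I)"
  using coset_zero by (force simp: quot_alg_simps)
 show "\<forall>v\<in>carrier (quot_alg V I). v \<oplus>\<^bsub>quot_alg V I\<^esub> \<zero>\<^bsub>quot_alg V I\<^esub> = v"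
  using quot_alg_simps(4)[OF _ zero_closed] by (auto simp: quot_alg_simps coset_zero)
 show "\<forall>v\<in>carrier (quot_alg V I). \<exists>neg_v\<in>carrier (quot_alg V I). v \<oplus>\<^bsub>quot_alg V I\<^esub> neg_v = \<zero>\<^bsub>quot_alg V I\<^esub>"
 proof
  fix v assume "v \<in> carrier (quot_alg V I)"
  then obtain x where "x \<in> carrier V" "v = I +> x" by (auto simp: quot_alg_simps)
  then show "\<exists>neg_v\<in>carrier (quot_alg V I). v \<oplus>\<^bsub>quot_alg V I\<^esub> neg_v = \<zero>\<^bsub>quot_alg V I\<^esub>"
   by (intro bexI[of _ "I +> (\<ominus> x)"]) (auto simp: quot_alg_simps r_neg coset_zero)
 qed
qed (auto simp: class_field quot_alg_simps a_ac smult_assoc1 smult_l_distr smult_r_distr)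

text \<open>A functional that kills the subspace descends to the quotient; it is evaluated at an
  arbitrary representative.\<close>

lemma dual_quot:
 assumes "\<phi> \<in> ann V I"
 shows "(%S. \<phi> (SOME x. x \<in> S)) \<in> dual (quot_alg V I)"
  "x \<in> carrier V ==> \<phi> (SOME y. y \<in> I +> x) = \<phi> x"
proof -
 have v: "\<phi> (SOME y. y \<in> I +> x) = \<phi> x" if x: "x \<in> carrier V" for x
 proof -
  have "(SOME y. y \<in> I +> x) \<in> I +> x" using coset_self[OF x] by (rule someI)
  then obtain i where "i \<in> I" "(SOME y. y \<in> I +> x) = i \<oplus> x" by (auto simp: coset_mem)
  then show ?thesis using x assms subspD(1)[OF I] by (auto simp: dual_add[OF annD(1)[OF assms]] annD)
 qed
 then show "x \<in> carrier V ==> \<phi> (SOME y. y \<in> I +> x) = \<phi> x" .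
 show "(%S. \<phi> (SOME x. x \<in> S)) \<in> dual (quot_alg V I)"
  unfolding dual_def using annD(1)[OF assms] v
  by (auto simp: quot_alg_simps dual_add dual_smult)
qed

end
end

section \<open>Bilinear forms and tensors\<close>

definition bil :: "('k::field, 'a, 'm) module_scheme => ('k, 'b, 'n) module_scheme => ('a => 'b => 'k) set" where
 "bil V W = {\<beta>. (\<forall>w\<in>carrier W. (%v. \<beta> v w) \<in> dual V) & (\<forall>v\<in>carrier V. \<beta> v \<in> dual W)}"

text \<open>Bilinearity of a map into \<open>U\<close> is tested after functionals of
  \<open>U\<close>. For separated \<open>U\<close> this is ordinary bilinearity, and it is the form
  in which \<open>tensor_lift\<close> uses it.\<close>

definition bil_maps :: "('k::field, 'a, 'm) module_scheme => ('k, 'b, 'n) module_scheme => ('k, 'c, 'l) module_scheme =>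
  ('a => 'b => 'c) set" where
 "bil_maps V W U = {\<beta>. (\<forall>v\<in>carrier V. \<forall>w\<in>carrier W. \<beta> v w \<in> carrier U) & (\<forall>\<phi>\<in>dual U. (%v w. \<phi> (\<beta> v w)) \<in> bil V W)}"

text \<open>The value of a bilinear form at a tensor, computed on a chosen representative;
  \<open>ev_class\<close> removes the choice.\<close>

definition ev :: "('a => 'b => 'k::field) => ('a \<times> 'b \<Rightarrow>\<^sub>0 'k) set => 'k" where
 "ev \<beta> T = klin (%z. \<beta> (fst z) (snd z)) (SOME t. t \<in> T)"

lemma bilD: "\<beta> \<in> bil V W ==> w \<in> carrier W ==> (%v. \<beta> v w) \<in> dual V" "\<beta> \<in> bil V W ==> v \<in> carrier V ==> \<beta> v \<in> dual W"
 by (auto simp: bil_def)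

lemma bil_mapsI:
 "(!!v w. v \<in> carrier V ==> w \<in> carrier W ==> \<beta> v w \<in> carrier U) ==> (!!\<phi>. \<phi> \<in> dual U ==> (%v w. \<phi> (\<beta> v w)) \<in> bil V W) ==>
  \<beta> \<in> bil_maps V W U"
 by (simp add: bil_maps_def)

lemma bil_mapsD:
 "\<beta> \<in> bil_maps V W U ==> v \<in> carrier V ==> w \<in> carrier W ==> \<beta> v w \<in> carrier U"
 "\<beta> \<in> bil_maps V W U ==> \<phi> \<in> dual U ==> (%v w. \<phi> (\<beta> v w)) \<in> bil V W"
 by (simp_all add: bil_maps_def)

lemma bil_prod: "\<phi> \<in> dual V ==> \<psi> \<in> dual W ==> (%v w. \<phi> v * \<psi> w) \<in> bil V W"
 by (auto simp: bil_def dual_def algebra_simps)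

lemma bil_comp: "\<beta> \<in> bil V' W' ==> f \<in> lin_maps V V' ==> g \<in> lin_maps W W' ==> (%v w. \<beta> (f v) (g w)) \<in> bil V W"
 by (auto simp: bil_def intro!: dual_lin[of f V V' "%v. \<beta> v _"] dual_lin[of g W W' "\<beta> _"] dest: lin_mapsD(1))

lemma bil_closed:
 "\<beta> \<in> bil V W ==> \<beta>' \<in> bil V W ==> (%v w. \<beta> v w + \<beta>' v w) \<in> bil V W"
 "\<beta> \<in> bil V W ==> \<beta>' \<in> bil V W ==> (%v w. \<beta> v w - \<beta>' v w) \<in> bil V W"
 "\<beta> \<in> bil V W ==> (%v w. c * \<beta> v w) \<in> bil V W"
 by (auto simp: bil_def dual_def algebra_simps)

text \<open>Membership in \<open>dual\<close> says nothing about arguments outside the carrier, so a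
  formula that is valid only on the carrier may be replaced by another one.\<close>

lemma dual_cong: "\<phi> \<in> dual V ==> vsp V ==> (!!v. v \<in> carrier V ==> \<phi> v = \<psi> v) ==> \<psi> \<in> dual V"
proof -
 assume a: "\<phi> \<in> dual V" "vsp V" and e: "!!v. v \<in> carrier V ==> \<phi> v = \<psi> v"
 interpret vspace V by (rule vspace.intro) fact
 show ?thesis using a(1) e[symmetric] by (auto simp: dual_def)
qed

section \<open>The tensor product of two spaces, studied through bilinear forms\<close>

locale tens_space = V: vspace V + W: vspace W
 for V :: "('k::field, 'a, 'm) module_scheme" and W :: "('k, 'b, 'n) module_scheme"
begin

abbreviation "M \<equiv> monoid_alg (V \<times>\<times> W) :: ('k, 'a \<times> 'b \<Rightarrow>\<^sub>0 'k) module"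

sublocale M: vspace M by (rule vspace.intro[OF vsp_monoid_alg])

lemma carrier_prod: "carrier (V \<times>\<times> W) = carrier V \<times> carrier W"
 by (simp add: DirProd_def)

lemma relators_carrier: "bilinear_relators V W <= carrier M"
proof -
 have k: "a - b \<in> carrier M" if "a \<in> carrier M" "b \<in> carrier M" for a b
 proof -
  have "Poly_Mapping.keys (a - b) \<subseteq> Poly_Mapping.keys a \<union> Poly_Mapping.keys b"
   by (auto simp: in_keys_iff lookup_minus)
  then show ?thesis using that by auto
 qed
 have s: "Poly_Mapping.single z c \<in> carrier M" if "z \<in> carrier V \<times> carrier W" for z c
  using that by (simp add: carrier_prod)
 show ?thesis
  unfolding bilinear_relators_def by (safe; intro k s) auto
qed

lemma null_subsp: "subsp M (tensor_null V W)"
 unfolding tensor_null_def by (rule M.subsp_span[OF relators_carrier])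

lemma klin_null:
 assumes "\<beta> \<in> bil V W" "t \<in> tensor_null V W"
 shows "klin (%z. \<beta> (fst z) (snd z)) t = 0"
proof (rule M.dual_span_zero[OF klin_dual relators_carrier])
 note l = dual_add[OF bilD(1)[OF assms(1)]] dual_smult[OF bilD(1)[OF assms(1)]]
  dual_add[OF bilD(2)[OF assms(1)]] dual_smult[OF bilD(2)[OF assms(1)]]
 show "t \<in> lspan M (bilinear_relators V W)" using assms(2) by (simp add: tensor_null_def)
 fix s assume "s \<in> bilinear_relators V W"
 then show "klin (%z. \<beta> (fst z) (snd z)) s = 0"
  unfolding bilinear_relators_def by (elim UnE CollectE exE conjE) (simp_all add: klin_diff klin_single l)
qed

text \<open>A formal sum outside the span of the relators is separated from it by some \<theta>, and
  vanishing on the relators is precisely bilinearity of \<theta>. So the relators span all that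
  every bilinear form kills.\<close>

lemma null_iff:
 assumes "t \<in> carrier M"
 shows "t \<in> tensor_null V W \<longleftrightarrow> (\<forall>\<beta>\<in>bil V W. klin (%z. \<beta> (fst z) (snd z)) t = 0)"
proof
 assume a: "\<forall>\<beta>\<in>bil V W. klin (%z. \<beta> (fst z) (snd z)) t = 0"
 show "t \<in> tensor_null V W"
 proof (rule ccontr)
  assume n: "t \<notin> tensor_null V W"
  obtain \<theta> where \<theta>: "klin \<theta> t = 1" "!!s. s \<in> tensor_null V W ==> klin \<theta> s = 0"
   using formal_separation[OF null_subsp _ relators_carrier assms n] by (metis tensor_null_def)
  have r: "klin \<theta> s = 0" if "s \<in> bilinear_relators V W" for s
   using \<theta>(2) M.span_base[OF relators_carrier that] by (simp add: tensor_null_def)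
  define \<beta> where "\<beta> v w = \<theta> (v, w)" for v w
  have "\<theta> (v \<oplus>\<^bsub>V\<^esub> v', w) = \<theta> (v, w) + \<theta> (v', w)" if "v \<in> carrier V" "v' \<in> carrier V" "w \<in> carrier W" for v v' w
  proof -
   have "Poly_Mapping.single (v \<oplus>\<^bsub>V\<^esub> v', w) 1 - Poly_Mapping.single (v, w) 1 - Poly_Mapping.single (v', w) 1 \<in> bilinear_relators V W"
    unfolding bilinear_relators_def using that by blast
   from r[OF this] show ?thesis by (simp add: klin_diff klin_single diff_eq_eq add.commute)
  qed
  moreover have "\<theta> (v, w \<oplus>\<^bsub>W\<^esub> w') = \<theta> (v, w) + \<theta> (v, w')" if "v \<in> carrier V" "w \<in> carrier W" "w' \<in> carrier W" for v w w'
  proof -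
   have "Poly_Mapping.single (v, w \<oplus>\<^bsub>W\<^esub> w') 1 - Poly_Mapping.single (v, w) 1 - Poly_Mapping.single (v, w') 1 \<in> bilinear_relators V W"
    unfolding bilinear_relators_def using that by blast
   from r[OF this] show ?thesis by (simp add: klin_diff klin_single diff_eq_eq add.commute)
  qed
  moreover have "\<theta> (c \<odot>\<^bsub>V\<^esub> v, w) = c * \<theta> (v, w)" if "v \<in> carrier V" "w \<in> carrier W" for c v w
  proof -
   have "Poly_Mapping.single (c \<odot>\<^bsub>V\<^esub> v, w) 1 - Poly_Mapping.single (v, w) c \<in> bilinear_relators V W"
    unfolding bilinear_relators_def using that by blast
   from r[OF this] show ?thesis by (simp add: klin_diff klin_single diff_eq_eq add.commute)
  qed
  moreover have "\<theta> (v, c \<odot>\<^bsub>W\<^esub> w) = c * \<theta> (v, w)" if "v \<in> carrier V" "w \<in> carrier W" for c v w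
  proof -
   have "Poly_Mapping.single (v, c \<odot>\<^bsub>W\<^esub> w) 1 - Poly_Mapping.single (v, w) c \<in> bilinear_relators V W"
    unfolding bilinear_relators_def using that by blast
   from r[OF this] show ?thesis by (simp add: klin_diff klin_single diff_eq_eq add.commute)
  qed
  ultimately have "\<beta> \<in> bil V W" by (auto simp: bil_def dual_def \<beta>_def)
  then show False using a \<theta>(1) by (auto simp: \<beta>_def)
 qed
qed (use klin_null in auto)

lemma tensor_simps:
 "carrier (tensor V W) = tensor_class V W ` carrier M"
 "\<zero>\<^bsub>tensor V W\<^esub> = tensor_class V W 0"
 "s \<in> carrier M ==> t \<in> carrier M ==> tensor_class V W s \<oplus>\<^bsub>tensor V W\<^esub> tensor_class V W t = tensor_class V W (s + t)"
 "t \<in> carrier M ==> c \<odot>\<^bsub>tensor V W\<^esub> tensor_class V W t = tensor_class V W (Poly_Mapping.map ((*) c) t)"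
 using M.quot_alg_simps[OF null_subsp] M.coset_zero[OF null_subsp] by (simp_all add: tensor_def tensor_class_def)

sublocale T: vspace "tensor V W"
 unfolding tensor_def by (rule vspace.intro[OF M.vsp_quot[OF null_subsp]])

lemma klin_ann: "\<beta> \<in> bil V W ==> klin (%z. \<beta> (fst z) (snd z)) \<in> ann M (tensor_null V W)"
 by (simp add: ann_def klin_dual klin_null)

lemma ev_class: "\<beta> \<in> bil V W ==> t \<in> carrier M ==> ev \<beta> (tensor_class V W t) = klin (%z. \<beta> (fst z) (snd z)) t"
 unfolding ev_def tensor_class_def by (rule M.dual_quot(2)[OF null_subsp klin_ann])

lemma ev_dual: "\<beta> \<in> bil V W ==> ev \<beta> \<in> dual (tensor V W)"
 using M.dual_quot(1)[OF null_subsp klin_ann] by (simp add: ev_def[abs_def] tensor_def)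

lemma class_eqI:
 assumes "s \<in> carrier M" "t \<in> carrier M" "!!\<beta>. \<beta> \<in> bil V W ==> klin (%z. \<beta> (fst z) (snd z)) s = klin (%z. \<beta> (fst z) (snd z)) t"
 shows "tensor_class V W s = tensor_class V W t"
proof -
 have "klin (%z. \<beta> (fst z) (snd z)) (s \<ominus>\<^bsub>M\<^esub> t) = 0" if "\<beta> \<in> bil V W" for \<beta>
  using M.dual_minus[OF klin_dual assms(1,2)] assms(3)[OF that] by simp
 then have "s \<ominus>\<^bsub>M\<^esub> t \<in> tensor_null V W" using null_iff[OF M.minus_closed[OF assms(1,2)]] by blast
 then show ?thesis unfolding tensor_class_def using M.coset_eq_iff[OF null_subsp assms(1,2)] by blast
qed

lemma tensor_eqI:
 assumes "S \<in> carrier (tensor V W)" "T \<in> carrier (tensor V W)" "!!\<beta>. \<beta> \<in> bil V W ==> ev \<beta> S = ev \<beta> T"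
 shows "S = T"
proof -
 obtain s t where st: "s \<in> carrier M" "t \<in> carrier M" "S = tensor_class V W s" "T = tensor_class V W t"
  using assms by (auto simp: tensor_simps)
 show ?thesis unfolding st(3,4)
  by (rule class_eqI) (use st assms(3) ev_class in auto)
qed

sublocale T: sep_space "tensor V W"
 by unfold_locales (use tensor_eqI ev_dual in blast)

lemma single_carrier: "v \<in> carrier V ==> w \<in> carrier W ==> Poly_Mapping.single (v, w) c \<in> carrier M"
 by (simp add: carrier_prod)

lemma tens_carrier: "v \<in> carrier V ==> w \<in> carrier W ==> tens V W v w \<in> carrier (tensor V W)"
 unfolding tens_def tensor_simps using single_carrier by blast

lemma ev_tens: "\<beta> \<in> bil V W ==> v \<in> carrier V ==> w \<in> carrier W ==> ev \<beta> (tens V W v w) = \<beta> v w"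
 unfolding tens_def using single_carrier by (simp add: ev_class klin_single)

lemma ev_simps:
 assumes "\<beta> \<in> bil V W"
 shows "S \<in> carrier (tensor V W) ==> T \<in> carrier (tensor V W) ==> ev \<beta> (S \<oplus>\<^bsub>tensor V W\<^esub> T) = ev \<beta> S + ev \<beta> T"
  "T \<in> carrier (tensor V W) ==> ev \<beta> (c \<odot>\<^bsub>tensor V W\<^esub> T) = c * ev \<beta> T"
  "ev \<beta> \<zero>\<^bsub>tensor V W\<^esub> = 0"
 using dual_add[OF ev_dual[OF assms]] dual_smult[OF ev_dual[OF assms]] T.dual_zero[OF ev_dual[OF assms]] by auto

lemma tens_bil:
 assumes "\<Theta> \<in> dual (tensor V W)"
 shows "(%v w. \<Theta> (tens V W v w)) \<in> bil V W"
proof -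
 have "tens V W (v \<oplus>\<^bsub>V\<^esub> v') w = tens V W v w \<oplus>\<^bsub>tensor V W\<^esub> tens V W v' w"
  "tens V W (c \<odot>\<^bsub>V\<^esub> v) w = c \<odot>\<^bsub>tensor V W\<^esub> tens V W v w"
  if "v \<in> carrier V" "v' \<in> carrier V" "w \<in> carrier W" for v v' w c
  by (rule tensor_eqI; use that in \<open>simp add: tens_carrier ev_simps ev_tens
    dual_add[OF bilD(1)[of _ V W]] dual_smult[OF bilD(1)[of _ V W]]\<close>)+
 moreover have "tens V W v (w \<oplus>\<^bsub>W\<^esub> w') = tens V W v w \<oplus>\<^bsub>tensor V W\<^esub> tens V W v w'"
  "tens V W v (c \<odot>\<^bsub>W\<^esub> w) = c \<odot>\<^bsub>tensor V W\<^esub> tens V W v w"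
  if "v \<in> carrier V" "w \<in> carrier W" "w' \<in> carrier W" for v w w' c
  by (rule tensor_eqI; use that in \<open>simp add: tens_carrier ev_simps ev_tens
    dual_add[OF bilD(2)[of _ V W]] dual_smult[OF bilD(2)[of _ V W]]\<close>)+
 ultimately show ?thesis
  using dual_add[OF assms] dual_smult[OF assms] by (simp add: bil_def dual_def tens_carrier)
qed

lemma tensor_span_tens:
 "carrier (tensor V W) = lspan (tensor V W) {tens V W v w | v w. v \<in> carrier V & w \<in> carrier W}" (is "_ = lspan _ ?S")
proof
 have S: "?S <= carrier (tensor V W)" using tens_carrier by auto
 show "lspan (tensor V W) ?S <= carrier (tensor V W)" by (rule T.span_least[OF T.subsp_carrier S])
 note sp = T.subsp_span[OF S]
 have "Poly_Mapping.keys (\<Sum>z\<in>A. Poly_Mapping.single z (c z)) <= carrier V \<times> carrier W &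
   tensor_class V W (\<Sum>z\<in>A. Poly_Mapping.single z (c z)) \<in> lspan (tensor V W) ?S"
  if "finite A" "A <= carrier V \<times> carrier W" for A c
  using that
 proof (induction A)
  case empty
  then show ?case using T.subspD(2)[OF sp] by (simp add: tensor_simps)
 next
  case (insert z A)
  obtain v w where z: "z = (v, w)" "v \<in> carrier V" "w \<in> carrier W" using insert by auto
  have "tensor_class V W (Poly_Mapping.single z (c z)) = c z \<odot>\<^bsub>tensor V W\<^esub> tens V W v w"
   unfolding tens_def using z single_carrier by (simp add: tensor_simps)
  moreover have "tens V W v w \<in> lspan (tensor V W) ?S" using z by (intro T.span_base[OF S]) auto
  ultimately have 1: "tensor_class V W (Poly_Mapping.single z (c z)) \<in> lspan (tensor V W) ?S"
   using T.subspD(4)[OF sp] by simp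
  let ?R = "\<Sum>z\<in>A. Poly_Mapping.single z (c z)"
  have "?R \<in> carrier M" "Poly_Mapping.single z (c z) \<in> carrier M" using insert z by (auto simp: carrier_prod)
  then show ?case using insert 1 T.subspD(3)[OF sp 1, of "tensor_class V W ?R"] M.a_closed[of "Poly_Mapping.single z (c z)" ?R]
   by (simp add: tensor_simps carrier_prod)
 qed
 note * = this
 show "carrier (tensor V W) <= lspan (tensor V W) ?S"
 proof
  fix T assume "T \<in> carrier (tensor V W)"
  then obtain t where t: "t \<in> carrier M" "T = tensor_class V W t" unfolding tensor_simps by blast
  show "T \<in> lspan (tensor V W) ?S"
   using *[of "Poly_Mapping.keys t" "Poly_Mapping.lookup t"] t formal_decomp[of t] by (simp add: carrier_prod)
 qed
qed

text \<open>Representatives of a tensor involve only carrier elements, so the values of a form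
  elsewhere do not matter.\<close>

lemma ev_fcong:
 assumes "!!v w. v \<in> carrier V ==> w \<in> carrier W ==> \<beta> v w = \<beta>' v w" "\<beta> \<in> bil V W" "\<beta>' \<in> bil V W" "T \<in> carrier (tensor V W)"
 shows "ev \<beta> T = ev \<beta>' T"
proof -
 obtain t where t: "t \<in> carrier M" "T = tensor_class V W t" using assms by (auto simp: tensor_simps)
 show ?thesis unfolding t(2) ev_class[OF assms(2) t(1)] ev_class[OF assms(3) t(1)]
  using t(1) assms(1) by (intro klin_cong) (auto simp: carrier_prod)
qed

lemma ev_fadd:
 "\<beta> \<in> bil V W ==> \<beta>' \<in> bil V W ==> T \<in> carrier (tensor V W) ==> ev (%v w. \<beta> v w + \<beta>' v w) T = ev \<beta> T + ev \<beta>' T"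
 by (auto simp: ev_class tensor_simps(1) klin_fadd bil_closed)

lemma ev_fscale: "\<beta> \<in> bil V W ==> T \<in> carrier (tensor V W) ==> ev (%v w. c * \<beta> v w) T = c * ev \<beta> T"
 by (auto simp: ev_class tensor_simps(1) klin_fscale bil_closed)

lemma ev_fsum:
 "(!!a. a \<in> A ==> \<beta> a \<in> bil V W) ==> T \<in> carrier (tensor V W) ==> ev (%v w. \<Sum>a\<in>A. \<beta> a v w) T = (\<Sum>a\<in>A. ev (\<beta> a) T)"
proof -
 assume a: "!!a. a \<in> A ==> \<beta> a \<in> bil V W" "T \<in> carrier (tensor V W)"
 have "(%v w. \<Sum>a\<in>A. \<beta> a v w) \<in> bil V W" using a(1) by (auto simp: bil_def intro!: V.dual_sum W.dual_sum)
 then show ?thesis using a by (auto simp: ev_class tensor_simps(1) klin_fsum)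
qed

text \<open>A functional of the separated space \<open>U\<close> composed with \<beta> is a bilinear
  form and takes the same value on all representatives. Hence these give a single vector of
  \<open>U\<close>, and \<open>the_elem\<close> is applied to a singleton.\<close>

lemma tensor_lift:
 assumes "sep_space U" and b: "\<beta> \<in> bil_maps V W U" and T: "T \<in> carrier (tensor V W)"
 shows "tensor_lift U \<beta> T \<in> carrier U" "\<phi> \<in> dual U ==> \<phi> (tensor_lift U \<beta> T) = ev (%v w. \<phi> (\<beta> v w)) T"
proof -
 interpret U: sep_space U by fact
 note cl' = bil_mapsD(1)[OF b] and bil = bil_mapsD(2)[OF b]
 define L where "L t = (\<Oplus>\<^bsub>U\<^esub>z\<in>Poly_Mapping.keys t. Poly_Mapping.lookup t z \<odot>\<^bsub>U\<^esub> \<beta> (fst z) (snd z))" for t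
 have cl: "(%z. Poly_Mapping.lookup t z \<odot>\<^bsub>U\<^esub> \<beta> (fst z) (snd z)) \<in> Poly_Mapping.keys t \<rightarrow> carrier U" if "t \<in> carrier M" for t
  using that cl' by (auto simp: carrier_prod subset_iff)
 have LU: "L t \<in> carrier U" if "t \<in> carrier M" for t
  unfolding L_def using cl[OF that] by (rule U.finsum_closed)
 have L\<phi>: "\<phi> (L t) = klin (%z. \<phi> (\<beta> (fst z) (snd z))) t" if "t \<in> carrier M" "\<phi> \<in> dual U" for t \<phi>
  unfolding L_def U.dual_finsum[OF that(2) cl[OF that(1)]] klin_def
  using that cl' by (intro sum.cong) (auto simp: carrier_prod dual_smult subset_iff)
 obtain t where t: "t \<in> carrier M" "T = tensor_class V W t" using T by (auto simp: tensor_simps)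
 have tT: "t \<in> T" unfolding t(2) tensor_class_def by (rule M.coset_self[OF null_subsp t(1)])
 have "L s = L t" if "s \<in> T" for s
 proof -
  have s: "s \<in> carrier M" "tensor_class V W s = T"
   using M.coset_memD[OF null_subsp, of s t] that t unfolding tensor_class_def by auto
  show ?thesis
  proof (rule U.sep[OF LU[OF s(1)] LU[OF t(1)]])
   fix \<phi> assume \<phi>: "\<phi> \<in> dual U"
   show "\<phi> (L s) = \<phi> (L t)"
    unfolding L\<phi>[OF s(1) \<phi>] L\<phi>[OF t(1) \<phi>]
    using ev_class[OF bil[OF \<phi>] s(1)] ev_class[OF bil[OF \<phi>] t(1)] s(2) t(2) by simp
  qed
 qed
 then have "L ` T = {L t}" using tT by blast
 then have e: "tensor_lift U \<beta> T = L t" unfolding tensor_lift_def L_def[abs_def, symmetric] by simp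
 show "tensor_lift U \<beta> T \<in> carrier U" using LU t e by simp
 show "\<phi> \<in> dual U ==> \<phi> (tensor_lift U \<beta> T) = ev (%v w. \<phi> (\<beta> v w)) T" using L\<phi> t e ev_class[OF bil] by simp
qed

lemma tensor_lift_lin:
 assumes "sep_space U" "\<beta> \<in> bil_maps V W U"
 shows "tensor_lift U \<beta> \<in> lin_maps (tensor V W) U"
proof (rule lin_mapsI_sep[OF T.vs assms(1)])
 show "tensor_lift U \<beta> \<in> carrier (tensor V W) \<rightarrow> carrier U" using tensor_lift(1)[OF assms] by auto
 fix \<phi> assume \<phi>: "\<phi> \<in> dual U"
 show "(%x. \<phi> (tensor_lift U \<beta> x)) \<in> dual (tensor V W)"
  by (rule dual_cong[OF ev_dual[OF bil_mapsD(2)[OF assms(2) \<phi>]] T.vs]) (simp add: tensor_lift(2)[OF assms _ \<phi>])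
qed

end

section \<open>Tensor products of maps, associativity, and separation by products of
  functionals\<close>

lemma tensor_map:
 assumes "vsp V" "vsp W" "vsp V'" "vsp W'" "f \<in> lin_maps V V'" "g \<in> lin_maps W W'" "T \<in> carrier (tensor V W)"
 shows "tensor_map V' W' f g T \<in> carrier (tensor V' W')"
  "\<beta> \<in> bil V' W' ==> ev \<beta> (tensor_map V' W' f g T) = ev (%v w. \<beta> (f v) (g w)) T"
proof -
 interpret A: tens_space V W by (intro tens_space.intro vspace.intro) fact+
 interpret B: tens_space V' W' by (intro tens_space.intro vspace.intro) fact+
 note f = lin_mapsD(1)[OF assms(5)] and g = lin_mapsD(1)[OF assms(6)]
 have bil: "(%v w. \<phi> (tens V' W' (f v) (g w))) \<in> bil V W" if "\<phi> \<in> dual (tensor V' W')" for \<phi>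
  using bil_comp[OF B.tens_bil[OF that] assms(5,6)] .
 have c: "tens V' W' (f v) (g w) \<in> carrier (tensor V' W')" if "v \<in> carrier V" "w \<in> carrier W" for v w
  using f g that B.tens_carrier by simp
 have bm: "(%v w. tens V' W' (f v) (g w)) \<in> bil_maps V W (tensor V' W')" by (rule bil_mapsI, rule c, assumption+, rule bil)
 show "tensor_map V' W' f g T \<in> carrier (tensor V' W')"
  unfolding tensor_map_def by (rule A.tensor_lift(1)[OF B.T.sep_space_axioms bm assms(7)])
 assume b: "\<beta> \<in> bil V' W'"
 have "ev \<beta> (tensor_map V' W' f g T) = ev (%v w. ev \<beta> (tens V' W' (f v) (g w))) T"
  unfolding tensor_map_def by (rule A.tensor_lift(2)[OF B.T.sep_space_axioms bm assms(7) B.ev_dual[OF b]])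
 also have "... = ev (%v w. \<beta> (f v) (g w)) T"
  using f g B.ev_tens[OF b] by (intro A.ev_fcong[OF _ _ _ assms(7)] bil[OF B.ev_dual[OF b]] bil_comp[OF b assms(5,6)]) auto
 finally show "ev \<beta> (tensor_map V' W' f g T) = ev (%v w. \<beta> (f v) (g w)) T" .
qed

lemma tensor_map_lin:
 assumes "vsp V" "vsp W" "vsp V'" "vsp W'" "f \<in> lin_maps V V'" "g \<in> lin_maps W W'"
 shows "tensor_map V' W' f g \<in> lin_maps (tensor V W) (tensor V' W')"
proof -
 interpret A: tens_space V W by (intro tens_space.intro vspace.intro) fact+
 interpret B: tens_space V' W' by (intro tens_space.intro vspace.intro) fact+
 show ?thesis unfolding tensor_map_def
  using lin_mapsD(1)[OF assms(5)] lin_mapsD(1)[OF assms(6)]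
  by (intro A.tensor_lift_lin[OF B.T.sep_space_axioms] bil_mapsI) (auto intro: B.tens_carrier bil_comp[OF B.tens_bil assms(5,6)])
qed

text \<open>Evaluation on products of three functionals is enough for coassociativity in finite
  dimension. The map is a lift inside a lift, so linearity of the inner lift in its parameter
  \<open>w\<close> has to be verified before the outer one is defined.\<close>

lemma tensor_assoc:
 assumes "vsp U" "vsp V" "vsp W" "X \<in> carrier (tensor (tensor U V) W)"
  and d: "\<phi> \<in> dual U" "\<psi> \<in> dual V" "\<chi> \<in> dual W"
 shows "tensor_assoc U V W X \<in> carrier (tensor U (tensor V W))"
  "ev (%u. ev (%v w. \<phi> u * (\<psi> v * \<chi> w))) (tensor_assoc U V W X) = ev (%T w. ev (%u v. \<phi> u * \<psi> v) T * \<chi> w) X"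
proof -
 interpret UV: tens_space U V by (intro tens_space.intro vspace.intro) fact+
 interpret VW: tens_space V W by (intro tens_space.intro vspace.intro) fact+
 interpret L: tens_space "tensor U V" W by (intro tens_space.intro UV.T.vspace_axioms VW.W.vspace_axioms)
 interpret R: tens_space U "tensor V W" by (intro tens_space.intro UV.V.vspace_axioms VW.T.vspace_axioms)
 let ?R = "tensor U (tensor V W)"
 let ?b = "%w u v. tens U (tensor V W) u (tens V W v w)"
 have b1: "(%u v. \<Theta> (?b w u v)) \<in> bil U V" if "\<Theta> \<in> dual ?R" "w \<in> carrier W" for \<Theta> w
 proof -
  note B = R.tens_bil[OF that(1)]
  show ?thesis unfolding bil_def
  proof (safe)
   fix v assume "v \<in> carrier V"
   then show "(%u. \<Theta> (?b w u v)) \<in> dual U" using bilD(1)[OF B] VW.tens_carrier that by auto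
  next
   fix u assume u: "u \<in> carrier U"
   show "(%v. \<Theta> (?b w u v)) \<in> dual V"
    using bilD(1)[OF VW.tens_bil[OF bilD(2)[OF B u]] that(2)] .
  qed
 qed
 have c1: "?b w u v \<in> carrier ?R" if "u \<in> carrier U" "v \<in> carrier V" "w \<in> carrier W" for u v w
  using that R.tens_carrier VW.tens_carrier by simp
 have bm1: "?b w \<in> bil_maps U V ?R" if "w \<in> carrier W" for w using that by (intro bil_mapsI c1 b1)
 have c2: "tensor_lift ?R (?b w) T \<in> carrier ?R" if "T \<in> carrier (tensor U V)" "w \<in> carrier W" for T w
  using UV.tensor_lift(1)[OF R.T.sep_space_axioms bm1] that by auto
 have e1: "\<Theta> (tensor_lift ?R (?b w) T) = ev (%u v. \<Theta> (?b w u v)) T"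
  if "\<Theta> \<in> dual ?R" "T \<in> carrier (tensor U V)" "w \<in> carrier W" for \<Theta> T w
  using UV.tensor_lift(2)[OF R.T.sep_space_axioms bm1] that by auto
 have b2: "(%T w. \<Theta> (tensor_lift ?R (?b w) T)) \<in> bil (tensor U V) W" if \<Theta>: "\<Theta> \<in> dual ?R" for \<Theta>
  unfolding bil_def
 proof safe
  fix w assume w: "w \<in> carrier W"
  show "(%T. \<Theta> (tensor_lift ?R (?b w) T)) \<in> dual (tensor U V)"
   by (rule dual_cong[OF UV.ev_dual[OF b1[OF \<Theta> w]] UV.T.vs]) (simp add: e1[OF \<Theta> _ w])
 next
  fix T assume T: "T \<in> carrier (tensor U V)"
  note B = R.tens_bil[OF \<Theta>]
  have lin: "(%w. \<Theta> (?b w u v)) \<in> dual W" if "u \<in> carrier U" "v \<in> carrier V" for u v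
   using bilD(2)[OF VW.tens_bil[OF bilD(2)[OF B that(1)]] that(2)] .
  have "(%w. ev (%u v. \<Theta> (?b w u v)) T) \<in> dual W"
   unfolding dual_def
  proof safe
   fix x y assume xy: "x \<in> carrier W" "y \<in> carrier W"
   have "ev (%u v. \<Theta> (?b (x \<oplus>\<^bsub>W\<^esub> y) u v)) T = ev (%u v. \<Theta> (?b x u v) + \<Theta> (?b y u v)) T"
    using xy by (intro UV.ev_fcong[OF _ _ _ T] b1[OF \<Theta>] bil_closed) (auto simp: dual_add[OF lin])
   then show "ev (%u v. \<Theta> (?b (x \<oplus>\<^bsub>W\<^esub> y) u v)) T = ev (%u v. \<Theta> (?b x u v)) T + ev (%u v. \<Theta> (?b y u v)) T"
    using UV.ev_fadd[OF b1[OF \<Theta>] b1[OF \<Theta>] T] xy by simp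
   fix c
   have "ev (%u v. \<Theta> (?b (c \<odot>\<^bsub>W\<^esub> x) u v)) T = ev (%u v. c * \<Theta> (?b x u v)) T"
    using xy by (intro UV.ev_fcong[OF _ _ _ T] b1[OF \<Theta>] bil_closed) (auto simp: dual_smult[OF lin])
   then show "ev (%u v. \<Theta> (?b (c \<odot>\<^bsub>W\<^esub> x) u v)) T = c * ev (%u v. \<Theta> (?b x u v)) T"
    using UV.ev_fscale[OF b1[OF \<Theta>] T] xy by simp
  qed
  then show "(%w. \<Theta> (tensor_lift ?R (?b w) T)) \<in> dual W"
   by (rule dual_cong[OF _ VW.W.vs]) (simp add: e1[OF \<Theta> T])
 qed
 have bm2: "(%T w. tensor_lift ?R (?b w) T) \<in> bil_maps (tensor U V) W ?R" by (rule bil_mapsI, rule c2, assumption+, rule b2)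
 show "tensor_assoc U V W X \<in> carrier ?R"
  unfolding tensor_assoc_def by (rule L.tensor_lift(1)[OF R.T.sep_space_axioms bm2 assms(4)])
 let ?\<beta> = "%u. ev (%v w. \<phi> u * (\<psi> v * \<chi> w))"
 have bi: "(%v w. \<phi> u * (\<psi> v * \<chi> w)) \<in> bil V W" for u
  by (rule bil_closed(3)[OF bil_prod[OF d(2,3)]])
 have \<beta>: "?\<beta> \<in> bil U (tensor V W)"
  unfolding bil_def
 proof safe
  fix T assume T: "T \<in> carrier (tensor V W)"
  have "(%u. \<phi> u * ev (%v w. \<psi> v * \<chi> w) T) \<in> dual U" by (rule UV.V.dual_closed(4)[OF d(1)])
  then show "(%u. ?\<beta> u T) \<in> dual U" using VW.ev_fscale[OF bil_prod[OF d(2,3)] T] by simp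
 qed (rule VW.ev_dual[OF bi])
 note \<Theta> = R.ev_dual[OF \<beta>]
 have "ev ?\<beta> (tensor_assoc U V W X) = ev (%T w. ev ?\<beta> (tensor_lift ?R (?b w) T)) X"
  unfolding tensor_assoc_def by (rule L.tensor_lift(2)[OF R.T.sep_space_axioms bm2 assms(4) \<Theta>])
 also have "... = ev (%T w. ev (%u v. \<phi> u * \<psi> v) T * \<chi> w) X"
 proof (rule L.ev_fcong[OF _ b2[OF \<Theta>] _ assms(4)])
  show "(%T w. ev (%u v. \<phi> u * \<psi> v) T * \<chi> w) \<in> bil (tensor U V) W"
   by (rule bil_prod[OF UV.ev_dual[OF bil_prod[OF d(1,2)]] d(3)])
  fix T w assume Tw: "T \<in> carrier (tensor U V)" "w \<in> carrier W"
  have "ev ?\<beta> (tensor_lift ?R (?b w) T) = ev (%u v. ev ?\<beta> (?b w u v)) T" by (rule e1[OF \<Theta> Tw])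
  also have "... = ev (%u v. \<chi> w * (\<phi> u * \<psi> v)) T"
   using Tw R.ev_tens[OF \<beta>] VW.ev_tens[OF bi] VW.tens_carrier
   by (intro UV.ev_fcong[OF _ _ _ Tw(1)] b1[OF \<Theta>] bil_closed bil_prod d) auto
  also have "... = ev (%u v. \<phi> u * \<psi> v) T * \<chi> w" using UV.ev_fscale[OF bil_prod[OF d(1,2)] Tw(1)] by simp
  finally show "ev ?\<beta> (tensor_lift ?R (?b w) T) = ev (%u v. \<phi> u * \<psi> v) T * \<chi> w" .
 qed
 finally show "ev ?\<beta> (tensor_assoc U V W X) = ev (%T w. ev (%u v. \<phi> u * \<psi> v) T * \<chi> w) X" .
qed

text \<open>Contracting the difference of S and T with \<psi> \<in> \<open>L2\<close> gives a vector
  of V killed by \<open>L1\<close>, hence zero; so \<open>L1\<close> may be enlarged to the full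
  dual, and then \<open>L2\<close> likewise. A general form \<beta> is the finite sum of products
  \<delta>_b \<otimes> \<beta>(b, -) over a basis of V. The roles of V and W differ because W is a
  tensor square in the proof of coassociativity, while \<open>L1\<close> and \<open>L2\<close> may
  be the functionals on components of a graded space.\<close>

lemma tensor_sep_prod:
 assumes "fd_space V" "sep_space W"
  and L1: "L1 \<subseteq> dual V" "!!v. v \<in> carrier V ==> (!!\<phi>. \<phi> \<in> L1 ==> \<phi> v = 0) ==> v = \<zero>\<^bsub>V\<^esub>"
  and L2: "L2 \<subseteq> dual W" "!!w. w \<in> carrier W ==> (!!\<phi>. \<phi> \<in> L2 ==> \<phi> w = 0) ==> w = \<zero>\<^bsub>W\<^esub>"
  and ST: "S \<in> carrier (tensor V W)" "T \<in> carrier (tensor V W)"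
  and eq: "!!\<phi> \<psi>. \<phi> \<in> L1 ==> \<psi> \<in> L2 ==> ev (%v w. \<phi> v * \<psi> w) S = ev (%v w. \<phi> v * \<psi> w) T"
 shows "S = T"
proof -
 interpret V: fd_space V by fact
 interpret W: sep_space W by fact
 interpret A: tens_space V W by (intro tens_space.intro V.vspace_axioms W.vspace_axioms)
 define X where "X = S \<ominus>\<^bsub>tensor V W\<^esub> T"
 have X: "X \<in> carrier (tensor V W)" unfolding X_def using ST by (rule A.T.minus_closed)
 have evX: "ev \<beta> X = ev \<beta> S - ev \<beta> T" if "\<beta> \<in> bil V W" for \<beta>
  unfolding X_def by (rule A.T.dual_minus[OF A.ev_dual[OF that] ST])
 have 1: "ev (%v w. \<phi> v * \<psi> w) X = 0" if "\<phi> \<in> dual V" "\<psi> \<in> L2" for \<phi> \<psi>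
 proof -
  have \<psi>: "\<psi> \<in> dual W" using that L2 by auto
  let ?b = "%v w. \<psi> w \<odot>\<^bsub>V\<^esub> v"
  have bb: "(%v w. \<chi> (?b v w)) \<in> bil V W" if "\<chi> \<in> dual V" for \<chi>
   using that \<psi> by (auto simp: bil_def dual_def algebra_simps V.smult_r_distr)
  have bm: "?b \<in> bil_maps V W V" by (rule bil_mapsI, simp, rule bb)
  have e: "\<chi> (tensor_lift V ?b X) = ev (%v w. \<chi> v * \<psi> w) X" if "\<chi> \<in> dual V" for \<chi>
  proof -
   have "\<chi> (tensor_lift V ?b X) = ev (%v w. \<chi> (?b v w)) X"
    by (rule A.tensor_lift(2)[OF V.sep_space_axioms bm X that])
   also have "... = ev (%v w. \<chi> v * \<psi> w) X"
    by (rule A.ev_fcong[OF _ bb[OF that] bil_prod[OF that \<psi>] X]) (simp add: dual_smult[OF that])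
   finally show ?thesis .
  qed
  have c: "tensor_lift V ?b X \<in> carrier V" by (rule A.tensor_lift(1)[OF V.sep_space_axioms bm X])
  have "tensor_lift V ?b X = \<zero>\<^bsub>V\<^esub>"
  proof (rule L1(2)[OF c])
   fix \<chi> assume "\<chi> \<in> L1"
   then have "\<chi> \<in> dual V" using L1(1) by blast
   then show "\<chi> (tensor_lift V ?b X) = 0" using e[of \<chi>] eq[OF \<open>\<chi> \<in> L1\<close> that(2)] evX[OF bil_prod[OF _ \<psi>], of \<chi>] by simp
  qed
  then show ?thesis using e[OF that(1)] V.dual_zero[OF that(1)] by simp
 qed
 have 2: "ev (%v w. \<phi> v * \<psi> w) X = 0" if "\<phi> \<in> dual V" "\<psi> \<in> dual W" for \<phi> \<psi>
 proof -
  let ?b = "%v w. \<phi> v \<odot>\<^bsub>W\<^esub> w"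
  have bb: "(%v w. \<chi> (?b v w)) \<in> bil V W" if "\<chi> \<in> dual W" for \<chi>
   using that \<open>\<phi> \<in> dual V\<close> by (auto simp: bil_def dual_def algebra_simps W.smult_r_distr)
  have bm: "?b \<in> bil_maps V W W" by (rule bil_mapsI, simp, rule bb)
  have e: "\<chi> (tensor_lift W ?b X) = ev (%v w. \<phi> v * \<chi> w) X" if "\<chi> \<in> dual W" for \<chi>
  proof -
   have "\<chi> (tensor_lift W ?b X) = ev (%v w. \<chi> (?b v w)) X"
    by (rule A.tensor_lift(2)[OF W.sep_space_axioms bm X that])
   also have "... = ev (%v w. \<phi> v * \<chi> w) X"
    by (rule A.ev_fcong[OF _ bb[OF that] bil_prod[OF \<open>\<phi> \<in> dual V\<close> that] X]) (simp add: dual_smult[OF that])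
   finally show ?thesis .
  qed
  have c: "tensor_lift W ?b X \<in> carrier W" by (rule A.tensor_lift(1)[OF W.sep_space_axioms bm X])
  have "tensor_lift W ?b X = \<zero>\<^bsub>W\<^esub>"
  proof (rule L2(2)[OF c])
   fix \<chi> assume "\<chi> \<in> L2"
   then show "\<chi> (tensor_lift W ?b X) = 0" using e[of \<chi>] 1[OF that(1), of \<chi>] L2(1) by auto
  qed
  then show ?thesis using e[OF that(2)] W.dual_zero[OF that(2)] by simp
 qed
 obtain B \<delta> where B: "finite B" "B <= carrier V" "!!b. b \<in> B ==> \<delta> b \<in> dual V"
  "!!v \<phi>. v \<in> carrier V ==> \<phi> \<in> dual V ==> \<phi> v = (\<Sum>b\<in>B. \<delta> b v * \<phi> b)"
  by (rule V.dual_basis) blast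
 show ?thesis
 proof (rule A.tensor_eqI[OF ST])
  fix \<beta> assume \<beta>: "\<beta> \<in> bil V W"
  have p: "(%v w. \<delta> b v * \<beta> b w) \<in> bil V W" if "b \<in> B" for b
   by (rule bil_prod[OF B(3)[OF that] bilD(2)[OF \<beta>]]) (use B(2) that in auto)
  have s: "(%v w. \<Sum>b\<in>B. \<delta> b v * \<beta> b w) \<in> bil V W"
   using p by (auto simp: bil_def intro!: V.dual_sum W.dual_sum)
  have "ev \<beta> X = ev (%v w. \<Sum>b\<in>B. \<delta> b v * \<beta> b w) X"
   by (rule A.ev_fcong[OF _ \<beta> s X]) (rule B(4)[OF _ bilD(1)[OF \<beta>]])
  also have "... = (\<Sum>b\<in>B. ev (%v w. \<delta> b v * \<beta> b w) X)"
   by (rule A.ev_fsum[OF p X])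
  also have "... = 0" using 2[OF B(3) bilD(2)[OF \<beta>]] B(2) by (intro sum.neutral) auto
  finally show "ev \<beta> S = ev \<beta> T" using evX[OF \<beta>] by simp
 qed
qed

section \<open>Algebras\<close>

locale kalg =
 fixes A :: "('k::field, 'a, 'm) module_scheme" (structure)
 assumes ka: "k_algebra A"
begin

sublocale vspace A by (rule vspace.intro) (use ka in \<open>simp add: k_algebra_def\<close>)

sublocale ring A using ka by (simp add: k_algebra_def)

lemma smult_mult:
 "x \<in> carrier A ==> y \<in> carrier A ==> (c \<odot> x) \<otimes> y = c \<odot> (x \<otimes> y)"
 "x \<in> carrier A ==> y \<in> carrier A ==> x \<otimes> (c \<odot> y) = c \<odot> (x \<otimes> y)"
 using ka unfolding k_algebra_def by blast+

lemma lmult_lin: "a \<in> carrier A ==> (%x. a \<otimes> x) \<in> lin_maps A A"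
 by (auto simp: lin_maps_iff r_distr smult_mult)

lemma rmult_lin: "a \<in> carrier A ==> (%x. x \<otimes> a) \<in> lin_maps A A"
 by (auto simp: lin_maps_iff l_distr smult_mult)

lemma dual_lmult: "\<phi> \<in> dual A ==> a \<in> carrier A ==> (%x. \<phi> (a \<otimes> x)) \<in> dual A"
 using dual_lin[OF lmult_lin] .

lemma dual_rmult: "\<phi> \<in> dual A ==> a \<in> carrier A ==> (%x. \<phi> (x \<otimes> a)) \<in> dual A"
 using dual_lin[OF rmult_lin] .

lemma bil_mult: "\<phi> \<in> dual A ==> (%x y. \<phi> (x \<otimes> y)) \<in> bil A A"
 unfolding bil_def using dual_lmult dual_rmult by simp

text \<open>Scalars act as multiplication by \<open>c \<odot> \<one>\<close>, so ring ideals are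
  subspaces.\<close>

lemma ideal_subsp:
 assumes "ideal I A"
 shows "subsp A I"
proof -
 interpret I: ideal I A by fact
 have "c \<odot> x \<in> I" if "x \<in> I" for c x
 proof -
  have x: "x \<in> carrier A" using I.a_Hcarr[OF that] .
  have "c \<odot> x = (c \<odot> \<one>) \<otimes> x" using x by (simp add: smult_mult)
  then show ?thesis using I.I_l_closed[OF that, of "c \<odot> \<one>"] by simp
 qed
 then show ?thesis unfolding subsp_def using I.a_subset by auto
qed

lemma k_algebra_quot:
 assumes I: "ideal I A"
 shows "k_algebra (quot_alg A I)"
  "x \<in> carrier A ==> y \<in> carrier A ==> (I +> x) \<otimes>\<^bsub>quot_alg A I\<^esub> (I +> y) = I +> (x \<otimes> y)"
proof -
 note sI = ideal_subsp[OF I]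
 interpret I: ideal I A by fact
 interpret Q: vspace "quot_alg A I" by (rule vspace.intro[OF vsp_quot[OF sI]])
 have m: "(I +> x) \<otimes>\<^bsub>quot_alg A I\<^esub> (I +> y) = I +> (x \<otimes> y)" if "x \<in> carrier A" "y \<in> carrier A" for x y
  using I.rcoset_mult_add[OF that] by (simp add: quot_alg_def FactRing_def)
 show "x \<in> carrier A ==> y \<in> carrier A ==> (I +> x) \<otimes>\<^bsub>quot_alg A I\<^esub> (I +> y) = I +> (x \<otimes> y)" by (rule m)
 note qs = quot_alg_simps[OF sI]
 have "ring (quot_alg A I)"
 proof (rule ringI)
  show "abelian_group (quot_alg A I)" by (rule Q.abelian_group_axioms)
  show "monoid (quot_alg A I)"
   by (rule monoidI) (auto simp: qs m m_assoc)
 qed (auto simp: qs m l_distr r_distr)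
 moreover have "(c \<odot>\<^bsub>quot_alg A I\<^esub> S) \<otimes>\<^bsub>quot_alg A I\<^esub> T = c \<odot>\<^bsub>quot_alg A I\<^esub> (S \<otimes>\<^bsub>quot_alg A I\<^esub> T)"
  "S \<otimes>\<^bsub>quot_alg A I\<^esub> (c \<odot>\<^bsub>quot_alg A I\<^esub> T) = c \<odot>\<^bsub>quot_alg A I\<^esub> (S \<otimes>\<^bsub>quot_alg A I\<^esub> T)"
  if "S \<in> carrier (quot_alg A I)" "T \<in> carrier (quot_alg A I)" for c S T
  using that by (auto simp: qs m smult_mult)
 ultimately show "k_algebra (quot_alg A I)" unfolding k_algebra_def using Q.vs by blast
qed

lemma ideal_iff:
 assumes "subsp A I" "!!x i. x \<in> carrier A ==> i \<in> I ==> x \<otimes> i \<in> I" "!!x i. x \<in> carrier A ==> i \<in> I ==> i \<otimes> x \<in> I"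
 shows "ideal I A"
 by (rule idealI[OF ring_axioms subgroup_I[OF assms(1)]]) (use assms in auto)

end

locale sep_alg = sep_space A + kalg A for A :: "('k::field, 'a, 'm) module_scheme" (structure)

lemma alg_hom_iff: "f \<in> alg_hom A B \<longleftrightarrow> f \<in> lin_maps A B & f \<one>\<^bsub>A\<^esub> = \<one>\<^bsub>B\<^esub> &
  (\<forall>x\<in>carrier A. \<forall>y\<in>carrier A. f (x \<otimes>\<^bsub>A\<^esub> y) = f x \<otimes>\<^bsub>B\<^esub> f y)"
 by (auto simp add: alg_hom_def Ring.ring_hom_def lin_maps_iff Pi_iff)

lemma alg_homD:
 assumes "f \<in> alg_hom A B"
 shows "f \<in> lin_maps A B" "x \<in> carrier A ==> f x \<in> carrier B" "f \<one>\<^bsub>A\<^esub> = \<one>\<^bsub>B\<^esub>"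
  "x \<in> carrier A ==> y \<in> carrier A ==> f (x \<otimes>\<^bsub>A\<^esub> y) = f x \<otimes>\<^bsub>B\<^esub> f y"
  "x \<in> carrier A ==> y \<in> carrier A ==> f (x \<oplus>\<^bsub>A\<^esub> y) = f x \<oplus>\<^bsub>B\<^esub> f y"
  "x \<in> carrier A ==> f (c \<odot>\<^bsub>A\<^esub> x) = c \<odot>\<^bsub>B\<^esub> f x"
 using assms lin_mapsD by (auto simp: alg_hom_iff)

lemma alg_hom_pow:
 assumes "k_algebra A" "k_algebra B" "f \<in> alg_hom A B" "x \<in> carrier A"
 shows "f (x [^]\<^bsub>A\<^esub> (n::nat)) = f x [^]\<^bsub>B\<^esub> n"
proof -
 interpret A: kalg A by (rule kalg.intro) fact
 interpret B: kalg B by (rule kalg.intro) fact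
 show ?thesis by (induction n) (simp_all add: alg_homD[OF assms(3)] assms(4))
qed

subsection \<open>Tensor products of algebras\<close>

lemma klin_swap: "klin (%u. klin (%v. F u v) g) f = klin (%v. klin (%u. F u v) f) g"
 unfolding klin_def sum_distrib_left by (subst sum.swap) (simp add: ac_simps)

locale tens_alg = A: kalg A + B: kalg B
 for A :: "('k::field, 'a, 'm) module_scheme" and B :: "('k, 'b, 'n) module_scheme"
begin

sublocale tens_space A B ..

lemma monoid_prod: "monoid (A \<times>\<times> B)"
 using DirProd_monoid[OF A.monoid_axioms B.monoid_axioms] .

sublocale MA: kalg M
 by (rule kalg.intro[OF monoid.k_algebra_monoid_alg[OF monoid_prod]])

lemma prod_mult: "u \<otimes>\<^bsub>A \<times>\<times> B\<^esub> v = (fst u \<otimes>\<^bsub>A\<^esub> fst v, snd u \<otimes>\<^bsub>B\<^esub> snd v)"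
 by (simp add: DirProd_def case_prod_unfold)

lemma bil_translate:
 assumes "\<beta> \<in> bil A B" "a \<in> carrier A" "b \<in> carrier B"
 shows "(%v w. \<beta> (a \<otimes>\<^bsub>A\<^esub> v) (b \<otimes>\<^bsub>B\<^esub> w)) \<in> bil A B" "(%v w. \<beta> (v \<otimes>\<^bsub>A\<^esub> a) (w \<otimes>\<^bsub>B\<^esub> b)) \<in> bil A B"
 using bil_comp[OF assms(1) A.lmult_lin[OF assms(2)] B.lmult_lin[OF assms(3)]]
  bil_comp[OF assms(1) A.rmult_lin[OF assms(2)] B.rmult_lin[OF assms(3)]] by auto

text \<open>Multiplication by a pair translates a bilinear form into another bilinear form. The
  value of a form at a product with an element of \<open>tensor_null\<close> is therefore a sum of
  values of translated forms at that element, all of them zero.\<close>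

lemma null_ideal: "ideal (tensor_null A B) M"
proof (rule MA.ideal_iff[OF null_subsp])
 fix x i assume x: "x \<in> carrier M" and i: "i \<in> tensor_null A B"
 have ic: "i \<in> carrier M" using M.subspD(1)[OF null_subsp i] .
 have k: "fst u \<in> carrier A" "snd u \<in> carrier B" if "u \<in> Poly_Mapping.keys x" for u
  using x that by (auto simp: carrier_prod)
 show "x \<otimes>\<^bsub>M\<^esub> i \<in> tensor_null A B"
 proof (subst null_iff[OF MA.m_closed[OF x ic]], safe)
  fix \<beta> assume \<beta>: "\<beta> \<in> bil A B"
  have "klin (%z. \<beta> (fst z) (snd z)) (x \<otimes>\<^bsub>M\<^esub> i) = klin (%u. 0) x"
   unfolding klin_mult prod_mult fst_conv snd_conv
   using klin_null[OF bil_translate(1)[OF \<beta>] i] k by (intro klin_cong) auto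
  then show "klin (%z. \<beta> (fst z) (snd z)) (x \<otimes>\<^bsub>M\<^esub> i) = 0" by simp
 qed
 show "i \<otimes>\<^bsub>M\<^esub> x \<in> tensor_null A B"
 proof (subst null_iff[OF MA.m_closed[OF ic x]], safe)
  fix \<beta> assume \<beta>: "\<beta> \<in> bil A B"
  have "klin (%z. \<beta> (fst z) (snd z)) (i \<otimes>\<^bsub>M\<^esub> x) =
    klin (%v. klin (%u. \<beta> (fst u \<otimes>\<^bsub>A\<^esub> fst v) (snd u \<otimes>\<^bsub>B\<^esub> snd v)) i) x"
   unfolding klin_mult prod_mult fst_conv snd_conv by (rule klin_swap)
  also have "... = klin (%v. 0) x"
   using klin_null[OF bil_translate(2)[OF \<beta>] i] k by (intro klin_cong) auto
  finally show "klin (%z. \<beta> (fst z) (snd z)) (i \<otimes>\<^bsub>M\<^esub> x) = 0" by simp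
 qed
qed

sublocale T: sep_alg "tensor A B"
 by (intro sep_alg.intro kalg.intro T.sep_space_axioms) (unfold tensor_def, rule MA.k_algebra_quot(1)[OF null_ideal])

lemma class_mult:
 "s \<in> carrier M ==> t \<in> carrier M ==> tensor_class A B s \<otimes>\<^bsub>tensor A B\<^esub> tensor_class A B t = tensor_class A B (s \<otimes>\<^bsub>M\<^esub> t)"
 unfolding tensor_def tensor_class_def by (rule MA.k_algebra_quot(2)[OF null_ideal])

lemma tensor_one: "\<one>\<^bsub>tensor A B\<^esub> = tens A B \<one>\<^bsub>A\<^esub> \<one>\<^bsub>B\<^esub>"
 using M.quot_alg_simps(3)[OF null_subsp] by (simp add: tensor_def tens_def tensor_class_def DirProd_def)

text \<open>Left multiplication by a pure tensor moves into the arguments of the form. This is how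
  \<Delta>(uc) is computed for grouplike and for primitive u.\<close>

lemma ev_lmult:
 assumes "\<beta> \<in> bil A B" "a \<in> carrier A" "b \<in> carrier B" "T \<in> carrier (tensor A B)"
 shows "ev \<beta> (tens A B a b \<otimes>\<^bsub>tensor A B\<^esub> T) = ev (%v w. \<beta> (a \<otimes>\<^bsub>A\<^esub> v) (b \<otimes>\<^bsub>B\<^esub> w)) T"
proof -
 obtain t where t: "t \<in> carrier M" "T = tensor_class A B t" using assms(4) unfolding tensor_simps by blast
 have s: "Poly_Mapping.single (a, b) 1 \<in> carrier M" by (rule single_carrier[OF assms(2,3)])
 have "ev \<beta> (tens A B a b \<otimes>\<^bsub>tensor A B\<^esub> T) = klin (%z. \<beta> (fst z) (snd z)) (Poly_Mapping.single (a, b) 1 \<otimes>\<^bsub>M\<^esub> t)"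
  unfolding tens_def t(2) class_mult[OF s t(1)] by (rule ev_class[OF assms(1) MA.m_closed[OF s t(1)]])
 also have "... = klin (%v. \<beta> (a \<otimes>\<^bsub>A\<^esub> fst v) (b \<otimes>\<^bsub>B\<^esub> snd v)) t" by (simp add: klin_mult klin_single prod_mult)
 also have "... = ev (%v w. \<beta> (a \<otimes>\<^bsub>A\<^esub> v) (b \<otimes>\<^bsub>B\<^esub> w)) T"
  unfolding t(2) by (rule ev_class[OF bil_translate(1)[OF assms(1-3)] t(1), symmetric])
 finally show ?thesis .
qed

lemma tens_mult:
 assumes "a \<in> carrier A" "b \<in> carrier B" "a' \<in> carrier A" "b' \<in> carrier B"
 shows "tens A B a b \<otimes>\<^bsub>tensor A B\<^esub> tens A B a' b' = tens A B (a \<otimes>\<^bsub>A\<^esub> a') (b \<otimes>\<^bsub>B\<^esub> b')"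
 using assms by (intro tensor_eqI) (simp_all add: tens_carrier ev_lmult ev_tens bil_translate)

end

subsection \<open>The free algebra and presentations\<close>

lemma monoid_words: "monoid \<lparr>carrier = UNIV, mult = (@), one = []\<rparr>"
 by (rule monoidI) auto

interpretation free: kalg "free_alg :: ('k::field, gen list \<Rightarrow>\<^sub>0 'k) module"
 unfolding free_alg_def by (rule kalg.intro[OF monoid.k_algebra_monoid_alg[OF monoid_words]])

lemma free_alg_simps [simp]:
 "carrier free_alg = UNIV" "zero free_alg = 0" "add free_alg = (+)"
 "smult free_alg c = Poly_Mapping.map ((*) c)" "one free_alg = Poly_Mapping.single [] 1"
 by (simp_all add: free_alg_def)

lemma free_minus [simp]: "x \<ominus>\<^bsub>free_alg\<^esub> y = x - (y :: gen list \<Rightarrow>\<^sub>0 'k::field)"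
 and free_neg [simp]: "\<ominus>\<^bsub>free_alg\<^esub> y = - (y :: gen list \<Rightarrow>\<^sub>0 'k::field)"
proof -
 show n: "\<ominus>\<^bsub>free_alg\<^esub> y = - y" for y :: "gen list \<Rightarrow>\<^sub>0 'k"
  using free.minus_equality[of "- y" y] by simp
 show "x \<ominus>\<^bsub>free_alg\<^esub> y = x - y" by (simp add: a_minus_def n)
qed

lemma free_induct [case_names one add smult mult]:
 fixes f :: "gen list \<Rightarrow>\<^sub>0 'k::field"
 assumes "P \<one>\<^bsub>free_alg\<^esub>" "!!x y. P x ==> P y ==> P (x + y)" "!!c x. P x ==> P (c \<odot>\<^bsub>free_alg\<^esub> x)"
  "!!a x. P x ==> P (var a \<otimes>\<^bsub>free_alg\<^esub> x)"
 shows "P f"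
proof -
 have w: "P (Poly_Mapping.single w 1)" for w
 proof (induction w)
  case Nil
  then show ?case using assms(1) by simp
 next
  case (Cons a w)
  then show ?case using assms(4)[OF Cons, of a] by (simp add: var_def free_alg_def single_mult)
 qed
 have s: "P (Poly_Mapping.single w c)" for w c using assms(3)[OF w, of c] by simp
 have "P (\<Sum>w\<in>S. Poly_Mapping.single w (c w))" if "finite S" for S c
  using that by (induction S) (use s[of _ 0] s assms(2) in auto)
 from this[of "Poly_Mapping.keys f" "Poly_Mapping.lookup f"] show ?thesis
  using formal_decomp[of f] by simp
qed

definition word :: "('k::field, 'b, 'n) module_scheme => (gen => 'b) => gen list => 'b" where
 "word B \<phi> w = foldr (%a b. \<phi> a \<otimes>\<^bsub>B\<^esub> b) w \<one>\<^bsub>B\<^esub>"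

context sep_alg
begin

context
 fixes \<phi> :: "gen => 'a" assumes \<phi>: "!!a. \<phi> a \<in> carrier A"
begin

lemma word_closed: "word A \<phi> w \<in> carrier A"
 by (induction w) (auto simp: word_def \<phi>)

lemma word_append: "word A \<phi> (v @ w) = word A \<phi> v \<otimes> word A \<phi> w"
proof (induction v)
 case Nil
 show ?case using word_closed[of w] by (simp add: word_def)
next
 case (Cons a v)
 have "word A \<phi> (a # u) = \<phi> a \<otimes> word A \<phi> u" for u by (simp add: word_def)
 then show ?case using Cons \<phi> word_closed by (simp add: m_assoc)
qed

lemma free_eval_closed: "free_eval A \<phi> f \<in> carrier A"
 unfolding free_eval_def word_def[symmetric] using word_closed by (intro finsum_closed) auto

lemma dual_free_eval: "\<psi> \<in> dual A ==> \<psi> (free_eval A \<phi> f) = klin (%w. \<psi> (word A \<phi> w)) f"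
 unfolding free_eval_def word_def[symmetric] klin_def using word_closed
 by (subst dual_finsum) (auto simp: dual_smult)

text \<open>Multiplicativity is checked after a functional. Translates of functionals by algebra
  elements are functionals again, so both factors can be expanded into words, where
  \<open>word_append\<close> applies.\<close>

lemma free_eval_hom: "free_eval A \<phi> \<in> alg_hom free_alg A"
 unfolding alg_hom_iff
proof (intro conjI ballI)
 show "free_eval A \<phi> \<in> lin_maps free_alg A"
  by (rule lin_mapsI_sep[OF free.vs sep_space_axioms])
   (auto simp: free_eval_closed dual_free_eval dual_def klin_add klin_scale)
 show "free_eval A \<phi> \<one>\<^bsub>free_alg\<^esub> = \<one>"
  by (rule sep) (auto simp: free_eval_closed dual_free_eval klin_single word_def)
 fix f g :: "gen list \<Rightarrow>\<^sub>0 'k"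
 show "free_eval A \<phi> (f \<otimes>\<^bsub>free_alg\<^esub> g) = free_eval A \<phi> f \<otimes> free_eval A \<phi> g"
 proof (rule sep)
  fix \<psi> assume \<psi>: "\<psi> \<in> dual A"
  have "\<psi> (free_eval A \<phi> f \<otimes> free_eval A \<phi> g) = klin (%u. \<psi> (word A \<phi> u \<otimes> free_eval A \<phi> g)) f"
   by (rule dual_free_eval[OF dual_rmult[OF \<psi> free_eval_closed]])
  also have "... = klin (%u. klin (%v. \<psi> (word A \<phi> u \<otimes> word A \<phi> v)) g) f"
   by (intro klin_cong dual_free_eval[OF dual_lmult[OF \<psi> word_closed]])
  finally show "\<psi> (free_eval A \<phi> (f \<otimes>\<^bsub>free_alg\<^esub> g)) = \<psi> (free_eval A \<phi> f \<otimes> free_eval A \<phi> g)"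
   by (simp add: dual_free_eval[OF \<psi>] free_alg_def klin_mult word_append)
 qed (simp_all add: free_eval_closed)
qed

lemma free_eval_var: "free_eval A \<phi> (var a) = \<phi> a"
 by (rule sep) (auto simp: free_eval_closed dual_free_eval klin_single word_def var_def \<phi>)

end
end

section \<open>Algebras presented by generators and relations, and their universal property\<close>

context
 fixes R :: "(gen list \<Rightarrow>\<^sub>0 'k::field) set"
begin

definition pcls :: "(gen list \<Rightarrow>\<^sub>0 'k) => (gen list \<Rightarrow>\<^sub>0 'k) set" where
 "pcls f = (Idl\<^bsub>free_alg\<^esub> R) +>\<^bsub>free_alg\<^esub> f"

lemma Idl_ideal: "ideal (Idl\<^bsub>free_alg\<^esub> R) free_alg"
 by (rule free.genideal_ideal) simp

interpretation P: kalg "pres_alg R"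
 unfolding pres_alg_def by (rule kalg.intro[OF free.k_algebra_quot(1)[OF Idl_ideal]])

lemma pres_kalg: "kalg (pres_alg R)" by (rule P.kalg_axioms)

lemma pres_carrier: "carrier (pres_alg R) = range pcls"
 using free.quot_alg_simps(1)[OF free.ideal_subsp[OF Idl_ideal]] by (auto simp: pres_alg_def pcls_def)

lemma pcls_hom: "pcls \<in> alg_hom free_alg (pres_alg R)"
 unfolding alg_hom_iff lin_maps_iff pres_carrier
 using free.quot_alg_simps(3-)[OF free.ideal_subsp[OF Idl_ideal]] free.k_algebra_quot(2)[OF Idl_ideal]
 by (auto simp: pres_alg_def pcls_def)

lemma pcls_eq_iff: "pcls f = pcls g \<longleftrightarrow> f - g \<in> Idl\<^bsub>free_alg\<^esub> R"
 using free.coset_eq_iff[OF free.ideal_subsp[OF Idl_ideal], of f g] by (simp add: pcls_def)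

lemma pcls_rel: "r \<in> R ==> pcls r = \<zero>\<^bsub>pres_alg R\<^esub>"
 using pcls_eq_iff[of r 0] free.genideal_self[of R] lin_maps_zero[OF free.vs P.vs alg_homD(1)[OF pcls_hom]] by auto

lemma pres_var_pcls: "pres_var R a = pcls (var a)"
 by (simp add: pres_var_def pcls_def)

lemma pres_induct [consumes 1, case_names one add smult mult]:
 assumes "\<xi> \<in> carrier (pres_alg R)"
  and "P \<one>\<^bsub>pres_alg R\<^esub>" "!!x y. x \<in> carrier (pres_alg R) ==> y \<in> carrier (pres_alg R) ==> P x ==> P y ==> P (x \<oplus>\<^bsub>pres_alg R\<^esub> y)"
  "!!c x. x \<in> carrier (pres_alg R) ==> P x ==> P (c \<odot>\<^bsub>pres_alg R\<^esub> x)"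
  "!!a x. x \<in> carrier (pres_alg R) ==> P x ==> P (pres_var R a \<otimes>\<^bsub>pres_alg R\<^esub> x)"
 shows "P \<xi>"
proof -
 note h = alg_homD[OF pcls_hom]
 have "P (pcls f)" for f
 proof (induction f rule: free_induct)
  case one
  then show ?case using assms(2) h(3) by simp
 next
  case (add x y)
  then show ?case using assms(3)[OF h(2) h(2), of x y] h(5)[of x y] by simp
 next
  case (smult c x)
  then show ?case using assms(4)[OF h(2), of x c] h(6)[of x c] by simp
 next
  case (mult a x)
  then show ?case using assms(5)[OF h(2), of x a] h(4)[of "var a" x] by (simp add: pres_var_pcls)
 qed
 then show ?thesis using assms(1) by (auto simp: pres_carrier)
qed

text \<open>The universal map out of a presented algebra, in the shape in which
  \<open>pres_hopf\<close> writes its comultiplication and counit.\<close>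

definition pres_lift :: "('k, 'b, 'n) module_scheme => (gen => 'b) => (gen list \<Rightarrow>\<^sub>0 'k) set => 'b" where
 "pres_lift B \<phi> \<xi> = the_elem (free_eval B \<phi> ` \<xi>)"

text \<open>The kernel of the evaluation map is an ideal that contains R, hence contains the ideal
  generated by R; so evaluation is constant on every coset.\<close>

lemma pres_lift:
 assumes "sep_alg B" "!!a. \<phi> a \<in> carrier B" and rel: "!!r. r \<in> R ==> free_eval B \<phi> r = \<zero>\<^bsub>B\<^esub>"
 shows "pres_lift B \<phi> \<in> alg_hom (pres_alg R) B" "pres_lift B \<phi> (pres_var R a) = \<phi> a"
  "pres_lift B \<phi> (pcls f) = free_eval B \<phi> f"
proof -
 interpret B: sep_alg B by fact
 let ?e = "free_eval B \<phi>"
 note e = B.free_eval_hom[of \<phi>, OF assms(2)]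
 note h = alg_homD[OF e]
 have "ring_hom_ring free_alg B ?e"
  by (rule ring_hom_ringI2[OF free.ring_axioms B.ring_axioms]) (use e in \<open>simp add: alg_hom_def\<close>)
 then have "ideal (a_kernel free_alg B ?e) free_alg" by (rule ring_hom_ring.kernel_is_ideal)
 then have "Idl\<^bsub>free_alg\<^esub> R \<subseteq> a_kernel free_alg B ?e"
  using rel by (intro free.genideal_minimal) (auto simp: a_kernel_def')
 then have z: "?e i = \<zero>\<^bsub>B\<^esub>" if "i \<in> Idl\<^bsub>free_alg\<^esub> R" for i using that by (auto simp: a_kernel_def')
 have ne: "f \<in> pcls f" for f
  unfolding pcls_def by (rule free.coset_self[OF free.ideal_subsp[OF Idl_ideal]]) simp
 have "?e g = ?e f" if "g \<in> pcls f" for f g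
 proof -
  have "\<exists>i\<in>Idl\<^bsub>free_alg\<^esub> R. g = i \<oplus>\<^bsub>free_alg\<^esub> f" using that unfolding pcls_def free.coset_mem .
  then obtain i where i: "i \<in> Idl\<^bsub>free_alg\<^esub> R" "g = i + f" by auto
  show ?thesis using h(5)[of i f] z[OF i(1)] h(2)[of f] i(2) by simp
 qed
 then have "?e ` pcls f = {?e f}" for f using ne by blast
 then have l: "pres_lift B \<phi> (pcls f) = ?e f" for f by (simp add: pres_lift_def)
 show "pres_lift B \<phi> (pcls f) = ?e f" by (rule l)
 show "pres_lift B \<phi> (pres_var R a) = \<phi> a"
  using B.free_eval_var[of \<phi>, OF assms(2)] by (simp add: pres_var_pcls l)
 note ch = alg_homD[OF pcls_hom]
 show "pres_lift B \<phi> \<in> alg_hom (pres_alg R) B"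
  unfolding alg_hom_iff lin_maps_iff
 proof (intro conjI ballI allI)
  show "pres_lift B \<phi> \<in> carrier (pres_alg R) \<rightarrow> carrier B" using h(2) by (auto simp: pres_carrier l)
  show "pres_lift B \<phi> \<one>\<^bsub>pres_alg R\<^esub> = \<one>\<^bsub>B\<^esub>" using l[of "\<one>\<^bsub>free_alg\<^esub>"] ch(3) h(3) by simp
  fix \<xi> assume "\<xi> \<in> carrier (pres_alg R)"
  then obtain f where f: "\<xi> = pcls f" by (auto simp: pres_carrier)
  show "pres_lift B \<phi> (c \<odot>\<^bsub>pres_alg R\<^esub> \<xi>) = c \<odot>\<^bsub>B\<^esub> pres_lift B \<phi> \<xi>" for c
   using ch(6)[of f c] h(6)[of f c] l[of f] l[of "c \<odot>\<^bsub>free_alg\<^esub> f"] f by simp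
  fix \<eta> assume "\<eta> \<in> carrier (pres_alg R)"
  then obtain g where g: "\<eta> = pcls g" by (auto simp: pres_carrier)
  show "pres_lift B \<phi> (\<xi> \<oplus>\<^bsub>pres_alg R\<^esub> \<eta>) = pres_lift B \<phi> \<xi> \<oplus>\<^bsub>B\<^esub> pres_lift B \<phi> \<eta>"
   using ch(5)[of f g] h(5)[of f g] l[of f] l[of g] l[of "f \<oplus>\<^bsub>free_alg\<^esub> g"] f g by simp
  show "pres_lift B \<phi> (\<xi> \<otimes>\<^bsub>pres_alg R\<^esub> \<eta>) = pres_lift B \<phi> \<xi> \<otimes>\<^bsub>B\<^esub> pres_lift B \<phi> \<eta>"
   using ch(4)[of f g] h(4)[of f g] l[of f] l[of g] l[of "f \<otimes>\<^bsub>free_alg\<^esub> g"] f g by simp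
 qed
qed

end

section \<open>Comultiplications through functionals\<close>

text \<open>The product of the dual algebra of a coalgebra. Coassociativity and the counit laws
  become its associativity and unit laws.\<close>

definition conv :: "('k::field, 'a, 'm) hopf_scheme => ('a => 'k) => ('a => 'k) => 'a => 'k" where
 "conv H \<phi> \<psi> c = ev (%a b. \<phi> a * \<psi> b) (comult H c)"

definition primitives :: "('k::field, 'a, 'm) hopf_scheme => 'a set" where
 "primitives H = {x \<in> carrier H. comult H x = tens H H x \<one>\<^bsub>H\<^esub> \<oplus>\<^bsub>tensor H H\<^esub> tens H H \<one>\<^bsub>H\<^esub> x}"

text \<open>Weak enough to cover the graded algebra, where only closure of the comultiplication and
  its values on functionals are established.\<close>

locale cospace = fd_space H for H :: "('k::field, 'a, 'm) hopf_scheme" (structure) +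
 assumes comult_closed: "c \<in> carrier H ==> comult H c \<in> carrier (tensor H H)"
begin

sublocale TT: tens_space H H ..

lemma tens_prod_eqI:
 assumes "S \<in> carrier (tensor H H)" "T \<in> carrier (tensor H H)"
  "!!\<phi> \<psi>. \<phi> \<in> dual H ==> \<psi> \<in> dual H ==> ev (%v w. \<phi> v * \<psi> w) S = ev (%v w. \<phi> v * \<psi> w) T"
 shows "S = T"
proof -
 have z: "v = \<zero>" if "v \<in> carrier H" "!!\<phi>. \<phi> \<in> dual H ==> \<phi> v = 0" for v
  using that by (intro sep) (auto simp: dual_zero)
 show ?thesis by (rule tensor_sep_prod[OF fd_space_axioms sep_space_axioms order_refl z order_refl z assms])
qed

lemma conv_simps:
 assumes "c \<in> carrier H" "\<phi> \<in> dual H" "\<psi> \<in> dual H" "\<chi> \<in> dual H"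
 shows "conv H (%x. \<phi> x + \<chi> x) \<psi> c = conv H \<phi> \<psi> c + conv H \<chi> \<psi> c"
  "conv H \<phi> (%x. \<psi> x + \<chi> x) c = conv H \<phi> \<psi> c + conv H \<phi> \<chi> c"
  "conv H (%x. \<phi> x - \<chi> x) \<psi> c = conv H \<phi> \<psi> c - conv H \<chi> \<psi> c"
  "conv H \<phi> (%x. \<psi> x - \<chi> x) c = conv H \<phi> \<psi> c - conv H \<phi> \<chi> c"
  "conv H (%x. k * \<phi> x) \<psi> c = k * conv H \<phi> \<psi> c"
  "conv H \<phi> (%x. k * \<psi> x) c = k * conv H \<phi> \<psi> c"
proof -
 note T = comult_closed[OF assms(1)]
 have b: "(%a b. f a * g b) \<in> bil H H" if "f \<in> dual H" "g \<in> dual H" for f g by (rule bil_prod[OF that])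
 have m: "ev (%a b. - f a b) (comult H c) = - ev f (comult H c)" if "f \<in> bil H H" for f
  using TT.ev_fscale[OF that T, of "-1"] by simp
 have mb: "(%a b. - f a b) \<in> bil H H" if "f \<in> bil H H" for f using bil_closed(3)[OF that, of "-1"] by simp
 show "conv H (%x. \<phi> x + \<chi> x) \<psi> c = conv H \<phi> \<psi> c + conv H \<chi> \<psi> c"
  "conv H \<phi> (%x. \<psi> x + \<chi> x) c = conv H \<phi> \<psi> c + conv H \<phi> \<chi> c"
  unfolding conv_def distrib_left distrib_right using assms by (auto intro: TT.ev_fadd T b)
 show "conv H (%x. k * \<phi> x) \<psi> c = k * conv H \<phi> \<psi> c" "conv H \<phi> (%x. k * \<psi> x) c = k * conv H \<phi> \<psi> c"
  unfolding conv_def mult.left_commute[of _ k] mult.assoc using assms by (auto intro: TT.ev_fscale T b)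
 show "conv H (%x. \<phi> x - \<chi> x) \<psi> c = conv H \<phi> \<psi> c - conv H \<chi> \<psi> c"
  using TT.ev_fadd[OF b[OF assms(2,3)] mb[OF b[OF assms(4,3)]] T] m[OF b[OF assms(4,3)]]
  by (simp add: conv_def left_diff_distrib)
 show "conv H \<phi> (%x. \<psi> x - \<chi> x) c = conv H \<phi> \<psi> c - conv H \<phi> \<chi> c"
  using TT.ev_fadd[OF b[OF assms(2,3)] mb[OF b[OF assms(2,4)]] T] m[OF b[OF assms(2,4)]]
  by (simp add: conv_def right_diff_distrib)
qed

lemma conv_cong:
 assumes "c \<in> carrier H" "\<phi> \<in> dual H" "\<psi> \<in> dual H" "\<phi>' \<in> dual H" "\<psi>' \<in> dual H"
  "!!x. x \<in> carrier H ==> \<phi> x = \<phi>' x" "!!x. x \<in> carrier H ==> \<psi> x = \<psi>' x"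
 shows "conv H \<phi> \<psi> c = conv H \<phi>' \<psi>' c"
 unfolding conv_def
 by (rule TT.ev_fcong[OF _ bil_prod[OF assms(2,3)] bil_prod[OF assms(4,5)] comult_closed[OF assms(1)]]) (simp add: assms)

lemma comult_eq_iff:
 assumes "c \<in> carrier H" "T \<in> carrier (tensor H H)"
 shows "comult H c = T \<longleftrightarrow> (\<forall>\<phi>\<in>dual H. \<forall>\<psi>\<in>dual H. conv H \<phi> \<psi> c = ev (%a b. \<phi> a * \<psi> b) T)"
 using tens_prod_eqI[OF comult_closed[OF assms(1)] assms(2)] by (auto simp: conv_def)

lemma primitive_iff:
 assumes "\<one> \<in> carrier H"
 shows "x \<in> primitives H \<longleftrightarrow> x \<in> carrier H & (\<forall>\<phi>\<in>dual H. \<forall>\<psi>\<in>dual H. conv H \<phi> \<psi> x = \<phi> x * \<psi> \<one> + \<phi> \<one> * \<psi> x)"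
proof (cases "x \<in> carrier H")
 case True
 then show ?thesis
  using assms by (simp add: primitives_def comult_eq_iff TT.tens_carrier TT.ev_simps[OF bil_prod] TT.ev_tens[OF bil_prod])
qed (simp add: primitives_def)

lemma grouplike_iff:
 "u \<in> grouplikes H \<longleftrightarrow> u \<in> carrier H & counit H u = 1 & (\<forall>\<phi>\<in>dual H. \<forall>\<psi>\<in>dual H. conv H \<phi> \<psi> u = \<phi> u * \<psi> u)"
proof (cases "u \<in> carrier H")
 case True
 then show ?thesis
  by (simp add: grouplikes_def comult_eq_iff TT.tens_carrier TT.ev_tens[OF bil_prod] conj_commute)
qed (simp add: grouplikes_def)

end

section \<open>Hopf algebra isomorphisms as maps compatible with convolution\<close>

lemma tensor_hopf_map:
 assumes "cospace H" "cospace L" "f \<in> lin_maps H L" "x \<in> carrier H"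
 shows "comult L (f x) = tensor_map L L f f (comult H x) \<longleftrightarrow>
  (\<forall>\<phi>\<in>dual L. \<forall>\<psi>\<in>dual L. conv L \<phi> \<psi> (f x) = conv H (%a. \<phi> (f a)) (%a. \<psi> (f a)) x)"
proof -
 interpret H: cospace H by fact
 interpret L: cospace L by fact
 note tm = tensor_map[OF H.vs H.vs L.vs L.vs assms(3,3) H.comult_closed[OF assms(4)]]
 have "ev (%a b. \<phi> a * \<psi> b) (tensor_map L L f f (comult H x)) = conv H (%a. \<phi> (f a)) (%a. \<psi> (f a)) x"
  if "\<phi> \<in> dual L" "\<psi> \<in> dual L" for \<phi> \<psi>
  unfolding conv_def by (rule tm(2)[OF bil_prod[OF that]])
 then show ?thesis
  unfolding L.comult_eq_iff[OF lin_mapsD(1)[OF assms(3,4)] tm(1)] by (intro ball_cong refl) simp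
qed

lemma hopf_isomorphic_iff:
 assumes "cospace H" "cospace L"
 shows "hopf_isomorphic H L \<longleftrightarrow> (\<exists>f. f \<in> alg_hom H L & bij_betw f (carrier H) (carrier L) &
   (\<forall>x\<in>carrier H. counit L (f x) = counit H x &
    (\<forall>\<phi>\<in>dual L. \<forall>\<psi>\<in>dual L. conv L \<phi> \<psi> (f x) = conv H (%a. \<phi> (f a)) (%a. \<psi> (f a)) x)))"
 unfolding hopf_isomorphic_def
 using tensor_hopf_map[OF assms alg_homD(1)] by (intro ex_cong) (auto simp: conj_ac)

lemma lin_maps_inv:
 assumes "vsp V" "vsp W" "f \<in> lin_maps V W" "bij_betw f (carrier V) (carrier W)"
 defines "g \<equiv> inv_into (carrier V) f"
 shows "g \<in> lin_maps W V" "!!y. y \<in> carrier W ==> f (g y) = y" "!!x. x \<in> carrier V ==> g (f x) = x"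
  "bij_betw g (carrier W) (carrier V)"
proof -
 interpret V: vspace V by (rule vspace.intro) fact
 interpret W: vspace W by (rule vspace.intro) fact
 note f = lin_mapsD[OF assms(3)]
 have 1: "f (g y) = y" if "y \<in> carrier W" for y
  unfolding g_def by (rule bij_betw_inv_into_right[OF assms(4) that])
 have 2: "g (f x) = x" if "x \<in> carrier V" for x
  unfolding g_def by (rule bij_betw_inv_into_left[OF assms(4) that])
 have b: "bij_betw g (carrier W) (carrier V)" unfolding g_def by (rule bij_betw_inv_into[OF assms(4)])
 have c: "g y \<in> carrier V" if "y \<in> carrier W" for y using b that by (auto simp: bij_betw_def)
 have "g (x \<oplus>\<^bsub>W\<^esub> y) = g x \<oplus>\<^bsub>V\<^esub> g y" if "x \<in> carrier W" "y \<in> carrier W" for x y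
  using 2[of "g x \<oplus>\<^bsub>V\<^esub> g y"] f(2)[OF c[OF that(1)] c[OF that(2)]] 1 that c by simp
 moreover have "g (k \<odot>\<^bsub>W\<^esub> x) = k \<odot>\<^bsub>V\<^esub> g x" if "x \<in> carrier W" for k x
  using 2[of "k \<odot>\<^bsub>V\<^esub> g x"] f(3)[OF c[OF that]] 1 that c by simp
 ultimately show "g \<in> lin_maps W V" using c by (auto simp: lin_maps_iff)
 show "!!y. y \<in> carrier W ==> f (g y) = y" "!!x. x \<in> carrier V ==> g (f x) = x" by (fact 1, fact 2)
 show "bij_betw g (carrier W) (carrier V)" by (rule b)
qed

lemma hopf_iso_sym:
 assumes "cospace H" "cospace L" "k_algebra H" "k_algebra L" "hopf_isomorphic H L"
 shows "hopf_isomorphic L H"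
proof -
 interpret H: cospace H by fact
 interpret L: cospace L by fact
 interpret HA: kalg H by (rule kalg.intro) fact
 interpret LA: kalg L by (rule kalg.intro) fact
 obtain f where f: "f \<in> alg_hom H L" "bij_betw f (carrier H) (carrier L)"
  "!!x. x \<in> carrier H ==> counit L (f x) = counit H x"
  "!!x \<phi> \<psi>. x \<in> carrier H ==> \<phi> \<in> dual L ==> \<psi> \<in> dual L ==> conv L \<phi> \<psi> (f x) = conv H (%a. \<phi> (f a)) (%a. \<psi> (f a)) x"
  using assms(5) unfolding hopf_isomorphic_iff[OF assms(1,2)] by blast
 define g where "g = inv_into (carrier H) f"
 note g = lin_maps_inv[OF H.vs L.vs alg_homD(1)[OF f(1)] f(2), folded g_def]
 have gc: "g y \<in> carrier H" if "y \<in> carrier L" for y using lin_mapsD(1)[OF g(1) that] .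
 have "g \<in> alg_hom L H"
  unfolding alg_hom_iff
 proof (intro conjI ballI g(1))
  show "g \<one>\<^bsub>L\<^esub> = \<one>\<^bsub>H\<^esub>" using g(3)[OF HA.one_closed] alg_homD(3)[OF f(1)] by simp
  fix x y assume xy: "x \<in> carrier L" "y \<in> carrier L"
  show "g (x \<otimes>\<^bsub>L\<^esub> y) = g x \<otimes>\<^bsub>H\<^esub> g y"
   using g(3)[OF HA.m_closed[OF gc gc], OF xy] alg_homD(4)[OF f(1) gc gc, OF xy] g(2) xy by simp
 qed
 moreover have "conv H \<phi> \<psi> (g x) = conv L (%a. \<phi> (g a)) (%a. \<psi> (g a)) x"
  if "x \<in> carrier L" "\<phi> \<in> dual H" "\<psi> \<in> dual H" for x \<phi> \<psi>
 proof -
  have "conv L (%a. \<phi> (g a)) (%a. \<psi> (g a)) (f (g x)) = conv H (%a. \<phi> (g (f a))) (%a. \<psi> (g (f a))) (g x)"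
   by (rule f(4)[OF gc[OF that(1)] dual_lin[OF g(1) that(2)] dual_lin[OF g(1) that(3)]])
  also have "... = conv H \<phi> \<psi> (g x)"
   by (rule H.conv_cong[OF gc[OF that(1)] dual_lin[OF alg_homD(1)[OF f(1)] dual_lin[OF g(1)]]
     dual_lin[OF alg_homD(1)[OF f(1)] dual_lin[OF g(1)]]]) (use that g(3) in auto)
  finally show ?thesis using g(2) that by simp
 qed
 moreover have "counit H (g x) = counit L x" if "x \<in> carrier L" for x
  using f(3)[OF gc[OF that]] g(2)[OF that] by simp
 ultimately show ?thesis unfolding hopf_isomorphic_iff[OF assms(2,1)] using g(4) by blast
qed

lemma hopf_isomorphic_trans:
 assumes "cospace H" "cospace L" "cospace K" "hopf_isomorphic H L" "hopf_isomorphic L K"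
 shows "hopf_isomorphic H K"
proof -
 obtain f where f: "f \<in> alg_hom H L" "bij_betw f (carrier H) (carrier L)"
  "!!x. x \<in> carrier H ==> counit L (f x) = counit H x"
  "!!x \<phi> \<psi>. x \<in> carrier H ==> \<phi> \<in> dual L ==> \<psi> \<in> dual L ==> conv L \<phi> \<psi> (f x) = conv H (%a. \<phi> (f a)) (%a. \<psi> (f a)) x"
  using assms(4) unfolding hopf_isomorphic_iff[OF assms(1,2)] by blast
 obtain g where g: "g \<in> alg_hom L K" "bij_betw g (carrier L) (carrier K)"
  "!!x. x \<in> carrier L ==> counit K (g x) = counit L x"
  "!!x \<phi> \<psi>. x \<in> carrier L ==> \<phi> \<in> dual K ==> \<psi> \<in> dual K ==> conv K \<phi> \<psi> (g x) = conv L (%a. \<phi> (g a)) (%a. \<psi> (g a)) x"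
  using assms(5) unfolding hopf_isomorphic_iff[OF assms(2,3)] by blast
 have "(%x. g (f x)) \<in> alg_hom H K"
  unfolding alg_hom_iff
 proof (intro conjI ballI)
  show "(%x. g (f x)) \<in> lin_maps H K" by (rule lin_maps_comp[OF alg_homD(1)[OF f(1)] alg_homD(1)[OF g(1)]])
 qed (simp_all add: alg_homD(2-4)[OF f(1)] alg_homD(3,4)[OF g(1)])
 moreover have "bij_betw (%x. g (f x)) (carrier H) (carrier K)"
  using bij_betw_trans[OF f(2) g(2)] by (simp add: comp_def)
 moreover have "conv K \<phi> \<psi> (g (f x)) = conv H (%a. \<phi> (g (f a))) (%a. \<psi> (g (f a))) x"
  if "x \<in> carrier H" "\<phi> \<in> dual K" "\<psi> \<in> dual K" for x \<phi> \<psi>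
  using g(4)[OF alg_homD(2)[OF f(1) that(1)] that(2,3)]
   f(4)[OF that(1) dual_lin[OF alg_homD(1)[OF g(1)] that(2)] dual_lin[OF alg_homD(1)[OF g(1)] that(3)]] by simp
 moreover have "counit K (g (f x)) = counit H x" if "x \<in> carrier H" for x
  using f(3)[OF that] g(3)[OF alg_homD(2)[OF f(1) that]] by simp
 ultimately show ?thesis unfolding hopf_isomorphic_iff[OF assms(1,3)]
  by (intro exI[of _ "%x. g (f x)"]) blast
qed

text \<open>Coassociativity and the counit laws are left open here: for the presented algebras they
  are derived inside this locale from the generators.\<close>

locale prebialg = sep_alg H + cospace H for H :: "('k::field, 'a, 'm) hopf_scheme" (structure) +
 assumes comult_hom: "comult H \<in> alg_hom H (tensor H H)"
  and counit_hom: "counit H \<in> alg_hom H base_alg"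
begin

sublocale TT: tens_alg H H ..

lemma counit_dual: "counit H \<in> dual H"
 using alg_homD[OF counit_hom] by (simp add: dual_def base_alg_def)

lemma counit_simps: "counit H \<one> = 1" "x \<in> carrier H ==> y \<in> carrier H ==> counit H (x \<otimes> y) = counit H x * counit H y"
 using alg_homD[OF counit_hom] by (simp_all add: base_alg_def)

lemma ev_comult_dual: "\<beta> \<in> bil H H ==> (%c. ev \<beta> (comult H c)) \<in> dual H"
 by (rule dual_lin[OF alg_homD(1)[OF comult_hom] TT.ev_dual])

lemma conv_dual: "\<phi> \<in> dual H ==> \<psi> \<in> dual H ==> conv H \<phi> \<psi> \<in> dual H"
 unfolding conv_def[abs_def] by (rule ev_comult_dual[OF bil_prod])

lemma ev_comult_grouplike_mult:
 assumes "u \<in> grouplikes H" "c \<in> carrier H" "\<beta> \<in> bil H H"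
 shows "ev \<beta> (comult H (u \<otimes> c)) = ev (%a b. \<beta> (u \<otimes> a) (u \<otimes> b)) (comult H c)"
 using assms alg_homD(4)[OF comult_hom] by (simp add: grouplikes_def TT.ev_lmult comult_closed)

text \<open>\<Delta>(xc) = (x \<otimes> 1 + 1 \<otimes> x) \<Delta>(c), so a primitive factor acts
  on bilinear forms by a Leibniz rule.\<close>

lemma ev_comult_primitive_mult:
 assumes "x \<in> primitives H" "c \<in> carrier H" "\<beta> \<in> bil H H"
 shows "ev \<beta> (comult H (x \<otimes> c)) = ev (%a b. \<beta> (x \<otimes> a) b) (comult H c) + ev (%a b. \<beta> a (x \<otimes> b)) (comult H c)"
proof -
 have x: "x \<in> carrier H" "comult H x = tens H H x \<one> \<oplus>\<^bsub>tensor H H\<^esub> tens H H \<one> x"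
  using assms(1) unfolding primitives_def by simp_all
 note T = comult_closed[OF assms(2)]
 have l: "(%a b. \<beta> (x \<otimes> a) b) \<in> bil H H" "(%a b. \<beta> a (x \<otimes> b)) \<in> bil H H"
  using bil_comp[OF assms(3) lmult_lin[OF x(1)], of "%b. b" H] bil_comp[OF assms(3) _ lmult_lin[OF x(1)], of "%b. b" H]
  by (auto simp: lin_maps_iff)
 have "ev \<beta> (comult H (x \<otimes> c)) = ev \<beta> (tens H H x \<one> \<otimes>\<^bsub>tensor H H\<^esub> comult H c) + ev \<beta> (tens H H \<one> x \<otimes>\<^bsub>tensor H H\<^esub> comult H c)"
  using x assms alg_homD(4)[OF comult_hom] T
  by (simp add: TT.T.l_distr TT.tens_carrier TT.ev_simps)
 also have "ev \<beta> (tens H H x \<one> \<otimes>\<^bsub>tensor H H\<^esub> comult H c) = ev (%a b. \<beta> (x \<otimes> a) b) (comult H c)"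
  unfolding TT.ev_lmult[OF assms(3) x(1) one_closed T]
  by (rule TT.ev_fcong[OF _ TT.bil_translate(1)[OF assms(3) x(1) one_closed] l(1) T]) simp
 also have "ev \<beta> (tens H H \<one> x \<otimes>\<^bsub>tensor H H\<^esub> comult H c) = ev (%a b. \<beta> a (x \<otimes> b)) (comult H c)"
  unfolding TT.ev_lmult[OF assms(3) one_closed x(1) T]
  by (rule TT.ev_fcong[OF _ TT.bil_translate(1)[OF assms(3) one_closed x(1)] l(2) T]) simp
 finally show ?thesis .
qed

lemma ev_comult_one: "\<beta> \<in> bil H H ==> ev \<beta> (comult H \<one>) = \<beta> \<one> \<one>"
 using alg_homD(3)[OF comult_hom] by (simp add: TT.tensor_one TT.ev_tens)

lemma one_grouplike: "\<one> \<in> grouplikes H"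
 using alg_homD(3)[OF comult_hom] by (simp add: grouplikes_def TT.tensor_one counit_simps)

lemma conv_one: "\<phi> \<in> dual H ==> \<psi> \<in> dual H ==> conv H \<phi> \<psi> \<one> = \<phi> \<one> * \<psi> \<one>"
 unfolding conv_def by (rule ev_comult_one[OF bil_prod])

lemma conv_group_mult:
 assumes "u \<in> grouplikes H" "c \<in> carrier H" "\<phi> \<in> dual H" "\<psi> \<in> dual H"
 shows "conv H \<phi> \<psi> (u \<otimes> c) = conv H (%a. \<phi> (u \<otimes> a)) (%b. \<psi> (u \<otimes> b)) c"
 unfolding conv_def by (rule ev_comult_grouplike_mult[OF assms(1,2) bil_prod[OF assms(3,4)]])

lemma conv_prim_mult:
 assumes "x \<in> primitives H" "c \<in> carrier H" "\<phi> \<in> dual H" "\<psi> \<in> dual H"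
 shows "conv H \<phi> \<psi> (x \<otimes> c) = conv H (%a. \<phi> (x \<otimes> a)) \<psi> c + conv H \<phi> (%b. \<psi> (x \<otimes> b)) c"
 unfolding conv_def by (rule ev_comult_primitive_mult[OF assms(1,2) bil_prod[OF assms(3,4)]])

lemma grouplike_mult:
 assumes "u \<in> grouplikes H" "v \<in> grouplikes H"
 shows "u \<otimes> v \<in> grouplikes H"
proof -
 have c: "u \<in> carrier H" "v \<in> carrier H" using assms by (auto simp: grouplikes_def)
 show ?thesis
  using assms c alg_homD(4)[OF comult_hom c] by (simp add: grouplikes_def counit_simps TT.tens_mult)
qed

text \<open>Both sides of coassociativity live in H \<otimes> (H \<otimes> H). There the products of
  a functional of H with functionals \<psi> \<otimes> \<chi> of the tensor square separate points,
  and on these products the two sides are the two bracketings of a triple convolution.\<close>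

lemma bialgebra_iff:
 "bialgebra H \<longleftrightarrow> (\<forall>c\<in>carrier H.
  (\<forall>\<phi>\<in>dual H. \<forall>\<psi>\<in>dual H. \<forall>\<chi>\<in>dual H. conv H (conv H \<phi> \<psi>) \<chi> c = conv H \<phi> (conv H \<psi> \<chi>) c) &
  (\<forall>\<phi>\<in>dual H. conv H (counit H) \<phi> c = \<phi> c & conv H \<phi> (counit H) c = \<phi> c))"
proof -
 have "(tensor_assoc H H H (tensor_map (tensor H H) H (comult H) (%b. b) (comult H c))
     = tensor_map H (tensor H H) (%a. a) (comult H) (comult H c)) \<longleftrightarrow>
   (\<forall>\<phi>\<in>dual H. \<forall>\<psi>\<in>dual H. \<forall>\<chi>\<in>dual H. conv H (conv H \<phi> \<psi>) \<chi> c = conv H \<phi> (conv H \<psi> \<chi>) c)"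
  if c: "c \<in> carrier H" for c
 proof -
  note T = comult_closed[OF c]
  have id: "(%a. a) \<in> lin_maps H H" by (simp add: lin_maps_iff)
  note dl = alg_homD(1)[OF comult_hom]
  interpret L: tens_space "tensor H H" H ..
  interpret R: tens_space H "tensor H H" ..
  let ?X = "tensor_map (tensor H H) H (comult H) (%b. b) (comult H c)"
  let ?Y = "tensor_map H (tensor H H) (%a. a) (comult H) (comult H c)"
  note X = tensor_map[OF vs vs TT.T.vs vs dl id T]
  note Y = tensor_map[OF vs vs vs TT.T.vs id dl T]
  note A = tensor_assoc[OF vs vs vs X(1)]
  \<comment> \<open>Closure of \<open>tensor_assoc\<close> comes from a lemma that also speaks of
    three functionals; zero functionals instantiate them.\<close>
  note A1 = A(1)[OF dual_closed(5) dual_closed(5) dual_closed(5)]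
  have 1: "ev (%u. ev (%v w. \<phi> u * (\<psi> v * \<chi> w))) (tensor_assoc H H H ?X) = conv H (conv H \<phi> \<psi>) \<chi> c"
   if "\<phi> \<in> dual H" "\<psi> \<in> dual H" "\<chi> \<in> dual H" for \<phi> \<psi> \<chi>
   using A(2)[OF that] X(2)[OF bil_prod[OF TT.ev_dual[OF bil_prod[OF that(1,2)]] that(3)]]
   by (simp add: conv_def[abs_def])
  have e: "k * ev (%v w. \<psi> v * \<chi> w) S = ev (%v w. k * (\<psi> v * \<chi> w)) S"
   if "\<psi> \<in> dual H" "\<chi> \<in> dual H" "S \<in> carrier (tensor H H)" for \<psi> \<chi> S k
   using TT.ev_fscale[OF bil_prod[OF that(1,2)] that(3)] by simp
  have b: "(%u. ev (%v w. \<phi> u * (\<psi> v * \<chi> w))) \<in> bil H (tensor H H)" if "\<phi> \<in> dual H" "\<psi> \<in> dual H" "\<chi> \<in> dual H" for \<phi> \<psi> \<chi>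
   unfolding bil_def
  proof safe
   fix S assume S: "S \<in> carrier (tensor H H)"
   show "(%u. ev (%v w. \<phi> u * (\<psi> v * \<chi> w)) S) \<in> dual H"
    using dual_closed(4)[OF that(1)] unfolding e[OF that(2,3) S, symmetric] .
  qed (rule TT.ev_dual[OF bil_closed(3)[OF bil_prod[OF that(2,3)]]])
  have b': "(%u S. \<phi> u * ev (%v w. \<psi> v * \<chi> w) S) \<in> bil H (tensor H H)" if "\<phi> \<in> dual H" "\<psi> \<in> dual H" "\<chi> \<in> dual H" for \<phi> \<psi> \<chi>
   by (rule bil_prod[OF that(1) TT.ev_dual[OF bil_prod[OF that(2,3)]]])
  have e': "ev (%u S. \<phi> u * ev (%v w. \<psi> v * \<chi> w) S) Z = ev (%u. ev (%v w. \<phi> u * (\<psi> v * \<chi> w))) Z"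
   if "\<phi> \<in> dual H" "\<psi> \<in> dual H" "\<chi> \<in> dual H" "Z \<in> carrier (tensor H (tensor H H))" for \<phi> \<psi> \<chi> Z
   by (rule R.ev_fcong[OF _ b'[OF that(1-3)] b[OF that(1-3)] that(4)]) (rule e[OF that(2,3)])
  have 2: "ev (%u. ev (%v w. \<phi> u * (\<psi> v * \<chi> w))) ?Y = conv H \<phi> (conv H \<psi> \<chi>) c"
   if "\<phi> \<in> dual H" "\<psi> \<in> dual H" "\<chi> \<in> dual H" for \<phi> \<psi> \<chi>
   using Y(2)[OF b'[OF that]] e'[OF that Y(1)] by (simp add: conv_def[abs_def])
  show ?thesis
  proof
   assume "tensor_assoc H H H ?X = ?Y"
   then show "\<forall>\<phi>\<in>dual H. \<forall>\<psi>\<in>dual H. \<forall>\<chi>\<in>dual H. conv H (conv H \<phi> \<psi>) \<chi> c = conv H \<phi> (conv H \<psi> \<chi>) c"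
    using 1 2 by metis
  next
   assume a: "\<forall>\<phi>\<in>dual H. \<forall>\<psi>\<in>dual H. \<forall>\<chi>\<in>dual H. conv H (conv H \<phi> \<psi>) \<chi> c = conv H \<phi> (conv H \<psi> \<chi>) c"
   show "tensor_assoc H H H ?X = ?Y"
   proof (rule tensor_sep_prod[OF fd_space_axioms TT.T.sep_space_axioms order_refl _ _ _ A1 Y(1)])
    show "v = \<zero>" if "v \<in> carrier H" "!!\<phi>. \<phi> \<in> dual H ==> \<phi> v = 0" for v
     using that by (intro sep) (auto simp: dual_zero)
    show "{ev (%v w. \<psi> v * \<chi> w) | \<psi> \<chi>. \<psi> \<in> dual H & \<chi> \<in> dual H} \<subseteq> dual (tensor H H)"
     using TT.ev_dual[OF bil_prod] by auto
    show "S = \<zero>\<^bsub>tensor H H\<^esub>" if "S \<in> carrier (tensor H H)"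
     "!!\<phi>. \<phi> \<in> {ev (%v w. \<psi> v * \<chi> w) | \<psi> \<chi>. \<psi> \<in> dual H & \<chi> \<in> dual H} ==> \<phi> S = 0" for S
     using that TT.ev_simps(3)[OF bil_prod] by (intro tens_prod_eqI) auto
   next
    fix \<phi> \<theta> assume f: "\<phi> \<in> dual H" "\<theta> \<in> {ev (%v w. \<psi> v * \<chi> w) | \<psi> \<chi>. \<psi> \<in> dual H & \<chi> \<in> dual H}"
    then obtain \<psi> \<chi> where p: "\<psi> \<in> dual H" "\<chi> \<in> dual H" "\<theta> = ev (%v w. \<psi> v * \<chi> w)" by auto
    show "ev (%v w. \<phi> v * \<theta> w) (tensor_assoc H H H ?X) = ev (%v w. \<phi> v * \<theta> w) ?Y"
     unfolding p(3) e'[OF f(1) p(1,2) A1] e'[OF f(1) p(1,2) Y(1)] 1[OF f(1) p(1,2)] 2[OF f(1) p(1,2)]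
     using a f(1) p(1,2) by simp
   qed
  qed
 qed
 moreover have "tensor_lift H (%a b. counit H a \<odot> b) (comult H c) = c \<longleftrightarrow> (\<forall>\<phi>\<in>dual H. conv H (counit H) \<phi> c = \<phi> c)"
  "tensor_lift H (%a b. counit H b \<odot> a) (comult H c) = c \<longleftrightarrow> (\<forall>\<phi>\<in>dual H. conv H \<phi> (counit H) c = \<phi> c)"
  if c: "c \<in> carrier H" for c
 proof -
  note T = comult_closed[OF c]
  have bl: "(%a b. counit H a * \<phi> b) \<in> bil H H" "(%a b. \<phi> a * counit H b) \<in> bil H H" if "\<phi> \<in> dual H" for \<phi>
   using bil_prod[OF counit_dual that] bil_prod[OF that counit_dual] by auto
  have bb: "(%a b. \<phi> (counit H a \<odot> b)) \<in> bil H H" "(%a b. \<phi> (counit H b \<odot> a)) \<in> bil H H" if "\<phi> \<in> dual H" for \<phi>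
   using that counit_dual by (auto simp: bil_def dual_def algebra_simps smult_r_distr)
  have m: "(%a b. counit H a \<odot> b) \<in> bil_maps H H H" "(%a b. counit H b \<odot> a) \<in> bil_maps H H H"
   using bb by (simp_all add: bil_maps_def)
  note l1 = TT.tensor_lift[OF sep_space_axioms m(1) T] and l2 = TT.tensor_lift[OF sep_space_axioms m(2) T]
  have e1: "\<phi> (tensor_lift H (%a b. counit H a \<odot> b) (comult H c)) = conv H (counit H) \<phi> c" if "\<phi> \<in> dual H" for \<phi>
   unfolding l1(2)[OF that] conv_def
   by (rule TT.ev_fcong[OF _ bb(1)[OF that] bl(1)[OF that] T]) (simp add: dual_smult[OF that])
  have e2: "\<phi> (tensor_lift H (%a b. counit H b \<odot> a) (comult H c)) = conv H \<phi> (counit H) c" if "\<phi> \<in> dual H" for \<phi>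
   unfolding l2(2)[OF that] conv_def
   by (rule TT.ev_fcong[OF _ bb(2)[OF that] bl(2)[OF that] T]) (simp add: dual_smult[OF that] mult.commute)
  show "tensor_lift H (%a b. counit H a \<odot> b) (comult H c) = c \<longleftrightarrow> (\<forall>\<phi>\<in>dual H. conv H (counit H) \<phi> c = \<phi> c)"
  proof
   assume "\<forall>\<phi>\<in>dual H. conv H (counit H) \<phi> c = \<phi> c"
   then show "tensor_lift H (%a b. counit H a \<odot> b) (comult H c) = c"
    using e1 by (intro sep[OF l1(1) c]) simp
  qed (use e1 in force)
  show "tensor_lift H (%a b. counit H b \<odot> a) (comult H c) = c \<longleftrightarrow> (\<forall>\<phi>\<in>dual H. conv H \<phi> (counit H) c = \<phi> c)"
  proof
   assume "\<forall>\<phi>\<in>dual H. conv H \<phi> (counit H) c = \<phi> c"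
   then show "tensor_lift H (%a b. counit H b \<odot> a) (comult H c) = c"
    using e2 by (intro sep[OF l2(1) c]) simp
  qed (use e2 in force)
 qed
 ultimately show ?thesis unfolding bialgebra_def using ka comult_hom counit_hom by auto
qed

lemma antipode_iff:
 assumes S: "S \<in> lin_maps H H"
 shows "antipode H S \<longleftrightarrow> (\<forall>c\<in>carrier H. \<forall>\<phi>\<in>dual H. ev (%a b. \<phi> (S a \<otimes> b)) (comult H c) = counit H c * \<phi> \<one> &
   ev (%a b. \<phi> (a \<otimes> S b)) (comult H c) = counit H c * \<phi> \<one>)"
proof -
 have id: "(%a. a) \<in> lin_maps H H" by (simp add: lin_maps_iff)
 have b: "(%a b. \<phi> (S a \<otimes> b)) \<in> bil H H" "(%a b. \<phi> (a \<otimes> S b)) \<in> bil H H" if "\<phi> \<in> dual H" for \<phi>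
  using bil_comp[OF bil_mult[OF that] S id] bil_comp[OF bil_mult[OF that] id S] by auto
 have m: "(%a b. S a \<otimes> b) \<in> bil_maps H H H" "(%a b. a \<otimes> S b) \<in> bil_maps H H H"
  using b lin_mapsD(1)[OF S] by (simp_all add: bil_maps_def)
 have "tensor_lift H (%a b. S a \<otimes> b) (comult H c) = counit H c \<odot> \<one> \<longleftrightarrow>
   (\<forall>\<phi>\<in>dual H. ev (%a b. \<phi> (S a \<otimes> b)) (comult H c) = counit H c * \<phi> \<one>)"
  "tensor_lift H (%a b. a \<otimes> S b) (comult H c) = counit H c \<odot> \<one> \<longleftrightarrow>
   (\<forall>\<phi>\<in>dual H. ev (%a b. \<phi> (a \<otimes> S b)) (comult H c) = counit H c * \<phi> \<one>)" if c: "c \<in> carrier H" for c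
 proof -
  note T = comult_closed[OF c]
  note l1 = TT.tensor_lift[OF sep_space_axioms m(1) T] and l2 = TT.tensor_lift[OF sep_space_axioms m(2) T]
  have k: "counit H c \<odot> \<one> \<in> carrier H" by simp
  show "tensor_lift H (%a b. S a \<otimes> b) (comult H c) = counit H c \<odot> \<one> \<longleftrightarrow>
   (\<forall>\<phi>\<in>dual H. ev (%a b. \<phi> (S a \<otimes> b)) (comult H c) = counit H c * \<phi> \<one>)"
  proof
   assume "\<forall>\<phi>\<in>dual H. ev (%a b. \<phi> (S a \<otimes> b)) (comult H c) = counit H c * \<phi> \<one>"
   then show "tensor_lift H (%a b. S a \<otimes> b) (comult H c) = counit H c \<odot> \<one>"
    using l1(2) by (intro sep[OF l1(1) k]) (simp add: dual_smult)
  next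
   assume "tensor_lift H (%a b. S a \<otimes> b) (comult H c) = counit H c \<odot> \<one>"
   then show "\<forall>\<phi>\<in>dual H. ev (%a b. \<phi> (S a \<otimes> b)) (comult H c) = counit H c * \<phi> \<one>"
    by (simp add: dual_smult flip: l1(2))
  qed
  show "tensor_lift H (%a b. a \<otimes> S b) (comult H c) = counit H c \<odot> \<one> \<longleftrightarrow>
   (\<forall>\<phi>\<in>dual H. ev (%a b. \<phi> (a \<otimes> S b)) (comult H c) = counit H c * \<phi> \<one>)"
  proof
   assume "\<forall>\<phi>\<in>dual H. ev (%a b. \<phi> (a \<otimes> S b)) (comult H c) = counit H c * \<phi> \<one>"
   then show "tensor_lift H (%a b. a \<otimes> S b) (comult H c) = counit H c \<odot> \<one>"
    using l2(2) by (intro sep[OF l2(1) k]) (simp add: dual_smult)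
  next
   assume "tensor_lift H (%a b. a \<otimes> S b) (comult H c) = counit H c \<odot> \<one>"
   then show "\<forall>\<phi>\<in>dual H. ev (%a b. \<phi> (a \<otimes> S b)) (comult H c) = counit H c * \<phi> \<one>"
    by (simp add: dual_smult flip: l2(2))
  qed
 qed
 then show ?thesis unfolding antipode_def using S by auto
qed

end

locale bialg = prebialg +
 assumes bialg: "bialgebra H"
begin

lemma conv_assoc: "c \<in> carrier H ==> \<phi> \<in> dual H ==> \<psi> \<in> dual H ==> \<chi> \<in> dual H ==>
  conv H (conv H \<phi> \<psi>) \<chi> c = conv H \<phi> (conv H \<psi> \<chi>) c"
 using bialg unfolding bialgebra_iff by blast

lemma conv_counit: "c \<in> carrier H ==> \<phi> \<in> dual H ==> conv H (counit H) \<phi> c = \<phi> c"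
 "c \<in> carrier H ==> \<phi> \<in> dual H ==> conv H \<phi> (counit H) c = \<phi> c"
 using bialg unfolding bialgebra_iff by blast+

text \<open>The vector \<open>(id \<otimes> \<psi>) \<Delta>(c)\<close>, characterised by its functionals.\<close>

lemma contract:
 assumes "c \<in> carrier H" "\<psi> \<in> dual H"
 obtains v where "v \<in> carrier H" "!!\<phi>. \<phi> \<in> dual H ==> \<phi> v = conv H \<phi> \<psi> c"
proof -
 have bb: "(%a b. \<phi> (\<psi> b \<odot> a)) \<in> bil H H" if "\<phi> \<in> dual H" for \<phi>
  using that assms(2) by (auto simp: bil_def dual_def algebra_simps smult_r_distr)
 have m: "(%a b. \<psi> b \<odot> a) \<in> bil_maps H H H" using bb by (simp add: bil_maps_def)
 note l = TT.tensor_lift[OF sep_space_axioms m comult_closed[OF assms(1)]]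
 have "\<phi> (tensor_lift H (%a b. \<psi> b \<odot> a) (comult H c)) = conv H \<phi> \<psi> c" if "\<phi> \<in> dual H" for \<phi>
  unfolding l(2)[OF that] conv_def
  by (rule TT.ev_fcong[OF _ bb[OF that] bil_prod[OF that assms(2)] comult_closed[OF assms(1)]])
   (simp add: dual_smult[OF that] mult.commute)
 then show ?thesis using that l(1) by blast
qed

text \<open>The mirror image of the preceding contraction: the vector (\<psi> \<otimes> id)
  \<Delta>(c).\<close>

lemma contract_left:
 assumes "c \<in> carrier H" "\<psi> \<in> dual H"
 obtains v where "v \<in> carrier H" "!!\<phi>. \<phi> \<in> dual H ==> \<phi> v = conv H \<psi> \<phi> c"
proof -
 have bb: "(%a b. \<phi> (\<psi> a \<odot> b)) \<in> bil H H" if "\<phi> \<in> dual H" for \<phi>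
  using that assms(2) by (auto simp: bil_def dual_def algebra_simps smult_r_distr)
 have m: "(%a b. \<psi> a \<odot> b) \<in> bil_maps H H H" using bb by (simp add: bil_maps_def)
 note l = TT.tensor_lift[OF sep_space_axioms m comult_closed[OF assms(1)]]
 have "\<phi> (tensor_lift H (%a b. \<psi> a \<odot> b) (comult H c)) = conv H \<psi> \<phi> c" if "\<phi> \<in> dual H" for \<phi>
  unfolding l(2)[OF that] conv_def
  by (rule TT.ev_fcong[OF _ bb[OF that] bil_prod[OF assms(2) that] comult_closed[OF assms(1)]])
   (simp add: dual_smult[OF that] mult.commute)
 then show ?thesis using that l(1) by blast
qed

end

lemma bialgI:
 assumes "bialgebra H" "vectorspace.fin_dim class_ring H"
 shows "bialg H"
proof -
 have ka: "k_algebra H" and h: "comult H \<in> alg_hom H (tensor H H)" "counit H \<in> alg_hom H base_alg"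
  using assms(1) by (auto simp: bialgebra_def)
 interpret A: kalg H by (rule kalg.intro[OF ka])
 interpret F: fd_space H by unfold_locales (rule assms(2))
 show ?thesis
  by unfold_locales (use h assms alg_homD(2)[OF h(1)] in auto)
qed

section \<open>The coradical filtration\<close>

lemma lin_span_image:
 assumes "vsp V" "vsp W" "f \<in> lin_maps V W" "S <= carrier V" "subsp W U" "f ` S \<subseteq> U" "x \<in> lspan V S"
 shows "f x \<in> U"
proof -
 interpret V: vspace V by (rule vspace.intro) fact
 interpret W: vspace W by (rule vspace.intro) fact
 show ?thesis
  using assms(7,4)
 proof (induction rule: V.span_induct)
  case zero
  then show ?case using lin_maps_zero[OF assms(1-3)] W.subspD(2)[OF assms(5)] by simp
 qed (use assms(6) lin_mapsD[OF assms(3)] W.subspD[OF assms(5)] in auto)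
qed

lemma tensor_map_tens:
 assumes "vsp V" "vsp W" "vsp V'" "vsp W'" "f \<in> lin_maps V V'" "g \<in> lin_maps W W'" "v \<in> carrier V" "w \<in> carrier W"
 shows "tensor_map V' W' f g (tens V W v w) = tens V' W' (f v) (g w)"
proof -
 interpret A: tens_space V W by (intro tens_space.intro vspace.intro) fact+
 interpret B: tens_space V' W' by (intro tens_space.intro vspace.intro) fact+
 note tm = tensor_map[OF assms(1-6) A.tens_carrier[OF assms(7,8)]]
 show ?thesis
  by (rule B.tensor_eqI[OF tm(1) B.tens_carrier])
   (simp_all add: tm(2) A.ev_tens bil_comp assms B.ev_tens lin_mapsD(1)[OF assms(5)] lin_mapsD(1)[OF assms(6)])
qed

context cospace
begin

lemma tensor_sub_subset:
 assumes "U <= carrier H" "W <= carrier H"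
 shows "{tens H H u w | u w. u \<in> U & w \<in> W} <= carrier (tensor H H)"
 using assms TT.tens_carrier by auto

lemma tensor_sub_ev:
 assumes "U <= carrier H" "W <= carrier H" "T \<in> tensor_sub H U W" "\<phi> \<in> dual H" "\<psi> \<in> dual H"
  and "(\<forall>u\<in>U. \<phi> u = 0) | (\<forall>w\<in>W. \<psi> w = 0)"
 shows "ev (%a b. \<phi> a * \<psi> b) T = 0"
proof (rule TT.T.dual_span_zero[OF TT.ev_dual[OF bil_prod[OF assms(4,5)]] tensor_sub_subset[OF assms(1,2)] _ assms(3)[unfolded tensor_sub_def]])
 fix s assume "s \<in> {tens H H u w | u w. u \<in> U & w \<in> W}"
 then obtain u w where uw: "s = tens H H u w" "u \<in> U" "w \<in> W" by blast
 then have "u \<in> carrier H" "w \<in> carrier H" using assms by auto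
 then show "ev (%a b. \<phi> a * \<psi> b) s = 0" using TT.ev_tens[OF bil_prod[OF assms(4,5)]] uw assms(6) by auto
qed

lemma tensor_map_sub:
 assumes "f \<in> lin_maps H H" "g \<in> lin_maps H H" "f ` carrier H \<subseteq> U" "g ` carrier H \<subseteq> W" "U <= carrier H" "W <= carrier H"
  and "T \<in> carrier (tensor H H)"
 shows "tensor_map H H f g T \<in> tensor_sub H U W"
proof (rule lin_span_image[OF TT.T.vs TT.T.vs tensor_map_lin[OF vs vs vs vs assms(1,2)], of "{tens H H v w | v w. v \<in> carrier H & w \<in> carrier H}"])
 show "{tens H H v w | v w. v \<in> carrier H & w \<in> carrier H} <= carrier (tensor H H)" using TT.tens_carrier by auto
 show "subsp (tensor H H) (tensor_sub H U W)"
  unfolding tensor_sub_def by (rule TT.T.subsp_span[OF tensor_sub_subset[OF assms(5,6)]])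
 show "tensor_map H H f g ` {tens H H v w | v w. v \<in> carrier H & w \<in> carrier H} \<subseteq> tensor_sub H U W"
 proof safe
  fix v w assume vw: "v \<in> carrier H" "w \<in> carrier H"
  have "tens H H (f v) (g w) \<in> tensor_sub H U W"
   unfolding tensor_sub_def by (rule TT.T.span_base[OF tensor_sub_subset[OF assms(5,6)]]) (use vw assms in blast)
  then show "tensor_map H H f g (tens H H v w) \<in> tensor_sub H U W"
   using tensor_map_tens[OF vs vs vs vs assms(1,2) vw] by simp
 qed
 show "T \<in> lspan (tensor H H) {tens H H v w | v w. v \<in> carrier H & w \<in> carrier H}"
  using assms(7) TT.tensor_span_tens by simp
qed

text \<open>With projections P onto U and Q onto W, split the identity as P + (1 - P) on the left
  and Q + (1 - Q) on the right. The part of T under (1 - P) \<otimes> (1 - Q) vanishes, because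
  \<phi> (1 - P) and \<psi> (1 - Q) lie in the two annihilators; the other parts lie in the two
  summands.\<close>

lemma tensor_sum_iff:
 assumes U: "subsp H U" and W: "subsp H W" and T: "T \<in> carrier (tensor H H)"
 shows "T \<in> tensor_sub H (carrier H) W <+>\<^bsub>tensor H H\<^esub> tensor_sub H U (carrier H) \<longleftrightarrow>
  (\<forall>\<phi>\<in>ann H U. \<forall>\<psi>\<in>ann H W. ev (%a b. \<phi> a * \<psi> b) T = 0)"
proof
 have Uc: "U <= carrier H" and Wc: "W <= carrier H" using U W by (auto simp: subsp_def)
 have sc: "tensor_sub H A B <= carrier (tensor H H)" if "A <= carrier H" "B <= carrier H" for A B
  unfolding tensor_sub_def by (rule TT.T.span_least[OF TT.T.subsp_carrier tensor_sub_subset[OF that]])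
 assume "T \<in> tensor_sub H (carrier H) W <+>\<^bsub>tensor H H\<^esub> tensor_sub H U (carrier H)"
 then obtain A B where AB: "A \<in> tensor_sub H (carrier H) W" "B \<in> tensor_sub H U (carrier H)" "T = A \<oplus>\<^bsub>tensor H H\<^esub> B"
  by (auto simp: set_add_def')
 have c: "A \<in> carrier (tensor H H)" "B \<in> carrier (tensor H H)" using AB sc Uc Wc by blast+
 show "\<forall>\<phi>\<in>ann H U. \<forall>\<psi>\<in>ann H W. ev (%a b. \<phi> a * \<psi> b) T = 0"
 proof (intro ballI)
  fix \<phi> \<psi> assume f: "\<phi> \<in> ann H U" "\<psi> \<in> ann H W"
  show "ev (%a b. \<phi> a * \<psi> b) T = 0"
   unfolding AB(3) TT.ev_simps(1)[OF bil_prod[OF annD(1)[OF f(1)] annD(1)[OF f(2)]] c]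
   using tensor_sub_ev[OF _ Wc AB(1) annD(1)[OF f(1)] annD(1)[OF f(2)]] annD(2)[OF f(2)]
    tensor_sub_ev[OF Uc _ AB(2) annD(1)[OF f(1)] annD(1)[OF f(2)]] annD(2)[OF f(1)] by simp
 qed
next
 have Uc: "U <= carrier H" and Wc: "W <= carrier H" using U W by (auto simp: subsp_def)
 assume z: "\<forall>\<phi>\<in>ann H U. \<forall>\<psi>\<in>ann H W. ev (%a b. \<phi> a * \<psi> b) T = 0"
 obtain P where P: "P \<in> lin_maps H H" "!!v. v \<in> carrier H ==> P v \<in> U" "!!u. u \<in> U ==> P u = u"
  by (rule projection[OF U]) blast
 obtain Q where Q: "Q \<in> lin_maps H H" "!!v. v \<in> carrier H ==> Q v \<in> W" "!!u. u \<in> W ==> Q u = u"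
  by (rule projection[OF W]) blast
 define N where "N v = v \<ominus> P v" for v
 have id: "(%a. a) \<in> lin_maps H H" by (simp add: lin_maps_iff)
 have N\<phi>: "\<phi> (N v) = \<phi> v - \<phi> (P v)" if "\<phi> \<in> dual H" "v \<in> carrier H" for \<phi> v
  unfolding N_def using dual_minus[OF that(1)] that lin_mapsD(1)[OF P(1)] by simp
 have Nd: "(%v. \<phi> (N v)) \<in> dual H" if "\<phi> \<in> dual H" for \<phi>
  by (rule dual_cong[OF dual_closed(2)[OF that dual_lin[OF P(1) that]] vs]) (simp add: N\<phi>[OF that])
 have N: "N \<in> lin_maps H H"
  by (rule lin_mapsI_sep[OF vs sep_space_axioms _ Nd]) (use lin_mapsD(1)[OF P(1)] in \<open>auto simp: N_def\<close>)
 let ?A = "tensor_map H H N Q T" and ?B = "tensor_map H H P (%a. a) T"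
 note tA = tensor_map[OF vs vs vs vs N Q(1) T] and tB = tensor_map[OF vs vs vs vs P(1) id T]
 have "T = ?A \<oplus>\<^bsub>tensor H H\<^esub> ?B"
 proof (rule tens_prod_eqI[OF T])
  show "?A \<oplus>\<^bsub>tensor H H\<^esub> ?B \<in> carrier (tensor H H)" using tA(1) tB(1) by simp
  fix \<phi> \<psi> assume f: "\<phi> \<in> dual H" "\<psi> \<in> dual H"
  note b = bil_prod[OF f]
  have a1: "(%v. \<phi> (N v)) \<in> ann H U" using Nd[OF f(1)] N\<phi>[OF f(1)] P(3) Uc by (auto simp: ann_def)
  have a2: "(%v. \<psi> v - \<psi> (Q v)) \<in> ann H W"
   using dual_closed(2)[OF f(2) dual_lin[OF Q(1) f(2)]] Q(3) by (auto simp: ann_def)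
  note b1 = bil_prod[OF Nd[OF f(1)] f(2)] and b2 = bil_prod[OF Nd[OF f(1)] dual_lin[OF Q(1) f(2)]]
   and b3 = bil_prod[OF dual_lin[OF P(1) f(1)] f(2)] and b4 = bil_prod[OF annD(1)[OF a1] annD(1)[OF a2]]
  have "ev (%a b. \<phi> a * \<psi> b) T = ev (%a b. \<phi> (N a) * (\<psi> b - \<psi> (Q b)) + (\<phi> (N a) * \<psi> (Q b) + \<phi> (P a) * \<psi> b)) T"
   by (rule TT.ev_fcong[OF _ b bil_closed(1)[OF b4 bil_closed(1)[OF b2 b3]] T]) (simp add: N\<phi>[OF f(1)] algebra_simps)
  also have "... = ev (%a b. \<phi> (N a) * \<psi> (Q b)) T + ev (%a b. \<phi> (P a) * \<psi> b) T"
   using TT.ev_fadd[OF b4 bil_closed(1)[OF b2 b3] T] TT.ev_fadd[OF b2 b3 T] z a1 a2 by simp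
  finally show "ev (%a b. \<phi> a * \<psi> b) T = ev (%a b. \<phi> a * \<psi> b) (?A \<oplus>\<^bsub>tensor H H\<^esub> ?B)"
   using TT.ev_simps(1)[OF b tA(1) tB(1)] tA(2)[OF b] tB(2)[OF b] by simp
 qed
 moreover have "?A \<in> tensor_sub H (carrier H) W"
  by (rule tensor_map_sub[OF N Q(1) _ _ _ Wc T]) (use lin_mapsD(1)[OF N] Q(2) in auto)
 moreover have "?B \<in> tensor_sub H U (carrier H)"
  by (rule tensor_map_sub[OF P(1) id _ _ Uc _ T]) (use P(2) in auto)
 ultimately show "T \<in> tensor_sub H (carrier H) W <+>\<^bsub>tensor H H\<^esub> tensor_sub H U (carrier H)"
  unfolding set_add_def' by blast
qed

lemma subsp_coradical: "subsp H (coradical H)"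
proof -
 have "C <= carrier H" if "simple_subcoalgebra H C" for C
  using that subspace_iff[of C] by (auto simp: simple_subcoalgebra_def subcoalgebra_def subsp_def)
 then show ?thesis unfolding coradical_def by (intro subsp_span) auto
qed

end

context prebialg
begin

text \<open>The step of the coradical filtration on the dual side. Its assumption on the previous
  stage is discharged by \<open>subsp_corad_filt\<close>, whose induction in turn rests on this
  equivalence.\<close>

lemma corad_filt_Suc_iff':
 assumes "subsp H (corad_filt H n)"
 shows "x \<in> corad_filt H (Suc n) \<longleftrightarrow> x \<in> carrier H & (\<forall>\<phi>\<in>ann H (coradical H). \<forall>\<psi>\<in>ann H (corad_filt H n). conv H \<phi> \<psi> x = 0)"
 using tensor_sum_iff[OF subsp_coradical assms comult_closed] by (auto simp: conv_def)

lemma subsp_corad_filt: "subsp H (corad_filt H n)"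
proof (induction n)
 case 0
 show ?case using subsp_coradical by simp
next
 case (Suc n)
 have d: "conv H \<phi> \<psi> \<in> dual H" if "\<phi> \<in> ann H (coradical H)" "\<psi> \<in> ann H (corad_filt H n)" for \<phi> \<psi>
  using conv_dual annD that by blast
 show ?case
  unfolding subsp_def subset_iff Ball_def corad_filt_Suc_iff'[OF Suc]
  using dual_zero[OF d] dual_add[OF d] dual_smult[OF d] by auto
qed

lemmas corad_filt_Suc_iff = corad_filt_Suc_iff'[OF subsp_corad_filt]

lemma subsp_filt: "subsp H (filt_below H n)"
 by (cases n) (simp_all add: filt_below_def subsp_zero subsp_corad_filt del: corad_filt.simps)

lemma filt_below_Suc: "filt_below H (Suc n) = corad_filt H n"
 by (simp add: filt_below_def)

lemma filt_below_0: "filt_below H 0 = {\<zero>}"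
 by (simp add: filt_below_def)

lemma ann_below_0: "ann H (filt_below H 0) = dual H"
 by (auto simp: filt_below_0 ann_def dual_zero)

end

section \<open>The filtration of a pointed bialgebra and its annihilators in the dual
  algebra\<close>

locale pointed_bialg = bialg +
 assumes pointed: "pointed H"
begin

text \<open>The index is shifted by one against the usual filtration: \<open>K 0\<close> is zero and
  \<open>K (Suc n)\<close> is the n-th stage. With this shift the annihilators multiply additively,
  see \<open>conv_K\<close>.\<close>

abbreviation "K \<equiv> filt_below H"

lemma K_carrier: "x \<in> K n ==> x \<in> carrier H"
 using subspD(1)[OF subsp_filt] .

lemma grouplikes_cl: "grouplikes H <= carrier H"
 by (auto simp: grouplikes_def)

lemma K_1: "K (Suc 0) = lspan H (grouplikes H)"
 using pointed by (simp add: filt_below_Suc pointed_def)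

lemma grouplikes_K1: "grouplikes H <= K (Suc 0)"
 using span_base[OF grouplikes_cl] K_1 by auto

lemma ann_K1: "\<phi> \<in> ann H (K (Suc 0)) \<longleftrightarrow> \<phi> \<in> dual H & (\<forall>u\<in>grouplikes H. \<phi> u = 0)"
 using ann_span[OF grouplikes_cl] by (auto simp: K_1 ann_def)

lemma K_Suc_Suc: "x \<in> K (Suc (Suc n)) \<longleftrightarrow> x \<in> carrier H & (\<forall>\<phi>\<in>ann H (K (Suc 0)). \<forall>\<psi>\<in>ann H (K (Suc n)). conv H \<phi> \<psi> x = 0)"
 unfolding filt_below_Suc corad_filt_Suc_iff by simp

lemma conv_grouplike: "u \<in> grouplikes H ==> \<phi> \<in> dual H ==> \<psi> \<in> dual H ==> conv H \<phi> \<psi> u = \<phi> u * \<psi> u"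
 unfolding grouplike_iff by blast

lemma conv_annI:
 assumes "\<phi> \<in> dual H" "\<psi> \<in> dual H" "!!u. u \<in> grouplikes H ==> \<phi> u * \<psi> u = 0"
 shows "conv H \<phi> \<psi> \<in> ann H (K (Suc 0))"
 unfolding ann_K1 using conv_dual[OF assms(1,2)] conv_grouplike[OF _ assms(1,2)] assms(3) by simp

text \<open>Equivalently, (\<phi> \<otimes> id) \<Delta> maps \<open>K j\<close> into itself. The
  contracted vector is put to the test for \<open>K j\<close>, and associativity moves \<phi> onto
  the test functional that kills the grouplike elements, which still kills them afterwards.\<close>

lemma conv_K_left: "\<phi> \<in> dual H ==> \<psi> \<in> ann H (K j) ==> conv H \<phi> \<psi> \<in> ann H (K j)"
proof -
 assume f: "\<phi> \<in> dual H" "\<psi> \<in> ann H (K j)"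
 note \<psi> = annD(1)[OF f(2)]
 consider "j = 0" | "j = Suc 0" | m where "j = Suc (Suc m)" by (metis not0_implies_Suc)
 then show ?thesis
 proof cases
  case 1
  then show ?thesis using conv_dual[OF f(1) \<psi>] by (simp add: ann_below_0)
 next
  case 2
  then show ?thesis using conv_annI[OF f(1) \<psi>] f(2) annD(2)[OF f(2)] grouplikes_K1 by auto
 next
  case (3 m)
  have "conv H \<phi> \<psi> c = 0" if c: "c \<in> K j" for c
  proof -
   note cc = K_carrier[OF c]
   obtain l where l: "l \<in> carrier H" "!!\<chi>. \<chi> \<in> dual H ==> \<chi> l = conv H \<phi> \<chi> c"
    by (rule contract_left[OF cc f(1)]) blast
   have "l \<in> K j" unfolding 3 K_Suc_Suc
   proof (intro conjI ballI l(1))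
    fix j' \<psi>' assume a: "j' \<in> ann H (K (Suc 0))" "\<psi>' \<in> ann H (K (Suc m))"
    note d = annD(1)[OF a(1)] annD(1)[OF a(2)]
    have "conv H \<phi> j' \<in> ann H (K (Suc 0))"
     using conv_annI[OF f(1) d(1)] a(1) by (simp add: ann_K1)
    then have "conv H (conv H \<phi> j') \<psi>' c = 0" using c a(2) unfolding 3 K_Suc_Suc by blast
    then have "conv H \<phi> (conv H j' \<psi>') c = 0" using conv_assoc[OF cc f(1) d] by simp
    then show "conv H j' \<psi>' l = 0" using l(2)[OF conv_dual[OF d]] by simp
   qed
   then show ?thesis using l(2)[OF \<psi>] annD(2)[OF f(2)] by simp
  qed
  then show ?thesis using conv_dual[OF f(1) \<psi>] by (simp add: ann_def)
 qed
qed

lemma conv_K_1: "\<phi> \<in> ann H (K (Suc 0)) ==> \<psi> \<in> ann H (K j) ==> conv H \<phi> \<psi> \<in> ann H (K (Suc j))"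
proof -
 assume f: "\<phi> \<in> ann H (K (Suc 0))" "\<psi> \<in> ann H (K j)"
 note d = annD(1)[OF f(1)] annD(1)[OF f(2)]
 show ?thesis
 proof (cases j)
  case 0
  then show ?thesis using conv_annI[OF d] f(1) by (simp add: ann_K1)
 next
  case (Suc m)
  then show ?thesis using conv_dual[OF d] f by (auto simp: ann_def K_Suc_Suc)
 qed
qed

text \<open>The annihilator of \<open>K (Suc 0)\<close> is an ideal of the dual algebra, and the
  annihilators of the other stages behave like its powers. In the induction the vector (id \<otimes>
  \<psi>) \<Delta>(c) is shown to lie in \<open>K (Suc i)\<close>: by associativity \<psi> joins the
  second of the two test functionals, where the induction hypothesis applies.\<close>

lemma conv_K: "\<phi> \<in> ann H (K i) ==> \<psi> \<in> ann H (K j) ==> conv H \<phi> \<psi> \<in> ann H (K (i + j))"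
proof (induction i arbitrary: \<phi> \<psi> j)
 case 0
 then show ?case using conv_K_left by (simp add: ann_below_0)
next
 case (Suc i)
 note d = annD(1)[OF Suc.prems(1)] annD(1)[OF Suc.prems(2)]
 show ?case
 proof (cases i)
  case 0
  then show ?thesis using conv_K_1 Suc.prems by simp
 next
  case (Suc m)
  have "conv H \<phi> \<psi> c = 0" if c: "c \<in> K (Suc i + j)" for c
  proof -
   note cc = K_carrier[OF c]
   obtain v where v: "v \<in> carrier H" "!!\<chi>. \<chi> \<in> dual H ==> \<chi> v = conv H \<chi> \<psi> c"
    by (rule contract[OF cc d(2)]) blast
   have "v \<in> K (Suc i)" unfolding Suc K_Suc_Suc
   proof (intro conjI ballI v(1))
    fix \<phi>' \<psi>' assume a: "\<phi>' \<in> ann H (K (Suc 0))" "\<psi>' \<in> ann H (K (Suc m))"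
    note d' = annD(1)[OF a(1)] annD(1)[OF a(2)]
    have "conv H \<psi>' \<psi> \<in> ann H (K (i + j))" using Suc.IH[OF _ Suc.prems(2)] a(2) Suc by simp
    then have "conv H \<phi>' (conv H \<psi>' \<psi>) c = 0" using annD(2)[OF conv_K_1[OF a(1)]] c by simp
    then show "conv H \<phi>' \<psi>' v = 0" using v(2)[OF conv_dual[OF d']] conv_assoc[OF cc d' d(2)] by simp
   qed
   then show ?thesis using v(2)[OF d(1)] annD(2)[OF Suc.prems(1)] by simp
  qed
  then show ?thesis using conv_dual[OF d] by (simp add: ann_def)
 qed
qed

lemma conv_K_zero: "\<phi> \<in> ann H (K i) ==> \<psi> \<in> ann H (K j) ==> c \<in> K n ==> n = i + j ==> conv H \<phi> \<psi> c = 0"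
 using annD(2)[OF conv_K] by blast

lemma K_mono_Suc: "K n <= K (Suc n)"
proof (cases n)
 case 0
 then show ?thesis using subspD(2)[OF subsp_filt] by (auto simp: filt_below_0)
next
 case (Suc m)
 show ?thesis
 proof
  fix x assume x: "x \<in> K n"
  show "x \<in> K (Suc n)"
   unfolding Suc K_Suc_Suc
  proof (intro conjI ballI K_carrier[OF x])
   fix \<phi> \<psi> assume "\<phi> \<in> ann H (K (Suc 0))" "\<psi> \<in> ann H (K (Suc m))"
   then show "conv H \<phi> \<psi> x = 0" using annD(2)[OF conv_K_left[OF annD(1)], of \<phi> _ \<psi> "Suc m" x] x Suc by blast
  qed
 qed
qed

lemma K_mono: "m \<le> n ==> K m \<subseteq> K n"
 by (rule lift_Suc_mono_le[of K, OF K_mono_Suc])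

lemma ann_K_mono: "m \<le> n ==> \<phi> \<in> ann H (K n) ==> \<phi> \<in> ann H (K m)"
 using K_mono[of m n] by (auto simp: ann_def)

text \<open>A tensor \<open>T\<close> killed by all \<open>K\<^sub>i\<^sup>\<bottom> \<otimes> K\<^sub>j\<^sup>\<bottom>\<close> with \<open>i + j = n + 1\<close> lies in the sum of the
 \<open>H\<^sub>i \<otimes> H\<^sub>n\<^sub>-\<^sub>i\<close>: with projections \<open>P\<^sub>i\<close> onto \<open>H\<^sub>i\<close> one has \<open>T = \<Sum> ((P\<^sub>i - P\<^sub>i\<^sub>-\<^sub>1) \<otimes> P\<^sub>n\<^sub>-\<^sub>i) T\<close>.\<close>

lemma comult_decomp:
 assumes c: "c \<in> K (Suc n)"
 obtains t where "!!i. i \<le> n ==> Poly_Mapping.keys (t i) \<subseteq> corad_filt H i \<times> corad_filt H (n - i)"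
  "comult H c = tensor_class H H (\<Sum>i\<le>n. t i)"
proof -
 have "\<exists>P. P \<in> lin_maps H H & (\<forall>v\<in>carrier H. P v \<in> K i) & (\<forall>u\<in>K i. P u = u)" for i
  by (rule projection[OF subsp_filt[of i]]) blast
 then obtain P where P: "!!i. P i \<in> lin_maps H H" "!!i v. v \<in> carrier H ==> P i v \<in> K i" "!!i u. u \<in> K i ==> P i u = u"
  by metis
 have Pc: "P i v \<in> carrier H" if "v \<in> carrier H" for i v using lin_mapsD(1)[OF P(1) that] .
 define Q where "Q i v = P (Suc i) v \<ominus> P i v" for i v
 have QK: "Q i v \<in> K (Suc i)" if "v \<in> carrier H" for i v
  unfolding Q_def using P(2)[OF that] K_mono_Suc by (intro subsp_minus[OF subsp_filt]) auto
 have Q\<phi>: "\<phi> (Q i v) = \<phi> (P (Suc i) v) - \<phi> (P i v)" if "\<phi> \<in> dual H" "v \<in> carrier H" for \<phi> i v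
  unfolding Q_def using dual_minus[OF that(1)] Pc[OF that(2)] by simp
 have Qd: "(%v. \<phi> (Q i v)) \<in> dual H" if "\<phi> \<in> dual H" for \<phi> i
  by (rule dual_cong[OF dual_closed(2)[OF dual_lin[OF P(1) that] dual_lin[OF P(1) that]] vs]) (simp add: Q\<phi>[OF that])
 have cc: "c \<in> carrier H" using K_carrier[OF c] .
 obtain t where t: "t \<in> carrier TT.M" "comult H c = tensor_class H H t"
  using comult_closed[OF cc] unfolding TT.tensor_simps by blast
 have tk: "fst z \<in> carrier H" "snd z \<in> carrier H" if "z \<in> Poly_Mapping.keys t" for z
  using t(1) that by (auto simp: TT.carrier_prod)
 \<comment> \<open>The projections are applied termwise to a formal sum for \<Delta>(c), so that the
   keys visibly lie in the required stages.\<close>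
 define s where "s i = (\<Sum>z\<in>Poly_Mapping.keys t. Poly_Mapping.single (Q i (fst z), P (Suc (n - i)) (snd z)) (Poly_Mapping.lookup t z))" for i
 have sk: "Poly_Mapping.keys (s i) \<subseteq> corad_filt H i \<times> corad_filt H (n - i)" for i
 proof -
  have "Poly_Mapping.keys (s i) \<subseteq> (\<Union>z\<in>Poly_Mapping.keys t. {(Q i (fst z), P (Suc (n - i)) (snd z))})"
   unfolding s_def by (rule order_trans[OF keys_sum]) (rule UN_mono[OF order_refl], simp)
  also have "... \<subseteq> corad_filt H i \<times> corad_filt H (n - i)"
   using tk QK P(2) unfolding filt_below_Suc[symmetric] by auto
  finally show ?thesis .
 qed
 have ks: "klin (%z. \<phi> (fst z) * \<psi> (snd z)) (s i) = klin (%z. \<phi> (Q i (fst z)) * \<psi> (P (Suc (n - i)) (snd z))) t" for \<phi> \<psi> i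
  unfolding s_def klin_sum klin_single by (simp add: klin_def)
 have sM: "(\<Sum>i\<le>n. s i) \<in> carrier TT.M"
 proof -
  have "Poly_Mapping.keys (\<Sum>i\<le>n. s i) \<subseteq> (\<Union>i\<in>{..n}. Poly_Mapping.keys (s i))" by (rule keys_sum)
  also have "... <= carrier H \<times> carrier H" using sk subspD(1)[OF subsp_corad_filt] by (fastforce simp: subset_iff)
  finally show ?thesis by (simp add: TT.carrier_prod)
 qed
 have "comult H c = tensor_class H H (\<Sum>i\<le>n. s i)"
 proof (rule tens_prod_eqI[OF comult_closed[OF cc]])
  show "tensor_class H H (\<Sum>i\<le>n. s i) \<in> carrier (tensor H H)" unfolding TT.tensor_simps using sM by blast
  fix \<phi> \<psi> assume f: "\<phi> \<in> dual H" "\<psi> \<in> dual H"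
  have a1: "(%v. \<phi> (Q i v)) \<in> ann H (K i)" for i
  proof -
   have "\<phi> (Q i u) = 0" if "u \<in> K i" for u
    using Q\<phi>[OF f(1) K_carrier[OF that]] P(3)[OF that] P(3)[OF subsetD[OF K_mono_Suc that]] by simp
   then show ?thesis using Qd[OF f(1)] by (simp add: ann_def)
  qed
  have a2: "(%v. \<psi> v - \<psi> (P i v)) \<in> ann H (K i)" for i
   using dual_closed(2)[OF f(2) dual_lin[OF P(1) f(2)]] P(3) by (auto simp: ann_def)
  have a3: "(%v. \<phi> v - \<phi> (P i v)) \<in> ann H (K i)" for i
   using dual_closed(2)[OF f(1) dual_lin[OF P(1) f(1)]] P(3) by (auto simp: ann_def)
  have "ev (%v w. \<phi> v * \<psi> w) (tensor_class H H (\<Sum>i\<le>n. s i)) = (\<Sum>i\<le>n. conv H (%v. \<phi> (Q i v)) (%v. \<psi> (P (Suc (n - i)) v)) c)"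
   unfolding TT.ev_class[OF bil_prod[OF f] sM] klin_sum ks conv_def t(2)
   by (intro sum.cong refl TT.ev_class[OF bil_prod[OF Qd[OF f(1)] dual_lin[OF P(1) f(2)]] t(1), symmetric])
  also have "... = (\<Sum>i\<le>n. conv H (%v. \<phi> (P (Suc i) v)) \<psi> c - conv H (%v. \<phi> (P i v)) \<psi> c)"
  proof (rule sum.cong[OF refl])
   fix i assume i: "i \<in> {..n}"
   \<comment> \<open>The first functional kills \<open>K i\<close> and the second kills
     \<open>K (Suc (n - i))\<close>; the indices add up to \<open>Suc n\<close>, the stage of
     \<open>c\<close>.\<close>
   have "conv H (%v. \<phi> (Q i v)) (%v. \<psi> v - \<psi> (P (Suc (n - i)) v)) c = 0"
    by (rule conv_K_zero[OF a1 a2 c]) (use i in auto)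
   then have "conv H (%v. \<phi> (Q i v)) (%v. \<psi> (P (Suc (n - i)) v)) c = conv H (%v. \<phi> (Q i v)) \<psi> c"
    using conv_simps(4)[OF cc Qd[OF f(1)] f(2) dual_lin[OF P(1) f(2)]] by simp
   also have "... = conv H (%v. \<phi> (P (Suc i) v) - \<phi> (P i v)) \<psi> c"
    by (rule conv_cong[OF cc Qd[OF f(1)] f(2) dual_closed(2)[OF dual_lin[OF P(1) f(1)] dual_lin[OF P(1) f(1)]] f(2)])
     (simp_all add: Q\<phi>[OF f(1)])
   also have "... = conv H (%v. \<phi> (P (Suc i) v)) \<psi> c - conv H (%v. \<phi> (P i v)) \<psi> c"
    by (rule conv_simps(3)[OF cc dual_lin[OF P(1) f(1)] f(2) dual_lin[OF P(1) f(1)]])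
   finally show "conv H (%v. \<phi> (Q i v)) (%v. \<psi> (P (Suc (n - i)) v)) c = conv H (%v. \<phi> (P (Suc i) v)) \<psi> c - conv H (%v. \<phi> (P i v)) \<psi> c" .
  qed
  \<comment> \<open>The sum telescopes. The lower end vanishes because \<open>P 0\<close> maps to
    \<open>K 0\<close>, which is zero; at the upper end the projection may be dropped on
    \<Delta>(c).\<close>
  also have "... = conv H (%v. \<phi> (P (Suc n) v)) \<psi> c - conv H (%v. \<phi> (P 0 v)) \<psi> c"
   by (induction n) simp_all
  also have "conv H (%v. \<phi> (P 0 v)) \<psi> c = conv H (%v. 0) \<psi> c"
   using P(2)[of _ 0] dual_zero[OF f(1)]
   by (intro conv_cong[OF cc dual_lin[OF P(1) f(1)] f(2) dual_closed(5) f(2)]) (auto simp: filt_below_0)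
  also have "conv H (%v. 0) \<psi> c = 0" using conv_simps(5)[OF cc f(1) f(2) f(1), of 0] by simp
  also have "conv H (%v. \<phi> (P (Suc n) v)) \<psi> c = conv H \<phi> \<psi> c"
   using conv_K_zero[OF a3[of "Suc n"], of \<psi> 0 c "Suc n"] c f conv_simps(3)[OF cc f dual_lin[OF P(1) f(1)]]
   by (simp add: ann_below_0)
  finally show "ev (%v w. \<phi> v * \<psi> w) (comult H c) = ev (%v w. \<phi> v * \<psi> w) (tensor_class H H (\<Sum>i\<le>n. s i))"
   by (simp add: conv_def)
 qed
 then show ?thesis using that[of s] sk by blast
qed

text \<open>Strong induction on i + j. In degree 0 products of grouplike elements are grouplike.
  Otherwise multiply the decompositions of \<Delta>(c) and \<Delta>(d): if both left factors have
  degree 0, their product is killed by \<phi>; in every other term the right factors have smaller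
  total degree, and the induction hypothesis puts their product where \<psi> vanishes.\<close>

lemma mult_filtration: "c \<in> K (Suc i) ==> d \<in> K (Suc j) ==> c \<otimes> d \<in> K (Suc (i + j))"
proof (induction "i + j" arbitrary: i j c d rule: less_induct)
 case less
 have cc: "c \<in> carrier H" "d \<in> carrier H" using K_carrier less.prems by auto
 have base: "x \<otimes> y \<in> K (Suc 0)" if "x \<in> K (Suc 0)" "y \<in> K (Suc 0)" for x y
 proof -
  have 1: "u \<otimes> y \<in> K (Suc 0)" if u: "u \<in> grouplikes H" and y: "y \<in> K (Suc 0)" for u y
  proof -
   have uc: "u \<in> carrier H" using u grouplikes_cl by auto
   have "(%y. u \<otimes> y) y \<in> K (Suc 0)"
    by (rule lin_span_image[OF vs vs lmult_lin[OF uc] grouplikes_cl subsp_filt _ y[unfolded K_1]])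
     (use grouplike_mult[OF u] grouplikes_K1 in auto)
   then show ?thesis .
  qed
  have "(%x. x \<otimes> y) x \<in> K (Suc 0)"
   by (rule lin_span_image[OF vs vs rmult_lin[OF K_carrier[OF that(2)]] grouplikes_cl subsp_filt _ that(1)[unfolded K_1]])
    (use 1 that(2) in auto)
  then show ?thesis .
 qed
 show ?case
 proof (cases "i + j")
  case 0
  then show ?thesis using base less.prems by simp
 next
  case (Suc m)
  obtain t where t: "!!a. a \<le> i ==> Poly_Mapping.keys (t a) \<subseteq> corad_filt H a \<times> corad_filt H (i - a)"
   "comult H c = tensor_class H H (\<Sum>a\<le>i. t a)" by (rule comult_decomp[OF less.prems(1)]) blast
  obtain s where s: "!!a. a \<le> j ==> Poly_Mapping.keys (s a) \<subseteq> corad_filt H a \<times> corad_filt H (j - a)"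
   "comult H d = tensor_class H H (\<Sum>a\<le>j. s a)" by (rule comult_decomp[OF less.prems(2)]) blast
  have M: "(\<Sum>a\<le>l. r a) \<in> carrier TT.M"
   if "!!a. a \<le> l ==> Poly_Mapping.keys (r a) \<subseteq> corad_filt H a \<times> corad_filt H (l - a)" for r l
  proof -
   have "Poly_Mapping.keys (\<Sum>a\<le>l. r a) \<subseteq> (\<Union>a\<in>{..l}. Poly_Mapping.keys (r a))" by (rule keys_sum)
   also have "... <= carrier H \<times> carrier H" using that subspD(1)[OF subsp_corad_filt] by (fastforce simp: subset_iff)
   finally show ?thesis by (simp add: TT.carrier_prod)
  qed
  have tM: "(\<Sum>a\<le>i. t a) \<in> carrier TT.M" by (rule M, rule t(1))
  have sM: "(\<Sum>a\<le>j. s a) \<in> carrier TT.M" by (rule M, rule s(1))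
  show ?thesis
   unfolding Suc K_Suc_Suc
  proof (intro conjI ballI)
   show "c \<otimes> d \<in> carrier H" using cc by simp
   fix \<phi> \<psi> assume f: "\<phi> \<in> ann H (K (Suc 0))" "\<psi> \<in> ann H (K (Suc m))"
   note b = bil_prod[OF annD(1)[OF f(1)] annD(1)[OF f(2)]]
   have "conv H \<phi> \<psi> (c \<otimes> d) = klin (%z. \<phi> (fst z) * \<psi> (snd z)) ((\<Sum>a\<le>i. t a) \<otimes>\<^bsub>TT.M\<^esub> (\<Sum>a\<le>j. s a))"
    unfolding conv_def alg_homD(4)[OF comult_hom cc] t(2) s(2) TT.class_mult[OF tM sM]
    by (rule TT.ev_class[OF b TT.MA.m_closed[OF tM sM]])
   also have "... = (\<Sum>a\<le>i. klin (%u. \<Sum>b\<le>j. klin (%v. \<phi> (fst u \<otimes> fst v) * \<psi> (snd u \<otimes> snd v)) (s b)) (t a))"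
    unfolding klin_mult klin_sum TT.prod_mult fst_conv snd_conv ..
   also have "... = (\<Sum>a\<le>i. klin (%u. 0) (t a))"
   proof (intro sum.cong refl klin_cong sum.neutral ballI)
    fix a u b assume a: "a \<in> {..i}" and u: "u \<in> Poly_Mapping.keys (t a)" and b: "b \<in> {..j}"
    have "\<phi> (fst u \<otimes> fst v) * \<psi> (snd u \<otimes> snd v) = 0" if v: "v \<in> Poly_Mapping.keys (s b)" for v
    proof -
     have uv: "fst u \<in> K (Suc a)" "snd u \<in> K (Suc (i - a))" "fst v \<in> K (Suc b)" "snd v \<in> K (Suc (j - b))"
      using u v t(1)[of a] s(1)[of b] a b by (auto simp: filt_below_Suc)
     show ?thesis
     proof (cases "a + b = 0")
      case True
      then have "fst u \<otimes> fst v \<in> K (Suc 0)" using base uv by simp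
      then show ?thesis using annD(2)[OF f(1)] by simp
     next
      case False
      then have "snd u \<otimes> snd v \<in> K (Suc ((i - a) + (j - b)))" using uv a b by (intro less.hyps) auto
      also have "... <= K (Suc m)" using False Suc a b by (intro K_mono) auto
      finally show ?thesis using annD(2)[OF f(2)] by simp
     qed
    qed
    then have "klin (%v. \<phi> (fst u \<otimes> fst v) * \<psi> (snd u \<otimes> snd v)) (s b) = klin (%v. 0) (s b)" by (intro klin_cong)
    then show "klin (%v. \<phi> (fst u \<otimes> fst v) * \<psi> (snd u \<otimes> snd v)) (s b) = 0" by simp
   qed
   finally show "conv H \<phi> \<psi> (c \<otimes> d) = 0" by simp
  qed
 qed
qed

text \<open>The same fact in the shifted index: a factor known to lie one degree lower lowers the
  product by one degree, with \<open>K 0\<close> as trivial case.\<close>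

lemma mult_K:
 "c \<in> K i ==> d \<in> K (Suc j) ==> c \<otimes> d \<in> K (i + j)"
 "d \<in> K (Suc j) ==> c \<in> K i ==> d \<otimes> c \<in> K (i + j)"
proof -
 assume a: "c \<in> K i" "d \<in> K (Suc j)"
 show "c \<otimes> d \<in> K (i + j)"
 proof (cases i)
  case 0
  then have "c \<otimes> d = \<zero>" using a K_carrier[OF a(2)] by (simp add: filt_below_0)
  then show ?thesis using subspD(2)[OF subsp_filt] by simp
 qed (use mult_filtration a in simp)
next
 assume a: "d \<in> K (Suc j)" "c \<in> K i"
 show "d \<otimes> c \<in> K (i + j)"
 proof (cases i)
  case 0
  then have "d \<otimes> c = \<zero>" using a K_carrier[OF a(1)] by (simp add: filt_below_0)
  then show ?thesis using subspD(2)[OF subsp_filt] by simp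
 next
  case (Suc m)
  then show ?thesis using mult_filtration[OF a(1), of c m] a(2) by (simp add: add.commute)
 qed
qed

end

section \<open>The associated graded algebra\<close>

text \<open>A Hopf record and its underlying algebra record have different types, so the algebra
  structures are compared field by field and facts are carried across.\<close>

definition same_alg :: "('k::field, 'a, 'm) module_scheme => ('k, 'a, 'n) module_scheme => bool" where
 "same_alg V W \<longleftrightarrow> carrier V = carrier W & mult V = mult W & one V = one W & zero V = zero W & add V = add W & smult V = smult W"

lemma same_alg_vsp:
 assumes "same_alg V W" "vsp V"
 shows "vsp W"
proof -
 interpret V: vspace V by (rule vspace.intro) fact
 have s: "carrier W = carrier V" "mult W = mult V" "one W = one V" "zero W = zero V" "add W = add V" "smult W = smult V"
  using assms by (auto simp: same_alg_def)
 show ?thesis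
  by (rule vs_criteria, unfold s)
   (use V.r_neg in \<open>auto simp: class_field V.a_ac V.smult_assoc1 V.smult_l_distr V.smult_r_distr intro!: bexI[of _ "\<ominus>\<^bsub>V\<^esub> _"]\<close>)
qed

lemma same_alg_k_algebra:
 assumes "same_alg V W" "k_algebra V"
 shows "k_algebra W"
proof -
 interpret V: kalg V by (rule kalg.intro) fact
 interpret W: vspace W by (rule vspace.intro[OF same_alg_vsp[OF assms(1) V.vs]])
 have s: "carrier W = carrier V" "mult W = mult V" "one W = one V" "zero W = zero V" "add W = add V" "smult W = smult V"
  using assms by (auto simp: same_alg_def)
 have "ring W"
 proof (rule ringI[OF W.abelian_group_axioms])
  show "monoid W" by (rule monoidI, unfold s) (auto simp: V.m_assoc)
 qed (simp_all add: s V.l_distr V.r_distr)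
 then show ?thesis unfolding k_algebra_def using W.vs V.smult_mult by (simp add: s)
qed

lemma same_alg_tensor:
 assumes "same_alg V W"
 shows "tensor W W = tensor V V" "tens W W = tens V V"
proof -
 have s: "carrier W = carrier V" "mult W = mult V" "one W = one V" "zero W = zero V" "add W = add V" "smult W = smult V"
  using assms by (auto simp: same_alg_def)
 have "W \<times>\<times> W = V \<times>\<times> V" by (simp add: DirProd_def s)
 then show "tensor W W = tensor V V" "tens W W = tens V V"
  by (simp_all add: tensor_def tens_def[abs_def] tensor_class_def tensor_null_def bilinear_relators_def s)
qed

lemma same_alg_hom: "same_alg V W ==> alg_hom V U = alg_hom W U" "same_alg V W ==> alg_hom U V = alg_hom U W"
 by (auto simp: same_alg_def alg_hom_iff lin_maps_iff)

lemma same_gr: "same_alg (gr_alg H) (gr_hopf H)"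
 by (simp add: same_alg_def gr_hopf_def)

text \<open>The functional on the graded algebra that reads the component of degree i; for \<phi> in
  the annihilator of \<open>K i\<close> the chosen representative is irrelevant.\<close>

definition hat :: "nat => ('a => 'k) => (nat => 'a set) => 'k" where
 "hat i \<phi> F = \<phi> (SOME x. x \<in> F i)"

context pointed_bialg
begin

abbreviation "G \<equiv> gr_hopf H"

lemma gr_simps:
 "F \<in> carrier G \<longleftrightarrow> (\<forall>n. F n \<in> (%x. K n +> x) ` K (Suc n)) & finite {n. F n ~= K n}"
 "\<zero>\<^bsub>G\<^esub> = K" "\<one>\<^bsub>G\<^esub> = gr_class H 0 \<one>"
 "F \<oplus>\<^bsub>G\<^esub> F' = (%n. F n <+> F' n)" "c \<odot>\<^bsub>G\<^esub> F = (%n. \<Union>x\<in>F n. K n +> (c \<odot> x))"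
 "F \<otimes>\<^bsub>G\<^esub> F' = (%n. \<Union>x\<in>Pi UNIV F. \<Union>y\<in>Pi UNIV F'. K n +> (\<Oplus>i\<in>{..n}. x i \<otimes> y (n - i)))"
 by (simp_all add: gr_hopf_def gr_alg_def filt_below_Suc)

lemma gr_mem:
 assumes "F \<in> carrier G"
 shows "\<exists>x. x \<in> F n" "x \<in> F n ==> x \<in> K (Suc n)" "x \<in> F n ==> F n = K n +> x"
proof -
 obtain y where y: "y \<in> K (Suc n)" "F n = K n +> y" using assms unfolding gr_simps by blast
 note yc = K_carrier[OF y(1)]
 show "\<exists>x. x \<in> F n" using coset_self[OF subsp_filt yc] y(2) by blast
 show "x \<in> F n ==> F n = K n +> x" using coset_memD(2)[OF subsp_filt _ yc, of x n] y(2) by auto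
 assume "x \<in> F n"
 then obtain i where "i \<in> K n" "x = i \<oplus> y" using y(2) coset_mem by blast
 then show "x \<in> K (Suc n)" using subspD(3)[OF subsp_filt _ y(1)] K_mono_Suc by blast
qed

lemma gr_memc: "F \<in> carrier G ==> x \<in> F n ==> x \<in> carrier H"
 using gr_mem(2) K_carrier by blast

lemma gr_add:
 assumes "F \<in> carrier G" "F' \<in> carrier G" "x \<in> F n" "y \<in> F' n"
 shows "(F \<oplus>\<^bsub>G\<^esub> F') n = K n +> (x \<oplus> y)"
 unfolding gr_simps(4) gr_mem(3)[OF assms(1,3)] gr_mem(3)[OF assms(2,4)]
 by (rule coset_add[OF subsp_filt gr_memc[OF assms(1,3)] gr_memc[OF assms(2,4)]])

lemma gr_smult:
 assumes "F \<in> carrier G" "x \<in> F n"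
 shows "(c \<odot>\<^bsub>G\<^esub> F) n = K n +> (c \<odot> x)"
 unfolding gr_simps(5) gr_mem(3)[OF assms]
 by (rule coset_smult[OF subsp_filt gr_memc[OF assms]])

text \<open>In each degree the graded operations are literally those of \<open>quot_alg\<close>,
  from which the functionals \<open>hat\<close> get their linearity.\<close>

lemma gr_quot:
 "F \<in> carrier G ==> F n \<in> carrier (quot_alg H (K n))"
 "(F \<oplus>\<^bsub>G\<^esub> F') n = F n \<oplus>\<^bsub>quot_alg H (K n)\<^esub> F' n"
 "(c \<odot>\<^bsub>G\<^esub> F) n = c \<odot>\<^bsub>quot_alg H (K n)\<^esub> F n"
proof -
 show "(F \<oplus>\<^bsub>G\<^esub> F') n = F n \<oplus>\<^bsub>quot_alg H (K n)\<^esub> F' n" "(c \<odot>\<^bsub>G\<^esub> F) n = c \<odot>\<^bsub>quot_alg H (K n)\<^esub> F n"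
  by (simp_all add: gr_simps(4,5) quot_alg_def FactRing_def)
 assume F: "F \<in> carrier G"
 obtain x where x: "x \<in> F n" using gr_mem(1)[OF F] by blast
 show "F n \<in> carrier (quot_alg H (K n))"
  unfolding gr_mem(3)[OF F x] quot_alg_simps(1)[OF subsp_filt] using gr_memc[OF F x] by (rule imageI)
qed

lemma gr_closed:
 assumes "F \<in> carrier G"
 shows "F' \<in> carrier G ==> F \<oplus>\<^bsub>G\<^esub> F' \<in> carrier G" "c \<odot>\<^bsub>G\<^esub> F \<in> carrier G"
proof -
 have o: "\<zero> \<in> K n" for n by (rule subspD(2)[OF subsp_filt])
 have z: "(c \<odot>\<^bsub>G\<^esub> F) n = K n" if "F n = K n" for n
  using gr_smult[OF assms, of \<zero> n c] o coset_zero[OF subsp_filt] by (simp only: that smult_r_null UNIV_I)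
 show "c \<odot>\<^bsub>G\<^esub> F \<in> carrier G"
  unfolding gr_simps(1)
 proof (intro conjI allI)
  fix n
  obtain x where x: "x \<in> F n" using gr_mem(1)[OF assms] by blast
  show "(c \<odot>\<^bsub>G\<^esub> F) n \<in> (%x. K n +> x) ` K (Suc n)"
   using gr_smult[OF assms x] subspD(4)[OF subsp_filt gr_mem(2)[OF assms x]] by auto
  show "finite {n. (c \<odot>\<^bsub>G\<^esub> F) n ~= K n}"
   by (rule finite_subset[of _ "{n. F n ~= K n}"]) (use z assms in \<open>auto simp: gr_simps(1)\<close>)
 qed
 assume F': "F' \<in> carrier G"
 have z: "(F \<oplus>\<^bsub>G\<^esub> F') n = K n" if "F n = K n" "F' n = K n" for n
  using gr_add[OF assms F', of \<zero> n \<zero>] o coset_zero[OF subsp_filt] by (simp only: that r_zero zero_closed)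
 show "F \<oplus>\<^bsub>G\<^esub> F' \<in> carrier G"
  unfolding gr_simps(1)
 proof (intro conjI allI)
  fix n
  obtain x where x: "x \<in> F n" using gr_mem(1)[OF assms] by blast
  obtain y where y: "y \<in> F' n" using gr_mem(1)[OF F'] by blast
  show "(F \<oplus>\<^bsub>G\<^esub> F') n \<in> (%x. K n +> x) ` K (Suc n)"
   using gr_add[OF assms F' x y] subspD(3)[OF subsp_filt gr_mem(2)[OF assms x] gr_mem(2)[OF F' y]] by auto
  show "finite {n. (F \<oplus>\<^bsub>G\<^esub> F') n ~= K n}"
   by (rule finite_subset[of _ "{n. F n ~= K n} \<union> {n. F' n ~= K n}"]) (use z assms F' in \<open>auto simp: gr_simps(1)\<close>)
 qed
qed

lemma hat_val:
 assumes "F \<in> carrier G" "\<phi> \<in> ann H (K i)" "x \<in> F i"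
 shows "hat i \<phi> F = \<phi> x"
 using dual_quot(2)[OF subsp_filt assms(2) gr_memc[OF assms(1,3)]] gr_mem(3)[OF assms(1,3)]
 by (simp add: hat_def)

lemma hat_dual:
 assumes "\<phi> \<in> ann H (K i)"
 shows "hat i \<phi> \<in> dual G"
 using dual_add[OF dual_quot(1)[OF subsp_filt assms]] dual_smult[OF dual_quot(1)[OF subsp_filt assms]]
 by (simp add: dual_def hat_def gr_quot(2,3) gr_quot(1)[of _ i])

lemma gr_eqI:
 assumes "F \<in> carrier G" "F' \<in> carrier G" "!!i \<phi>. \<phi> \<in> ann H (K i) ==> hat i \<phi> F = hat i \<phi> F'"
 shows "F = F'"
proof
 fix i
 obtain x where x: "x \<in> F i" using gr_mem(1)[OF assms(1)] by blast
 obtain y where y: "y \<in> F' i" using gr_mem(1)[OF assms(2)] by blast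
 note c = gr_memc[OF assms(1) x] gr_memc[OF assms(2) y]
 have "\<phi> (x \<ominus> y) = 0" if "\<phi> \<in> ann H (K i)" for \<phi>
  using assms(3)[OF that] hat_val[OF assms(1) that x] hat_val[OF assms(2) that y] dual_minus[OF annD(1)[OF that] c] by simp
 then have "x \<ominus> y \<in> K i" using in_subsp_iff[OF subsp_filt minus_closed[OF c]] by blast
 then show "F i = F' i"
  using coset_eq_iff[OF subsp_filt c] gr_mem(3)[OF assms(1) x] gr_mem(3)[OF assms(2) y] by simp
qed

lemma gr_zero: "\<zero>\<^bsub>G\<^esub> \<in> carrier G" "hat i \<phi> \<zero>\<^bsub>G\<^esub> = 0" if "\<phi> \<in> ann H (K i)" for i \<phi>
proof -
 show c: "\<zero>\<^bsub>G\<^esub> \<in> carrier G"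
  using coset_zero[OF subsp_filt] subspD(2)[OF subsp_filt] by (force simp: gr_simps)
 show "hat i \<phi> \<zero>\<^bsub>G\<^esub> = 0"
  using hat_val[OF c that, of \<zero>] subspD(2)[OF subsp_filt] dual_zero[OF annD(1)[OF that]] by (simp add: gr_simps(2))
qed

text \<open>The functionals \<open>hat\<close> are additive and homogeneous and separate elements,
  so each axiom is an identity of scalars.\<close>

lemma vsp_gr: "vsp G"
proof (rule vs_criteria)
 note a = gr_closed(1) and sm = gr_closed(2) and h = dual_add[OF hat_dual] dual_smult[OF hat_dual]
 have d0: "(%_. 0) \<in> ann H (K 0)" by (simp add: ann_def dual_closed(5))
 note zc = gr_zero(1)[OF d0]
 show "\<zero>\<^bsub>G\<^esub> \<in> carrier G" by (rule zc)
 show "\<forall>v\<in>carrier G. \<exists>w\<in>carrier G. v \<oplus>\<^bsub>G\<^esub> w = \<zero>\<^bsub>G\<^esub>"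
 proof
  fix F assume F: "F \<in> carrier G"
  have "F \<oplus>\<^bsub>G\<^esub> ((-1) \<odot>\<^bsub>G\<^esub> F) = \<zero>\<^bsub>G\<^esub>"
   by (rule gr_eqI[OF a[OF F sm[OF F]] zc]) (simp add: h F sm gr_zero(2))
  then show "\<exists>w\<in>carrier G. F \<oplus>\<^bsub>G\<^esub> w = \<zero>\<^bsub>G\<^esub>" using sm[OF F] by blast
 qed
 show "\<forall>v w. v \<in> carrier G & w \<in> carrier G --> v \<oplus>\<^bsub>G\<^esub> w = w \<oplus>\<^bsub>G\<^esub> v"
  by (safe, rule gr_eqI) (simp_all add: h a add.commute)
 show "\<forall>v w x. v \<in> carrier G & w \<in> carrier G & x \<in> carrier G --> v \<oplus>\<^bsub>G\<^esub> w \<oplus>\<^bsub>G\<^esub> x = v \<oplus>\<^bsub>G\<^esub> (w \<oplus>\<^bsub>G\<^esub> x)"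
  by (safe, rule gr_eqI) (simp_all add: h a add.assoc)
 show "\<forall>v\<in>carrier G. v \<oplus>\<^bsub>G\<^esub> \<zero>\<^bsub>G\<^esub> = v"
  by (safe, rule gr_eqI) (simp_all add: h a zc gr_zero(2))
 show "\<forall>a b v. a \<in> carrier class_ring & b \<in> carrier class_ring & v \<in> carrier G -->
   (a \<otimes>\<^bsub>class_ring\<^esub> b) \<odot>\<^bsub>G\<^esub> v = a \<odot>\<^bsub>G\<^esub> (b \<odot>\<^bsub>G\<^esub> v)"
  by (safe, rule gr_eqI) (simp_all add: h sm mult.assoc)
 show "\<forall>v\<in>carrier G. \<one>\<^bsub>class_ring\<^esub> \<odot>\<^bsub>G\<^esub> v = v"
  by (safe, rule gr_eqI) (simp_all add: h sm)
 show "\<forall>a b v. a \<in> carrier class_ring & b \<in> carrier class_ring & v \<in> carrier G -->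
   (a \<oplus>\<^bsub>class_ring\<^esub> b) \<odot>\<^bsub>G\<^esub> v = a \<odot>\<^bsub>G\<^esub> v \<oplus>\<^bsub>G\<^esub> b \<odot>\<^bsub>G\<^esub> v"
  by (safe, rule gr_eqI) (simp_all add: h sm a distrib_right)
 show "\<forall>b v w. b \<in> carrier class_ring & v \<in> carrier G & w \<in> carrier G -->
   b \<odot>\<^bsub>G\<^esub> (v \<oplus>\<^bsub>G\<^esub> w) = b \<odot>\<^bsub>G\<^esub> v \<oplus>\<^bsub>G\<^esub> b \<odot>\<^bsub>G\<^esub> w"
  by (safe, rule gr_eqI) (simp_all add: h sm a distrib_left)
qed (simp_all add: class_field gr_closed)

lemma sep_gr: "sep_space G"
 by (intro sep_space.intro vspace.intro vsp_gr sep_space_axioms.intro) (use gr_eqI hat_dual in blast)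

lemma gr_class_val: "gr_class H n x m = (if m = n then K n +> x else K m)"
 by (simp add: gr_class_def)

lemma K_coset: "K m = K m +> \<zero>"
 using coset_zero[OF subsp_filt] by simp

lemma gr_class_cl: "x \<in> K (Suc n) ==> gr_class H n x \<in> carrier G"
 unfolding gr_simps(1) gr_class_val
proof (intro conjI allI)
 assume x: "x \<in> K (Suc n)"
 show "(if m = n then K n +> x else K m) \<in> (%x. K m +> x) ` K (Suc m)" for m
  using x K_coset[of m] subspD(2)[OF subsp_filt[of "Suc m"]] by (auto intro: image_eqI[of _ _ \<zero>])
 show "finite {m. (if m = n then K n +> x else K m) ~= K m}"
  by (rule finite_subset[of _ "{n}"]) auto
qed

lemma gr_class_mem: "x \<in> K (Suc n) ==> x \<in> gr_class H n x n" "m ~= n ==> \<zero> \<in> gr_class H n x m"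
 using coset_self[OF subsp_filt K_carrier] subspD(2)[OF subsp_filt] by (auto simp: gr_class_val)

lemma hat_class:
 assumes "x \<in> K (Suc n)" "\<phi> \<in> ann H (K i)"
 shows "hat i \<phi> (gr_class H n x) = (if i = n then \<phi> x else 0)"
 using hat_val[OF gr_class_cl[OF assms(1)] assms(2)] gr_class_mem(1)[of x n] gr_class_mem(2)[where m = i and n = n and x = x]
  assms dual_zero[OF annD(1)[OF assms(2)]] by auto

subsection \<open>Multiplication\<close>

text \<open>uv - xy = (u - x) v + x (v - y), and by \<open>mult_K\<close> both terms drop by one
  degree; so the union in the definition of the product is taken over a single coset.\<close>

lemma gr_mult_rep:
 assumes "F \<in> carrier G" "F' \<in> carrier G" "x \<in> Pi UNIV F" "y \<in> Pi UNIV F'"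
 shows "(F \<otimes>\<^bsub>G\<^esub> F') n = K n +> (\<Oplus>i\<in>{..n}. x i \<otimes> y (n - i))"
proof -
 have cl: "(%i. u i \<otimes> v (n - i)) \<in> {..n} \<rightarrow> carrier H" if "u \<in> Pi UNIV F" "v \<in> Pi UNIV F'" for u v
 proof (rule Pi_I)
  fix i
  have "u i \<in> F i" "v (n - i) \<in> F' (n - i)" using that by auto
  then show "u i \<otimes> v (n - i) \<in> carrier H" by (rule m_closed[OF gr_memc[OF assms(1)] gr_memc[OF assms(2)]])
 qed
 have "K n +> (\<Oplus>i\<in>{..n}. u i \<otimes> v (n - i)) = K n +> (\<Oplus>i\<in>{..n}. x i \<otimes> y (n - i))"
  if uv: "u \<in> Pi UNIV F" "v \<in> Pi UNIV F'" for u v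
 proof -
  note c1 = finsum_closed[OF cl[OF uv]] and c2 = finsum_closed[OF cl[OF assms(3,4)]]
  have "\<phi> ((\<Oplus>i\<in>{..n}. u i \<otimes> v (n - i)) \<ominus> (\<Oplus>i\<in>{..n}. x i \<otimes> y (n - i))) = 0" if \<phi>: "\<phi> \<in> ann H (K n)" for \<phi>
  proof -
   have "\<phi> (u i \<otimes> v (n - i)) = \<phi> (x i \<otimes> y (n - i))" if i: "i \<in> {..n}" for i
   proof -
    have m: "u i \<in> F i" "x i \<in> F i" "v (n - i) \<in> F' (n - i)" "y (n - i) \<in> F' (n - i)" using uv assms by auto
    note c = gr_memc[OF assms(1) m(1)] gr_memc[OF assms(1) m(2)] gr_memc[OF assms(2) m(3)] gr_memc[OF assms(2) m(4)]
    have d1: "u i \<ominus> x i \<in> K i"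
     using coset_eq_iff[OF subsp_filt c(1,2), of i] gr_mem(3)[OF assms(1) m(1)] gr_mem(3)[OF assms(1) m(2)] by simp
    have d2: "v (n - i) \<ominus> y (n - i) \<in> K (n - i)"
     using coset_eq_iff[OF subsp_filt c(3,4), of "n - i"] gr_mem(3)[OF assms(2) m(3)] gr_mem(3)[OF assms(2) m(4)] by simp
    have "(u i \<ominus> x i) \<otimes> v (n - i) \<in> K n" "x i \<otimes> (v (n - i) \<ominus> y (n - i)) \<in> K n"
     using mult_K(1)[OF d1 gr_mem(2)[OF assms(2) m(3)]] mult_K(2)[OF gr_mem(2)[OF assms(1) m(2)] d2] i by auto
    then have "\<phi> ((u i \<ominus> x i) \<otimes> v (n - i)) = 0" "\<phi> (x i \<otimes> (v (n - i) \<ominus> y (n - i))) = 0" using annD(2)[OF \<phi>] by auto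
    then show ?thesis
     using dual_minus[OF dual_rmult[OF annD(1)[OF \<phi>] c(3)] c(1,2)] dual_minus[OF dual_lmult[OF annD(1)[OF \<phi>] c(2)] c(3,4)]
     by simp
   qed
   then show ?thesis
    using dual_minus[OF annD(1)[OF \<phi>] c1 c2] dual_finsum[OF annD(1)[OF \<phi>] cl[OF uv]] dual_finsum[OF annD(1)[OF \<phi>] cl[OF assms(3,4)]]
    by simp
  qed
  then have "(\<Oplus>i\<in>{..n}. u i \<otimes> v (n - i)) \<ominus> (\<Oplus>i\<in>{..n}. x i \<otimes> y (n - i)) \<in> K n"
   using in_subsp_iff[OF subsp_filt minus_closed[OF c1 c2]] by blast
  then show ?thesis using coset_eq_iff[OF subsp_filt c1 c2] by simp
 qed
 then show ?thesis using assms(3,4) unfolding gr_simps(6) by blast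
qed

definition rep :: "(nat => 'a set) => nat => 'a" where
 "rep F n = (SOME x. x \<in> F n)"

lemma rep: "F \<in> carrier G ==> rep F n \<in> F n" "F \<in> carrier G ==> rep F n \<in> K (Suc n)" "F \<in> carrier G ==> rep F n \<in> carrier H"
 "F \<in> carrier G ==> rep F \<in> Pi UNIV F"
 using someI_ex[OF gr_mem(1)] gr_mem(2) gr_memc unfolding rep_def by blast+

lemma gr_mult_closed_sum:
 assumes "F \<in> carrier G" "F' \<in> carrier G"
 shows "(%i. rep F i \<otimes> rep F' (n - i)) \<in> {..n} \<rightarrow> K (Suc n)"
proof
 fix i assume i: "i \<in> {..n}"
 have "rep F i \<otimes> rep F' (n - i) \<in> K (Suc (i + (n - i)))"
  by (rule mult_filtration[OF rep(2)[OF assms(1)] rep(2)[OF assms(2)]])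
 then show "rep F i \<otimes> rep F' (n - i) \<in> K (Suc n)" using i by simp
qed

lemma gr_mult_closed:
 assumes F: "F \<in> carrier G" and F': "F' \<in> carrier G"
 shows "F \<otimes>\<^bsub>G\<^esub> F' \<in> carrier G"
 unfolding gr_simps(1)
proof (intro conjI allI)
 note r = gr_mult_rep[OF F F' rep(4)[OF F] rep(4)[OF F']]
 show "(F \<otimes>\<^bsub>G\<^esub> F') n \<in> (%x. K n +> x) ` K (Suc n)" for n
  unfolding r using subsp_finsum[OF subsp_filt gr_mult_closed_sum[OF F F']] by blast
 have "finite ({n. F n ~= K n} \<union> {n. F' n ~= K n})" using F F' by (simp add: gr_simps(1))
 then obtain N where N: "\<forall>n\<in>{n. F n ~= K n} \<union> {n. F' n ~= K n}. n < N" using finite_nat_set_iff_bounded by auto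
 have zF: "rep F n \<in> K n" if "n \<ge> N" for n
 proof -
  have "n < N" if "F n ~= K n" using bspec[OF N, of n] that by simp
  then have "F n = K n" using that by (metis leD)
  then show ?thesis using rep(1)[OF F, of n] by simp
 qed
 have zF': "rep F' n \<in> K n" if "n \<ge> N" for n
 proof -
  have "n < N" if "F' n ~= K n" using bspec[OF N, of n] that by simp
  then have "F' n = K n" using that by (metis leD)
  then show ?thesis using rep(1)[OF F', of n] by simp
 qed
 \<comment> \<open>Both factors vanish from degree \<open>N\<close> on, and in total degree at least
   \<open>2 * N\<close> one of the two degrees is at least \<open>N\<close>.\<close>
 have "(F \<otimes>\<^bsub>G\<^esub> F') n = K n" if n: "n \<ge> 2 * N" for n
 proof -
  have "(%i. rep F i \<otimes> rep F' (n - i)) \<in> {..n} \<rightarrow> K n"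
  proof
   fix i assume i: "i \<in> {..n}"
   consider "i \<ge> N" | "n - i \<ge> N" using n by linarith
   then show "rep F i \<otimes> rep F' (n - i) \<in> K n"
   proof cases
    case 1
    then show ?thesis using mult_K(1)[OF zF[OF 1] rep(2)[OF F'], of "n - i"] i by simp
   next
    case 2
    then show ?thesis using mult_K(2)[OF rep(2)[OF F] zF'[OF 2], of i] i by (simp add: add.commute)
   qed
  qed
  then have m: "(\<Oplus>i\<in>{..n}. rep F i \<otimes> rep F' (n - i)) \<in> K n" by (rule subsp_finsum[OF subsp_filt])
  have "K n +> (\<Oplus>i\<in>{..n}. rep F i \<otimes> rep F' (n - i)) = K n +> \<zero>"
   using coset_eq_iff[OF subsp_filt K_carrier[OF m] zero_closed, of n] m K_carrier[OF m] by (simp add: a_minus_def)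
  then show ?thesis unfolding r coset_zero[OF subsp_filt] .
 qed
 then have "{n. (F \<otimes>\<^bsub>G\<^esub> F') n ~= K n} \<subseteq> {..<2 * N}" by (auto simp: not_le[symmetric])
 then show "finite {n. (F \<otimes>\<^bsub>G\<^esub> F') n ~= K n}" using finite_subset by blast
qed

lemma hat_mult:
 assumes F: "F \<in> carrier G" "F' \<in> carrier G" and xy: "!!i. x i \<in> F i" "!!i. y i \<in> F' i" and \<phi>: "\<phi> \<in> ann H (K n)"
 shows "hat n \<phi> (F \<otimes>\<^bsub>G\<^esub> F') = (\<Sum>i\<le>n. \<phi> (x i \<otimes> y (n - i)))"
proof -
 have c: "(%i. x i \<otimes> y (n - i)) \<in> {..n} \<rightarrow> carrier H" using gr_memc[OF F(1) xy(1)] gr_memc[OF F(2) xy(2)] by auto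
 have "(\<Oplus>i\<in>{..n}. x i \<otimes> y (n - i)) \<in> (F \<otimes>\<^bsub>G\<^esub> F') n"
  using gr_mult_rep[OF F, of x y n] xy coset_self[OF subsp_filt finsum_closed[OF c]] by auto
 from hat_val[OF gr_mult_closed[OF F] \<phi> this] show ?thesis using dual_finsum[OF annD(1)[OF \<phi>] c] by simp
qed

lemma gr_mult_mem:
 assumes F: "F \<in> carrier G" "F' \<in> carrier G" and xy: "!!i. x i \<in> F i" "!!i. y i \<in> F' i"
 shows "(\<Oplus>i\<in>{..n}. x i \<otimes> y (n - i)) \<in> (F \<otimes>\<^bsub>G\<^esub> F') n"
proof -
 have c: "(%i. x i \<otimes> y (n - i)) \<in> {..n} \<rightarrow> carrier H" using gr_memc[OF F(1) xy(1)] gr_memc[OF F(2) xy(2)] by auto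
 show ?thesis using gr_mult_rep[OF F, of x y n] xy coset_self[OF subsp_filt finsum_closed[OF c]] by auto
qed

lemma hat_class_mult:
 assumes "x \<in> K (Suc i)" "y \<in> K (Suc j)"
 shows "gr_class H i x \<otimes>\<^bsub>G\<^esub> gr_class H j y = gr_class H (i + j) (x \<otimes> y)"
proof (rule gr_eqI)
 note c = gr_class_cl[OF assms(1)] gr_class_cl[OF assms(2)]
 note xy = mult_filtration[OF assms]
 show "gr_class H i x \<otimes>\<^bsub>G\<^esub> gr_class H j y \<in> carrier G" by (rule gr_mult_closed[OF c])
 show "gr_class H (i + j) (x \<otimes> y) \<in> carrier G" by (rule gr_class_cl[OF xy])
 fix n \<phi> assume \<phi>: "\<phi> \<in> ann H (K n)"
 have xc: "x \<in> carrier H" "y \<in> carrier H" using assms K_carrier by auto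
 have "hat n \<phi> (gr_class H i x \<otimes>\<^bsub>G\<^esub> gr_class H j y) = (\<Sum>k\<le>n. \<phi> ((if k = i then x else \<zero>) \<otimes> (if n - k = j then y else \<zero>)))"
  by (rule hat_mult[OF c _ _ \<phi>]) (use gr_class_mem assms in auto)
 also have "... = (\<Sum>k\<le>n. if k = i then (if n - i = j then \<phi> (x \<otimes> y) else 0) else 0)"
  using xc dual_zero[OF annD(1)[OF \<phi>]] by (intro sum.cong) auto
 also have "... = (if n = i + j then \<phi> (x \<otimes> y) else 0)" by auto
 finally show "hat n \<phi> (gr_class H i x \<otimes>\<^bsub>G\<^esub> gr_class H j y) = hat n \<phi> (gr_class H (i + j) (x \<otimes> y))"
  using hat_class[OF xy \<phi>] by simp
qed

text \<open>All axioms are checked after \<open>hat\<close>. For associativity the two triple sums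
  are matched by the reindexing (i, k) to (k, i - k) of their summation domains.\<close>

lemma k_algebra_gr: "k_algebra G"
proof -
 interpret G: vspace G by (rule vspace.intro[OF vsp_gr])
 have one: "\<one>\<^bsub>G\<^esub> \<in> carrier G" "\<one>\<^bsub>G\<^esub> = gr_class H 0 \<one>"
  using gr_class_cl[of \<one> 0] one_grouplike grouplikes_K1 by (auto simp: gr_simps)
 have onem: "(if i = 0 then \<one> else \<zero>) \<in> \<one>\<^bsub>G\<^esub> i" for i
  using gr_class_mem(1)[of \<one> 0] gr_class_mem(2)[where m = i and n = 0 and x = \<one>] one_grouplike grouplikes_K1 by (auto simp: one(2))
 have "ring G"
 proof (rule ringI[OF G.abelian_group_axioms])
  show "monoid G"
  proof (rule monoidI)
   fix F F' F'' assume F: "F \<in> carrier G" "F' \<in> carrier G" "F'' \<in> carrier G"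
   note m = gr_mult_closed
   show "F \<otimes>\<^bsub>G\<^esub> F' \<otimes>\<^bsub>G\<^esub> F'' = F \<otimes>\<^bsub>G\<^esub> (F' \<otimes>\<^bsub>G\<^esub> F'')"
   proof (rule gr_eqI[OF m[OF m[OF F(1,2)] F(3)] m[OF F(1) m[OF F(2,3)]]])
    fix n \<phi> assume \<phi>: "\<phi> \<in> ann H (K n)"
    let ?x = "rep F" and ?y = "rep F'" and ?z = "rep F''"
    note xyz = rep(3)[OF F(1)] rep(3)[OF F(2)] rep(3)[OF F(3)]
    have "hat n \<phi> (F \<otimes>\<^bsub>G\<^esub> F' \<otimes>\<^bsub>G\<^esub> F'') = (\<Sum>i\<le>n. \<phi> ((\<Oplus>k\<in>{..i}. ?x k \<otimes> ?y (i - k)) \<otimes> ?z (n - i)))"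
     by (rule hat_mult[OF m[OF F(1,2)] F(3) gr_mult_mem[OF F(1,2) rep(1)[OF F(1)] rep(1)[OF F(2)]] rep(1)[OF F(3)] \<phi>])
    also have "... = (\<Sum>i\<le>n. \<Sum>k\<le>i. \<phi> (?x k \<otimes> ?y (i - k) \<otimes> ?z (n - i)))"
     using xyz by (intro sum.cong refl dual_finsum[OF dual_rmult[OF annD(1)[OF \<phi>]]]) auto
    also have "... = (\<Sum>(i, k)\<in>(SIGMA i:{..n}. {..i}). \<phi> (?x k \<otimes> ?y (i - k) \<otimes> ?z (n - i)))"
     by (rule sum.Sigma) auto
    also have "... = (\<Sum>(k, l)\<in>(SIGMA k:{..n}. {..n - k}). \<phi> (?x k \<otimes> (?y l \<otimes> ?z (n - k - l))))"
     by (rule sum.reindex_bij_witness[of _ "%(k, l). (k + l, k)" "%(i, k). (k, i - k)"])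
      (use xyz in \<open>auto simp: m_assoc\<close>)
    also have "... = (\<Sum>k\<le>n. \<Sum>l\<le>n - k. \<phi> (?x k \<otimes> (?y l \<otimes> ?z (n - k - l))))"
     by (rule sum.Sigma[symmetric]) auto
    also have "... = (\<Sum>k\<le>n. \<phi> (?x k \<otimes> (\<Oplus>l\<in>{..n - k}. ?y l \<otimes> ?z (n - k - l))))"
     using xyz by (intro sum.cong refl dual_finsum[OF dual_lmult[OF annD(1)[OF \<phi>]], symmetric]) auto
    also have "... = hat n \<phi> (F \<otimes>\<^bsub>G\<^esub> (F' \<otimes>\<^bsub>G\<^esub> F''))"
     by (rule hat_mult[OF F(1) m[OF F(2,3)] rep(1)[OF F(1)] gr_mult_mem[OF F(2,3) rep(1)[OF F(2)] rep(1)[OF F(3)]] \<phi>, symmetric])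
    finally show "hat n \<phi> (F \<otimes>\<^bsub>G\<^esub> F' \<otimes>\<^bsub>G\<^esub> F'') = hat n \<phi> (F \<otimes>\<^bsub>G\<^esub> (F' \<otimes>\<^bsub>G\<^esub> F''))" .
   qed
  next
   fix F assume F: "F \<in> carrier G"
   show "\<one>\<^bsub>G\<^esub> \<otimes>\<^bsub>G\<^esub> F = F"
   proof (rule gr_eqI[OF gr_mult_closed[OF one(1) F] F])
    fix n \<phi> assume \<phi>: "\<phi> \<in> ann H (K n)"
    have "hat n \<phi> (\<one>\<^bsub>G\<^esub> \<otimes>\<^bsub>G\<^esub> F) = (\<Sum>i\<le>n. \<phi> ((if i = 0 then \<one> else \<zero>) \<otimes> rep F (n - i)))"
     by (rule hat_mult[OF one(1) F onem rep(1)[OF F] \<phi>])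
    also have "... = (\<Sum>i\<le>n. if i = 0 then \<phi> (rep F n) else 0)"
     using rep(3)[OF F] dual_zero[OF annD(1)[OF \<phi>]] by (intro sum.cong) auto
    finally show "hat n \<phi> (\<one>\<^bsub>G\<^esub> \<otimes>\<^bsub>G\<^esub> F) = hat n \<phi> F" using hat_val[OF F \<phi> rep(1)[OF F]] by simp
   qed
   show "F \<otimes>\<^bsub>G\<^esub> \<one>\<^bsub>G\<^esub> = F"
   proof (rule gr_eqI[OF gr_mult_closed[OF F one(1)] F])
    fix n \<phi> assume \<phi>: "\<phi> \<in> ann H (K n)"
    have "hat n \<phi> (F \<otimes>\<^bsub>G\<^esub> \<one>\<^bsub>G\<^esub>) = (\<Sum>i\<le>n. \<phi> (rep F i \<otimes> (if n - i = 0 then \<one> else \<zero>)))"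
     by (rule hat_mult[OF F one(1) rep(1)[OF F] onem \<phi>])
    also have "... = (\<Sum>i\<le>n. if i = n then \<phi> (rep F n) else 0)"
     using rep(3)[OF F] dual_zero[OF annD(1)[OF \<phi>]] by (intro sum.cong) auto
    finally show "hat n \<phi> (F \<otimes>\<^bsub>G\<^esub> \<one>\<^bsub>G\<^esub>) = hat n \<phi> F" using hat_val[OF F \<phi> rep(1)[OF F]] by simp
   qed
  qed (use gr_mult_closed one in auto)
 next
  fix F F' F'' assume F: "F \<in> carrier G" "F' \<in> carrier G" "F'' \<in> carrier G"
  note m = gr_mult_closed and r = rep(1)[OF F(1)] rep(1)[OF F(2)] rep(1)[OF F(3)] and rc = rep(3)[OF F(1)] rep(3)[OF F(2)] rep(3)[OF F(3)]
  have am: "rep F i \<oplus> rep F' i \<in> (F \<oplus>\<^bsub>G\<^esub> F') i" for i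
   using gr_add[OF F(1,2) r(1,2)] coset_self[OF subsp_filt] rc by simp
  show "(F \<oplus>\<^bsub>G\<^esub> F') \<otimes>\<^bsub>G\<^esub> F'' = F \<otimes>\<^bsub>G\<^esub> F'' \<oplus>\<^bsub>G\<^esub> F' \<otimes>\<^bsub>G\<^esub> F''"
  proof (rule gr_eqI)
   fix n \<phi> assume \<phi>: "\<phi> \<in> ann H (K n)"
   show "hat n \<phi> ((F \<oplus>\<^bsub>G\<^esub> F') \<otimes>\<^bsub>G\<^esub> F'') = hat n \<phi> (F \<otimes>\<^bsub>G\<^esub> F'' \<oplus>\<^bsub>G\<^esub> F' \<otimes>\<^bsub>G\<^esub> F'')"
    unfolding hat_mult[OF gr_closed(1)[OF F(1,2)] F(3) am r(3) \<phi>] dual_add[OF hat_dual[OF \<phi>] m[OF F(1,3)] m[OF F(2,3)]]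
     hat_mult[OF F(1,3) r(1,3) \<phi>] hat_mult[OF F(2,3) r(2,3) \<phi>]
    using rc by (simp add: l_distr dual_add[OF annD(1)[OF \<phi>]] sum.distrib)
  qed (use F m gr_closed in auto)
  show "F'' \<otimes>\<^bsub>G\<^esub> (F \<oplus>\<^bsub>G\<^esub> F') = F'' \<otimes>\<^bsub>G\<^esub> F \<oplus>\<^bsub>G\<^esub> F'' \<otimes>\<^bsub>G\<^esub> F'"
  proof (rule gr_eqI)
   fix n \<phi> assume \<phi>: "\<phi> \<in> ann H (K n)"
   show "hat n \<phi> (F'' \<otimes>\<^bsub>G\<^esub> (F \<oplus>\<^bsub>G\<^esub> F')) = hat n \<phi> (F'' \<otimes>\<^bsub>G\<^esub> F \<oplus>\<^bsub>G\<^esub> F'' \<otimes>\<^bsub>G\<^esub> F')"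
    unfolding hat_mult[OF F(3) gr_closed(1)[OF F(1,2)] r(3) am \<phi>] dual_add[OF hat_dual[OF \<phi>] m[OF F(3,1)] m[OF F(3,2)]]
     hat_mult[OF F(3,1) r(3,1) \<phi>] hat_mult[OF F(3,2) r(3,2) \<phi>]
    using rc by (simp add: r_distr dual_add[OF annD(1)[OF \<phi>]] sum.distrib)
  qed (use F m gr_closed in auto)
 qed
 moreover have "(c \<odot>\<^bsub>G\<^esub> F) \<otimes>\<^bsub>G\<^esub> F' = c \<odot>\<^bsub>G\<^esub> (F \<otimes>\<^bsub>G\<^esub> F') & F \<otimes>\<^bsub>G\<^esub> (c \<odot>\<^bsub>G\<^esub> F') = c \<odot>\<^bsub>G\<^esub> (F \<otimes>\<^bsub>G\<^esub> F')"
  if F: "F \<in> carrier G" "F' \<in> carrier G" for c F F'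
 proof -
  note m = gr_mult_closed and r = rep(1)[OF F(1)] rep(1)[OF F(2)] and rc = rep(3)[OF F(1)] rep(3)[OF F(2)]
  have sm: "c \<odot> rep E i \<in> (c \<odot>\<^bsub>G\<^esub> E) i" if "E \<in> carrier G" for i E
   using gr_smult[OF that rep(1)[OF that]] coset_self[OF subsp_filt] rep(3)[OF that] by simp
  show ?thesis
  proof
   show "(c \<odot>\<^bsub>G\<^esub> F) \<otimes>\<^bsub>G\<^esub> F' = c \<odot>\<^bsub>G\<^esub> (F \<otimes>\<^bsub>G\<^esub> F')"
   proof (rule gr_eqI)
    fix n \<phi> assume \<phi>: "\<phi> \<in> ann H (K n)"
    show "hat n \<phi> ((c \<odot>\<^bsub>G\<^esub> F) \<otimes>\<^bsub>G\<^esub> F') = hat n \<phi> (c \<odot>\<^bsub>G\<^esub> (F \<otimes>\<^bsub>G\<^esub> F'))"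
     unfolding hat_mult[OF gr_closed(2)[OF F(1)] F(2) sm[OF F(1)] r(2) \<phi>] dual_smult[OF hat_dual[OF \<phi>] m[OF F]] hat_mult[OF F r \<phi>]
     using rc by (simp add: smult_mult dual_smult[OF annD(1)[OF \<phi>]] sum_distrib_left)
   qed (use F m gr_closed in auto)
   show "F \<otimes>\<^bsub>G\<^esub> (c \<odot>\<^bsub>G\<^esub> F') = c \<odot>\<^bsub>G\<^esub> (F \<otimes>\<^bsub>G\<^esub> F')"
   proof (rule gr_eqI)
    fix n \<phi> assume \<phi>: "\<phi> \<in> ann H (K n)"
    show "hat n \<phi> (F \<otimes>\<^bsub>G\<^esub> (c \<odot>\<^bsub>G\<^esub> F')) = hat n \<phi> (c \<odot>\<^bsub>G\<^esub> (F \<otimes>\<^bsub>G\<^esub> F'))"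
     unfolding hat_mult[OF F(1) gr_closed(2)[OF F(2)] r(1) sm[OF F(2)] \<phi>] dual_smult[OF hat_dual[OF \<phi>] m[OF F]] hat_mult[OF F r \<phi>]
     using rc by (simp add: smult_mult dual_smult[OF annD(1)[OF \<phi>]] sum_distrib_left)
   qed (use F m gr_closed in auto)
  qed
 qed
 ultimately show ?thesis unfolding k_algebra_def using vsp_gr by blast
qed

subsection \<open>Comultiplication\<close>

text \<open>Any admissible decomposition of \<Delta>(c) gives the same numbers on the functionals
  \<open>hat\<close>. When i + j = n, the terms of the convolution in H that \<open>hat\<close> does
  not see are zero anyway, because \<phi> or \<psi> kills a factor of lower degree.\<close>

lemma gr_comult_value:
 assumes c: "c \<in> K (Suc n)" and v: "v \<in> gr_comult_values H n c"
 shows "v \<in> carrier (tensor G G)"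
  "\<phi> \<in> ann H (K i) ==> \<psi> \<in> ann H (K j) ==>
   ev (%a b. hat i \<phi> a * hat j \<psi> b) v = (if i + j = n then conv H \<phi> \<psi> c else 0)"
proof -
 interpret G: tens_space G G by (intro tens_space.intro vspace.intro vsp_gr)
 obtain t where t: "!!i. i \<le> n ==> Poly_Mapping.keys (t i) \<subseteq> corad_filt H i \<times> corad_filt H (n - i)"
  "comult H c = tensor_class H H (\<Sum>i\<le>n. t i)"
  and v': "v = (\<Oplus>\<^bsub>tensor G G\<^esub>i\<in>{..n}. \<Oplus>\<^bsub>tensor G G\<^esub>z\<in>Poly_Mapping.keys (t i).
     Poly_Mapping.lookup (t i) z \<odot>\<^bsub>tensor G G\<^esub> tens G G (gr_class H i (fst z)) (gr_class H (n - i) (snd z)))"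
  using v unfolding gr_comult_values_def same_alg_tensor[OF same_gr] by blast
 have tk: "fst z \<in> K (Suc a)" "snd z \<in> K (Suc (n - a))" if "a \<le> n" "z \<in> Poly_Mapping.keys (t a)" for a z
  using t(1)[OF that(1)] that(2) by (auto simp: filt_below_Suc)
 let ?f = "%a z. Poly_Mapping.lookup (t a) z \<odot>\<^bsub>tensor G G\<^esub> tens G G (gr_class H a (fst z)) (gr_class H (n - a) (snd z))"
 have c1: "?f a z \<in> carrier (tensor G G)" if "a \<in> {..n}" "z \<in> Poly_Mapping.keys (t a)" for a z
  using tk that by (intro G.T.smult_closed G.tens_carrier gr_class_cl) auto
 have c2: "(%a. \<Oplus>\<^bsub>tensor G G\<^esub>z\<in>Poly_Mapping.keys (t a). ?f a z) \<in> {..n} \<rightarrow> carrier (tensor G G)"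
  using c1 by (intro Pi_I G.T.finsum_closed) auto
 show "v \<in> carrier (tensor G G)" unfolding v' by (rule G.T.finsum_closed[OF c2])
 assume f: "\<phi> \<in> ann H (K i)" "\<psi> \<in> ann H (K j)"
 note b = bil_prod[OF hat_dual[OF f(1)] hat_dual[OF f(2)]]
 have "ev (%a b. hat i \<phi> a * hat j \<psi> b) v = (\<Sum>a\<le>n. \<Sum>z\<in>Poly_Mapping.keys (t a). ev (%a b. hat i \<phi> a * hat j \<psi> b) (?f a z))"
  unfolding v' G.T.dual_finsum[OF G.ev_dual[OF b] c2]
  using c1 by (intro sum.cong refl G.T.dual_finsum[OF G.ev_dual[OF b]]) auto
 also have "... = (\<Sum>a\<le>n. \<Sum>z\<in>Poly_Mapping.keys (t a). Poly_Mapping.lookup (t a) z *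
   ((if i = a then \<phi> (fst z) else 0) * (if j = n - a then \<psi> (snd z) else 0)))"
 proof (intro sum.cong refl)
  fix a z assume a: "a \<in> {..n}" "z \<in> Poly_Mapping.keys (t a)"
  then have k: "fst z \<in> K (Suc a)" "snd z \<in> K (Suc (n - a))" using tk by auto
  note gc = gr_class_cl[OF k(1)] gr_class_cl[OF k(2)]
  show "ev (%a b. hat i \<phi> a * hat j \<psi> b) (?f a z) = Poly_Mapping.lookup (t a) z *
   ((if i = a then \<phi> (fst z) else 0) * (if j = n - a then \<psi> (snd z) else 0))"
   unfolding G.ev_simps(2)[OF b G.tens_carrier[OF gc]] G.ev_tens[OF b gc] hat_class[OF k(1) f(1)] hat_class[OF k(2) f(2)] ..
 qed
 also have "... = (if i + j = n then conv H \<phi> \<psi> c else 0)"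
 proof (cases "i + j = n")
  case False
  then show ?thesis by (auto intro!: sum.neutral)
 next
  case True
  note bH = bil_prod[OF annD(1)[OF f(1)] annD(1)[OF f(2)]]
  have M: "(\<Sum>a\<le>n. t a) \<in> carrier TT.M"
  proof -
   have "Poly_Mapping.keys (\<Sum>a\<le>n. t a) \<subseteq> (\<Union>a\<in>{..n}. Poly_Mapping.keys (t a))" by (rule keys_sum)
   also have "... <= carrier H \<times> carrier H" using t(1) subspD(1)[OF subsp_corad_filt] by (fastforce simp: subset_iff)
   finally show ?thesis by (simp add: TT.carrier_prod)
  qed
  have "conv H \<phi> \<psi> c = (\<Sum>a\<le>n. klin (%z. \<phi> (fst z) * \<psi> (snd z)) (t a))"
   unfolding conv_def t(2) TT.ev_class[OF bH M] klin_sum ..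
  also have "... = (\<Sum>a\<le>n. \<Sum>z\<in>Poly_Mapping.keys (t a). Poly_Mapping.lookup (t a) z *
   ((if i = a then \<phi> (fst z) else 0) * (if j = n - a then \<psi> (snd z) else 0)))"
   unfolding klin_def
  proof (intro sum.cong refl)
   fix a z assume a: "a \<in> {..n}" "z \<in> Poly_Mapping.keys (t a)"
   then have k: "fst z \<in> K (Suc a)" "snd z \<in> K (Suc (n - a))" using tk by auto
   \<comment> \<open>As i + j = n, a split at \<open>a\<close> different from \<open>i\<close> has a
     left degree below \<open>i\<close> or a right degree below \<open>j\<close>.\<close>
   consider "a = i" | "a < i" | "n - a < j" using True a by force
   then show "Poly_Mapping.lookup (t a) z * (\<phi> (fst z) * \<psi> (snd z)) = Poly_Mapping.lookup (t a) z *
    ((if i = a then \<phi> (fst z) else 0) * (if j = n - a then \<psi> (snd z) else 0))"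
   proof cases
    case 1
    then show ?thesis using True by auto
   next
    case 2
    then have "\<phi> (fst z) = 0" using annD(2)[OF f(1)] k(1) K_mono[of "Suc a" i] by auto
    then show ?thesis by simp
   next
    case 3
    then have "\<psi> (snd z) = 0" using annD(2)[OF f(2)] k(2) K_mono[of "Suc (n - a)" j] by auto
    then show ?thesis by simp
   qed
  qed
  finally show ?thesis using True by simp
 qed
 finally show "ev (%a b. hat i \<phi> a * hat j \<psi> b) v = (if i + j = n then conv H \<phi> \<psi> c else 0)" .
qed

end

text \<open>Finite dimension of gr H lets the products of the functionals \<open>hat\<close>
  separate its tensor square. It is later obtained from a surjection or an isomorphism that links gr
  H to a presented algebra.\<close>

locale gr_fd = pointed_bialg +
 assumes gr_fin: "vectorspace.fin_dim class_ring (gr_hopf H)"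
begin

lemma fd_gr: "fd_space G"
 by (intro fd_space.intro vspace.intro vsp_gr fd_space_axioms.intro gr_fin)

lemma hats_separate:
 assumes "S \<in> carrier (tensor G G)" "T \<in> carrier (tensor G G)"
  "!!i j \<phi> \<psi>. \<phi> \<in> ann H (K i) ==> \<psi> \<in> ann H (K j) ==>
   ev (%a b. hat i \<phi> a * hat j \<psi> b) S = ev (%a b. hat i \<phi> a * hat j \<psi> b) T"
 shows "S = T"
proof -
 interpret G: fd_space G by (rule fd_gr)
 let ?L = "{hat i \<phi> | i \<phi>. \<phi> \<in> ann H (K i)}"
 have L: "?L \<subseteq> dual G" using hat_dual by auto
 have z: "F = \<zero>\<^bsub>G\<^esub>" if "F \<in> carrier G" "!!\<theta>. \<theta> \<in> ?L ==> \<theta> F = 0" for F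
  by (rule gr_eqI[OF that(1) G.zero_closed]) (use that(2) G.dual_zero[OF hat_dual] in auto)
 show ?thesis
  by (rule tensor_sep_prod[OF fd_gr sep_gr L z L z assms(1,2)]) (use assms(3) in auto)
qed

text \<open>Two representatives of a component differ by an element of \<open>K n\<close>, on which
  the convolutions in question vanish by \<open>conv_K\<close>. So all admissible values agree and
  \<open>the_elem\<close> is meaningful; on the functionals \<open>hat\<close> the coproduct is
  convolution in H.\<close>

lemma gr_comult:
 assumes F: "F \<in> carrier G"
 shows "comult G F \<in> carrier (tensor G G)"
  "\<phi> \<in> ann H (K i) ==> \<psi> \<in> ann H (K j) ==> c \<in> F (i + j) ==> conv G (hat i \<phi>) (hat j \<psi>) F = conv H \<phi> \<psi> c"
proof -
 interpret G: tens_space G G by (intro tens_space.intro vspace.intro vsp_gr)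
 have "\<exists>v. (\<Union>c\<in>F n. gr_comult_values H n c) = {v}" for n
 proof -
  let ?V = "\<Union>c\<in>F n. gr_comult_values H n c"
  obtain c where c: "c \<in> F n" using gr_mem(1)[OF F] by blast
  obtain t where "!!i. i \<le> n ==> Poly_Mapping.keys (t i) \<subseteq> corad_filt H i \<times> corad_filt H (n - i)"
   "comult H c = tensor_class H H (\<Sum>i\<le>n. t i)" by (rule comult_decomp[OF gr_mem(2)[OF F c]]) blast
  then have "gr_comult_values H n c ~= {}" unfolding gr_comult_values_def by blast
  then obtain v where v: "v \<in> gr_comult_values H n c" by blast
  have "w = v" if wV: "w \<in> ?V" for w
  proof -
   obtain d where d: "d \<in> F n" "w \<in> gr_comult_values H n d" using wV by blast
   note cK = gr_mem(2)[OF F c] and dK = gr_mem(2)[OF F d(1)]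
   note cc = K_carrier[OF cK] and dc = K_carrier[OF dK]
   have diff: "d \<ominus> c \<in> K n"
    using coset_eq_iff[OF subsp_filt dc cc, of n] gr_mem(3)[OF F d(1)] gr_mem(3)[OF F c] by simp
   show "w = v"
   proof (rule hats_separate[OF gr_comult_value(1)[OF dK d(2)] gr_comult_value(1)[OF cK v]])
    fix i j \<phi> \<psi> assume f: "\<phi> \<in> ann H (K i)" "\<psi> \<in> ann H (K j)"
    have "conv H \<phi> \<psi> d = conv H \<phi> \<psi> c" if "i + j = n"
     using conv_K_zero[OF f diff] that dual_minus[OF conv_dual[OF annD(1)[OF f(1)] annD(1)[OF f(2)]] dc cc] by simp
    then show "ev (%a b. hat i \<phi> a * hat j \<psi> b) w = ev (%a b. hat i \<phi> a * hat j \<psi> b) v"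
     unfolding gr_comult_value(2)[OF dK d(2) f] gr_comult_value(2)[OF cK v f] by simp
   qed
  qed
  then show ?thesis using v c by blast
 qed
 then obtain w where w: "!!n. (\<Union>c\<in>F n. gr_comult_values H n c) = {w n}" by metis
 have wv: "\<exists>c\<in>F n. w n \<in> gr_comult_values H n c" for n using w[of n] by blast
 have wc: "w n \<in> carrier (tensor G G)" for n using wv[of n] gr_comult_value(1) gr_mem(2)[OF F] by blast
 have e: "comult G F = (\<Oplus>\<^bsub>tensor G G\<^esub>n\<in>{n. F n ~= K n}. w n)"
 proof -
  have "comult G F = (\<Oplus>\<^bsub>tensor (gr_alg H) (gr_alg H)\<^esub>n\<in>{n. F n ~= K n}. the_elem (\<Union>c\<in>F n. gr_comult_values H n c))"
   by (simp add: gr_hopf_def)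
  then show ?thesis unfolding w the_elem_eq same_alg_tensor(1)[OF same_gr, symmetric] .
 qed
 show "comult G F \<in> carrier (tensor G G)" unfolding e by (rule G.T.finsum_closed) (use wc in auto)
 assume f: "\<phi> \<in> ann H (K i)" "\<psi> \<in> ann H (K j)" and c: "c \<in> F (i + j)"
 have wn: "ev (%a b. hat i \<phi> a * hat j \<psi> b) (w n) = (if i + j = n then conv H \<phi> \<psi> c else 0)" for n
 proof -
  obtain d where d: "d \<in> F n" "w n \<in> gr_comult_values H n d" using wv by blast
  note dK = gr_mem(2)[OF F d(1)]
  have "conv H \<phi> \<psi> d = conv H \<phi> \<psi> c" if n: "i + j = n"
  proof -
   have c': "c \<in> F n" using c n by simp
   note cc = K_carrier[OF gr_mem(2)[OF F c']] and dc = K_carrier[OF dK]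
   have diff: "d \<ominus> c \<in> K n"
    using coset_eq_iff[OF subsp_filt dc cc, of n] gr_mem(3)[OF F d(1)] gr_mem(3)[OF F c'] by simp
   show ?thesis
    using conv_K_zero[OF f diff] n dual_minus[OF conv_dual[OF annD(1)[OF f(1)] annD(1)[OF f(2)]] dc cc] by simp
  qed
  then show ?thesis unfolding gr_comult_value(2)[OF dK d(2) f] by simp
 qed
 have fin: "finite {n. F n ~= K n}" using F by (simp add: gr_simps(1))
 note b = bil_prod[OF hat_dual[OF f(1)] hat_dual[OF f(2)]]
 have "conv G (hat i \<phi>) (hat j \<psi>) F = (\<Sum>n\<in>{n. F n ~= K n}. ev (%a b. hat i \<phi> a * hat j \<psi> b) (w n))"
  unfolding conv_def e by (rule G.T.dual_finsum[OF G.ev_dual[OF b]]) (use wc in auto)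
 also have "... = (if F (i + j) ~= K (i + j) then conv H \<phi> \<psi> c else 0)"
  unfolding wn using fin by (simp add: sum.delta')
 \<comment> \<open>If the component is zero, then \<open>c\<close> itself lies in
   \<open>K (i + j)\<close> and its convolution vanishes too.\<close>
 also have "... = conv H \<phi> \<psi> c" using conv_K_zero[OF f, of c] c by auto
 finally show "conv G (hat i \<phi>) (hat j \<psi>) F = conv H \<phi> \<psi> c" .
qed

lemma cospace_gr: "cospace G"
 by (intro cospace.intro fd_gr cospace_axioms.intro gr_comult(1))

text \<open>\<open>K 0\<close> is zero, so the component of degree 0 is a singleton.\<close>

lemma counit_gr:
 assumes "F \<in> carrier G" "c \<in> F 0"
 shows "counit G F = counit H c"
proof -
 have "F 0 = {c}" using gr_mem(3)[OF assms] K_carrier[OF gr_mem(2)[OF assms]] by (simp add: filt_below_0 a_r_coset_def')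
 then show ?thesis by (simp add: gr_hopf_def)
qed

end

section \<open>Powers of commuting and of primitive elements\<close>

text \<open>Pascal's rule, in a form that serves both the binomial theorem for commuting elements
  and the comultiplication of powers of a primitive element.\<close>

lemma binom_step:
 fixes F :: "nat => nat => 'k::comm_ring_1"
 shows "(\<Sum>a\<le>n. of_nat (n choose a) * (F (Suc a) (n - a) + F a (Suc (n - a)))) = (\<Sum>a\<le>Suc n. of_nat (Suc n choose a) * F a (Suc n - a))"
proof -
 have "(\<Sum>a\<le>Suc n. of_nat (Suc n choose a) * F a (Suc n - a)) =
   F 0 (Suc n) + (\<Sum>a\<le>n. of_nat (n choose Suc a) * F (Suc a) (n - a)) + (\<Sum>a\<le>n. of_nat (n choose a) * F (Suc a) (n - a))"
  unfolding sum.atMost_Suc_shift by (simp add: distrib_right sum.distrib)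
 also have "F 0 (Suc n) + (\<Sum>a\<le>n. of_nat (n choose Suc a) * F (Suc a) (n - a)) = (\<Sum>a\<le>Suc n. of_nat (n choose a) * F a (Suc n - a))"
  unfolding sum.atMost_Suc_shift by simp
 also have "... = (\<Sum>a\<le>n. of_nat (n choose a) * F a (Suc (n - a)))"
  unfolding sum.atMost_Suc by (simp add: binomial_eq_0, intro sum.cong refl) (simp add: Suc_diff_le)
 finally show ?thesis by (simp add: distrib_left sum.distrib)
qed

text \<open>A positive characteristic is prime and divides all inner binomial coefficients.\<close>

lemma sum_binom_char:
 fixes F :: "nat => nat => 'k::field"
 assumes "CHAR('k) = p" "p > 0"
 shows "(\<Sum>a\<le>p. of_nat (p choose a) * F a (p - a)) = F 0 p + F p 0"
proof -
 have p: "prime p" using assms prime_CHAR_semidom[where 'a = 'k] by simp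
 have "(\<Sum>a\<le>p. of_nat (p choose a) * F a (p - a)) = (\<Sum>a\<in>{0, p}. of_nat (p choose a) * F a (p - a))"
 proof (rule sum.mono_neutral_right)
  show "\<forall>a\<in>{..p} - {0, p}. of_nat (p choose a) * F a (p - a) = 0"
  proof
   fix a assume "a \<in> {..p} - {0, p}"
   then have "p dvd (p choose a)" using p by (intro dvd_choose_prime) auto
   then have "(of_nat (p choose a) :: 'k) = 0" using assms(1) by (simp add: of_nat_eq_0_iff_char_dvd)
   then show "of_nat (p choose a) * F a (p - a) = 0" by simp
  qed
 qed auto
 then show ?thesis using assms(2) by simp
qed

context sep_alg
begin

lemma pow_Suc_left: "x \<in> carrier A ==> u \<in> carrier A ==> x \<otimes> (x [^] (n::nat) \<otimes> u) = x [^] Suc n \<otimes> u"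
 using nat_pow_Suc2[of x n] m_assoc[of x "x [^] n" u] by simp

text \<open>The functional is kept general because the induction absorbs the leading factors
  \<open>u\<close> and \<open>v\<close> into it.\<close>

lemma dual_pow_commuting:
 assumes "u \<in> carrier A" "v \<in> carrier A" "u \<otimes> v = v \<otimes> u" "c \<in> carrier A" "\<phi> \<in> dual A"
 shows "\<phi> ((u \<oplus> v) [^] (n::nat) \<otimes> c) = (\<Sum>a\<le>n. of_nat (n choose a) * \<phi> (u [^] a \<otimes> (v [^] (n - a) \<otimes> c)))"
 using assms(5)
proof (induction n arbitrary: \<phi>)
 case 0
 show ?case using assms by simp
next
 case (Suc n)
 have vu: "v \<otimes> u [^] (a::nat) = u [^] a \<otimes> v" for a
 proof (induction a)
  case (Suc a)
  have "v \<otimes> (u [^] a \<otimes> u) = u [^] a \<otimes> (v \<otimes> u)" using Suc assms by (simp add: m_assoc[symmetric])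
  then show ?case using assms by (simp add: m_assoc)
 qed (use assms in simp)
 have "\<phi> ((u \<oplus> v) [^] Suc n \<otimes> c) = \<phi> (u \<otimes> ((u \<oplus> v) [^] n \<otimes> c)) + \<phi> (v \<otimes> ((u \<oplus> v) [^] n \<otimes> c))"
 proof -
  have "(u \<oplus> v) [^] Suc n \<otimes> c = (u \<oplus> v) \<otimes> ((u \<oplus> v) [^] n \<otimes> c)" using assms by (intro pow_Suc_left[symmetric]) auto
  also have "... = u \<otimes> ((u \<oplus> v) [^] n \<otimes> c) \<oplus> v \<otimes> ((u \<oplus> v) [^] n \<otimes> c)" using assms by (intro l_distr) auto
  finally show ?thesis using assms Suc.prems by (simp only: dual_add m_closed a_closed nat_pow_closed)
 qed
 also have "... = (\<Sum>a\<le>n. of_nat (n choose a) * \<phi> (u \<otimes> (u [^] a \<otimes> (v [^] (n - a) \<otimes> c)))) +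
   (\<Sum>a\<le>n. of_nat (n choose a) * \<phi> (v \<otimes> (u [^] a \<otimes> (v [^] (n - a) \<otimes> c))))"
  using Suc.IH[OF dual_lmult[OF Suc.prems assms(1)]] Suc.IH[OF dual_lmult[OF Suc.prems assms(2)]] by simp
 also have "... = (\<Sum>a\<le>n. of_nat (n choose a) *
   (\<phi> (u [^] Suc a \<otimes> (v [^] (n - a) \<otimes> c)) + \<phi> (u [^] a \<otimes> (v [^] Suc (n - a) \<otimes> c))))"
 proof -
  have 1: "u \<otimes> (u [^] a \<otimes> d) = u [^] Suc a \<otimes> d" if "d \<in> carrier A" for a d
   by (rule pow_Suc_left[OF assms(1) that])
  have 2: "v \<otimes> (u [^] a \<otimes> (v [^] b \<otimes> c)) = u [^] a \<otimes> (v [^] Suc b \<otimes> c)" for a b :: nat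
  proof -
   have "v \<otimes> (u [^] a \<otimes> (v [^] b \<otimes> c)) = (v \<otimes> u [^] a) \<otimes> (v [^] b \<otimes> c)" using assms by (simp add: m_assoc)
   also have "... = u [^] a \<otimes> (v [^] Suc b \<otimes> c)"
    unfolding vu using assms pow_Suc_left[of v c b] by (simp add: m_assoc del: nat_pow_Suc)
   finally show ?thesis .
  qed
  show ?thesis using assms by (simp add: 1 2 distrib_left sum.distrib del: nat_pow_Suc)
 qed
 also have "... = (\<Sum>a\<le>Suc n. of_nat (Suc n choose a) * \<phi> (u [^] a \<otimes> (v [^] (Suc n - a) \<otimes> c)))"
  by (rule binom_step)
 finally show ?case .
qed

lemma freshman:
 assumes "CHAR('k) = p" "p > 0" "u \<in> carrier A" "v \<in> carrier A" "u \<otimes> v = v \<otimes> u"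
 shows "(u \<oplus> v) [^] p = u [^] p \<oplus> v [^] p"
proof (rule sep)
 fix \<phi> assume \<phi>: "\<phi> \<in> dual A"
 have "\<phi> ((u \<oplus> v) [^] p \<otimes> \<one>) = \<phi> (u [^] (0::nat) \<otimes> (v [^] p \<otimes> \<one>)) + \<phi> (u [^] p \<otimes> (v [^] (0::nat) \<otimes> \<one>))"
  unfolding dual_pow_commuting[OF assms(3-5) one_closed \<phi>]
  by (rule sum_binom_char[OF assms(1,2), of "%a b. \<phi> (u [^] a \<otimes> (v [^] b \<otimes> \<one>))"])
 then show "\<phi> ((u \<oplus> v) [^] p) = \<phi> (u [^] p \<oplus> v [^] p)"
  using assms \<phi> by (simp add: dual_add)
qed (use assms in auto)

lemma smult_pow: "u \<in> carrier A ==> (c \<odot> u) [^] (n::nat) = (c ^ n) \<odot> (u [^] n)"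
proof (induction n)
 case (Suc n)
 then show ?case by (simp add: smult_mult smult_assoc1[symmetric] mult.commute)
qed simp

end

subsection \<open>Families of vectors separated by functionals\<close>

context fd_space
begin

text \<open>Linear independence of an indexed family, with relations tested by functionals. It
  entails injectivity of the indexing.\<close>

definition indep :: "'i set => ('i => 'a) => bool" where
 "indep I b \<longleftrightarrow> finite I & b ` I <= carrier V & (\<forall>c. (\<forall>\<phi>\<in>dual V. (\<Sum>i\<in>I. c i * \<phi> (b i)) = 0) --> (\<forall>i\<in>I. c i = 0))"

lemma indep_dual:
 assumes "indep I b" "i \<in> I"
 obtains \<phi> where "\<phi> \<in> dual V" "!!j. j \<in> I ==> \<phi> (b j) = (if j = i then 1 else 0)"
 by (rule functional_on_family[of I b i]) (use assms in \<open>auto simp: indep_def\<close>)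

lemma indep_inj: "indep I b ==> inj_on b I"
proof (rule inj_onI)
 fix i j assume a: "indep I b" "i \<in> I" "j \<in> I" "b i = b j"
 obtain \<phi> where "\<phi> \<in> dual V" "!!k. k \<in> I ==> \<phi> (b k) = (if k = i then 1 else 0)" by (rule indep_dual[OF a(1,2)]) blast
 then show "i = j" using a by (metis zero_neq_one)
qed

lemma indep_li: "indep I b ==> lin_indpt (b ` I)"
proof (rule finite_lin_indpt2)
 assume I: "indep I b"
 show "finite (b ` I)" "b ` I <= carrier V" using I by (auto simp: indep_def)
 fix a assume l: "lincomb a (b ` I) = \<zero>"
 show "\<forall>v\<in>b ` I. a v = 0"
 proof
  fix v assume "v \<in> b ` I"
  then obtain i where i: "i \<in> I" "v = b i" by auto
  obtain \<phi> where \<phi>: "\<phi> \<in> dual V" "!!k. k \<in> I ==> \<phi> (b k) = (if k = i then 1 else 0)" by (rule indep_dual[OF I i(1)]) blast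
  have "0 = \<phi> (lincomb a (b ` I))" using l dual_zero[OF \<phi>(1)] by simp
  also have "... = (\<Sum>w\<in>b ` I. \<phi> (a w \<odot> w))"
   unfolding lincomb_def by (rule dual_finsum[OF \<phi>(1)]) (use I in \<open>auto simp: indep_def\<close>)
  also have "... = (\<Sum>j\<in>I. \<phi> (a (b j) \<odot> b j))" by (rule sum.reindex_cong[OF indep_inj[OF I] refl refl])
  also have "... = (\<Sum>j\<in>I. if j = i then a (b i) else 0)"
   using I \<phi> by (intro sum.cong) (auto simp: indep_def dual_smult image_subset_iff)
  also have "... = a v" using I i by (simp add: indep_def)
  finally show "a v = 0" by simp
 qed
qed

lemma indep_card: "indep I b ==> card I \<le> dim"
 and indep_basis: "indep I b ==> card I = dim ==> lspan V (b ` I) = carrier V"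
 and indep_dim: "indep I b ==> lspan V (b ` I) = carrier V ==> dim = card I"
proof -
 assume I: "indep I b"
 have f: "finite (b ` I)" "b ` I <= carrier V" using I by (simp_all add: indep_def)
 note li = indep_li[OF I] and c = card_image[OF indep_inj[OF I]]
 show "card I \<le> dim" using li_le_dim(2)[OF fd f(2) li] c by simp
 show "lspan V (b ` I) = carrier V" if "card I = dim"
  using dim_li_is_basis[OF fd f li] c that by (simp add: basis_def)
 show "dim = card I" if "lspan V (b ` I) = carrier V"
  using dim_basis[OF f(1)] li f(2) c that by (simp add: basis_def)
qed

lemma indep_coords:
 assumes I: "indep I b" and sp: "lspan V (b ` I) = carrier V"
 obtains \<delta> where "!!i. i \<in> I ==> \<delta> i \<in> dual V" "!!i j. i \<in> I ==> j \<in> I ==> \<delta> i (b j) = (if j = i then 1 else 0)"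
  "!!v \<phi>. v \<in> carrier V ==> \<phi> \<in> dual V ==> \<phi> v = (\<Sum>i\<in>I. \<delta> i v * \<phi> (b i))"
proof -
 have "\<forall>i\<in>I. \<exists>\<phi>. \<phi> \<in> dual V & (\<forall>j\<in>I. \<phi> (b j) = (if j = i then 1 else 0))"
 proof
  fix i assume "i \<in> I"
  from indep_dual[OF I this] show "\<exists>\<phi>. \<phi> \<in> dual V & (\<forall>j\<in>I. \<phi> (b j) = (if j = i then 1 else 0))" by metis
 qed
 then obtain \<delta> where \<delta>: "!!i. i \<in> I ==> \<delta> i \<in> dual V" "!!i j. i \<in> I ==> j \<in> I ==> \<delta> i (b j) = (if j = i then 1 else 0)"
  by metis
 have fin: "finite I" and bc: "b ` I <= carrier V" using I by (auto simp: indep_def)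
 have "\<phi> v = (\<Sum>i\<in>I. \<delta> i v * \<phi> (b i))" if v: "v \<in> carrier V" and \<phi>: "\<phi> \<in> dual V" for v \<phi>
 proof (rule dual_span_eq[OF \<phi> _ bc _ v[folded sp]])
  show "(%v. \<Sum>i\<in>I. \<delta> i v * \<phi> (b i)) \<in> dual V" using \<delta>(1) by (intro dual_sum dual_closed(4))
  fix s assume "s \<in> b ` I"
  then obtain j where "j \<in> I" "s = b j" by auto
  then show "\<phi> s = (\<Sum>i\<in>I. \<delta> i s * \<phi> (b i))" using \<delta>(2) fin by (simp add: if_distrib[of "%x. x * _"] cong: if_cong)
 qed
 then show ?thesis using that \<delta> by blast
qed

end

section \<open>Grouplike and primitive elements\<close>

context prebialg
begin

lemma grouplike_carrier: "u \<in> grouplikes H ==> u \<in> carrier H"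
 by (simp add: grouplikes_def)

lemma conv_group: "u \<in> grouplikes H ==> \<phi> \<in> dual H ==> \<psi> \<in> dual H ==> conv H \<phi> \<psi> u = \<phi> u * \<psi> u"
 unfolding grouplike_iff by blast

lemma conv_prim: "x \<in> primitives H ==> \<phi> \<in> dual H ==> \<psi> \<in> dual H ==> conv H \<phi> \<psi> x = \<phi> x * \<psi> \<one> + \<phi> \<one> * \<psi> x"
 unfolding primitive_iff[OF one_closed] by blast

lemma prim_carrier: "x \<in> primitives H ==> x \<in> carrier H"
 by (simp add: primitives_def)

text \<open>In a relation b_u = \<Sum> l_i b_i with independent b_i on the right, convolution with
  the functional dual to b_t gives l_t b_u = l_t b_t. As the b_i are distinct, all l_t vanish, and
  then the counit of b_u would be 0 instead of 1.\<close>

lemma grouplikes_indep: "finite I ==> inj_on b I ==> b ` I <= grouplikes H ==> indep I b"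
proof (induction I rule: finite_induct)
 case empty
 show ?case by (simp add: indep_def)
next
 case (insert u I)
 then have I: "indep I b" by simp
 have g: "b u \<in> grouplikes H" "!!i. i \<in> I ==> b i \<in> grouplikes H" using insert by auto
 note gc = grouplike_carrier[OF g(1)] grouplike_carrier[OF g(2)]
 have "\<forall>i\<in>insert u I. c i = 0" if c: "!!\<phi>. \<phi> \<in> dual H ==> (\<Sum>i\<in>insert u I. c i * \<phi> (b i)) = 0" for c
 proof -
  have s: "c u * \<phi> (b u) + (\<Sum>i\<in>I. c i * \<phi> (b i)) = 0" if "\<phi> \<in> dual H" for \<phi> using c[OF that] insert by simp
  have cu: "c u = 0"
  proof (rule ccontr)
   assume n: "c u ~= 0"
   define l where "l i = - c i / c u" for i
   have rel: "\<phi> (b u) = (\<Sum>i\<in>I. l i * \<phi> (b i))" if "\<phi> \<in> dual H" for \<phi>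
   proof -
    have "\<phi> (b u) = - (\<Sum>i\<in>I. c i * \<phi> (b i)) / c u" using s[OF that] n by (simp add: field_simps add_eq_0_iff)
    also have "... = (\<Sum>i\<in>I. l i * \<phi> (b i))" by (simp add: l_def sum_divide_distrib sum_negf)
    finally show ?thesis .
   qed
   have "l t = 0" if t: "t \<in> I" for t
   proof (rule ccontr)
    assume lt: "l t ~= 0"
    obtain \<gamma> where \<gamma>: "\<gamma> \<in> dual H" "!!k. k \<in> I ==> \<gamma> (b k) = (if k = t then 1 else 0)" by (rule indep_dual[OF I t]) blast
    have gu: "\<gamma> (b u) = l t" using rel[OF \<gamma>(1)] \<gamma>(2) t insert(1) by (simp add: if_distrib[of "%x. _ * x"] cong: if_cong)
    have "\<phi> (b u) = \<phi> (b t)" if \<phi>: "\<phi> \<in> dual H" for \<phi>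
    proof -
     have "\<phi> (b u) * l t = conv H \<phi> \<gamma> (b u)" using conv_group[OF g(1) \<phi> \<gamma>(1)] gu by simp
     also have "... = (\<Sum>i\<in>I. l i * (\<phi> (b i) * \<gamma> (b i)))"
      using rel[OF conv_dual[OF \<phi> \<gamma>(1)]] conv_group[OF g(2) \<phi> \<gamma>(1)] by simp
     also have "... = (\<Sum>i\<in>I. if i = t then l t * \<phi> (b t) else 0)" using \<gamma>(2) by (intro sum.cong) auto
     also have "... = \<phi> (b t) * l t" using t insert(1) by simp
     finally show ?thesis using lt by simp
    qed
    then have "b u = b t" by (rule sep[OF gc(1) gc(2)[OF t]])
    then show False using insert t by (auto simp: inj_on_def)
   qed
   then have "counit H (b u) = 0" using rel[OF counit_dual] by simp
   then show False using g(1) by (simp add: grouplikes_def)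
  qed
  then have "\<forall>i\<in>I. c i = 0" using s I unfolding indep_def by auto
  then show ?thesis using cu by simp
 qed
 then show ?case unfolding indep_def using insert(1) gc by auto
qed

lemma grouplike_functional:
 assumes "finite U" "U <= grouplikes H"
 obtains e where "e \<in> dual H" "e \<one> = 1" "!!u. u \<in> U ==> u ~= \<one> ==> e u = 0"
proof -
 have "indep (insert \<one> U) (%u. u)" using assms one_grouplike by (intro grouplikes_indep) auto
 then obtain e where "e \<in> dual H" "!!j. j \<in> insert \<one> U ==> e j = (if j = \<one> then 1 else 0)"
  by (rule indep_dual[of _ _ \<one>]) auto
 then show ?thesis using that by auto
qed

text \<open>Evaluate \<phi> \<otimes> e on \<Delta>(w), where e is 1 at the unit and 0 at the other
  grouplike elements involved. Primitivity gives \<phi>(w) + \<phi>(1) e(w), and the expansion into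
  grouplike elements gives \<phi>(1) e(w).\<close>

lemma primitive_span_grouplikes:
 assumes w: "w \<in> primitives H" and I: "finite I" "b ` I <= grouplikes H"
  and rel: "!!\<phi>. \<phi> \<in> dual H ==> \<phi> w = (\<Sum>i\<in>I. \<mu> i * \<phi> (b i))"
 shows "w = \<zero>"
proof -
 obtain e where e: "e \<in> dual H" "e \<one> = 1" "!!u. u \<in> b ` I ==> u ~= \<one> ==> e u = 0"
  by (rule grouplike_functional[of "b ` I"]) (use I in auto)
 have "\<phi> w = 0" if \<phi>: "\<phi> \<in> dual H" for \<phi>
 proof -
  have "\<phi> w + \<phi> \<one> * e w = conv H \<phi> e w" using conv_prim[OF w \<phi> e(1)] e(2) by simp
  also have "... = (\<Sum>i\<in>I. \<mu> i * (\<phi> (b i) * e (b i)))"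
   using rel[OF conv_dual[OF \<phi> e(1)]] conv_group[OF _ \<phi> e(1)] I by (simp add: image_subset_iff)
  also have "... = (\<Sum>i\<in>I. \<phi> \<one> * (\<mu> i * e (b i)))"
   by (intro sum.cong refl) (use e(3) in \<open>metis (no_types, lifting) imageI mult.left_commute mult_zero_left mult_zero_right\<close>)
  also have "... = \<phi> \<one> * e w" using rel[OF e(1)] by (simp add: sum_distrib_left)
  finally show ?thesis by simp
 qed
 then show ?thesis using prim_carrier[OF w] by (intro sep) (auto simp: dual_zero)
qed

lemma prim_subsp: "subsp H (primitives H)"
proof -
 have c: "primitives H <= carrier H" by (auto simp: primitives_def)
 have "\<zero> \<in> primitives H"
  unfolding primitive_iff[OF one_closed] by (auto simp: dual_zero dual_zero[OF conv_dual])
 moreover have "x \<oplus> y \<in> primitives H" "k \<odot> x \<in> primitives H" if "x \<in> primitives H" "y \<in> primitives H" for x y k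
  using that c dual_add[OF conv_dual] dual_smult[OF conv_dual] unfolding primitive_iff[OF one_closed]
  by (auto simp: dual_add dual_smult algebra_simps)
 ultimately show ?thesis using c by (auto simp: subsp_def)
qed

text \<open>The mixed terms \<phi>(x) \<psi>(y) + \<phi>(y) \<psi>(x) are symmetric in x and y and
  cancel.\<close>

lemma primitive_commutator:
 assumes "x \<in> primitives H" "y \<in> primitives H"
 shows "x \<otimes> y \<ominus> y \<otimes> x \<in> primitives H"
proof -
 note c = prim_carrier[OF assms(1)] prim_carrier[OF assms(2)]
 have e: "conv H \<phi> \<psi> (u \<otimes> v) = \<phi> (u \<otimes> v) * \<psi> \<one> + \<phi> u * \<psi> v + (\<phi> v * \<psi> u + \<phi> \<one> * \<psi> (u \<otimes> v))"
  if uv: "u \<in> primitives H" "v \<in> primitives H" and f: "\<phi> \<in> dual H" "\<psi> \<in> dual H" for u v \<phi> \<psi>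
 proof -
  note uc = prim_carrier[OF uv(1)] and vc = prim_carrier[OF uv(2)]
  show ?thesis
   using conv_prim_mult[OF uv(1) vc f] conv_prim[OF uv(2) dual_lmult[OF f(1) uc] f(2)]
    conv_prim[OF uv(2) f(1) dual_lmult[OF f(2) uc]] uc by simp
 qed
 show ?thesis
  unfolding primitive_iff[OF one_closed]
  using c e[OF assms] e[OF assms(2,1)] by (simp add: dual_minus dual_minus[OF conv_dual] algebra_simps)
qed

lemma grouplike_pow: "u \<in> grouplikes H ==> u [^] (n::nat) \<in> grouplikes H"
 by (induction n) (use one_grouplike grouplike_mult in auto)

lemma conv_primitive_pow:
 assumes x: "x \<in> primitives H" and c: "c \<in> carrier H" and "\<phi> \<in> dual H" "\<psi> \<in> dual H"
 shows "conv H \<phi> \<psi> (x [^] (n::nat) \<otimes> c) =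
  (\<Sum>a\<le>n. of_nat (n choose a) * conv H (%u. \<phi> (x [^] a \<otimes> u)) (%u. \<psi> (x [^] (n - a) \<otimes> u)) c)"
 using assms(3,4)
proof (induction n arbitrary: \<phi> \<psi>)
 case 0
 note xc = prim_carrier[OF x]
 have "conv H \<phi> \<psi> c = conv H (%u. \<phi> (\<one> \<otimes> u)) (%u. \<psi> (\<one> \<otimes> u)) c"
  by (rule conv_cong[OF c 0 dual_lmult[OF 0(1) one_closed] dual_lmult[OF 0(2) one_closed]]) auto
 then show ?case using c by simp
next
 case (Suc n)
 note xc = prim_carrier[OF x] and f = Suc.prems
 have pc: "x [^] (a::nat) \<in> carrier H" for a using xc by simp
 have s: "x \<otimes> (x [^] (a::nat) \<otimes> u) = x [^] Suc a \<otimes> u" if "u \<in> carrier H" for a u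
  by (rule pow_Suc_left[OF xc that])
 have d: "(%u. \<chi> (x [^] (a::nat) \<otimes> u)) \<in> dual H" if "\<chi> \<in> dual H" for \<chi> a by (rule dual_lmult[OF that pc])
 have "conv H \<phi> \<psi> (x [^] Suc n \<otimes> c) = conv H \<phi> \<psi> (x \<otimes> (x [^] n \<otimes> c))" by (simp only: s[OF c])
 also have "... = conv H (%u. \<phi> (x \<otimes> u)) \<psi> (x [^] n \<otimes> c) + conv H \<phi> (%u. \<psi> (x \<otimes> u)) (x [^] n \<otimes> c)"
  by (rule conv_prim_mult[OF x m_closed[OF pc c] f])
 also have "... = (\<Sum>a\<le>n. of_nat (n choose a) * (conv H (%u. \<phi> (x [^] Suc a \<otimes> u)) (%u. \<psi> (x [^] (n - a) \<otimes> u)) c +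
   conv H (%u. \<phi> (x [^] a \<otimes> u)) (%u. \<psi> (x [^] Suc (n - a) \<otimes> u)) c))"
  unfolding Suc.IH[OF dual_lmult[OF f(1) xc] f(2)] Suc.IH[OF f(1) dual_lmult[OF f(2) xc]]
   sum.distrib[symmetric] distrib_left[symmetric]
 proof (intro sum.cong refl arg_cong2[where f = "(*)"] arg_cong2[where f = "(+)"])
  fix a
  show "conv H (%u. \<phi> (x \<otimes> (x [^] a \<otimes> u))) (%u. \<psi> (x [^] (n - a) \<otimes> u)) c = conv H (%u. \<phi> (x [^] Suc a \<otimes> u)) (%u. \<psi> (x [^] (n - a) \<otimes> u)) c"
   by (rule conv_cong[OF c d[OF dual_lmult[OF f(1) xc]] d[OF f(2)] d[OF f(1)] d[OF f(2)]]) (simp_all only: s)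
  show "conv H (%u. \<phi> (x [^] a \<otimes> u)) (%u. \<psi> (x \<otimes> (x [^] (n - a) \<otimes> u))) c = conv H (%u. \<phi> (x [^] a \<otimes> u)) (%u. \<psi> (x [^] Suc (n - a) \<otimes> u)) c"
   by (rule conv_cong[OF c d[OF f(1)] d[OF dual_lmult[OF f(2) xc]] d[OF f(1)] d[OF f(2)]]) (simp_all only: s)
 qed
 also have "... = (\<Sum>a\<le>Suc n. of_nat (Suc n choose a) * conv H (%u. \<phi> (x [^] a \<otimes> u)) (%u. \<psi> (x [^] (Suc n - a) \<otimes> u)) c)"
  by (rule binom_step)
 finally show ?case .
qed

text \<open>In characteristic p only the two outer terms of the binomial expansion survive. Together
  with the commutator this makes the primitive elements a restricted Lie algebra.\<close>

lemma prim_pow_char: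
 assumes "CHAR('k) = p" "p > 0" "x \<in> primitives H"
 shows "x [^] p \<in> primitives H"
 unfolding primitive_iff[OF one_closed]
proof (intro conjI ballI)
 note xc = prim_carrier[OF assms(3)]
 show "x [^] p \<in> carrier H" using xc by simp
 fix \<phi> \<psi> assume f: "\<phi> \<in> dual H" "\<psi> \<in> dual H"
 have d: "(%u. \<chi> (x [^] (a::nat) \<otimes> u)) \<in> dual H" if "\<chi> \<in> dual H" for \<chi> a by (rule dual_lmult[OF that]) (simp add: xc)
 have "conv H \<phi> \<psi> (x [^] p \<otimes> \<one>) = (\<Sum>a\<le>p. of_nat (p choose a) * (\<phi> (x [^] a) * \<psi> (x [^] (p - a))))"
  unfolding conv_primitive_pow[OF assms(3) one_closed f] conv_one[OF d[OF f(1)] d[OF f(2)]] using xc by simp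
 also have "... = \<phi> (x [^] (0::nat)) * \<psi> (x [^] p) + \<phi> (x [^] p) * \<psi> (x [^] (0::nat))"
  by (rule sum_binom_char[OF assms(1,2)])
 finally show "conv H \<phi> \<psi> (x [^] p) = \<phi> (x [^] p) * \<psi> \<one> + \<phi> \<one> * \<psi> (x [^] p)" using xc by simp
qed

end

section \<open>Monomials in a grouplike and two primitive elements\<close>

lemma finite_max_nat:
 fixes d :: "'i => nat"
 assumes "finite S" "S ~= {}"
 obtains i where "i \<in> S" "!!k. k \<in> S ==> d k \<le> d i"
proof -
 have "Max (d ` S) \<in> d ` S" using assms by (intro Max_in) auto
 then obtain i where i: "i \<in> S" "Max (d ` S) = d i" by blast
 show ?thesis by (rule that[OF i(1)]) (use assms(1) i(2)[symmetric] in simp)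
qed

lemma single_sum:
 fixes f :: "nat => nat => 'k::comm_monoid_add"
 assumes "!!c d. c \<le> j ==> d \<le> l ==> f c d = (if c = a & d = b then X else 0)"
 shows "(\<Sum>c\<le>j. \<Sum>d\<le>l. f c d) = (if a \<le> j & b \<le> l then X else 0)"
proof -
 have "(\<Sum>c\<le>j. \<Sum>d\<le>l. f c d) = (\<Sum>c\<le>j. \<Sum>d\<le>l. if c = a then if d = b then X else 0 else 0)"
  using assms by (intro sum.cong) auto
 also have "... = (\<Sum>c\<le>j. if c = a then if b \<le> l then X else 0 else 0)"
  by (intro sum.cong) auto
 finally show ?thesis by simp
qed

section \<open>The comultiplication of ordered monomials\<close>

locale gxy = prebialg H for H :: "('k::field, 'a, 'm) hopf_scheme" (structure) +
 fixes g x y :: 'a and p :: nat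
 assumes g: "g \<in> grouplikes H" and gp: "g [^] p = \<one>" and x: "x \<in> primitives H" and y: "y \<in> primitives H"
  and char: "CHAR('k) = p" and p: "p > 0"
begin

lemma prime_p: "prime p"
 using char p prime_CHAR_semidom[where 'a = 'k] by simp

lemma p2: "p > 1"
 by (rule prime_gt_1_nat[OF prime_p])

lemma of_nat_neq: "0 < j ==> j < p ==> (of_nat j :: 'k) ~= 0"
 using char by (auto simp: of_nat_eq_0_iff_char_dvd dest: dvd_imp_le)

lemma gc: "g \<in> carrier H" and xc: "x \<in> carrier H" and yc: "y \<in> carrier H"
 using grouplike_carrier[OF g] prim_carrier[OF x] prim_carrier[OF y] by auto

definition mon :: "nat => nat => nat => 'a" where
 "mon s j l = g [^] s \<otimes> (x [^] j \<otimes> y [^] l)"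

lemma mon_closed: "mon s j l \<in> carrier H"
 by (simp add: mon_def gc xc yc)

lemma mon_simps: "mon s 0 0 = g [^] s" "mon 0 (Suc 0) 0 = x" "mon 0 0 (Suc 0) = y" "mon 0 0 0 = \<one>"
 by (simp_all add: mon_def gc xc yc)

lemma mon_grouplike: "mon s 0 0 \<in> grouplikes H"
 using grouplike_pow[OF g] by (simp add: mon_simps)

lemma conv_pow:
 assumes z: "z \<in> primitives H" and f: "\<phi> \<in> dual H" "\<psi> \<in> dual H"
 shows "conv H \<phi> \<psi> (z [^] (l::nat)) = (\<Sum>b\<le>l. of_nat (l choose b) * (\<phi> (z [^] b) * \<psi> (z [^] (l - b))))"
proof -
 note zc = prim_carrier[OF z]
 have d: "(%u. \<chi> (z [^] (a::nat) \<otimes> u)) \<in> dual H" if "\<chi> \<in> dual H" for \<chi> a by (rule dual_lmult[OF that]) (simp add: zc)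
 show ?thesis
  using conv_primitive_pow[OF z one_closed f, of l] unfolding conv_one[OF d[OF f(1)] d[OF f(2)]] using zc by simp
qed

text \<open>\<Delta>(x)^j and \<Delta>(y)^l are expanded one after the other, so both tensor factors
  are again ordered monomials, and the coefficients depend on the exponents alone.\<close>

lemma conv_mon:
 assumes f: "\<phi> \<in> dual H" "\<psi> \<in> dual H"
 shows "conv H \<phi> \<psi> (mon s j l) = (\<Sum>a\<le>j. \<Sum>b\<le>l. of_nat (j choose a) * of_nat (l choose b) * (\<phi> (mon s a b) * \<psi> (mon s (j - a) (l - b))))"
proof -
 note gs = grouplike_pow[OF g, of s]
 have c: "x [^] (a::nat) \<in> carrier H" "y [^] (a::nat) \<in> carrier H" for a by (simp_all add: xc yc)
 have d: "(%a. \<chi> (g [^] s \<otimes> a)) \<in> dual H" if "\<chi> \<in> dual H" for \<chi> by (rule dual_lmult[OF that grouplike_carrier[OF gs]])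
 have d2: "(%u. \<chi> (g [^] s \<otimes> (x [^] (a::nat) \<otimes> u))) \<in> dual H" if "\<chi> \<in> dual H" for \<chi> a by (rule dual_lmult[OF d[OF that] c(1)])
 show ?thesis
  unfolding mon_def conv_group_mult[OF gs m_closed[OF c] f] conv_primitive_pow[OF x c(2) d[OF f(1)] d[OF f(2)]]
   conv_pow[OF y d2[OF f(1)] d2[OF f(2)]] sum_distrib_left mult.assoc ..
qed

definition M :: "nat \<times> nat \<times> nat => 'a" where
 "M i = (case i of (s, j, l) => mon s j l)"

abbreviation J :: "(nat \<times> nat \<times> nat) set" where
 "J \<equiv> {..<p} \<times> {..<p} \<times> {..<p}"

lemma M_closed: "M i \<in> carrier H"
 by (simp add: M_def mon_closed split: prod.split)

end

section \<open>Linear independence of the monomials\<close>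

locale gxy_free = gxy H g x y p for H :: "('k::field, 'a, 'm) hopf_scheme" (structure) and g x y p +
 assumes distinct: "inj_on (%s. g [^] (s::nat)) {..<p}"
  and xy_free: "\<alpha> \<odot> x \<oplus> \<beta> \<odot> y = \<zero> ==> \<alpha> = 0 & \<beta> = 0"
begin

lemma powers_indep: "indep {..<p} (%s. mon s 0 0)"
 by (rule grouplikes_indep) (use distinct mon_grouplike in \<open>auto simp: mon_simps inj_on_def\<close>)

text \<open>Convolving the relation with a functional that picks g^t isolates the degree-one part at
  g^t up to grouplike terms. Multiplied by g^(p - t), that part is a primitive element in the span
  of grouplike elements, hence zero. What remains is a relation between the powers of g.\<close>

lemma low_indep:
 assumes rel: "!!\<phi>. \<phi> \<in> dual H ==> (\<Sum>s<p. \<kappa> s * \<phi> (mon s 0 0) + \<mu> s * \<phi> (mon s (Suc 0) 0) + \<nu> s * \<phi> (mon s 0 (Suc 0))) = 0"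
  and t: "t < p"
 shows "\<kappa> t = 0 & \<mu> t = 0 & \<nu> t = 0"
proof -
 have mn: "\<mu> t = 0 & \<nu> t = 0" if t: "t < p" for t
 proof -
  obtain \<gamma> where \<gamma>: "\<gamma> \<in> dual H" "!!s. s \<in> {..<p} ==> \<gamma> (mon s 0 0) = (if s = t then 1 else 0)"
   by (rule indep_dual[OF powers_indep, of t]) (use t in auto)
  \<comment> \<open>Collects all that the convolution leaves on pure powers of g, including the
    original coefficient at g^t.\<close>
  define \<eta> where "\<eta> s = \<mu> s * \<gamma> (mon s (Suc 0) 0) + \<nu> s * \<gamma> (mon s 0 (Suc 0)) + (if s = t then \<kappa> t else 0)" for s
  have e: "\<mu> t * \<phi> (mon t (Suc 0) 0) + \<nu> t * \<phi> (mon t 0 (Suc 0)) = (\<Sum>s<p. - \<eta> s * \<phi> (mon s 0 0))" if \<phi>: "\<phi> \<in> dual H" for \<phi>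
  proof -
   have "0 = (\<Sum>s<p. \<kappa> s * conv H \<phi> \<gamma> (mon s 0 0) + \<mu> s * conv H \<phi> \<gamma> (mon s (Suc 0) 0) + \<nu> s * conv H \<phi> \<gamma> (mon s 0 (Suc 0)))"
    using rel[OF conv_dual[OF \<phi> \<gamma>(1)]] by simp
   also have "... = (\<Sum>s<p. (if s = t then \<mu> t * \<phi> (mon t (Suc 0) 0) + \<nu> t * \<phi> (mon t 0 (Suc 0)) else 0) + \<eta> s * \<phi> (mon s 0 0))"
   proof (rule sum.cong[OF refl])
    fix s assume "s \<in> {..<p}"
    then show "\<kappa> s * conv H \<phi> \<gamma> (mon s 0 0) + \<mu> s * conv H \<phi> \<gamma> (mon s (Suc 0) 0) + \<nu> s * conv H \<phi> \<gamma> (mon s 0 (Suc 0)) =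
     (if s = t then \<mu> t * \<phi> (mon t (Suc 0) 0) + \<nu> t * \<phi> (mon t 0 (Suc 0)) else 0) + \<eta> s * \<phi> (mon s 0 0)"
     using \<gamma>(2)[of s] unfolding conv_mon[OF \<phi> \<gamma>(1)] \<eta>_def by (simp add: algebra_simps)
   qed
   also have "... = (\<mu> t * \<phi> (mon t (Suc 0) 0) + \<nu> t * \<phi> (mon t 0 (Suc 0))) + (\<Sum>s<p. \<eta> s * \<phi> (mon s 0 0))"
    using t by (simp add: sum.distrib)
   finally show ?thesis by (simp add: sum_negf eq_neg_iff_add_eq_0)
  qed
  let ?h = "g [^] (p - t)" and ?w = "\<mu> t \<odot> x \<oplus> \<nu> t \<odot> y"
  have hc: "?h \<in> carrier H" using gc by simp
  have hm: "?h \<otimes> mon t j l = x [^] j \<otimes> y [^] l" for j l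
  proof -
   have "?h \<otimes> mon t j l = (?h \<otimes> g [^] t) \<otimes> (x [^] j \<otimes> y [^] l)" using gc xc yc by (simp add: mon_def m_assoc)
   also have "?h \<otimes> g [^] t = \<one>" using t gp gc by (simp add: nat_pow_mult)
   finally show ?thesis using xc yc by simp
  qed
  have "?w = \<zero>"
  proof (rule primitive_span_grouplikes[where I = "{..<p}" and b = "%s. ?h \<otimes> mon s 0 0" and \<mu> = "%s. - \<eta> s"])
   show "?w \<in> primitives H" using prim_subsp x y by (simp add: subsp_def)
   show "(%s. ?h \<otimes> mon s 0 0) ` {..<p} <= grouplikes H" using grouplike_mult[OF grouplike_pow[OF g] mon_grouplike] by auto
   fix \<phi> assume \<phi>: "\<phi> \<in> dual H"
   show "\<phi> ?w = (\<Sum>s<p. - \<eta> s * \<phi> (?h \<otimes> mon s 0 0))"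
    using e[OF dual_lmult[OF \<phi> hc]] unfolding hm using \<phi> xc yc by (simp add: dual_add dual_smult)
  qed simp
  then show ?thesis by (rule xy_free)
 qed
 have "(\<Sum>s<p. \<kappa> s * \<phi> (mon s 0 0)) = 0" if "\<phi> \<in> dual H" for \<phi> using rel[OF that] mn by simp
 then have "\<forall>s\<in>{..<p}. \<kappa> s = 0" using powers_indep unfolding indep_def by blast
 then show ?thesis using mn t by auto
qed

lemma low_functional:
 assumes "s < p" "(j, l) \<in> {(0, 0), (Suc 0, 0), (0, Suc 0)}"
 obtains \<phi> where "\<phi> \<in> dual H"
  "!!t a b. t < p ==> (a, b) \<in> {(0, 0), (Suc 0, 0), (0, Suc 0)} ==> \<phi> (mon t a b) = (if (t, a, b) = (s, j, l) then 1 else 0)"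
proof -
 let ?L = "{(0, 0), (Suc 0, 0), (0, Suc 0)}" and ?I = "{..<p} \<times> {(0, 0), (Suc 0, 0), (0, Suc 0)}"
 have s: "(\<Sum>i\<in>?I. c i * \<phi> (M i)) =
  (\<Sum>s<p. c (s, 0, 0) * \<phi> (mon s 0 0) + c (s, Suc 0, 0) * \<phi> (mon s (Suc 0) 0) + c (s, 0, Suc 0) * \<phi> (mon s 0 (Suc 0)))" for c and \<phi> :: "'a => 'k"
  unfolding sum.cartesian_product'[of _ "{..<p}" ?L] by (simp add: M_def add.assoc)
 have "\<forall>i\<in>?I. c i = 0" if z: "!!\<phi>. \<phi> \<in> dual H ==> (\<Sum>i\<in>?I. c i * \<phi> (M i)) = 0" for c
  using low_indep[OF z[unfolded s]] by auto
 then have I: "indep ?I M" using M_closed by (auto simp: indep_def)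
 obtain \<phi> where \<phi>: "\<phi> \<in> dual H" "!!i. i \<in> ?I ==> \<phi> (M i) = (if i = (s, j, l) then 1 else 0)"
  by (rule indep_dual[OF I, of "(s, j, l)"]) (use assms in auto)
 show ?thesis by (rule that[OF \<phi>(1)]) (use \<phi>(2) in \<open>force simp: M_def\<close>)
qed

text \<open>A functional dual to a monomial modulo monomials of higher degree is obtained by convolving
 functionals dual to \<open>g\<^sup>s x\<close> and \<open>g\<^sup>s y\<close>.\<close>

lemma top_functional:
 assumes "s < p" "j < p" "l < p"
 shows "\<exists>\<theta>\<in>dual H. \<forall>t<p. \<forall>a b. a + b \<le> j + l --> \<theta> (mon t a b) = (if (t, a, b) = (s, j, l) then 1 else 0)"
 using assms(2,3)
proof (induction "j + l" arbitrary: j l)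
 case 0
 obtain \<phi> where "\<phi> \<in> dual H" "!!t a b. t < p ==> (a, b) \<in> {(0, 0), (Suc 0, 0), (0, Suc 0)} ==> \<phi> (mon t a b) = (if (t, a, b) = (s, 0, 0) then 1 else 0)"
  by (rule low_functional[of s 0 0]) (use assms(1) in auto)
 then show ?case using 0 by (intro bexI[of _ \<phi>]) auto
next
 case (Suc n)
 \<comment> \<open>Split off one factor x if there is one, and one factor y otherwise.\<close>
 define e f where "e = (if j > 0 then Suc 0 else 0)" and "f = (if j > 0 then 0 else Suc 0)"
 have ef: "(e, f) \<in> {(Suc 0, 0), (0, Suc 0)}" by (simp add: e_def f_def)
 have jl: "e \<le> j" "f \<le> l" "n = (j - e) + (l - f)" "j - e < p" "l - f < p" using Suc.hyps(2) Suc.prems by (auto simp: e_def f_def)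
 from Suc.hyps(1)[OF jl(3-5)] obtain \<theta> where \<theta>: "\<theta> \<in> dual H"
  "!!t a b. t < p ==> a + b \<le> n ==> \<theta> (mon t a b) = (if (t, a, b) = (s, j - e, l - f) then 1 else 0)" using jl(3) by auto
 obtain \<alpha> where \<alpha>: "\<alpha> \<in> dual H"
  "!!t a b. t < p ==> (a, b) \<in> {(0, 0), (Suc 0, 0), (0, Suc 0)} ==> \<alpha> (mon t a b) = (if (t, a, b) = (s, e, f) then 1 else 0)"
  by (rule low_functional[of s e f]) (use assms(1) ef in auto)
 \<comment> \<open>This is \<open>j\<close> or \<open>l\<close> as a scalar, and it is nonzero
   because positive exponents stay below \<open>p\<close>.\<close>
 define k :: 'k where "k = of_nat (j choose e) * of_nat (l choose f)"
 have k0: "k ~= 0" using Suc.hyps(2) Suc.prems of_nat_neq[of j] of_nat_neq[of l] by (auto simp: k_def e_def f_def)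
 have v: "conv H \<alpha> \<theta> (mon t a b) = (if (t, a, b) = (s, j, l) then k else 0)" if t: "t < p" and ab: "a + b \<le> j + l" for t a b
 proof -
  have "conv H \<alpha> \<theta> (mon t a b) = (if e \<le> a & f \<le> b then (if (t, a, b) = (s, j, l) then k else 0) else 0)"
   unfolding conv_mon[OF \<alpha>(1) \<theta>(1)]
  proof (rule single_sum)
   fix c d assume cd: "c \<le> a" "d \<le> b"
   show "of_nat (a choose c) * of_nat (b choose d) * (\<alpha> (mon t c d) * \<theta> (mon t (a - c) (b - d))) =
    (if c = e & d = f then (if (t, a, b) = (s, j, l) then k else 0) else 0)"
   proof (cases "c = e & d = f")
    case True
    have "(a - c) + (b - d) \<le> n" using cd ab Suc.hyps(2) True ef by auto
    from \<theta>(2)[OF t this] have "\<theta> (mon t (a - c) (b - d)) = (if (t, a, b) = (s, j, l) then 1 else 0)" using True cd jl(1,2) by auto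
    moreover have "\<alpha> (mon t c d) = (if t = s then 1 else 0)" using \<alpha>(2)[OF t, of c d] True ef by auto
    ultimately show ?thesis using True by (auto simp: k_def)
   next
    case False
    show ?thesis
    \<comment> \<open>A wrong split of degree at most 1 is killed by \<alpha>; a split of degree at
      least 2 leaves a right factor of degree below \<open>n\<close>, where \<theta>
      vanishes.\<close>
    proof (cases "c + d \<le> 1")
     case le: True
     then have "(c, d) \<in> {(0, 0), (Suc 0, 0), (0, Suc 0)}" by auto
     then have "\<alpha> (mon t c d) = 0" using \<alpha>(2)[OF t, of c d] False by auto
     then show ?thesis by (simp only: False if_False mult_zero_left mult_zero_right)
    next
     case gt: False
     then have "(a - c) + (b - d) < n" using cd ab Suc.hyps(2) by auto
     then have "\<theta> (mon t (a - c) (b - d)) = 0" using \<theta>(2)[OF t, of "a - c" "b - d"] jl(3) by auto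
     then show ?thesis by (simp only: False if_False mult_zero_left mult_zero_right)
    qed
   qed
  qed
  then show ?thesis using jl(1,2) by auto
 qed
 show ?case
  by (rule bexI[of _ "%u. inverse k * conv H \<alpha> \<theta> u"]) (use v k0 dual_closed(3)[OF conv_dual[OF \<alpha>(1) \<theta>(1)]] in auto)
qed

text \<open>Consider a monomial of maximal degree among those with nonzero coefficient: the
  functional of \<open>top_functional\<close> for it sees no other term of the relation.\<close>

theorem mon_indep: "indep J M"
 unfolding indep_def
proof (intro conjI allI impI)
 show "finite J" "M ` J <= carrier H" using M_closed by auto
 fix c assume rel: "\<forall>\<phi>\<in>dual H. (\<Sum>i\<in>J. c i * \<phi> (M i)) = 0"
 let ?d = "%i :: nat \<times> nat \<times> nat. fst (snd i) + snd (snd i)"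
 show "\<forall>i\<in>J. c i = 0"
 proof (rule ccontr)
  assume "~ ?thesis"
  then have ne: "{i \<in> J. c i ~= 0} ~= {}" by auto
  have fin: "finite {i \<in> J. c i ~= 0}" by simp
  obtain i where i: "i \<in> J" "c i ~= 0" "!!k. k \<in> J ==> c k ~= 0 ==> ?d k \<le> ?d i"
   by (rule finite_max_nat[OF fin ne, of ?d]) blast
  obtain s j l where e: "i = (s, j, l)" by (cases i) auto
  then have b: "s < p" "j < p" "l < p" using i(1) by auto
  obtain \<theta> where \<theta>: "\<theta> \<in> dual H" "\<forall>t<p. \<forall>a b. a + b \<le> j + l --> \<theta> (mon t a b) = (if (t, a, b) = (s, j, l) then 1 else 0)"
   using top_functional[OF b] by blast
  have "(\<Sum>k\<in>J. c k * \<theta> (M k)) = (\<Sum>k\<in>J. if k = i then c i else 0)"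
  proof (rule sum.cong[OF refl])
   fix k assume k: "k \<in> J"
   obtain t a b where ek: "k = (t, a, b)" by (cases k) auto
   show "c k * \<theta> (M k) = (if k = i then c i else 0)"
   proof (cases "c k = 0")
    case True
    then show ?thesis using i(2) by auto
   next
    case False
    then have "a + b \<le> j + l" "t < p" using i(3)[OF k] k ek e by auto
    then show ?thesis using \<theta>(2) ek e by (auto simp: M_def)
   qed
  qed
  also have "... = c i" using i(1) by simp
  finally show False using rel \<theta>(1) i(2) by simp
 qed
qed

end

section \<open>Subcoalgebras and grouplike elements\<close>

context cospace
begin

lemma subcoalgebra_D:
 assumes "subcoalgebra H C" "\<phi> \<in> ann H C" "\<psi> \<in> dual H" "c \<in> C"
 shows "conv H \<phi> \<psi> c = 0"
 unfolding conv_def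
proof (rule tensor_sub_ev)
 show "C <= carrier H" using assms(1) by (auto simp: subcoalgebra_def subspace_iff subsp_def)
 then show "C <= carrier H" .
 show "comult H c \<in> tensor_sub H C C" using assms(1,4) by (auto simp: subcoalgebra_def)
qed (use assms(2,3) annD in auto)

end

context prebialg
begin

text \<open>The line through a grouplike element is a subcoalgebra of dimension one, hence
  simple.\<close>

lemma grouplike_coradical:
 assumes u: "u \<in> grouplikes H"
 shows "subcoalgebra H (range (%k. k \<odot> u))" "u \<in> coradical H"
proof -
 note uc = grouplike_carrier[OF u]
 let ?C = "range (%k. k \<odot> u)"
 have mem: "k \<odot> u \<in> ?C" for k by blast
 have u0: "u ~= \<zero>" using u dual_zero[OF counit_dual] by (auto simp: grouplikes_def)
 have uC: "u \<in> ?C" using mem[of 1] uc by simp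
 have sC: "subsp H ?C"
  unfolding subsp_def
 proof (intro conjI ballI allI)
  show "?C <= carrier H" using uc by auto
  show "\<zero> \<in> ?C" using mem[of 0] uc by simp
  fix v assume "v \<in> ?C"
  then obtain k where k: "v = k \<odot> u" by blast
  show "c \<odot> v \<in> ?C" for c using mem[of "c * k"] uc k by (simp add: smult_assoc1)
  fix w assume "w \<in> ?C"
  then obtain l where l: "w = l \<odot> u" by blast
  show "v \<oplus> w \<in> ?C" using mem[of "k + l"] uc k l by (simp add: smult_l_distr)
 qed
 have sub: "subcoalgebra H ?C"
  unfolding subcoalgebra_def subspace_iff
 proof (intro conjI sC subsetI)
  fix T assume "T \<in> comult H ` ?C"
  then obtain k where T: "T = comult H (k \<odot> u)" by blast
  have Cc: "?C <= carrier H" using sC by (simp add: subsp_def)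
  have "T = k \<odot>\<^bsub>tensor H H\<^esub> tens H H u u"
   using alg_homD(6)[OF comult_hom uc] u T by (simp add: grouplikes_def)
  moreover have "tens H H u u \<in> tensor_sub H ?C ?C"
   unfolding tensor_sub_def by (rule TT.T.span_base[OF tensor_sub_subset[OF Cc Cc]]) (use uC in blast)
  moreover have "subsp (tensor H H) (tensor_sub H ?C ?C)"
   unfolding tensor_sub_def by (rule TT.T.subsp_span[OF tensor_sub_subset[OF Cc Cc]])
  ultimately show "T \<in> tensor_sub H ?C ?C" by (simp add: subsp_def)
 qed
 then show "subcoalgebra H ?C" .
 have "simple_subcoalgebra H ?C"
  unfolding simple_subcoalgebra_def
 proof (intro conjI sub allI impI)
  show "?C ~= {\<zero>}" using uC u0 by blast
  fix D assume D: "subcoalgebra H D & D \<subseteq> ?C"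
  then have sD: "subsp H D" by (simp add: subcoalgebra_def subspace_iff)
  show "D = {\<zero>} | D = ?C"
  proof (cases "D \<subseteq> {\<zero>}")
   case True
   then show ?thesis using sD by (auto simp: subsp_def)
  next
   case False
   then obtain k where k: "k \<odot> u \<in> D" "k \<odot> u ~= \<zero>" using D by blast
   then have k0: "k ~= 0" using uc by auto
   have "l \<odot> u \<in> D" for l
   proof -
    have "(l / k) \<odot> (k \<odot> u) \<in> D" using k(1) sD by (simp add: subsp_def)
    then show ?thesis using k0 uc by (simp add: smult_assoc1[symmetric])
   qed
   then show ?thesis using D by blast
  qed
 qed
 moreover have "\<Union> {C. simple_subcoalgebra H C} <= carrier H"
  by (auto simp: simple_subcoalgebra_def subcoalgebra_def subspace_iff subsp_def)
 ultimately show "u \<in> coradical H" unfolding coradical_def using uC by (intro span_base) blast+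
qed

end

section \<open>Coradical, filtration and primitive elements read off from the monomial basis\<close>

locale mono_basis = gxy_free H g x y p for H :: "('k::field, 'a, 'm) hopf_scheme" (structure) and g x y p +
 assumes span: "lspan H (M ` J) = carrier H"
begin

text \<open>The coordinate functionals of the monomial basis, fixed once by choice so that they have
  a name across lemmas.\<close>

definition cd :: "nat \<times> nat \<times> nat => 'a => 'k" where
 "cd = (SOME \<delta>. (\<forall>i\<in>J. \<delta> i \<in> dual H) & (\<forall>i\<in>J. \<forall>j\<in>J. \<delta> i (M j) = (if j = i then 1 else 0)) &
   (\<forall>v\<in>carrier H. \<forall>\<phi>\<in>dual H. \<phi> v = (\<Sum>i\<in>J. \<delta> i v * \<phi> (M i))))"

lemma cd_dual: "i \<in> J ==> cd i \<in> dual H"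
 and cd_M: "i \<in> J ==> k \<in> J ==> cd i (M k) = (if k = i then 1 else 0)"
 and expand: "v \<in> carrier H ==> \<phi> \<in> dual H ==> \<phi> v = (\<Sum>i\<in>J. cd i v * \<phi> (M i))"
proof -
 let ?P = "%\<delta>. (\<forall>i\<in>J. \<delta> i \<in> dual H) & (\<forall>i\<in>J. \<forall>j\<in>J. \<delta> i (M j) = (if j = i then 1 else 0)) &
   (\<forall>v\<in>carrier H. \<forall>\<phi>\<in>dual H. \<phi> v = (\<Sum>i\<in>J. \<delta> i v * \<phi> (M i)))"
 obtain \<delta> where \<delta>: "!!i. i \<in> J ==> \<delta> i \<in> dual H" "!!i j. i \<in> J ==> j \<in> J ==> \<delta> i (M j) = (if j = i then 1 else 0)"
  "!!v \<phi>. v \<in> carrier H ==> \<phi> \<in> dual H ==> \<phi> v = (\<Sum>i\<in>J. \<delta> i v * \<phi> (M i))"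
  by (rule indep_coords[OF mon_indep span]) blast
 have "?P \<delta>" by (intro conjI ballI \<delta>)
 then have P: "?P cd" unfolding cd_def by (rule someI[of ?P])
 show "i \<in> J ==> cd i \<in> dual H" by (rule conjunct1[OF P, rule_format])
 show "i \<in> J ==> k \<in> J ==> cd i (M k) = (if k = i then 1 else 0)" by (rule conjunct1[OF conjunct2[OF P], rule_format])
 show "v \<in> carrier H ==> \<phi> \<in> dual H ==> \<phi> v = (\<Sum>i\<in>J. cd i v * \<phi> (M i))" by (rule conjunct2[OF conjunct2[OF P], rule_format])
qed

lemma dim_eq: "dim = p ^ 3"
proof -
 have "dim = card J" by (rule indep_dim[OF mon_indep span])
 also have "... = p ^ 3" by (simp add: card_cartesian_product power3_eq_cube)
 finally show ?thesis .
qed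

lemma cd_eqI:
 assumes "\<phi> \<in> dual H" "\<psi> \<in> dual H" "!!t j l. t < p ==> j < p ==> l < p ==> \<phi> (mon t j l) = \<psi> (mon t j l)" "v \<in> carrier H"
 shows "\<phi> v = \<psi> v"
 unfolding expand[OF assms(4,1)] expand[OF assms(4,2)]
 by (rule sum.cong) (use assms(3) in \<open>auto simp: M_def\<close>)

lemma cd_mon: "(s, j, l) \<in> J ==> t < p ==> a < p ==> b < p ==> cd (s, j, l) (mon t a b) = (if (t, a, b) = (s, j, l) then 1 else 0)"
 using cd_M[of "(s, j, l)" "(t, a, b)"] by (simp add: M_def)

text \<open>For fixed s the dual algebra multiplies like a divided power algebra in two variables;
  the bounds keep the product monomial inside the basis.\<close>

lemma conv_cd:
 assumes "s < p" "a + a' < p" "b + b' < p" "z \<in> carrier H"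
 shows "conv H (cd (s, a, b)) (cd (s, a', b')) z =
  of_nat (a + a' choose a) * of_nat (b + b' choose b) * cd (s, a + a', b + b') z"
proof -
 have m: "(s, a, b) \<in> J" "(s, a', b') \<in> J" "(s, a + a', b + b') \<in> J" using assms by auto
 note f = cd_dual[OF m(1)] cd_dual[OF m(2)]
 show ?thesis
 proof (rule cd_eqI[OF conv_dual[OF f] dual_closed(3)[OF cd_dual[OF m(3)]] _ assms(4)])
  fix t j l assume t: "t < p" "j < p" "l < p"
  have "conv H (cd (s, a, b)) (cd (s, a', b')) (mon t j l) =
   (if a \<le> j & b \<le> l then (if (t, j, l) = (s, a + a', b + b') then of_nat (j choose a) * of_nat (l choose b) else 0) else 0)"
   unfolding conv_mon[OF f]
  proof (rule single_sum)
   fix c d assume "c \<le> j" "d \<le> l"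
   then have i: "c < p" "d < p" "j - c < p" "l - d < p" "c = a ==> j = a + (j - c)" "d = b ==> l = b + (l - d)" using t by auto
   show "of_nat (j choose c) * of_nat (l choose d) * (cd (s, a, b) (mon t c d) * cd (s, a', b') (mon t (j - c) (l - d))) =
    (if c = a & d = b then (if (t, j, l) = (s, a + a', b + b') then of_nat (j choose a) * of_nat (l choose b) else 0) else 0)"
    unfolding cd_mon[OF m(1) t(1) i(1,2)] cd_mon[OF m(2) t(1) i(3,4)] using i(5,6) by auto
  qed
  then show "conv H (cd (s, a, b)) (cd (s, a', b')) (mon t j l) =
   of_nat (a + a' choose a) * of_nat (b + b' choose b) * cd (s, a + a', b + b') (mon t j l)"
   unfolding cd_mon[OF m(3) t] by auto
 qed
qed

definition deg_below :: "nat => 'a set" where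
 "deg_below n = {v \<in> carrier H. \<forall>s j l. (s, j, l) \<in> J --> n \<le> j + l --> cd (s, j, l) v = 0}"

lemma deg_below_subsp: "subsp H (deg_below n)"
 unfolding subsp_def deg_below_def using cd_dual by (auto simp: dual_zero dual_add dual_smult)

lemma mon_deg_below: "(s, j, l) \<in> J ==> j + l < n ==> mon s j l \<in> deg_below n"
 unfolding deg_below_def using mon_closed cd_mon by auto

lemma deg_below_expand:
 assumes "v \<in> deg_below n" "\<phi> \<in> dual H" "!!s j l. (s, j, l) \<in> J ==> j + l < n ==> \<phi> (mon s j l) = 0"
 shows "\<phi> v = 0"
proof -
 have v: "v \<in> carrier H" using assms(1) by (simp add: deg_below_def)
 have "cd k v * \<phi> (M k) = 0" if k: "k \<in> J" for k
 proof (cases k)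
  case (fields s j l)
  then show ?thesis using assms(1,3) k by (cases "j + l < n") (auto simp: deg_below_def M_def)
 qed
 then show ?thesis unfolding expand[OF v assms(2)] by simp
qed

lemma deg_below_1: "v \<in> deg_below (Suc 0) ==> \<phi> \<in> dual H ==> (!!s. \<phi> (mon s 0 0) = 0) ==> \<phi> v = 0"
 by (rule deg_below_expand) auto

text \<open>Take a monomial of maximal degree that occurs in a nonzero element c of C. Contracting
  the right factor of \<Delta>(c) with its coordinate leaves a nonzero multiple of a power of g, and
  a subcoalgebra is stable under such contractions.\<close>

lemma subcoalgebra_contains_power:
 assumes C: "subcoalgebra H C" "C ~= {\<zero>}"
 obtains s where "s < p" "mon s 0 0 \<in> C"
proof -
 have sC: "subsp H C" using C(1) by (simp add: subcoalgebra_def subspace_iff)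
 then have "\<zero> \<in> C" by (simp add: subsp_def)
 then obtain c where c: "c \<in> C" "c ~= \<zero>" using C(2) by blast
 have cc: "c \<in> carrier H" using c(1) sC by (auto simp: subsp_def)
 let ?S = "{i \<in> J. cd i c ~= 0}" and ?d = "%i :: nat \<times> nat \<times> nat. fst (snd i) + snd (snd i)"
 have ne: "?S ~= {}"
 proof
  assume e: "?S = {}"
  have "\<phi> c = \<phi> \<zero>" if "\<phi> \<in> dual H" for \<phi> unfolding expand[OF cc that] dual_zero[OF that] using e by (intro sum.neutral) auto
  then show False using sep[OF cc zero_closed] c(2) by blast
 qed
 have fin: "finite ?S" by simp
 obtain i where i: "i \<in> J" "cd i c ~= 0" "!!k. k \<in> J ==> cd k c ~= 0 ==> ?d k \<le> ?d i"
  by (rule finite_max_nat[OF fin ne, of ?d]) blast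
 obtain s j l where e: "i = (s, j, l)" by (cases i) auto
 have sp: "s < p" using i(1) e by simp
 note \<delta> = cd_dual[OF i(1)]
 have cv: "conv H \<phi> (cd i) c = cd i c * \<phi> (mon s 0 0)" if \<phi>: "\<phi> \<in> dual H" for \<phi>
 proof -
  have "conv H \<phi> (cd i) c = (\<Sum>k\<in>J. cd k c * conv H \<phi> (cd i) (M k))" by (rule expand[OF cc conv_dual[OF \<phi> \<delta>]])
  also have "... = (\<Sum>k\<in>J. if k = i then cd i c * \<phi> (mon s 0 0) else 0)"
  proof (rule sum.cong[OF refl])
   fix k assume k: "k \<in> J"
   obtain t a b where ek: "k = (t, a, b)" by (cases k) auto
   have t: "t < p" "a < p" "b < p" using k ek by auto
   show "cd k c * conv H \<phi> (cd i) (M k) = (if k = i then cd i c * \<phi> (mon s 0 0) else 0)"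
   proof (cases "cd k c = 0")
    case True
    then show ?thesis using i(2) by auto
   next
    case False
    then have le: "a + b \<le> j + l" using i(3)[OF k] ek e by simp
    have "conv H \<phi> (cd i) (mon t a b) = (if 0 \<le> a & 0 \<le> b then (if k = i then \<phi> (mon s 0 0) else 0) else 0)"
     unfolding conv_mon[OF \<phi> \<delta>]
    proof (rule single_sum)
     fix c' d assume cd: "c' \<le> a" "d \<le> b"
     then have "a - c' < p" "b - d < p" using t by auto
     note v = cd_mon[OF i(1)[unfolded e] t(1) this]
     \<comment> \<open>As \<open>a + b\<close> does not exceed the maximal degree, the right factor
       can match the top monomial only if the left factor took no x and no y.\<close>
     have "(t, a - c', b - d) = (s, j, l) \<longleftrightarrow> k = i & c' = 0 & d = 0" using le cd e ek by auto
     then show "of_nat (a choose c') * of_nat (b choose d) * (\<phi> (mon t c' d) * cd i (mon t (a - c') (b - d))) =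
      (if c' = 0 & d = 0 then if k = i then \<phi> (mon s 0 0) else 0 else 0)"
      unfolding e v using e ek by auto
    qed
    then show ?thesis by (simp add: ek M_def)
   qed
  qed
  also have "... = cd i c * \<phi> (mon s 0 0)" using i(1) by simp
  finally show ?thesis .
 qed
 have "mon s 0 0 \<in> C"
  unfolding in_subsp_iff[OF sC mon_closed]
  using subcoalgebra_D[OF C(1) _ \<delta> c(1)] cv[OF annD(1)] i(2) by auto
 then show ?thesis by (rule that[OF sp])
qed

text \<open>A simple subcoalgebra contains some power of g, hence the line through it, and by
  simplicity it is that line.\<close>

lemma coradical_eq: "coradical H = deg_below (Suc 0)"
proof
 have "C \<subseteq> deg_below (Suc 0)" if C: "simple_subcoalgebra H C" for C
 proof -
  obtain s where s: "s < p" "mon s 0 0 \<in> C"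
   by (rule subcoalgebra_contains_power) (use C in \<open>auto simp: simple_subcoalgebra_def\<close>)
  have sC: "subsp H C" using C by (simp add: simple_subcoalgebra_def subcoalgebra_def subspace_iff)
  let ?D = "range (%k. k \<odot> mon s 0 0)"
  have u0: "mon s 0 0 ~= \<zero>" using mon_grouplike[of s] dual_zero[OF counit_dual] by (auto simp: grouplikes_def)
  have "mon s 0 0 \<in> ?D" by (rule range_eqI[of _ _ 1]) (simp add: mon_closed)
  then have "?D = C"
   using C grouplike_coradical(1)[OF mon_grouplike[of s]] sC s(2) u0 unfolding simple_subcoalgebra_def subsp_def by blast
  moreover have "mon s 0 0 \<in> deg_below (Suc 0)" using s(1) p by (intro mon_deg_below) auto
  ultimately show ?thesis using deg_below_subsp unfolding subsp_def by blast
 qed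
 then show "coradical H \<subseteq> deg_below (Suc 0)" unfolding coradical_def by (intro span_least[OF deg_below_subsp]) blast
 show "deg_below (Suc 0) \<subseteq> coradical H"
 proof
  fix v assume v: "v \<in> deg_below (Suc 0)"
  have "v \<in> carrier H" using v by (simp add: deg_below_def)
  show "v \<in> coradical H"
   unfolding in_subsp_iff[OF subsp_coradical \<open>v \<in> carrier H\<close>]
   by (rule ballI, rule deg_below_1[OF v annD(1)], assumption, erule annD(2), rule grouplike_coradical(2), rule mon_grouplike)
 qed
qed

lemma pointed: "pointed H"
 unfolding pointed_def
proof
 have gl: "grouplikes H <= carrier H" by (auto simp: grouplikes_def)
 show "lspan H (grouplikes H) \<subseteq> coradical H"
  by (rule span_least[OF subsp_coradical]) (use grouplike_coradical(2) in blast)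
 show "coradical H <= lspan H (grouplikes H)"
  unfolding coradical_eq
 proof
  fix v assume v: "v \<in> deg_below (Suc 0)"
  have vc: "v \<in> carrier H" using v by (simp add: deg_below_def)
  show "v \<in> lspan H (grouplikes H)"
   unfolding in_subsp_iff[OF subsp_span[OF gl] vc]
   by (rule ballI, rule deg_below_1[OF v annD(1)], assumption, erule annD(2), rule span_base[OF gl], rule mon_grouplike)
 qed
qed

text \<open>The splitting of \<open>top_functional\<close> for coordinates, now exact instead of
  modulo higher degree. It drives the comparison of the filtrations and the computation of the
  primitive elements.\<close>

lemma split_degree:
 assumes "(s, j, l) \<in> J" "j + l > 0" "z \<in> carrier H"
 obtains e f k where "e \<le> j" "f \<le> l" "e + f = 1" "(k::'k) ~= 0" "conv H (cd (s, e, f)) (cd (s, j - e, l - f)) z = k * cd (s, j, l) z"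
proof -
 define e f where "e = (if j > 0 then Suc 0 else 0)" and "f = (if j > 0 then 0 else Suc 0)"
 define k :: 'k where "k = of_nat (j choose e) * of_nat (l choose f)"
 have ef: "e \<le> j" "f \<le> l" "e + f = 1" using assms(2) by (auto simp: e_def f_def)
 have "k ~= 0" using assms(1,2) of_nat_neq[of j] of_nat_neq[of l] by (auto simp: k_def e_def f_def)
 moreover have "conv H (cd (s, e, f)) (cd (s, j - e, l - f)) z = k * cd (s, j, l) z"
  using conv_cd[of s e "j - e" f "l - f" z] assms(1,3) ef by (simp add: k_def)
 ultimately show ?thesis using that ef by blast
qed

text \<open>If z passes the dual test for the next stage, \<open>split_degree\<close> makes its
  coordinates of too high degree vanish. Conversely, each term in the coproduct of a monomial has a
  left factor of degree 0, or else its right factor has smaller degree.\<close>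

theorem filtration: "filt_below H n = deg_below n"
proof (induction n)
 case 0
 have "v = \<zero>" if v: "v \<in> deg_below 0" for v
 proof (rule sep)
  show "v \<in> carrier H" using v by (simp add: deg_below_def)
  show "\<phi> v = \<phi> \<zero>" if "\<phi> \<in> dual H" for \<phi> using deg_below_expand[OF v that] dual_zero[OF that] by simp
 qed simp
 then show ?case using deg_below_subsp[of 0] by (auto simp: filt_below_0 subsp_def)
next
 case (Suc m)
 show ?case
 proof (cases m)
  case 0
  then show ?thesis by (simp add: filt_below_Suc coradical_eq)
 next
  case (Suc n)
  have IH: "corad_filt H n = deg_below m" using Suc.IH Suc by (simp add: filt_below_Suc)
  have "z \<in> corad_filt H m \<longleftrightarrow> z \<in> deg_below (Suc m)" if z: "z \<in> carrier H" for z
   unfolding Suc corad_filt_Suc_iff[of z n] IH coradical_eq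
  proof (intro iffI conjI z ballI)
   assume a: "z \<in> carrier H & (\<forall>\<phi>\<in>ann H (deg_below (Suc 0)). \<forall>\<psi>\<in>ann H (deg_below (Suc n)). conv H \<phi> \<psi> z = 0)"
   have "cd (s, j, l) z = 0" if i: "(s, j, l) \<in> J" and d: "Suc m \<le> j + l" for s j l
   proof -
    have "j + l > 0" using d by linarith
    from split_degree[OF i this z] obtain e f k where ef: "e \<le> j" "f \<le> l" "e + f = 1" "(k::'k) ~= 0"
     "conv H (cd (s, e, f)) (cd (s, j - e, l - f)) z = k * cd (s, j, l) z" by metis
    have J: "(s, e, f) \<in> J" "(s, j - e, l - f) \<in> J" using i ef by auto
    have "cd (s, e, f) \<in> ann H (deg_below (Suc 0))" "cd (s, j - e, l - f) \<in> ann H (deg_below (Suc n))"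
     using cd_dual[OF J(1)] cd_dual[OF J(2)] J ef d Suc by (auto simp: ann_def deg_below_def)
    then show ?thesis using a ef by auto
   qed
   then show "z \<in> deg_below (Suc (Suc n))" using z Suc by (auto simp: deg_below_def)
  next
   fix \<phi> \<psi> assume zd: "z \<in> deg_below (Suc (Suc n))" and f: "\<phi> \<in> ann H (deg_below (Suc 0))" "\<psi> \<in> ann H (deg_below (Suc n))"
   show "conv H \<phi> \<psi> z = 0"
   proof (rule deg_below_expand[OF zd conv_dual[OF annD(1)[OF f(1)] annD(1)[OF f(2)]]])
    fix s j l assume i: "(s, j, l) \<in> J" "j + l < Suc (Suc n)"
    show "conv H \<phi> \<psi> (mon s j l) = 0"
     unfolding conv_mon[OF annD(1)[OF f(1)] annD(1)[OF f(2)]]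
    proof (intro sum.neutral ballI)
     fix a b assume ab: "a \<in> {..j}" "b \<in> {..l}"
     show "of_nat (j choose a) * of_nat (l choose b) * (\<phi> (mon s a b) * \<psi> (mon s (j - a) (l - b))) = 0"
     proof (cases "a + b = 0")
      case True
      then have "\<phi> (mon s a b) = 0" using i p by (intro annD(2)[OF f(1)] mon_deg_below) auto
      then show ?thesis by simp
     next
      case False
      then have "\<psi> (mon s (j - a) (l - b)) = 0" using i ab Suc by (intro annD(2)[OF f(2)] mon_deg_below) auto
      then show ?thesis by simp
     qed
    qed
   qed
  qed
  moreover have "corad_filt H m <= carrier H" using subsp_corad_filt by (simp add: subsp_def)
  ultimately show ?thesis unfolding filt_below_Suc by (auto simp: deg_below_def)
 qed
qed

text \<open>A coordinate of degree at least 2 is, up to a nonzero scalar, a convolution of two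
  functionals that vanish at the unit, so it kills primitive elements. In degree at most 1 the
  coordinate at g^s acts as a left unit on those with the same s, and evaluating that identity on a
  primitive element leaves only x and y.\<close>

theorem primitives_span:
 assumes w: "w \<in> primitives H"
 shows "\<exists>\<alpha> \<beta>. w = \<alpha> \<odot> x \<oplus> \<beta> \<odot> y"
proof (intro exI)
 note wc = prim_carrier[OF w]
 have one: "\<one> = mon 0 0 0" by (simp add: mon_simps)
 have c1: "cd (s, j, l) \<one> = (if s = 0 & j = 0 & l = 0 then 1 else 0)" if "(s, j, l) \<in> J" for s j l
  unfolding one cd_mon[OF that p p p] by auto
 let ?x = "(0, Suc 0, 0)" and ?y = "(0, 0, Suc 0)"
 have z: "cd (s, j, l) w = 0" if i: "(s, j, l) \<in> J" and n: "(s, j, l) ~= ?x" "(s, j, l) ~= ?y" for s j l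
 proof (cases "j + l \<ge> 2")
  case True
  from split_degree[OF i _ wc] obtain e f k where ef: "e \<le> j" "f \<le> l" "e + f = 1" "(k::'k) ~= 0"
   "conv H (cd (s, e, f)) (cd (s, j - e, l - f)) w = k * cd (s, j, l) w" using True by (metis add_gr_0 le_add_diff_inverse zero_less_numeral)
  have J: "(s, e, f) \<in> J" "(s, j - e, l - f) \<in> J" using i ef by auto
  have "cd (s, e, f) \<one> = 0" "cd (s, j - e, l - f) \<one> = 0" using c1[OF J(1)] c1[OF J(2)] ef True by auto
  then show ?thesis using conv_prim[OF w cd_dual[OF J(1)] cd_dual[OF J(2)]] ef by simp
 next
  case False
  have jl: "(j, l) \<in> {(0, 0), (Suc 0, 0), (0, Suc 0)}" using False by auto
  have J0: "(s, 0, 0) \<in> J" using i by auto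
  have "cd (s, j, l) w = conv H (cd (s, 0, 0)) (cd (s, j, l)) w"
   using conv_cd[of s 0 j 0 l w] i wc by simp
  also have "... = cd (s, 0, 0) w * cd (s, j, l) \<one> + cd (s, 0, 0) \<one> * cd (s, j, l) w"
   by (rule conv_prim[OF w cd_dual[OF J0] cd_dual[OF i]])
  finally show ?thesis using c1[OF i] c1[OF J0] n jl by (auto split: if_splits)
 qed
 show "w = cd ?x w \<odot> x \<oplus> cd ?y w \<odot> y"
 proof (rule sep[OF wc])
  fix \<phi> assume \<phi>: "\<phi> \<in> dual H"
  have "\<phi> w = (\<Sum>k\<in>J. (if k = ?x then cd ?x w * \<phi> x else 0) + (if k = ?y then cd ?y w * \<phi> y else 0))"
   unfolding expand[OF wc \<phi>]
  proof (rule sum.cong[OF refl])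
   fix k assume k: "k \<in> J"
   obtain s j l where e: "k = (s, j, l)" by (cases k) auto
   show "cd k w * \<phi> (M k) = (if k = ?x then cd ?x w * \<phi> x else 0) + (if k = ?y then cd ?y w * \<phi> y else 0)"
    using z[of s j l] k mon_simps(2,3) by (auto simp: e M_def)
  qed
  also have "... = cd ?x w * \<phi> x + cd ?y w * \<phi> y" using p2 by (simp add: sum.distrib)
  finally show "\<phi> w = \<phi> (cd ?x w \<odot> x \<oplus> cd ?y w \<odot> y)" using \<phi> xc yc by (simp add: dual_add dual_smult)
 qed (use xc yc in simp)
qed

end

section \<open>The relations of the five families\<close>

text \<open>The right hand sides of x^p, y^p and [x, y] in the five cases, with an argument
  \<open>z\<close> in the place of zero, so that one table can be read in any algebra.\<close>

fun rhs_x :: "label => 'b => 'b => 'b => 'b" where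
 "rhs_x Case_a z x y = z" | "rhs_x Case_b z x y = x" | "rhs_x Case_c z x y = y"
| "rhs_x Case_d z x y = x" | "rhs_x Case_e z x y = x"

fun rhs_y :: "label => 'b => 'b => 'b" where
 "rhs_y Case_d z y = y" | "rhs_y _ z y = z"

fun rhs_c :: "label => 'b => 'b => 'b" where
 "rhs_c Case_e z y = y" | "rhs_c _ z y = z"

definition satisfies :: "nat => label => ('k::field, 'b, 'n) module_scheme => 'b => 'b => 'b => bool" where
 "satisfies p i B g x y \<longleftrightarrow> g [^]\<^bsub>B\<^esub> p = \<one>\<^bsub>B\<^esub> & x [^]\<^bsub>B\<^esub> p = rhs_x i \<zero>\<^bsub>B\<^esub> x y & y [^]\<^bsub>B\<^esub> p = rhs_y i \<zero>\<^bsub>B\<^esub> y &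
   g \<otimes>\<^bsub>B\<^esub> x = x \<otimes>\<^bsub>B\<^esub> g & g \<otimes>\<^bsub>B\<^esub> y = y \<otimes>\<^bsub>B\<^esub> g & x \<otimes>\<^bsub>B\<^esub> y = y \<otimes>\<^bsub>B\<^esub> x \<oplus>\<^bsub>B\<^esub> rhs_c i \<zero>\<^bsub>B\<^esub> y"

lemma relators_zero_iff:
 assumes "kalg B" and f: "f \<in> alg_hom free_alg B"
 shows "(\<forall>r\<in>relators p i. f r = \<zero>\<^bsub>B\<^esub>) \<longleftrightarrow> satisfies p i B (f (var Gen_g)) (f (var Gen_x)) (f (var Gen_y))"
proof -
 interpret B: kalg B by fact
 note h = alg_homD[OF f]
 have c: "f u \<in> carrier B" for u using h(2)[of u] by simp
 have m: "f (u \<otimes>\<^bsub>free_alg\<^esub> v) = f u \<otimes>\<^bsub>B\<^esub> f v" for u v using h(4)[of u v] by simp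
 have d: "f (u - v) = f u \<ominus>\<^bsub>B\<^esub> f v" for u v
  using h(5)[of "u - v" v] c[of "u - v"] c[of v] by (simp add: a_minus_def B.a_assoc B.r_neg)
 have o: "f \<one>\<^bsub>free_alg\<^esub> = \<one>\<^bsub>B\<^esub>" by (rule h(3))
 have pw: "f (u [^]\<^bsub>free_alg\<^esub> p) = f u [^]\<^bsub>B\<^esub> p" for u
  by (rule alg_hom_pow[OF free.ka B.ka f]) simp
 have e: "u \<ominus>\<^bsub>B\<^esub> v = \<zero>\<^bsub>B\<^esub> \<longleftrightarrow> u = v" if "u \<in> carrier B" "v \<in> carrier B" for u v
 proof -
  have s: "(u \<ominus>\<^bsub>B\<^esub> v) \<oplus>\<^bsub>B\<^esub> v = u" using that by (simp add: a_minus_def B.a_assoc B.l_neg)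
  show ?thesis
  proof
   assume e: "u \<ominus>\<^bsub>B\<^esub> v = \<zero>\<^bsub>B\<^esub>"
   show "u = v" using s that unfolding e by simp
  qed (use that in \<open>simp add: a_minus_def B.r_neg\<close>)
 qed
 have e2: "(u \<ominus>\<^bsub>B\<^esub> v) \<ominus>\<^bsub>B\<^esub> w = \<zero>\<^bsub>B\<^esub> \<longleftrightarrow> u = v \<oplus>\<^bsub>B\<^esub> w" if "u \<in> carrier B" "v \<in> carrier B" "w \<in> carrier B" for u v w
 proof -
  have "(u \<ominus>\<^bsub>B\<^esub> v) \<ominus>\<^bsub>B\<^esub> w = u \<ominus>\<^bsub>B\<^esub> (v \<oplus>\<^bsub>B\<^esub> w)" using that by (simp add: a_minus_def B.minus_add B.a_assoc)
  then show ?thesis using e that by simp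
 qed
 show ?thesis
  by (cases i) (simp_all only: relators.simps Let_def commutator_def ball_simps satisfies_def rhs_x.simps rhs_y.simps rhs_c.simps
   d m o pw e e2 c B.m_closed B.nat_pow_closed B.one_closed B.zero_closed B.r_zero conj_ac simp_thms)
qed

lemma pres_satisfies:
 "satisfies p i (pres_alg (relators p i)) (pres_var (relators p i) Gen_g) (pres_var (relators p i) Gen_x) (pres_var (relators p i) Gen_y)"
 unfolding pres_var_pcls relators_zero_iff[OF pres_kalg pcls_hom, symmetric] using pcls_rel by blast

lemma satisfies_lift:
 assumes "sep_alg B" "!!a. \<phi> a \<in> carrier B" "satisfies p i B (\<phi> Gen_g) (\<phi> Gen_x) (\<phi> Gen_y)"
 shows "pres_lift B \<phi> \<in> alg_hom (pres_alg (relators p i)) B" "pres_lift B \<phi> (pres_var (relators p i) a) = \<phi> a"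
proof -
 interpret B: sep_alg B by fact
 have "\<forall>r\<in>relators p i. free_eval B \<phi> r = \<zero>\<^bsub>B\<^esub>"
  unfolding relators_zero_iff[OF B.kalg_axioms B.free_eval_hom[of \<phi>, OF assms(2)]] B.free_eval_var[of \<phi>, OF assms(2)] by fact
 then show "pres_lift B \<phi> \<in> alg_hom (pres_alg (relators p i)) B" "pres_lift B \<phi> (pres_var (relators p i) a) = \<phi> a"
  using pres_lift(1,2)[where \<phi> = \<phi> and R = "relators p i", OF assms(1,2)] by blast+
qed

subsection \<open>Spanning by monomials\<close>

context vspace
begin

lemma subsp_vimage:
 assumes U: "subsp V U" and f: "f \<in> lin_maps V V"
 shows "subsp V {v \<in> carrier V. f v \<in> U}"
 using U f lin_maps_zero[OF vs vs f] unfolding subsp_def lin_maps_iff by auto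

lemma span_mapsto:
 assumes U: "subsp V U" and f: "f \<in> lin_maps V V" and S: "S <= carrier V" "!!s. s \<in> S ==> f s \<in> U" and v: "v \<in> lspan V S"
 shows "f v \<in> U"
 using span_least[OF subsp_vimage[OF U f], of S] S v by auto

end

locale gens_rel = kalg B for B :: "('k::field, 'b, 'n) module_scheme" (structure) +
 fixes g x y :: 'b and p :: nat and i :: label
 assumes gc: "g \<in> carrier B" and xc: "x \<in> carrier B" and yc: "y \<in> carrier B"
  and sat: "satisfies p i B g x y" and p2: "p > 1"
begin

abbreviation W :: "'b set" where "W \<equiv> lspan B ((%(a, b). x [^] a \<otimes> y [^] b) ` ({..<p} \<times> {..<p}))"
abbreviation U :: "'b set" where "U \<equiv> lspan B ((%(s, a, b). g [^] s \<otimes> (x [^] a \<otimes> y [^] b)) ` ({..<p} \<times> {..<p} \<times> {..<p}))"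

lemmas rel = sat[unfolded satisfies_def]

lemma W_base: "(%(a, b). x [^] a \<otimes> y [^] b) ` ({..<p} \<times> {..<p}) <= carrier B"
 and U_base: "(%(s, a, b). g [^] s \<otimes> (x [^] a \<otimes> y [^] b)) ` ({..<p} \<times> {..<p} \<times> {..<p}) <= carrier B"
 using gc xc yc by auto

lemmas W_subsp = subsp_span[OF W_base] and U_subsp = subsp_span[OF U_base]

lemma pow_add: "z \<in> carrier B ==> z [^] (m + n) = z [^] (m::nat) \<otimes> z [^] (n::nat)"
 by (simp add: nat_pow_mult)

text \<open>By the relations x^p and y^p are zero or single generators; as p > 1, an exponent of at
  least p is traded for smaller total degree.\<close>

lemma W_mon: "x [^] j \<otimes> y [^] l \<in> W" for j l :: nat
proof (induction "j + l" arbitrary: j l rule: less_induct)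
 case less
 have z: "\<zero> \<in> W" using W_subsp by (simp add: subsp_def)
 show ?case
 proof (cases "j < p & l < p")
  case True
  then show ?thesis by (intro span_base[OF W_base]) auto
 next
  case False
  show ?thesis
  proof (cases "j < p")
   case True
   define m where "m = l - p"
   have l: "l = m + p" using True False by (simp add: m_def)
   have e: "x [^] j \<otimes> y [^] l = x [^] j \<otimes> (y [^] m \<otimes> y [^] p)" by (simp add: l pow_add yc)
   have "x [^] j \<otimes> y [^] Suc m \<in> W" using less[of j "Suc m"] p2 l by simp
   then show ?thesis using rel xc yc z unfolding e by (cases i) auto
  next
   case F: False
   define m where "m = j - p"
   have j: "j = m + p" using F by (simp add: m_def)
   have e: "x [^] j \<otimes> y [^] l = x [^] m \<otimes> (x [^] p \<otimes> y [^] l)" by (simp add: j pow_add xc yc m_assoc)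
   \<comment> \<open>Both candidates are prepared, since x^p may be x or y.\<close>
   have "x [^] Suc m \<otimes> y [^] l \<in> W" "x [^] m \<otimes> y [^] Suc l \<in> W" using less[of "Suc m" l] less[of m "Suc l"] p2 j by simp_all
   moreover have "x [^] m \<otimes> (x \<otimes> y [^] l) = x [^] Suc m \<otimes> y [^] l" "x [^] m \<otimes> (y \<otimes> y [^] l) = x [^] m \<otimes> y [^] Suc l"
    using xc yc by (simp_all add: m_assoc nat_pow_Suc2 del: nat_pow_Suc) (simp add: nat_pow_Suc2[symmetric] m_assoc)
   ultimately show ?thesis using rel xc yc z unfolding e by (cases i) auto
  qed
 qed
qed

lemma pow_mod: "g [^] (s::nat) = g [^] (s mod p)"
proof -
 have "g [^] s = g [^] (p * (s div p) + s mod p)" by simp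
 also have "... = (g [^] p) [^] (s div p) \<otimes> g [^] (s mod p)" using gc by (simp only: pow_add nat_pow_pow)
 also have "... = g [^] (s mod p)" using rel gc by simp
 finally show ?thesis .
qed

lemma U_mult_W: "w \<in> W ==> g [^] (s::nat) \<otimes> w \<in> U"
proof (rule span_mapsto[OF U_subsp lmult_lin W_base])
 fix v assume "v \<in> (%(a, b). x [^] a \<otimes> y [^] b) ` ({..<p} \<times> {..<p})"
 then obtain a b where v: "v = x [^] a \<otimes> y [^] b" "a < p" "b < p" by auto
 show "g [^] s \<otimes> v \<in> U" unfolding v pow_mod[of s]
  by (rule span_base[OF U_base], rule image_eqI[of _ _ "(s mod p, a, b)"]) (use v p2 in auto)
qed (use gc in simp_all)

lemma x_mult_W: "w \<in> W ==> x \<otimes> w \<in> W"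
proof (rule span_mapsto[OF W_subsp lmult_lin W_base])
 fix v assume "v \<in> (%(a, b). x [^] a \<otimes> y [^] b) ` ({..<p} \<times> {..<p})"
 then obtain a b :: nat where v: "v = x [^] a \<otimes> y [^] b" by auto
 have "x \<otimes> v = x [^] Suc a \<otimes> y [^] b" unfolding v using xc yc by (simp only: nat_pow_Suc2 m_assoc nat_pow_closed)
 then show "x \<otimes> v \<in> W" using W_mon[of "Suc a" b] by (simp only:)
qed (use xc in simp_all)

text \<open>Move y past one x at a time: y x = x y - [x, y], where [x, y] is zero or y and the
  induction hypothesis covers both terms.\<close>

lemma y_mult_mon: "y \<otimes> (x [^] j \<otimes> y [^] l) \<in> W" for j l :: nat
proof (induction j)
 case 0
 have "y \<otimes> (x [^] (0::nat) \<otimes> y [^] l) = x [^] (0::nat) \<otimes> y [^] Suc l" using yc nat_pow_Suc2[OF yc, of l] by simp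
 then show ?case using W_mon[of 0 "Suc l"] by (simp only:)
next
 case (Suc j)
 let ?w = "x [^] j \<otimes> y [^] l" and ?c = "rhs_c i \<zero> y"
 have wc: "?w \<in> carrier B" and cc: "?c \<in> carrier B" using xc yc by (simp, cases i, auto)
 have cw: "?c \<otimes> ?w \<in> W" using Suc W_subsp wc by (cases i) (auto simp: subsp_def)
 have e: "x [^] Suc j \<otimes> y [^] l = x \<otimes> ?w" using xc yc by (simp only: nat_pow_Suc2 m_assoc nat_pow_closed)
 have xy: "x \<otimes> y = y \<otimes> x \<oplus> ?c" using rel by blast
 have "x \<otimes> (y \<otimes> ?w) = (y \<otimes> x \<oplus> ?c) \<otimes> ?w" unfolding m_assoc[OF xc yc wc, symmetric] xy ..
 also have "... = y \<otimes> (x \<otimes> ?w) \<oplus> ?c \<otimes> ?w" using xc yc wc cc by (simp add: l_distr m_assoc)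
 finally have "y \<otimes> (x \<otimes> ?w) = x \<otimes> (y \<otimes> ?w) \<ominus> ?c \<otimes> ?w" using xc yc wc cc by (simp add: a_minus_def a_assoc r_neg)
 then show ?case unfolding e using subsp_minus[OF W_subsp x_mult_W[OF Suc] cw] by simp
qed

lemma U_one: "\<one> \<in> U"
 using U_mult_W[OF W_mon[of 0 0], of 0] by simp

text \<open>g commutes with x and y, so these pass the power of g and act on the span of the x^a
  y^b; a further g only shifts the exponent modulo p.\<close>

lemma U_mult:
 assumes "u \<in> U" "z \<in> {g, x, y}"
 shows "z \<otimes> u \<in> U"
proof (rule span_mapsto[OF U_subsp lmult_lin U_base _ assms(1)])
 show "z \<in> carrier B" using assms(2) gc xc yc by auto
 fix v assume "v \<in> (%(s, a, b). g [^] s \<otimes> (x [^] a \<otimes> y [^] b)) ` ({..<p} \<times> {..<p} \<times> {..<p})"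
 then obtain s a b :: nat where v: "v = g [^] s \<otimes> (x [^] a \<otimes> y [^] b)" by auto
 have wc: "x [^] a \<otimes> y [^] b \<in> carrier B" using xc yc by simp
 have eg: "g \<otimes> v = g [^] Suc s \<otimes> (x [^] a \<otimes> y [^] b)" unfolding v using gc wc by (simp only: nat_pow_Suc2 m_assoc nat_pow_closed)
 have exy: "x \<otimes> v = g [^] s \<otimes> (x \<otimes> (x [^] a \<otimes> y [^] b))" "y \<otimes> v = g [^] s \<otimes> (y \<otimes> (x [^] a \<otimes> y [^] b))"
  unfolding v using gc xc yc wc group_commutes_pow[of g x s] group_commutes_pow[of g y s] rel by (simp_all add: m_assoc[symmetric])
 from assms(2) consider "z = g" | "z = x" | "z = y" by auto
 then show "z \<otimes> v \<in> U"
  by cases (simp_all only: eg exy U_mult_W[OF W_mon] U_mult_W[OF x_mult_W[OF W_mon]] U_mult_W[OF y_mult_mon])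
qed

end

lemma pres_span:
 assumes "p > 1"
 shows "lspan (pres_alg (relators p i)) ((%(s, a, b). pres_var (relators p i) Gen_g [^]\<^bsub>pres_alg (relators p i)\<^esub> s \<otimes>\<^bsub>pres_alg (relators p i)\<^esub>
   (pres_var (relators p i) Gen_x [^]\<^bsub>pres_alg (relators p i)\<^esub> a \<otimes>\<^bsub>pres_alg (relators p i)\<^esub>
    pres_var (relators p i) Gen_y [^]\<^bsub>pres_alg (relators p i)\<^esub> b)) ` ({..<p} \<times> {..<p} \<times> {..<p})) = carrier (pres_alg (relators p i :: (gen list \<Rightarrow>\<^sub>0 'k::field) set))"
  (is "?U = carrier ?A")
proof -
 interpret A: kalg ?A by (rule pres_kalg)
 have vc: "pres_var (relators p i) a \<in> carrier ?A" for a by (auto simp: pres_var_pcls pres_carrier)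
 interpret gens_rel ?A "pres_var (relators p i) Gen_g" "pres_var (relators p i) Gen_x" "pres_var (relators p i) Gen_y" p i
  by unfold_locales (use vc pres_satisfies assms in auto)
 have "\<xi> \<in> ?U" if "\<xi> \<in> carrier ?A" for \<xi>
  using that
 proof (induction \<xi> rule: pres_induct)
  case one
  show ?case by (rule U_one)
 next
  case (add u v)
  then show ?case using U_subsp by (simp add: subsp_def)
 next
  case (smult c u)
  then show ?case using U_subsp by (simp add: subsp_def)
 next
  case (mult a u)
  then show ?case using U_mult[of u "pres_var (relators p i) a"] by (cases a) auto
 qed
 then show ?thesis using U_subsp by (auto simp: subsp_def)
qed

subsection \<open>Two representations\<close>

text \<open>All endomorphisms of the space of sequences: a single algebra with room for a cyclic
  shift of every length and for all matrices below, so that no type depends on p.\<close>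

definition lin_end :: "('k::field, (nat => 'k) => nat => 'k) module" where
 "lin_end = \<lparr>carrier = {T. (\<forall>f h n. T (%n. f n + h n) n = T f n + T h n) & (\<forall>c f n. T (%n. c * f n) n = c * T f n)},
   mult = (%S T f. S (T f)), one = (%f. f), zero = (%f n. 0), add = (%S T f n. S f n + T f n), smult = (%c T f n. c * T f n)\<rparr>"

lemma lin_end_mult_ext:
 assumes "S \<in> carrier lin_end"
 shows "S (%n. f n + h n) = (%n. S f n + S h n)" "S (%n. c * f n) = (%n. c * S f n)"
 using assms by (auto simp: lin_end_def)

lemma sep_lin_end: "sep_alg (lin_end :: ('k::field, (nat => 'k) => nat => 'k) module)"
proof -
 let ?E = "lin_end :: ('k, (nat => 'k) => nat => 'k) module"
 have vs: "vsp ?E"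
 proof (rule vs_criteria)
  show "\<forall>T\<in>carrier ?E. \<exists>S\<in>carrier ?E. T \<oplus>\<^bsub>?E\<^esub> S = \<zero>\<^bsub>?E\<^esub>"
  proof
   fix T assume "T \<in> carrier ?E"
   then show "\<exists>S\<in>carrier ?E. T \<oplus>\<^bsub>?E\<^esub> S = \<zero>\<^bsub>?E\<^esub>"
    by (intro bexI[of _ "%f n. - T f n"]) (auto simp: lin_end_def algebra_simps)
  qed
 qed (auto simp: class_field lin_end_def algebra_simps fun_eq_iff)
 interpret vspace ?E by (rule vspace.intro) (rule vs)
 have "ring ?E"
 proof (rule ringI[OF abelian_group_axioms])
  have cl: "S \<otimes>\<^bsub>?E\<^esub> T \<in> carrier ?E" if "S \<in> carrier ?E" "T \<in> carrier ?E" for S T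
   using lin_end_mult_ext[OF that(1)] lin_end_mult_ext[OF that(2)] by (simp add: lin_end_def)
  show "monoid ?E" by (rule monoidI, rule cl) (auto simp: lin_end_def)
 qed (auto simp: lin_end_def fun_eq_iff)
 then have "k_algebra ?E" using vs by (auto simp: k_algebra_def lin_end_def fun_eq_iff)
 moreover have "sep_space ?E"
 proof
  fix S T assume "!!\<phi>. \<phi> \<in> dual ?E ==> \<phi> S = \<phi> T"
  moreover have "(%T. T f n) \<in> dual ?E" for f n by (auto simp: dual_def lin_end_def)
  ultimately have "S f n = T f n" for f n by blast
  then show "S = T" by blast
 qed
 ultimately show ?thesis by (intro sep_alg.intro kalg.intro)
qed

lemma lin_end_pow: "T [^]\<^bsub>lin_end\<^esub> n = (T ^^ n)"
proof (induction n)
 case (Suc n)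
 have "T [^]\<^bsub>lin_end\<^esub> Suc n = (%f. (T [^]\<^bsub>lin_end\<^esub> n) (T f))" by (simp add: nat_pow_def lin_end_def)
 then show ?case unfolding Suc by (simp add: funpow_swap1 fun_eq_iff)
qed (simp add: nat_pow_def lin_end_def id_def)

definition matrix_unit :: "nat => nat => (nat => 'k::field) => nat => 'k" where
 "matrix_unit r c f n = (if n = r then f c else 0)"

lemma matrix_unit_pow: "matrix_unit r c ^^ Suc (Suc n) = (if r = c then matrix_unit r c else (%f n. 0 :: 'k::field))"
proof (induction n)
 case (Suc n)
 have s: "matrix_unit r c ^^ Suc (Suc (Suc n)) = matrix_unit r c \<circ> ((matrix_unit r c :: (nat => 'k) => _) ^^ Suc (Suc n))" by (rule funpow.simps(2))
 show ?case unfolding s Suc.IH by (auto simp: matrix_unit_def fun_eq_iff)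
qed (auto simp: matrix_unit_def fun_eq_iff)

lemma matrix_unit_pow_char: "p > 1 ==> matrix_unit r c ^^ p = (if r = c then matrix_unit r c else (%f n. 0 :: 'k::field))"
 using matrix_unit_pow[of "p - 2" r c] by (simp only: Suc_diff_Suc numeral_2_eq_2) (simp add: Suc_diff_Suc)

text \<open>The cyclic shift of length p together with x = y = 0 satisfies all five sets of
  relations. It serves to tell the powers of g apart in the presented algebra.\<close>

lemma exists_cyclic_rep:
 assumes "p > 1"
 obtains g x y where "g \<in> carrier lin_end" "x \<in> carrier lin_end" "y \<in> carrier lin_end"
  "satisfies p i (lin_end :: ('k::field, (nat => 'k) => nat => 'k) module) g x y"
  "inj_on (%s. g [^]\<^bsub>lin_end :: ('k, (nat => 'k) => nat => 'k) module\<^esub> (s::nat)) {..<p}"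
proof -
 define g :: "(nat => 'k) => nat => 'k" where "g f n = (if n < p then f (Suc n mod p) else f n)" for f n
 have gp: "(g ^^ s) f n = (if n < p then f ((n + s) mod p) else f n)" for s f n
 proof (induction s arbitrary: n)
  case (Suc s)
  have "(g ^^ Suc s) f n = g ((g ^^ s) f) n" by simp
  also have "... = (if n < p then (g ^^ s) f (Suc n mod p) else (g ^^ s) f n)" by (rule g_def)
  also have "... = (if n < p then f ((n + Suc s) mod p) else f n)"
   using assms by (auto simp: Suc mod_add_left_eq)
  finally show ?case .
 qed simp
 let ?z = "(%f n. 0) :: (nat => 'k) => nat => 'k"
 show ?thesis
 proof (rule that[of g ?z ?z])
  show "g \<in> carrier lin_end" "?z \<in> carrier lin_end" "?z \<in> carrier lin_end" by (auto simp: lin_end_def g_def)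
  have "?z ^^ p = ?z" using assms by (cases p) auto
  moreover have "g (%n. 0) = (%n. 0)" by (simp add: g_def fun_eq_iff)
  moreover have "g ^^ p = (%f. f)" by (auto simp: gp fun_eq_iff)
  ultimately show "satisfies p i lin_end g ?z ?z"
   unfolding satisfies_def lin_end_pow by (cases i) (auto simp: lin_end_def)
  show "inj_on (%s. g [^]\<^bsub>lin_end :: ('k, (nat => 'k) => nat => 'k) module\<^esub> (s::nat)) {..<p}"
   unfolding lin_end_pow
  proof (rule inj_onI)
   fix s t assume st: "s \<in> {..<p}" "t \<in> {..<p}" "g ^^ s = g ^^ t"
   have "(g ^^ s) (%n. if n = s then 1 else 0) 0 = (g ^^ t) (%n. if n = s then 1 else 0) 0" using st by simp
   then show "s = t" using st(1,2) assms by (auto simp: gp split: if_splits)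
  qed
 qed
qed

text \<open>Here g acts as the identity, and the point is independence of x and y. Diagonal matrix
  units are idempotent and off-diagonal ones have square zero; E_00 E_01 = E_01 and E_01 E_00 = 0
  give [x, y] = y in the last case.\<close>

lemma exists_free_rep:
 assumes "p > 1"
 obtains g x y where "g \<in> carrier lin_end" "x \<in> carrier lin_end" "y \<in> carrier lin_end"
  "satisfies p i (lin_end :: ('k::field, (nat => 'k) => nat => 'k) module) g x y"
  "!!\<alpha> \<beta>. \<alpha> \<odot>\<^bsub>lin_end\<^esub> x \<oplus>\<^bsub>lin_end\<^esub> \<beta> \<odot>\<^bsub>lin_end\<^esub> y = \<zero>\<^bsub>lin_end :: ('k, (nat => 'k) => nat => 'k) module\<^esub> ==> \<alpha> = 0 & \<beta> = 0"
proof -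
 \<comment> \<open>For the case x^p = y: a truncated shift whose p-th power is the matrix unit at
   (0, p), an element of square zero.\<close>
 define N :: "(nat => 'k) => nat => 'k" where "N f n = (if n < p then f (Suc n) else 0)" for f n
 have Np: "(N ^^ s) f n = (if n + s \<le> p | s = 0 then f (n + s) else 0)" for s f n
 proof (induction s arbitrary: n)
  case (Suc s)
  have "(N ^^ Suc s) f n = N ((N ^^ s) f) n" by simp
  then show ?case using Suc by (auto simp: N_def)
 qed simp
 then have Npp: "N ^^ p = matrix_unit 0 p" using assms by (auto simp: fun_eq_iff matrix_unit_def)
 let ?g = "(%f. f) :: (nat => 'k) => nat => 'k"
 have gp: "?g ^^ p = ?g" by (induction p) auto
 define x y :: "(nat => 'k) => nat => 'k" where "x = (case i of Case_a => matrix_unit 0 1 | Case_b => matrix_unit 3 3 | Case_c => N | Case_d => matrix_unit 0 0 | Case_e => matrix_unit 0 0)"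
  and "y = (case i of Case_a => matrix_unit 0 2 | Case_b => matrix_unit 0 1 | Case_c => matrix_unit 0 p | Case_d => matrix_unit 1 1 | Case_e => matrix_unit 0 (1::nat))"
 show ?thesis
 proof (rule that[of ?g x y])
  show "?g \<in> carrier lin_end" by (auto simp: lin_end_def)
  show "x \<in> carrier lin_end" "y \<in> carrier lin_end" by (cases i; auto simp: x_def y_def lin_end_def matrix_unit_def N_def)+
  show "satisfies p i lin_end ?g x y"
   unfolding satisfies_def lin_end_pow
   using assms by (cases i) (auto simp: x_def y_def gp Npp matrix_unit_pow_char, auto simp: lin_end_def matrix_unit_def N_def fun_eq_iff)
  fix \<alpha> \<beta> assume "\<alpha> \<odot>\<^bsub>lin_end\<^esub> x \<oplus>\<^bsub>lin_end\<^esub> \<beta> \<odot>\<^bsub>lin_end\<^esub> y = \<zero>\<^bsub>lin_end :: ('k, (nat => 'k) => nat => 'k) module\<^esub>"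
  then have e: "\<alpha> * x (%k. if k = c then 1 else 0) n + \<beta> * y (%k. if k = c then 1 else 0) n = 0" for c n
   by (simp add: lin_end_def) meson
  show "\<alpha> = 0 & \<beta> = 0"
  proof (cases i)
   case Case_a
   then show ?thesis using e[of 1 0] e[of 2 0] by (simp add: x_def y_def matrix_unit_def)
  next
   case Case_b
   then show ?thesis using e[of 3 3] e[of 1 0] by (simp add: x_def y_def matrix_unit_def)
  next
   case Case_c
   then show ?thesis using e[of 1 0] e[of p 0] assms by (simp add: x_def y_def matrix_unit_def N_def)
  next
   case Case_d
   then show ?thesis using e[of 0 0] e[of 1 1] by (simp add: x_def y_def matrix_unit_def)
  next
   case Case_e
   then show ?thesis using e[of 0 0] e[of 1 0] by (simp add: x_def y_def matrix_unit_def)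
  qed
 qed
qed

subsection \<open>Primitive generators in the tensor square and in the opposite algebra\<close>

text \<open>This makes \<Delta> well defined on the presented algebra. Since z \<otimes> 1 and 1
  \<otimes> z commute, p-th powers of their sum are computed by \<open>freshman\<close>. In the
  commutator of \<delta>(x) and \<delta>(y) the mixed terms cancel.\<close>

lemma tensor_satisfies:
 fixes A :: "('k::field, 'b, 'n) module_scheme" (structure)
 assumes A: "kalg A" and c: "g \<in> carrier A" "x \<in> carrier A" "y \<in> carrier A" and s: "satisfies p i A g x y"
  and ch: "CHAR('k) = p" "p > 0"
 defines "\<delta> \<equiv> %z. tens A A z \<one> \<oplus>\<^bsub>tensor A A\<^esub> tens A A \<one> z"
 shows "satisfies p i (tensor A A) (tens A A g g) (\<delta> x) (\<delta> y)"
proof -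
 interpret A: kalg A by fact
 interpret tens_alg A A ..
 have tc: "tens A A a b \<in> carrier (tensor A A)" if "a \<in> carrier A" "b \<in> carrier A" for a b using that by (rule tens_carrier)
 have tp: "tens A A a b [^]\<^bsub>tensor A A\<^esub> n = tens A A (a [^] n) (b [^] n)" if "a \<in> carrier A" "b \<in> carrier A" for a b and n :: nat
  using that by (induction n) (simp_all add: tensor_one tens_mult)
 have d0: "\<delta> \<zero> = \<zero>\<^bsub>tensor A A\<^esub>"
 proof (rule tensor_eqI)
  fix \<beta> assume b: "\<beta> \<in> bil A A"
  have "\<beta> \<zero> \<one> = 0" "\<beta> \<one> \<zero> = 0" using b A.dual_zero by (auto simp: bil_def)
  then show "ev \<beta> (\<delta> \<zero>) = ev \<beta> \<zero>\<^bsub>tensor A A\<^esub>"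
   using b by (simp add: \<delta>_def ev_simps ev_tens tc T.dual_zero[OF ev_dual[OF b]])
 qed (simp_all add: \<delta>_def tc)
 have dp: "\<delta> z [^]\<^bsub>tensor A A\<^esub> p = \<delta> (z [^] p)" if "z \<in> carrier A" for z
 proof -
  have "\<delta> z [^]\<^bsub>tensor A A\<^esub> p = tens A A z \<one> [^]\<^bsub>tensor A A\<^esub> p \<oplus>\<^bsub>tensor A A\<^esub> tens A A \<one> z [^]\<^bsub>tensor A A\<^esub> p"
   unfolding \<delta>_def by (rule T.freshman[OF ch]) (use that in \<open>simp_all add: tc tens_mult\<close>)
  then show ?thesis using that by (simp add: tp \<delta>_def)
 qed
 have gd: "tens A A g g \<otimes>\<^bsub>tensor A A\<^esub> \<delta> z = \<delta> z \<otimes>\<^bsub>tensor A A\<^esub> tens A A g g" if "z \<in> carrier A" "g \<otimes> z = z \<otimes> g" for z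
  using that c by (simp add: \<delta>_def T.l_distr T.r_distr tc tens_mult)
 have cc: "rhs_c i \<zero> y \<in> carrier A" using c by (cases i) auto
 have xy: "\<delta> x \<otimes>\<^bsub>tensor A A\<^esub> \<delta> y = \<delta> y \<otimes>\<^bsub>tensor A A\<^esub> \<delta> x \<oplus>\<^bsub>tensor A A\<^esub> \<delta> (rhs_c i \<zero> y)"
 proof (rule tensor_eqI)
  fix \<beta> assume b: "\<beta> \<in> bil A A"
  have "\<beta> (y \<otimes> x \<oplus> rhs_c i \<zero> y) \<one> = \<beta> (y \<otimes> x) \<one> + \<beta> (rhs_c i \<zero> y) \<one>" "\<beta> \<one> (y \<otimes> x \<oplus> rhs_c i \<zero> y) = \<beta> \<one> (y \<otimes> x) + \<beta> \<one> (rhs_c i \<zero> y)"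
   using b c cc dual_add[of "%v. \<beta> v \<one>" A "y \<otimes> x" "rhs_c i \<zero> y"] by (auto simp: bil_def dual_add)
  moreover have "x \<otimes> y = y \<otimes> x \<oplus> rhs_c i \<zero> y" using s by (simp add: satisfies_def)
  ultimately show "ev \<beta> (\<delta> x \<otimes>\<^bsub>tensor A A\<^esub> \<delta> y) = ev \<beta> (\<delta> y \<otimes>\<^bsub>tensor A A\<^esub> \<delta> x \<oplus>\<^bsub>tensor A A\<^esub> \<delta> (rhs_c i \<zero> y))"
   using b c cc by (simp add: \<delta>_def T.l_distr T.r_distr tc tens_mult ev_simps ev_tens)
 qed (use c cc in \<open>simp_all add: \<delta>_def tc\<close>)
 have r: "rhs_x i \<zero>\<^bsub>tensor A A\<^esub> (\<delta> x) (\<delta> y) = \<delta> (rhs_x i \<zero> x y)" "rhs_y i \<zero>\<^bsub>tensor A A\<^esub> (\<delta> y) = \<delta> (rhs_y i \<zero> y)"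
  "rhs_c i \<zero>\<^bsub>tensor A A\<^esub> (\<delta> y) = \<delta> (rhs_c i \<zero> y)" by (cases i; simp add: d0)+
 show ?thesis
  using s c unfolding satisfies_def r by (simp add: dp xy gd tp tensor_one)
qed

text \<open>An antipode reverses products, so it is constructed as an algebra map into the opposite
  algebra.\<close>

definition op_alg :: "('k, 'a, 'm) module_scheme => ('k, 'a, 'm) module_scheme" where
 "op_alg A = A\<lparr>mult := %a b. b \<otimes>\<^bsub>A\<^esub> a\<rparr>"

lemma op_alg_simps [simp]:
 "carrier (op_alg A) = carrier A" "zero (op_alg A) = zero A" "one (op_alg A) = one A" "add (op_alg A) = add A"
 "smult (op_alg A) = smult A" "a \<otimes>\<^bsub>op_alg A\<^esub> b = b \<otimes>\<^bsub>A\<^esub> a"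
 by (simp_all add: op_alg_def)

lemma sep_op_alg:
 assumes "sep_alg A"
 shows "sep_alg (op_alg A)"
proof -
 interpret A: sep_alg A by fact
 have vs: "vsp (op_alg A)"
  by (rule vs_criteria) (use A.r_neg in \<open>auto simp: class_field A.a_ac A.smult_assoc1 A.smult_l_distr A.smult_r_distr intro!: bexI[of _ "\<ominus>\<^bsub>A\<^esub> _"]\<close>)
 interpret O: vspace "op_alg A" by (rule vspace.intro) (rule vs)
 have "ring (op_alg A)"
 proof (rule ringI[OF O.abelian_group_axioms])
  show "monoid (op_alg A)" by (rule monoidI) (auto simp: A.m_assoc)
 qed (simp_all add: A.l_distr A.r_distr)
 then have "k_algebra (op_alg A)" using vs A.smult_mult by (simp add: k_algebra_def)
 moreover have "dual (op_alg A) = dual A" by (simp add: dual_def)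
 then have "sep_space (op_alg A)" using A.sep by unfold_locales simp
 ultimately show ?thesis by (intro sep_alg.intro kalg.intro)
qed

lemma op_pow:
 assumes "kalg A" "a \<in> carrier A"
 shows "a [^]\<^bsub>op_alg A\<^esub> (n::nat) = a [^]\<^bsub>A\<^esub> n"
proof -
 interpret A: kalg A by fact
 show ?thesis by (induction n) (use assms(2) A.nat_pow_Suc2 in \<open>simp_all add: nat_pow_def\<close>)
qed

text \<open>The values of the antipode on generators: the inverse g^(p - 1) and the negatives of x
  and y. The signs agree since (-1)^p = -1, by oddness of p, or because 1 = -1 when p = 2.\<close>

lemma op_satisfies:
 fixes A :: "('k::field, 'b, 'n) module_scheme" (structure)
 assumes A: "sep_alg A" and c: "g \<in> carrier A" "x \<in> carrier A" "y \<in> carrier A" and s: "satisfies p i A g x y"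
  and ch: "CHAR('k) = p" "p > 0"
 shows "satisfies p i (op_alg A) (g [^] (p - 1)) (\<ominus> x) (\<ominus> y)"
proof -
 interpret A: sep_alg A by fact
 have m1: "(-1::'k) ^ p = - 1"
 proof (cases "p = 2")
  case True
  have "of_nat p = (0::'k)" using ch(1) of_nat_CHAR[where 'a = 'k] by simp
  then have "(1::'k) + 1 = 0" using True by simp
  then show ?thesis using True by (simp add: eq_neg_iff_add_eq_0)
 next
  case False
  have "prime p" using ch prime_CHAR_semidom[where 'a = 'k] by simp
  then have "odd p" using False prime_odd_nat[of p] prime_ge_2_nat[of p] by force
  then show ?thesis by simp
 qed
 have np: "(\<ominus> z) [^] p = \<ominus> (z [^] p)" if "z \<in> carrier A" for z
  using A.smult_pow[OF that, where c = "-1" and n = p] that by (simp add: A.neg_smult m1)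
 have gg: "(g [^] (p - 1)) [^] p = \<one>" using s c
  by (metis A.nat_pow_pow A.nat_pow_one mult.commute satisfies_def)
 have gz: "g [^] (p - 1) \<otimes> z = z \<otimes> g [^] (p - 1)" if "g \<otimes> z = z \<otimes> g" "z \<in> carrier A" for z
  using A.group_commutes_pow[OF that(1) c(1) that(2)] .
 have r: "rhs_x i \<zero> (\<ominus> x) (\<ominus> y) = \<ominus> (rhs_x i \<zero> x y)" "rhs_y i \<zero> (\<ominus> y) = \<ominus> (rhs_y i \<zero> y)"
  "rhs_c i \<zero> (\<ominus> y) = \<ominus> (rhs_c i \<zero> y)" by (cases i; simp)+
 have cc: "rhs_c i \<zero> y \<in> carrier A" using c by (cases i) auto
 have xy: "y \<otimes> x = x \<otimes> y \<oplus> \<ominus> (rhs_c i \<zero> y)" using s c cc by (simp add: satisfies_def A.a_assoc A.r_neg)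
 have s': "g [^] p = \<one> & x [^] p = rhs_x i \<zero> x y & y [^] p = rhs_y i \<zero> y & g \<otimes> x = x \<otimes> g & g \<otimes> y = y \<otimes> g"
  using s by (simp add: satisfies_def)
 have xy2: "(\<ominus> y) \<otimes> (\<ominus> x) = (\<ominus> x) \<otimes> (\<ominus> y) \<oplus> \<ominus> (rhs_c i \<zero> y)" using xy c cc by (simp add: A.l_minus A.r_minus)
 show ?thesis
  unfolding satisfies_def op_alg_simps r
  using s' c cc gz[of x] gz[of y] xy2 gg np by (auto simp: op_pow[OF A.kalg_axioms] A.l_minus A.r_minus simp del: One_nat_def)
qed

lemma sep_base_alg: "sep_alg (base_alg :: ('k::field, 'k) module)"
proof -
 let ?E = "base_alg :: ('k, 'k) module"
 have vs: "vsp ?E"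
  by (rule vs_criteria) (auto simp: class_field base_alg_def algebra_simps intro: exI[of _ "- _"] bexI[of _ "- _"])
 interpret vspace ?E by (rule vspace.intro) (rule vs)
 have "ring ?E"
 proof (rule ringI[OF abelian_group_axioms])
  show "monoid ?E" by (rule monoidI) (auto simp: base_alg_def)
 qed (auto simp: base_alg_def algebra_simps)
 then have "k_algebra ?E" using vs by (auto simp: k_algebra_def base_alg_def)
 moreover have "sep_space ?E"
 proof
  fix S T assume "!!\<phi>. \<phi> \<in> dual ?E ==> \<phi> S = \<phi> T"
  moreover have "(%t. t) \<in> dual ?E" by (auto simp: dual_def base_alg_def)
  ultimately show "S = T" by blast
 qed
 ultimately show ?thesis by (intro sep_alg.intro kalg.intro)
qed

lemma base_pow: "c [^]\<^bsub>base_alg\<^esub> (n::nat) = c ^ n"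
 by (induction n) (simp_all add: nat_pow_def base_alg_def)

lemma base_satisfies: "p > 0 ==> satisfies p i base_alg 1 0 0"
 unfolding satisfies_def base_pow by (cases i) (auto simp: base_alg_def power_0_left)

section \<open>The presented Hopf algebras\<close>

lemma (in vspace) subsp_equalizer:
 assumes "!!t. t \<in> T ==> F t \<in> dual V" "!!t. t \<in> T ==> G t \<in> dual V"
 shows "subsp V {v \<in> carrier V. \<forall>t\<in>T. F t v = G t v}"
 using assms by (auto simp: subsp_def dual_zero[OF assms(1)] dual_zero[OF assms(2)] dual_add[OF assms(1)] dual_add[OF assms(2)]
  dual_smult[OF assms(1)] dual_smult[OF assms(2)])

section \<open>Hopf algebra axioms verified on generators\<close>

context prebialg
begin

text \<open>Each axiom holds on a subspace that contains the unit and is stable under left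
  multiplication by generators: grouplike ones multiply both tensor factors, primitive ones act by
  the Leibniz rule. The assumption \<open>gen\<close> is the induction principle of an algebra
  generated by \<open>S\<close>.\<close>

lemma bialgebra_generated:
 assumes gen: "!!U. subsp H U ==> \<one> \<in> U ==> (!!s u. s \<in> S ==> u \<in> U ==> s \<otimes> u \<in> U) ==> carrier H \<subseteq> U"
  and S: "!!s. s \<in> S ==> s \<in> grouplikes H | s \<in> primitives H & counit H s = 0"
 shows "bialgebra H"
proof -
 let ?D = "dual H"
 have Sc: "s \<in> carrier H" if "s \<in> S" for s using S[OF that] grouplike_carrier prim_carrier by blast
 have lm: "(%a. \<phi> (s \<otimes> a)) \<in> ?D" if "\<phi> \<in> ?D" "s \<in> S" for \<phi> s by (rule dual_lmult[OF that(1) Sc[OF that(2)]])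
 \<comment> \<open>The three functionals are packed into one triple, so that the set is an equalizer
   of two families of functionals.\<close>
 let ?U = "{c \<in> carrier H. \<forall>t\<in>?D \<times> ?D \<times> ?D. (case t of (\<phi>, \<psi>, \<chi>) => conv H (conv H \<phi> \<psi>) \<chi>) c = (case t of (\<phi>, \<psi>, \<chi>) => conv H \<phi> (conv H \<psi> \<chi>)) c}"
 have U: "carrier H \<subseteq> ?U"
 proof (rule gen)
  show "subsp H ?U" by (rule subsp_equalizer) (auto intro!: conv_dual)
  show "\<one> \<in> ?U" by (auto simp: conv_one conv_dual)
  fix s c assume s: "s \<in> S" and "c \<in> ?U"
  then have c: "c \<in> carrier H" and IH: "!!\<phi> \<psi> \<chi>. \<phi> \<in> ?D ==> \<psi> \<in> ?D ==> \<chi> \<in> ?D ==> conv H (conv H \<phi> \<psi>) \<chi> c = conv H \<phi> (conv H \<psi> \<chi>) c" by auto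
  have "conv H (conv H \<phi> \<psi>) \<chi> (s \<otimes> c) = conv H \<phi> (conv H \<psi> \<chi>) (s \<otimes> c)" if f: "\<phi> \<in> ?D" "\<psi> \<in> ?D" "\<chi> \<in> ?D" for \<phi> \<psi> \<chi>
  proof -
   note d = lm[OF f(1) s] lm[OF f(2) s] lm[OF f(3) s]
   note cv = conv_dual[OF f(1,2)] conv_dual[OF f(2,3)]
   from S[OF s] show ?thesis
   proof
    assume g: "s \<in> grouplikes H"
    have "conv H (conv H \<phi> \<psi>) \<chi> (s \<otimes> c) = conv H (conv H (%a. \<phi> (s \<otimes> a)) (%b. \<psi> (s \<otimes> b))) (%b. \<chi> (s \<otimes> b)) c"
     unfolding conv_group_mult[OF g c cv(1) f(3)]
     by (rule conv_cong[OF c lm[OF cv(1) s] d(3) conv_dual[OF d(1,2)] d(3)]) (simp_all add: conv_group_mult[OF g _ f(1,2)])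
    also have "... = conv H (%a. \<phi> (s \<otimes> a)) (conv H (%b. \<psi> (s \<otimes> b)) (%b. \<chi> (s \<otimes> b))) c" by (rule IH[OF d])
    also have "... = conv H \<phi> (conv H \<psi> \<chi>) (s \<otimes> c)"
     unfolding conv_group_mult[OF g c f(1) cv(2)]
     by (rule conv_cong[OF c d(1) conv_dual[OF d(2,3)] d(1) lm[OF cv(2) s]]) (simp_all add: conv_group_mult[OF g _ f(2,3)])
    finally show ?thesis .
   next
    assume "s \<in> primitives H & counit H s = 0"
    then have x: "s \<in> primitives H" by simp
    have "conv H (%a. conv H \<phi> \<psi> (s \<otimes> a)) \<chi> c = conv H (%a. conv H (%a. \<phi> (s \<otimes> a)) \<psi> a + conv H \<phi> (%b. \<psi> (s \<otimes> b)) a) \<chi> c"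
     by (rule conv_cong[OF c lm[OF cv(1) s] f(3) dual_closed(1)[OF conv_dual[OF d(1) f(2)] conv_dual[OF f(1) d(2)]] f(3)])
      (simp_all add: conv_prim_mult[OF x _ f(1,2)])
    moreover have "conv H \<phi> (%a. conv H \<psi> \<chi> (s \<otimes> a)) c = conv H \<phi> (%a. conv H (%a. \<psi> (s \<otimes> a)) \<chi> a + conv H \<psi> (%b. \<chi> (s \<otimes> b)) a) c"
     by (rule conv_cong[OF c f(1) lm[OF cv(2) s] f(1) dual_closed(1)[OF conv_dual[OF d(2) f(3)] conv_dual[OF f(2) d(3)]]])
      (simp_all add: conv_prim_mult[OF x _ f(2,3)])
    ultimately show ?thesis
     unfolding conv_prim_mult[OF x c cv(1) f(3)] conv_prim_mult[OF x c f(1) cv(2)]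
     using conv_simps(1)[OF c conv_dual[OF d(1) f(2)] f(3) conv_dual[OF f(1) d(2)]]
      conv_simps(2)[OF c f(1) conv_dual[OF d(2) f(3)] conv_dual[OF f(2) d(3)]]
      IH[OF d(1) f(2,3)] IH[OF f(1) d(2) f(3)] IH[OF f(1,2) d(3)] by simp
   qed
  qed
  then show "s \<otimes> c \<in> ?U" using Sc[OF s] c by auto
 qed
 let ?V = "{c \<in> carrier H. \<forall>\<phi>\<in>?D. conv H (counit H) \<phi> c = \<phi> c}"
 let ?W = "{c \<in> carrier H. \<forall>\<phi>\<in>?D. conv H \<phi> (counit H) c = \<phi> c}"
 have V: "carrier H \<subseteq> ?V"
 proof (rule gen)
  show "subsp H ?V" by (rule subsp_equalizer) (auto intro!: conv_dual counit_dual)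
  show "\<one> \<in> ?V" by (auto simp: conv_one counit_dual counit_simps)
  fix s c assume s: "s \<in> S" and "c \<in> ?V"
  then have c: "c \<in> carrier H" and IH: "!!\<phi>. \<phi> \<in> ?D ==> conv H (counit H) \<phi> c = \<phi> c" by auto
  have "conv H (counit H) \<phi> (s \<otimes> c) = \<phi> (s \<otimes> c)" if f: "\<phi> \<in> ?D" for \<phi>
   using S[OF s]
  proof
   assume g: "s \<in> grouplikes H"
   then have e: "counit H s = 1" by (simp add: grouplikes_def)
   show ?thesis
    unfolding conv_group_mult[OF g c counit_dual f] IH[OF lm[OF f s], symmetric]
    by (rule conv_cong[OF c lm[OF counit_dual s] lm[OF f s] counit_dual lm[OF f s]]) (simp_all add: counit_simps Sc[OF s] e)
  next
   assume x: "s \<in> primitives H & counit H s = 0"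
   \<comment> \<open>The counit kills \<open>s\<close>. The zero functional is written as a multiple
     of the counit so that homogeneity of convolution applies.\<close>
   have "conv H (%a. counit H (s \<otimes> a)) \<phi> c = conv H (%a. 0 * counit H a) \<phi> c"
    by (rule conv_cong[OF c lm[OF counit_dual s] f dual_closed(3)[OF counit_dual] f]) (simp_all add: counit_simps Sc[OF s] x)
   then show ?thesis
    using conv_prim_mult[OF conjunct1[OF x] c counit_dual f] IH[OF lm[OF f s]] conv_simps(5)[OF c counit_dual f f, of 0] by simp
  qed
  then show "s \<otimes> c \<in> ?V" using Sc[OF s] c by auto
 qed
 have W: "carrier H \<subseteq> ?W"
 proof (rule gen)
  show "subsp H ?W" by (rule subsp_equalizer) (auto intro!: conv_dual counit_dual)
  show "\<one> \<in> ?W" by (auto simp: conv_one counit_dual counit_simps)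
  fix s c assume s: "s \<in> S" and "c \<in> ?W"
  then have c: "c \<in> carrier H" and IH: "!!\<phi>. \<phi> \<in> ?D ==> conv H \<phi> (counit H) c = \<phi> c" by auto
  have "conv H \<phi> (counit H) (s \<otimes> c) = \<phi> (s \<otimes> c)" if f: "\<phi> \<in> ?D" for \<phi>
   using S[OF s]
  proof
   assume g: "s \<in> grouplikes H"
   then have e: "counit H s = 1" by (simp add: grouplikes_def)
   show ?thesis
    unfolding conv_group_mult[OF g c f counit_dual] IH[OF lm[OF f s], symmetric]
    by (rule conv_cong[OF c lm[OF f s] lm[OF counit_dual s] lm[OF f s] counit_dual]) (simp_all add: counit_simps Sc[OF s] e)
  next
   assume x: "s \<in> primitives H & counit H s = 0"
   have "conv H \<phi> (%a. counit H (s \<otimes> a)) c = conv H \<phi> (%a. 0 * counit H a) c"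
    by (rule conv_cong[OF c f lm[OF counit_dual s] f dual_closed(3)[OF counit_dual]]) (simp_all add: counit_simps Sc[OF s] x)
   then show ?thesis
    using conv_prim_mult[OF conjunct1[OF x] c f counit_dual] IH[OF lm[OF f s]] conv_simps(6)[OF c f counit_dual f, of 0] by simp
  qed
  then show "s \<otimes> c \<in> ?W" using Sc[OF s] c by auto
 qed
 show ?thesis
  unfolding bialgebra_iff
 proof (intro ballI conjI)
  fix c \<phi> \<psi> \<chi> assume c: "c \<in> carrier H" and f: "\<phi> \<in> ?D" "\<psi> \<in> ?D" "\<chi> \<in> ?D"
  show "conv H (conv H \<phi> \<psi>) \<chi> c = conv H \<phi> (conv H \<psi> \<chi>) c" using subsetD[OF U c] f by simp
 next
  fix c \<phi> assume c: "c \<in> carrier H" and f: "\<phi> \<in> ?D"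
  show "conv H (counit H) \<phi> c = \<phi> c" using subsetD[OF V c] f by simp
  show "conv H \<phi> (counit H) c = \<phi> c" using subsetD[OF W c] f by simp
 qed
qed

text \<open>For grouplike s one has A(su)(sv) = A(u) A(s) s v = A(u) v. For primitive s the two
  Leibniz terms cancel because A(s) = - s.\<close>

lemma antipode_generated:
 assumes gen: "!!U. subsp H U ==> \<one> \<in> U ==> (!!s u. s \<in> S ==> u \<in> U ==> s \<otimes> u \<in> U) ==> carrier H \<subseteq> U"
  and A: "A \<in> lin_maps H H" "A \<one> = \<one>" "!!a b. a \<in> carrier H ==> b \<in> carrier H ==> A (a \<otimes> b) = A b \<otimes> A a"
  and S: "!!s. s \<in> S ==> s \<in> grouplikes H & A s \<otimes> s = \<one> & s \<otimes> A s = \<one> | s \<in> primitives H & counit H s = 0 & A s = \<ominus> s"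
 shows "antipode H A"
proof -
 note Ac = lin_mapsD(1)[OF A(1)]
 have Sc: "s \<in> carrier H" if "s \<in> S" for s using S[OF that] grouplike_carrier prim_carrier by blast
 have id: "(%a. a) \<in> lin_maps H H" by (simp add: lin_maps_iff)
 have b: "(%a b. \<phi> (A a \<otimes> b)) \<in> bil H H" "(%a b. \<phi> (a \<otimes> A b)) \<in> bil H H" if "\<phi> \<in> dual H" for \<phi>
  using bil_comp[OF bil_mult[OF that] A(1) id] bil_comp[OF bil_mult[OF that] id A(1)] by auto
 have ed: "(%c. counit H c * \<phi> \<one>) \<in> dual H" for \<phi> :: "'a => 'k" by (rule dual_closed(4)[OF counit_dual])
 have lb: "(%a b. \<beta> (s \<otimes> a) (s \<otimes> b)) \<in> bil H H" "(%a b. \<beta> (s \<otimes> a) b) \<in> bil H H" "(%a b. \<beta> a (s \<otimes> b)) \<in> bil H H"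
  if "\<beta> \<in> bil H H" "s \<in> carrier H" for \<beta> s
  using TT.bil_translate(1)[OF that(1) that(2) that(2)] bil_comp[OF that(1) lmult_lin[OF that(2)] id] bil_comp[OF that(1) id lmult_lin[OF that(2)]] by auto
 let ?L = "{c \<in> carrier H. \<forall>\<phi>\<in>dual H. ev (%a b. \<phi> (A a \<otimes> b)) (comult H c) = counit H c * \<phi> \<one>}"
 let ?R = "{c \<in> carrier H. \<forall>\<phi>\<in>dual H. ev (%a b. \<phi> (a \<otimes> A b)) (comult H c) = counit H c * \<phi> \<one>}"
 have "carrier H \<subseteq> ?L"
 proof (rule gen)
  show "subsp H ?L" by (rule subsp_equalizer) (auto intro!: ev_comult_dual b ed)
  show "\<one> \<in> ?L" by (auto simp: ev_comult_one b counit_simps A(2))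
  fix s c assume s: "s \<in> S" and "c \<in> ?L"
  then have c: "c \<in> carrier H" and IH: "!!\<phi>. \<phi> \<in> dual H ==> ev (%a b. \<phi> (A a \<otimes> b)) (comult H c) = counit H c * \<phi> \<one>" by auto
  note sc = Sc[OF s] and T = comult_closed[OF c]
  have "ev (%a b. \<phi> (A a \<otimes> b)) (comult H (s \<otimes> c)) = counit H (s \<otimes> c) * \<phi> \<one>" if f: "\<phi> \<in> dual H" for \<phi>
   using S[OF s]
  proof
   assume g: "s \<in> grouplikes H & A s \<otimes> s = \<one> & s \<otimes> A s = \<one>"
   have e: "A (s \<otimes> u) \<otimes> (s \<otimes> v) = A u \<otimes> v" if uv: "u \<in> carrier H" "v \<in> carrier H" for u v
   proof -
    have "A (s \<otimes> u) \<otimes> (s \<otimes> v) = A u \<otimes> ((A s \<otimes> s) \<otimes> v)" using uv sc Ac by (simp add: A(3) m_assoc)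
    then show ?thesis using g uv by simp
   qed
   have "ev (%a b. \<phi> (A a \<otimes> b)) (comult H (s \<otimes> c)) = ev (%a b. \<phi> (A (s \<otimes> a) \<otimes> (s \<otimes> b))) (comult H c)"
    by (rule ev_comult_grouplike_mult[OF conjunct1[OF g] c b(1)[OF f]])
   also have "... = ev (%a b. \<phi> (A a \<otimes> b)) (comult H c)"
    by (rule TT.ev_fcong[OF _ lb(1)[OF b(1)[OF f] sc] b(1)[OF f] T]) (simp add: e)
   finally show ?thesis using IH[OF f] g c sc by (simp add: counit_simps grouplikes_def)
  next
   assume x: "s \<in> primitives H & counit H s = 0 & A s = \<ominus> s"
   have e: "\<phi> (A (s \<otimes> u) \<otimes> v) + \<phi> (A u \<otimes> (s \<otimes> v)) = 0 * \<phi> (A u \<otimes> v)" if uv: "u \<in> carrier H" "v \<in> carrier H" for u v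
    using uv x sc Ac f by (simp add: A(3) m_assoc l_minus r_minus dual_neg)
   have "ev (%a b. \<phi> (A a \<otimes> b)) (comult H (s \<otimes> c)) = ev (%a b. \<phi> (A (s \<otimes> a) \<otimes> b) + \<phi> (A a \<otimes> (s \<otimes> b))) (comult H c)"
    unfolding ev_comult_primitive_mult[OF conjunct1[OF x] c b(1)[OF f]]
    by (rule TT.ev_fadd[OF lb(2)[OF b(1)[OF f] sc] lb(3)[OF b(1)[OF f] sc] T, symmetric])
   also have "... = ev (%a b. 0 * \<phi> (A a \<otimes> b)) (comult H c)"
    by (rule TT.ev_fcong[OF e bil_closed(1)[OF lb(2)[OF b(1)[OF f] sc] lb(3)[OF b(1)[OF f] sc]] bil_closed(3)[OF b(1)[OF f]] T])
   also have "... = 0" using TT.ev_fscale[OF b(1)[OF f] T, of 0] by simp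
   finally show ?thesis using x sc c by (simp add: counit_simps)
  qed
  then show "s \<otimes> c \<in> ?L" using sc c by auto
 qed
 moreover have "carrier H \<subseteq> ?R"
 proof (rule gen)
  show "subsp H ?R" by (rule subsp_equalizer) (auto intro!: ev_comult_dual b ed)
  show "\<one> \<in> ?R" by (auto simp: ev_comult_one b counit_simps A(2))
  fix s c assume s: "s \<in> S" and "c \<in> ?R"
  then have c: "c \<in> carrier H" and IH: "!!\<phi>. \<phi> \<in> dual H ==> ev (%a b. \<phi> (a \<otimes> A b)) (comult H c) = counit H c * \<phi> \<one>" by auto
  note sc = Sc[OF s] and T = comult_closed[OF c]
  note Asc = Ac[OF sc]
  have "ev (%a b. \<phi> (a \<otimes> A b)) (comult H (s \<otimes> c)) = counit H (s \<otimes> c) * \<phi> \<one>" if f: "\<phi> \<in> dual H" for \<phi>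
   using S[OF s]
  proof
   assume g: "s \<in> grouplikes H & A s \<otimes> s = \<one> & s \<otimes> A s = \<one>"
   \<comment> \<open>On this side \<open>s\<close> and \<open>A s\<close> end up outermost, so the
     induction hypothesis is used for the functional that includes both of them.\<close>
   have d: "(%u. \<phi> (s \<otimes> (u \<otimes> A s))) \<in> dual H" by (rule dual_rmult[OF dual_lmult[OF f sc] Asc])
   have e: "(s \<otimes> u) \<otimes> A (s \<otimes> v) = s \<otimes> ((u \<otimes> A v) \<otimes> A s)" if "u \<in> carrier H" "v \<in> carrier H" for u v
    using that sc Ac by (simp add: A(3) m_assoc)
   have "ev (%a b. \<phi> (a \<otimes> A b)) (comult H (s \<otimes> c)) = ev (%a b. \<phi> ((s \<otimes> a) \<otimes> A (s \<otimes> b))) (comult H c)"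
    by (rule ev_comult_grouplike_mult[OF conjunct1[OF g] c b(2)[OF f]])
   also have "... = ev (%a b. \<phi> (s \<otimes> ((a \<otimes> A b) \<otimes> A s))) (comult H c)"
    by (rule TT.ev_fcong[OF _ lb(1)[OF b(2)[OF f] sc] b(2)[OF d] T]) (simp add: e)
   also have "... = counit H c * \<phi> (s \<otimes> (\<one> \<otimes> A s))" by (rule IH[OF d])
   finally show ?thesis using g c sc Asc by (simp add: counit_simps grouplikes_def)
  next
   assume x: "s \<in> primitives H & counit H s = 0 & A s = \<ominus> s"
   have 1: "ev (%a b. \<phi> ((s \<otimes> a) \<otimes> A b)) (comult H c) = ev (%a b. \<phi> (s \<otimes> (a \<otimes> A b))) (comult H c)"
    by (rule TT.ev_fcong[OF _ lb(2)[OF b(2)[OF f] sc] b(2)[OF dual_lmult[OF f sc]] T]) (simp add: sc Ac m_assoc)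
   have 2: "ev (%a b. \<phi> (a \<otimes> A (s \<otimes> b))) (comult H c) = ev (%a b. \<phi> ((a \<otimes> A b) \<otimes> A s)) (comult H c)"
    by (rule TT.ev_fcong[OF _ lb(3)[OF b(2)[OF f] sc] b(2)[OF dual_rmult[OF f Asc]] T]) (simp add: sc Ac m_assoc A(3))
   have "ev (%a b. \<phi> (a \<otimes> A b)) (comult H (s \<otimes> c)) = counit H c * \<phi> (s \<otimes> \<one>) + counit H c * \<phi> (\<one> \<otimes> A s)"
    unfolding ev_comult_primitive_mult[OF conjunct1[OF x] c b(2)[OF f]] 1 2 IH[OF dual_lmult[OF f sc]] IH[OF dual_rmult[OF f Asc]] ..
   then show ?thesis using x sc c f by (simp add: counit_simps dual_neg)
  qed
  then show "s \<otimes> c \<in> ?R" using sc c by auto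
 qed
 ultimately show ?thesis unfolding antipode_iff[OF A(1)] by blast
qed

end

lemma same_pres: "same_alg (pres_alg R) (pres_hopf R)"
 by (simp add: same_alg_def pres_hopf_def)

lemma same_alg_pow: "same_alg V W ==> a [^]\<^bsub>W\<^esub> (n::nat) = a [^]\<^bsub>V\<^esub> n"
 by (simp add: same_alg_def nat_pow_def)

lemma (in vspace) fin_dim_spanI:
 assumes "finite S" "S <= carrier V" "lspan V S = carrier V"
 shows "fin_dim"
 using assms unfolding fin_dim_def by blast

section \<open>The presented algebras are Hopf algebras with monomial basis\<close>

context
 fixes p :: nat and i :: label
 assumes ch: "CHAR('k::field) = p" and p0: "p > 0"
begin

abbreviation (input) R0 :: "(gen list \<Rightarrow>\<^sub>0 'k) set" where "R0 \<equiv> relators p i"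
abbreviation (input) A0 where "A0 \<equiv> pres_alg R0"
abbreviation (input) P0 where "P0 \<equiv> pres_hopf R0"
abbreviation (input) v0 where "v0 \<equiv> pres_var R0"

lemma p1: "p > 1"
 using ch p0 prime_CHAR_semidom[where 'a = 'k] prime_gt_1_nat by simp

lemma v0_closed: "v0 a \<in> carrier A0"
 by (auto simp: pres_var_pcls pres_carrier)

lemma pres_fd: "fd_space A0" "sep_alg A0"
proof -
 interpret A: kalg A0 by (rule pres_kalg)
 have "A.fin_dim" by (rule A.fin_dim_spanI[OF _ _ pres_span[OF p1]]) (use v0_closed in auto)
 then show "fd_space A0" by unfold_locales
 then interpret fd_space A0 .
 show "sep_alg A0" by unfold_locales
qed

text \<open>The spanning set of the algebra record is carried over to the Hopf record along the
  identity map.\<close>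

lemma pres_fd_hopf: "fd_space P0" "sep_alg P0"
proof -
 interpret A: sep_alg A0 by (rule pres_fd)
 interpret P: kalg P0 by (rule kalg.intro[OF same_alg_k_algebra[OF same_pres A.ka]])
 define S where "S = (%(s, a, b). v0 Gen_g [^]\<^bsub>A0\<^esub> s \<otimes>\<^bsub>A0\<^esub> (v0 Gen_x [^]\<^bsub>A0\<^esub> a \<otimes>\<^bsub>A0\<^esub> v0 Gen_y [^]\<^bsub>A0\<^esub> b)) ` ({..<p} \<times> {..<p} \<times> {..<p})"
 have c: "carrier P0 = carrier A0" by (simp add: pres_hopf_def)
 have Sc: "S <= carrier A0" using v0_closed by (auto simp: S_def)
 then have ScP: "S <= carrier P0" using c by simp
 have id: "(%x. x) \<in> lin_maps A0 P0" using A.vs by (auto simp: lin_maps_iff pres_hopf_def)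
 have im: "(%x. x) ` S <= lspan P0 S" using P.span_base[OF ScP] by auto
 have "u \<in> lspan P0 S" if "u \<in> lspan A0 S" for u
  by (rule lin_span_image[OF A.vs P.vs id Sc P.subsp_span[OF ScP] im that])
 moreover have "lspan A0 S = carrier A0" unfolding S_def by (rule pres_span[OF p1])
 ultimately have sp: "lspan P0 S = carrier P0"
  using P.subsp_span[OF ScP] c by (auto simp: subsp_def)
 have "P.fin_dim" by (rule P.fin_dim_spanI[OF _ ScP sp]) (simp add: S_def)
 then show "fd_space P0" by unfold_locales
 then interpret fd_space P0 .
 show "sep_alg P0" by unfold_locales
qed

text \<open>Comultiplication and counit of \<open>pres_hopf\<close> are instances of
  \<open>pres_lift\<close>; the relations of their images hold in the tensor square and in the
  ground field.\<close>

lemma pres_maps: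
 "comult P0 \<in> alg_hom A0 (tensor A0 A0)" "comult P0 (v0 a) = gen_comult R0 a"
 "counit P0 \<in> alg_hom A0 base_alg" "counit P0 (v0 a) = gen_counit a"
proof -
 interpret A: sep_alg A0 by (rule pres_fd)
 interpret T: tens_alg A0 A0 ..
 have c: "comult P0 = pres_lift (tensor A0 A0) (gen_comult R0)" "counit P0 = pres_lift base_alg gen_counit"
  by (simp_all add: pres_hopf_def pres_lift_def fun_eq_iff)
 have tc: "tens A0 A0 u w \<in> carrier (tensor A0 A0)" if "u \<in> carrier A0" "w \<in> carrier A0" for u w
  using that by (rule T.tens_carrier)
 have gc: "gen_comult R0 b \<in> carrier (tensor A0 A0)" for b
  by (cases b) (simp_all add: tc v0_closed)
 have s: "satisfies p i (tensor A0 A0) (gen_comult R0 Gen_g) (gen_comult R0 Gen_x) (gen_comult R0 Gen_y)"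
  using tensor_satisfies[OF A.kalg_axioms v0_closed v0_closed v0_closed pres_satisfies ch p0] by simp
 show "comult P0 \<in> alg_hom A0 (tensor A0 A0)" "comult P0 (v0 a) = gen_comult R0 a"
  unfolding c by (rule satisfies_lift[of _ "gen_comult R0", OF T.T.sep_alg_axioms gc s])+
 have s2: "satisfies p i base_alg (gen_counit Gen_g) (gen_counit Gen_x) (gen_counit Gen_y :: 'k)"
  using base_satisfies[OF p0] by simp
 have gc2: "(gen_counit b :: 'k) \<in> carrier base_alg" for b by (simp add: base_alg_def)
 show "counit P0 \<in> alg_hom A0 base_alg" "counit P0 (v0 a) = gen_counit a"
  unfolding c by (rule satisfies_lift[of _ gen_counit, OF sep_base_alg gc2 s2])+
qed

lemma pres_prebialg: "prebialg P0"
proof -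
 interpret P: sep_alg P0 by (rule pres_fd_hopf)
 interpret P: fd_space P0 by (rule pres_fd_hopf)
 have h: "comult P0 \<in> alg_hom P0 (tensor P0 P0)" "counit P0 \<in> alg_hom P0 base_alg"
  using pres_maps(1,3) unfolding same_alg_hom(1)[OF same_pres] same_alg_tensor[OF same_pres] .
 show ?thesis by unfold_locales (use h alg_homD(2)[OF h(1)] in auto)
qed

lemma pres_gens: "v0 Gen_g \<in> grouplikes P0" "v0 Gen_x \<in> primitives P0" "v0 Gen_y \<in> primitives P0"
 "counit P0 (v0 Gen_x) = 0" "counit P0 (v0 Gen_y) = 0" "satisfies p i P0 (v0 Gen_g) (v0 Gen_x) (v0 Gen_y)"
proof -
 have s: "carrier P0 = carrier A0" "\<one>\<^bsub>P0\<^esub> = \<one>\<^bsub>A0\<^esub>" "\<zero>\<^bsub>P0\<^esub> = \<zero>\<^bsub>A0\<^esub>" "mult P0 = mult A0" "add P0 = add A0" by (simp_all add: pres_hopf_def)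
 show "v0 Gen_g \<in> grouplikes P0" "v0 Gen_x \<in> primitives P0" "v0 Gen_y \<in> primitives P0"
  using v0_closed unfolding grouplikes_def primitives_def s same_alg_tensor[OF same_pres] by (simp_all add: pres_maps)
 show "counit P0 (v0 Gen_x) = 0" "counit P0 (v0 Gen_y) = 0" by (simp_all add: pres_maps)
 show "satisfies p i P0 (v0 Gen_g) (v0 Gen_x) (v0 Gen_y)"
  using pres_satisfies[where i = i and p = p] unfolding satisfies_def s same_alg_pow[OF same_pres] .
qed

lemma pres_hom_lift:
 assumes "sep_alg B" "!!a. \<phi> a \<in> carrier B" "satisfies p i B (\<phi> Gen_g) (\<phi> Gen_x) (\<phi> Gen_y)"
 obtains f where "f \<in> alg_hom P0 B" "!!a. f (v0 a) = \<phi> a"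
 using satisfies_lift[of B \<phi> p i, OF assms] unfolding same_alg_hom(1)[OF same_pres] by (intro that)

lemma pres_generated:
 assumes "subsp P0 U" "\<one>\<^bsub>P0\<^esub> \<in> U" "!!s u. s \<in> range v0 ==> u \<in> U ==> s \<otimes>\<^bsub>P0\<^esub> u \<in> U"
 shows "carrier P0 \<subseteq> U"
proof
 have s: "carrier P0 = carrier A0" "\<one>\<^bsub>P0\<^esub> = \<one>\<^bsub>A0\<^esub>" "mult P0 = mult A0" "add P0 = add A0" "smult P0 = smult A0" by (simp_all add: pres_hopf_def)
 fix \<xi> assume "\<xi> \<in> carrier P0"
 then have "\<xi> \<in> carrier A0" by (simp add: s)
 then show "\<xi> \<in> U"
  by (induction \<xi> rule: pres_induct) (use assms in \<open>auto simp: subsp_def s\<close>)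
qed

text \<open>A homomorphism cannot create distinctness or independence, so both are seen in a
  representation: the cyclic one separates the powers of g, the other makes x and y independent.
  Spanning comes from the relations.\<close>

theorem pres_mono_basis: "mono_basis P0 (v0 Gen_g) (v0 Gen_x) (v0 Gen_y) p"
proof -
 interpret prebialg P0 by (rule pres_prebialg)
 have gp: "v0 Gen_g [^]\<^bsub>P0\<^esub> p = \<one>\<^bsub>P0\<^esub>" using pres_gens(6) by (simp add: satisfies_def)
 interpret gxy P0 "v0 Gen_g" "v0 Gen_x" "v0 Gen_y" p
  by unfold_locales (use pres_gens gp ch p0 in auto)
 have d: "inj_on (%s. v0 Gen_g [^]\<^bsub>P0\<^esub> (s::nat)) {..<p}"
 proof -
  obtain g x y where E: "g \<in> carrier lin_end" "x \<in> carrier lin_end" "y \<in> carrier lin_end"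
   "satisfies p i (lin_end :: ('k, (nat => 'k) => nat => 'k) module) g x y"
   "inj_on (%s. g [^]\<^bsub>lin_end :: ('k, (nat => 'k) => nat => 'k) module\<^esub> (s::nat)) {..<p}"
   by (rule exists_cyclic_rep[OF p1, where i = i and 'k = 'k]) blast
  define \<phi> where "\<phi> a = (case a of Gen_g => g | Gen_x => x | Gen_y => y)" for a
  have \<phi>: "\<phi> a \<in> carrier lin_end" for a using E by (cases a) (auto simp: \<phi>_def)
  obtain f where f: "f \<in> alg_hom P0 lin_end" "!!a. f (v0 a) = \<phi> a"
   by (rule pres_hom_lift[OF sep_lin_end, of \<phi>]) (use \<phi> E in \<open>auto simp: \<phi>_def\<close>)
  have "f (v0 Gen_g [^]\<^bsub>P0\<^esub> s) = g [^]\<^bsub>lin_end\<^esub> s" for s :: nat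
   using alg_hom_pow[OF ka sep_alg.axioms(2)[OF sep_lin_end, THEN kalg.ka] f(1), where x = "v0 Gen_g"] gc f(2) by (simp add: \<phi>_def)
  then show ?thesis using E(5) unfolding inj_on_def by metis
 qed
 have xy: "\<alpha> = 0 & \<beta> = 0" if e: "\<alpha> \<odot>\<^bsub>P0\<^esub> v0 Gen_x \<oplus>\<^bsub>P0\<^esub> \<beta> \<odot>\<^bsub>P0\<^esub> v0 Gen_y = \<zero>\<^bsub>P0\<^esub>" for \<alpha> \<beta>
 proof -
  obtain g x y where E: "g \<in> carrier lin_end" "x \<in> carrier lin_end" "y \<in> carrier lin_end"
   "satisfies p i (lin_end :: ('k, (nat => 'k) => nat => 'k) module) g x y"
   "!!\<alpha> \<beta>. \<alpha> \<odot>\<^bsub>lin_end\<^esub> x \<oplus>\<^bsub>lin_end\<^esub> \<beta> \<odot>\<^bsub>lin_end\<^esub> y = \<zero>\<^bsub>lin_end :: ('k, (nat => 'k) => nat => 'k) module\<^esub> ==> \<alpha> = 0 & \<beta> = 0"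
   by (rule exists_free_rep[OF p1, where i = i and 'k = 'k]) blast
  define \<phi> where "\<phi> a = (case a of Gen_g => g | Gen_x => x | Gen_y => y)" for a
  have \<phi>: "\<phi> a \<in> carrier lin_end" for a using E by (cases a) (auto simp: \<phi>_def)
  obtain f where f: "f \<in> alg_hom P0 lin_end" "!!a. f (v0 a) = \<phi> a"
   by (rule pres_hom_lift[OF sep_lin_end, of \<phi>]) (use \<phi> E in \<open>auto simp: \<phi>_def\<close>)
  interpret E: sep_alg "lin_end :: ('k, (nat => 'k) => nat => 'k) module" by (rule sep_lin_end)
  have "f (\<alpha> \<odot>\<^bsub>P0\<^esub> v0 Gen_x \<oplus>\<^bsub>P0\<^esub> \<beta> \<odot>\<^bsub>P0\<^esub> v0 Gen_y) = \<alpha> \<odot>\<^bsub>lin_end\<^esub> x \<oplus>\<^bsub>lin_end\<^esub> \<beta> \<odot>\<^bsub>lin_end\<^esub> y"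
   using alg_homD(5)[OF f(1)] alg_homD(6)[OF f(1)] xc yc f(2) by (simp add: \<phi>_def)
  then show ?thesis using E(5)[of \<alpha> \<beta>] e lin_maps_zero[OF vs E.vs alg_homD(1)[OF f(1)]] by simp
 qed
 interpret gens_rel P0 "v0 Gen_g" "v0 Gen_x" "v0 Gen_y" p i
  by unfold_locales (use gc xc yc pres_gens(6) p1 in auto)
 have "M ` J = (%(s, a, b). v0 Gen_g [^]\<^bsub>P0\<^esub> s \<otimes>\<^bsub>P0\<^esub> (v0 Gen_x [^]\<^bsub>P0\<^esub> a \<otimes>\<^bsub>P0\<^esub> v0 Gen_y [^]\<^bsub>P0\<^esub> b)) ` J"
  by (rule image_cong) (auto simp: M_def mon_def)
 then have "lspan P0 (M ` J) = U" by simp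
 moreover have "carrier P0 \<subseteq> U"
 proof (rule pres_generated[OF U_subsp U_one])
  fix s u assume "s \<in> range v0" "u \<in> U"
  moreover have "v0 a \<in> {v0 Gen_g, v0 Gen_x, v0 Gen_y}" for a by (cases a) auto
  ultimately show "s \<otimes>\<^bsub>P0\<^esub> u \<in> U" by (intro U_mult) auto
 qed
 ultimately have "lspan P0 (M ` J) = carrier P0" using U_subsp by (auto simp: subsp_def)
 then show ?thesis by unfold_locales (use d xy in auto)
qed

theorem pres_hopf_algebra: "hopf_algebra P0"
proof -
 interpret prebialg P0 by (rule pres_prebialg)
 have "bialgebra P0"
 proof (rule bialgebra_generated[OF pres_generated])
  fix s assume "s \<in> range v0"
  then obtain a where "s = v0 a" by blast
  then show "s \<in> grouplikes P0 | s \<in> primitives P0 & counit P0 s = 0"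
   using pres_gens by (cases a) auto
 qed
 moreover have "\<exists>S. antipode P0 S"
 proof -
  note gc = grouplike_carrier[OF pres_gens(1)] and xc = prim_carrier[OF pres_gens(2)] and yc = prim_carrier[OF pres_gens(3)]
  define \<sigma> where "\<sigma> a = (case a of Gen_g => v0 Gen_g [^]\<^bsub>P0\<^esub> (p - 1) | Gen_x => \<ominus>\<^bsub>P0\<^esub> v0 Gen_x | Gen_y => \<ominus>\<^bsub>P0\<^esub> v0 Gen_y)" for a
  have \<sigma>: "\<sigma> a \<in> carrier (op_alg P0)" for a by (cases a) (simp_all add: \<sigma>_def gc xc yc)
  have sat: "satisfies p i (op_alg P0) (\<sigma> Gen_g) (\<sigma> Gen_x) (\<sigma> Gen_y)"
   using op_satisfies[OF sep_alg_axioms gc xc yc pres_gens(6) ch p0] by (simp add: \<sigma>_def)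
  obtain S where S: "S \<in> alg_hom P0 (op_alg P0)" "!!a. S (v0 a) = \<sigma> a"
   by (rule pres_hom_lift[of _ \<sigma>, OF sep_op_alg[OF sep_alg_axioms] \<sigma> sat]) blast
  have lin: "S \<in> lin_maps P0 P0" using alg_homD(1)[OF S(1)] by (simp add: lin_maps_iff)
  have "antipode P0 S"
  proof (rule antipode_generated[OF pres_generated lin])
   show "S \<one>\<^bsub>P0\<^esub> = \<one>\<^bsub>P0\<^esub>" using alg_homD(3)[OF S(1)] by simp
   show "S (a \<otimes>\<^bsub>P0\<^esub> b) = S b \<otimes>\<^bsub>P0\<^esub> S a" if "a \<in> carrier P0" "b \<in> carrier P0" for a b
    using alg_homD(4)[OF S(1) that] by simp
   fix s assume "s \<in> range v0"
   then obtain a where a: "s = v0 a" by blast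
   have gp: "v0 Gen_g [^]\<^bsub>P0\<^esub> p = \<one>\<^bsub>P0\<^esub>" using pres_gens(6) by (simp add: satisfies_def)
   have p: "p = Suc (p - 1)" using p0 by simp
   have "v0 Gen_g [^]\<^bsub>P0\<^esub> (p - 1) \<otimes>\<^bsub>P0\<^esub> v0 Gen_g = v0 Gen_g [^]\<^bsub>P0\<^esub> Suc (p - 1)" by (rule nat_pow_Suc[symmetric])
   moreover have "v0 Gen_g \<otimes>\<^bsub>P0\<^esub> v0 Gen_g [^]\<^bsub>P0\<^esub> (p - 1) = v0 Gen_g [^]\<^bsub>P0\<^esub> Suc (p - 1)" by (rule nat_pow_Suc2[OF gc, symmetric])
   moreover have "v0 Gen_g [^]\<^bsub>P0\<^esub> Suc (p - 1) = \<one>\<^bsub>P0\<^esub>" unfolding p[symmetric] by (rule gp)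
   ultimately show "s \<in> grouplikes P0 & S s \<otimes>\<^bsub>P0\<^esub> s = \<one>\<^bsub>P0\<^esub> & s \<otimes>\<^bsub>P0\<^esub> S s = \<one>\<^bsub>P0\<^esub> |
     s \<in> primitives P0 & counit P0 s = 0 & S s = \<ominus>\<^bsub>P0\<^esub> s"
    using pres_gens a S(2) by (cases a) (simp_all add: \<sigma>_def)
  qed
  then show ?thesis by blast
 qed
 ultimately show ?thesis by (simp add: hopf_algebra_def)
qed

end

section \<open>The associated graded algebra of the five families\<close>

declare relators.simps [simp del]

text \<open>\<epsilon> is the unit of convolution, so \<epsilon>(x) is also the convolution square
  of \<epsilon> at x, which is 2 \<epsilon>(x) by primitivity.\<close>

lemma (in bialg) primitive_counit:
 assumes x: "x \<in> primitives H"
 shows "counit H x = 0"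
proof -
 have "counit H x = counit H x + counit H x"
  using conv_prim[OF x counit_dual counit_dual] conv_counit(1)[OF prim_carrier[OF x] counit_dual]
  by (simp only: counit_simps mult_1_left mult_1_right)
 then show ?thesis by (metis add_cancel_right_left)
qed

lemma (in gxy) counit_mon:
 assumes "counit H x = 0" "counit H y = 0"
 shows "counit H (mon s j l) = (if j = 0 & l = 0 then 1 else 0)"
proof -
 have pw: "counit H (u [^] (n::nat)) = counit H u ^ n" if "u \<in> carrier H" for u n
  using that by (induction n) (simp_all add: counit_simps)
 have "counit H g = 1" using g by (simp add: grouplikes_def)
 then show ?thesis using assms gc xc yc by (auto simp: mon_def counit_simps pw power_0_left)
qed

context pointed_bialg
begin

lemma gr_class_zero:
 assumes "z \<in> K n"
 shows "gr_class H n z = \<zero>\<^bsub>gr_hopf H\<^esub>"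
proof (rule gr_eqI)
 have z: "z \<in> K (Suc n)" using K_mono[of n "Suc n"] assms by auto
 have d0: "(%_. 0) \<in> ann H (K 0)" by (simp add: ann_def dual_closed(5))
 show "gr_class H n z \<in> carrier (gr_hopf H)" by (rule gr_class_cl[OF z])
 show "\<zero>\<^bsub>gr_hopf H\<^esub> \<in> carrier (gr_hopf H)" by (rule gr_zero(1)[OF d0])
 fix i \<phi> assume \<phi>: "\<phi> \<in> ann H (K i)"
 show "hat i \<phi> (gr_class H n z) = hat i \<phi> \<zero>\<^bsub>gr_hopf H\<^esub>"
  unfolding hat_class[OF z \<phi>] gr_zero(2)[OF \<phi>] using annD(2)[OF \<phi>] assms by simp
qed

lemma gr_class_cong:
 assumes "z \<in> K (Suc n)" "w \<in> K (Suc n)" "z \<ominus> w \<in> K n"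
 shows "gr_class H n z = gr_class H n w"
proof (rule gr_eqI)
 show "gr_class H n z \<in> carrier (gr_hopf H)" "gr_class H n w \<in> carrier (gr_hopf H)"
  by (rule gr_class_cl, fact)+
 fix i \<phi> assume \<phi>: "\<phi> \<in> ann H (K i)"
 show "hat i \<phi> (gr_class H n z) = hat i \<phi> (gr_class H n w)"
  unfolding hat_class[OF assms(1) \<phi>] hat_class[OF assms(2) \<phi>]
  using annD(2)[OF \<phi>, of "z \<ominus> w"] assms(3) dual_minus[OF annD(1)[OF \<phi>] K_carrier[OF assms(1)] K_carrier[OF assms(2)]] by auto
qed

lemma one_K: "\<one> \<in> K (Suc 0)"
 using one_grouplike grouplikes_K1 by blast

lemma gr_one: "\<one>\<^bsub>gr_hopf H\<^esub> = gr_class H 0 \<one>"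
 by (simp add: gr_simps)

lemma pow_K: "u \<in> K (Suc i) ==> u [^] (n::nat) \<in> K (Suc (n * i))"
proof (induction n)
 case 0
 then show ?case using one_K by simp
next
 case (Suc n)
 then show ?case using mult_filtration[of "u [^] n" "n * i" u i] by (simp add: add.commute)
qed

lemma gr_pow: "u \<in> K (Suc i) ==> gr_class H i u [^]\<^bsub>gr_hopf H\<^esub> (n::nat) = gr_class H (n * i) (u [^] n)"
proof (induction n)
 case 0
 then show ?case by (simp add: gr_one nat_pow_def)
next
 case (Suc n)
 have "gr_class H i u [^]\<^bsub>gr_hopf H\<^esub> Suc n = gr_class H (n * i) (u [^] n) \<otimes>\<^bsub>gr_hopf H\<^esub> gr_class H i u"
  using Suc by (simp add: nat_pow_def)
 then show ?case using hat_class_mult[OF pow_K[OF Suc.prems] Suc.prems] by (simp add: add.commute)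
qed

end

text \<open>The prescribed model of gr H is the first of the five families, so its basis theorem is
  already available.\<close>

lemma graded_relators_eq: "graded_relators p = relators p Case_a"
 by (auto simp: graded_relators_def Let_def relators.simps)

text \<open>Generators go to their classes. The right hand sides of the relations have degree at
  most 1, so they vanish in the degrees p and 2 where they are compared. On coordinates the map
  preserves exponents, which gives bijectivity; it respects convolution because both sides obey the
  same formula on monomials.\<close>

theorem gr_isomorphic:
 fixes H :: "('k::field, 'a, 'm) hopf_scheme" (structure)
 assumes mb: "mono_basis H g x y p" and ba: "bialgebra H" and sat: "satisfies p i H g x y"
 shows "hopf_isomorphic (gr_hopf H) (pres_hopf (graded_relators p))"
proof -
 interpret mono_basis H g x y p by (rule mb)
 interpret pointed_bialg H by unfold_locales (fact ba, rule pointed)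
 let ?Q = "pres_hopf (relators p Case_a) :: ('k, (gen list \<Rightarrow>\<^sub>0 'k) set) hopf"
 let ?v = "pres_var (relators p Case_a) :: gen => (gen list \<Rightarrow>\<^sub>0 'k) set"
 note cp = char p
 interpret Q: mono_basis ?Q "?v Gen_g" "?v Gen_x" "?v Gen_y" p by (rule pres_mono_basis[OF cp])
 interpret GA: sep_alg G by (intro sep_alg.intro sep_gr kalg.intro k_algebra_gr)
 have x2: "x \<in> K (Suc 1)" "y \<in> K (Suc 1)" and g1: "g \<in> K (Suc 0)"
  using mon_deg_below[of 0 1 0 2] mon_deg_below[of 0 0 1 2] p2 grouplikes_K1 g mon_simps
  by (auto simp: filtration numeral_2_eq_2)
 note sr = sat[unfolded satisfies_def]
 \<comment> \<open>The p-th powers of x and y have degree at most 1, while their classes are taken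
   in degree p, which is at least 2.\<close>
 have K2p: "K (Suc 1) \<subseteq> K p" using p2 by (intro K_mono) simp
 have z2: "\<zero> \<in> K n" for n by (rule subspD(2)[OF subsp_filt])
 have cls: "gr_class H 0 g \<in> carrier G" "gr_class H 1 x \<in> carrier G" "gr_class H 1 y \<in> carrier G"
  using gr_class_cl g1 x2 by auto
 have satG: "satisfies p Case_a G (gr_class H 0 g) (gr_class H 1 x) (gr_class H 1 y)"
 proof -
  have "gr_class H 0 g [^]\<^bsub>G\<^esub> p = \<one>\<^bsub>G\<^esub>" using gr_pow[OF g1, of p] sr by (simp add: gr_one)
  moreover have "gr_class H 1 x [^]\<^bsub>G\<^esub> p = \<zero>\<^bsub>G\<^esub>"
  proof -
   have "x [^] p \<in> K p" using sr x2 z2 K2p by (cases i) auto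
   then show ?thesis using gr_pow[OF x2(1), of p] gr_class_zero[of "x [^] p" p] by simp
  qed
  moreover have "gr_class H 1 y [^]\<^bsub>G\<^esub> p = \<zero>\<^bsub>G\<^esub>"
  proof -
   have "y [^] p \<in> K p" using sr x2 z2 K2p by (cases i) auto
   then show ?thesis using gr_pow[OF x2(2), of p] gr_class_zero[of "y [^] p" p] by simp
  qed
  moreover have "gr_class H 0 g \<otimes>\<^bsub>G\<^esub> gr_class H 1 x = gr_class H 1 x \<otimes>\<^bsub>G\<^esub> gr_class H 0 g"
   "gr_class H 0 g \<otimes>\<^bsub>G\<^esub> gr_class H 1 y = gr_class H 1 y \<otimes>\<^bsub>G\<^esub> gr_class H 0 g"
   unfolding hat_class_mult[OF g1 x2(1)] hat_class_mult[OF x2(1) g1] hat_class_mult[OF g1 x2(2)] hat_class_mult[OF x2(2) g1]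
   using sr by simp_all
  moreover have "gr_class H 1 x \<otimes>\<^bsub>G\<^esub> gr_class H 1 y = gr_class H 1 y \<otimes>\<^bsub>G\<^esub> gr_class H 1 x"
   unfolding hat_class_mult[OF x2] hat_class_mult[OF x2(2,1)]
  proof (rule gr_class_cong)
   show "x \<otimes> y \<in> K (Suc (1 + 1))" "y \<otimes> x \<in> K (Suc (1 + 1))"
    using mult_filtration[OF x2] mult_filtration[OF x2(2,1)] by simp_all
   have cc: "rhs_c i \<zero> y \<in> K (1 + 1)" using x2 z2 by (cases i) (auto simp: numeral_2_eq_2)
   then have "rhs_c i \<zero> y \<in> carrier H" by (rule K_carrier)
   then have "x \<otimes> y \<ominus> y \<otimes> x = rhs_c i \<zero> y"
    using sr xc yc by (intro sep) (simp_all add: dual_minus dual_add)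
   then show "x \<otimes> y \<ominus> y \<otimes> x \<in> K (1 + 1)" using cc by simp
  qed
  moreover have "gr_class H 1 y \<otimes>\<^bsub>G\<^esub> gr_class H 1 x \<in> carrier G" using cls by simp
  ultimately show ?thesis by (simp add: satisfies_def)
 qed
 define \<gamma> where "\<gamma> a = (case a of Gen_g => gr_class H 0 g | Gen_x => gr_class H 1 x | Gen_y => gr_class H 1 y)" for a
 have \<gamma>: "\<gamma> a \<in> carrier G" for a using cls by (cases a) (auto simp: \<gamma>_def)
 obtain f where f: "f \<in> alg_hom ?Q G" "!!a. f (?v a) = \<gamma> a"
  by (rule pres_hom_lift[OF cp GA.sep_alg_axioms, of \<gamma> Case_a]) (use \<gamma> satG in \<open>auto simp: \<gamma>_def\<close>)
 note fh = alg_homD[OF f(1)]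
 have xK: "x [^] (a::nat) \<in> K (Suc a)" "y [^] (a::nat) \<in> K (Suc a)" "g [^] (a::nat) \<in> K (Suc 0)" for a
  using pow_K[OF x2(1), of a] pow_K[OF x2(2), of a] pow_K[OF g1, of a] by simp_all
 have monK: "mon s a b \<in> K (Suc (a + b))" for s a b
  using mult_filtration[OF xK(3) mult_filtration[OF xK(1,2)]] by (simp add: mon_def)
 have fmon: "f (Q.mon s a b) = gr_class H (a + b) (mon s a b)" for s a b
 proof -
  note pw = alg_hom_pow[OF Q.ka GA.ka f(1)]
  have "f (Q.mon s a b) = gr_class H 0 (g [^] s) \<otimes>\<^bsub>G\<^esub> (gr_class H a (x [^] a) \<otimes>\<^bsub>G\<^esub> gr_class H b (y [^] b))"
   using Q.gc Q.xc Q.yc gr_pow[OF g1, of s] gr_pow[OF x2(1), of a] gr_pow[OF x2(2), of b]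
   by (simp add: Q.mon_def fh(4) pw f(2) \<gamma>_def)
  also have "... = gr_class H (a + b) (mon s a b)"
   using hat_class_mult[OF xK(1,2)] hat_class_mult[OF xK(3) mult_filtration[OF xK(1,2)]] by (simp add: mon_def)
  finally show ?thesis .
 qed
 have hatf: "hat n \<phi> (f (Q.mon s a b)) = (if n = a + b then \<phi> (mon s a b) else 0)" if "\<phi> \<in> ann H (K n)" for n \<phi> s a b
  unfolding fmon by (rule hat_class[OF monK that])
 have hd: "(%v. hat n \<phi> (f v)) \<in> dual ?Q" if "\<phi> \<in> ann H (K n)" for n \<phi>
  by (rule dual_lin[OF fh(1) hat_dual[OF that]])
 have cdK: "cd (s, j, l) \<in> ann H (K (j + l))" if "(s, j, l) \<in> J" for s j l
  using cd_dual[OF that] that by (auto simp: ann_def filtration deg_below_def)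
 have coord: "hat (j + l) (cd (s, j, l)) (f v) = Q.cd (s, j, l) v" if i: "(s, j, l) \<in> J" and v: "v \<in> carrier ?Q" for s j l v
  by (rule Q.cd_eqI[OF hd[OF cdK[OF i]] Q.cd_dual[OF i] _ v]) (auto simp: hatf[OF cdK[OF i]] cd_mon[OF i] Q.cd_mon[OF i])
 have inj: "inj_on f (carrier ?Q)"
 proof (rule inj_onI)
  fix v w assume vw: "v \<in> carrier ?Q" "w \<in> carrier ?Q" "f v = f w"
  have c: "Q.cd k v = Q.cd k w" if "k \<in> J" for k
   using that coord[of _ _ _ v] coord[of _ _ _ w] vw by (cases k) auto
  show "v = w"
  proof (rule Q.sep[OF vw(1,2)])
   fix \<psi> assume \<psi>: "\<psi> \<in> dual ?Q"
   show "\<psi> v = \<psi> w" unfolding Q.expand[OF vw(1) \<psi>] Q.expand[OF vw(2) \<psi>] using c by (intro sum.cong) auto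
  qed
 qed
 have surj: "F \<in> f ` carrier ?Q" if F: "F \<in> carrier G" for F
 proof -
  \<comment> \<open>The coefficient that a preimage of \<open>F\<close> must have at a monomial: its
    coordinate on the component of \<open>F\<close> in the degree of that monomial.\<close>
  define c where "c k = hat (fst (snd k) + snd (snd k)) (cd k) F" for k
  define v where "v = (\<Oplus>\<^bsub>?Q\<^esub>k\<in>J. c k \<odot>\<^bsub>?Q\<^esub> Q.M k)"
  have vc: "v \<in> carrier ?Q" unfolding v_def using Q.M_closed by (intro Q.finsum_closed) auto
  have pv: "\<psi> v = (\<Sum>k\<in>J. c k * \<psi> (Q.M k))" if \<psi>: "\<psi> \<in> dual ?Q" for \<psi>
   unfolding v_def using Q.M_closed by (subst Q.dual_finsum[OF \<psi>]) (auto simp: dual_smult[OF \<psi>])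
  have "f v = F"
  proof (rule gr_eqI[OF fh(2)[OF vc] F])
   fix n \<phi> assume \<phi>: "\<phi> \<in> ann H (K n)"
   note r = rep(1-3)[OF F, of n]
   have "hat n \<phi> (f v) = (\<Sum>k\<in>J. c k * hat n \<phi> (f (Q.M k)))" by (rule pv[OF hd[OF \<phi>]])
   also have "... = (\<Sum>k\<in>J. cd k (rep F n) * \<phi> (M k))"
   proof (rule sum.cong[OF refl])
    fix k assume k: "k \<in> J"
    obtain s a b where e: "k = (s, a, b)" by (cases k) auto
    have "hat n \<phi> (f (Q.M k)) = (if n = a + b then \<phi> (mon s a b) else 0)" by (simp add: e Q.M_def hatf[OF \<phi>])
    moreover consider "n = a + b" | "a + b < n" | "n < a + b" by linarith
    then have "(if n = a + b then c k * \<phi> (mon s a b) else 0) = cd k (rep F n) * \<phi> (mon s a b)"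
    proof cases
     case 1
     have "c k = cd k (rep F n)" unfolding c_def e fst_conv snd_conv
      by (rule hat_val[OF F]) (use cdK[of s a b] k e r 1 in auto)
     then show ?thesis using 1 by simp
    next
     case 2
     have "mon s a b \<in> K n" using monK[of s a b] K_mono[of "Suc (a + b)" n] 2 by auto
     then show ?thesis using annD(2)[OF \<phi>] 2 by simp
    next
     case 3
     have "rep F n \<in> K (a + b)" using r(2) K_mono[of "Suc n" "a + b"] 3 by auto
     then show ?thesis using annD(2)[OF cdK[of s a b]] k e 3 by simp
    qed
    ultimately show "c k * hat n \<phi> (f (Q.M k)) = cd k (rep F n) * \<phi> (M k)" by (simp add: e M_def split: if_splits)
   qed
   also have "... = \<phi> (rep F n)" by (rule expand[OF r(3) annD(1)[OF \<phi>], symmetric])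
   also have "... = hat n \<phi> F" by (rule hat_val[OF F \<phi> r(1), symmetric])
   finally show "hat n \<phi> (f v) = hat n \<phi> F" .
  qed
  then show ?thesis using vc by blast
 qed
 have bij: "bij_betw f (carrier ?Q) (carrier G)"
  unfolding bij_betw_def using inj surj fh(2) by auto
 have QM: "Q.M ` J <= carrier ?Q" using Q.M_closed by auto
 have fQM: "f ` Q.M ` J <= carrier G" using QM fh(2) by auto
 have im: "f v \<in> lspan G (f ` Q.M ` J)" if "v \<in> carrier ?Q" for v
  by (rule lin_span_image[OF Q.vs GA.vs fh(1) QM GA.subsp_span[OF fQM] GA.span_base[OF fQM, THEN subsetI] that[folded Q.span]])
 have "lspan G (f ` Q.M ` J) = carrier G"
 proof
  show "lspan G (f ` Q.M ` J) <= carrier G" using GA.subsp_span[OF fQM] by (simp add: subsp_def)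
  show "carrier G <= lspan G (f ` Q.M ` J)" using surj im by blast
 qed
 \<comment> \<open>gr H is spanned by the images of finitely many monomials; from here on its
   comultiplication is under control.\<close>
 then have "GA.fin_dim" by (intro GA.fin_dim_spanI[OF _ fQM]) auto
 then interpret gr_fd H by unfold_locales
 note cG = cospace_gr
 have cQ: "cospace ?Q" by (rule Q.cospace_axioms)
 have eps: "counit G (f v) = counit ?Q v" if v: "v \<in> carrier ?Q" for v
 proof -
  have e0: "counit H \<in> ann H (K 0)" using counit_dual dual_zero[OF counit_dual] by (simp add: ann_def filt_below_0)
  have "counit G F = hat 0 (counit H) F" if F: "F \<in> carrier G" for F
   using counit_gr[OF F rep(1)[OF F]] hat_val[OF F e0 rep(1)[OF F]] by simp
  then have "counit G (f v) = hat 0 (counit H) (f v)" using fh(2)[OF v] by simp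
  also have "... = counit ?Q v"
  proof (rule Q.cd_eqI[OF hd[OF e0] Q.counit_dual _ v])
   fix s a b
   interpret bialg H by (rule bialg_axioms)
   show "hat 0 (counit H) (f (Q.mon s a b)) = counit ?Q (Q.mon s a b)"
    unfolding hatf[OF e0] counit_mon[OF primitive_counit[OF x] primitive_counit[OF y]]
     Q.counit_mon[OF pres_gens(4)[OF cp] pres_gens(5)[OF cp]] by auto
  qed
  finally show ?thesis .
 qed
 have cv: "comult G (f v) = tensor_map G G f f (comult ?Q v)" if v: "v \<in> carrier ?Q" for v
 proof (rule hats_separate[OF gr_comult(1)[OF fh(2)[OF v]]])
  note tm = tensor_map[OF Q.vs Q.vs GA.vs GA.vs fh(1) fh(1) Q.comult_closed[OF v]]
  show "tensor_map G G f f (comult ?Q v) \<in> carrier (tensor G G)" by (rule tm(1))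
  fix m n \<phi> \<psi> assume F: "\<phi> \<in> ann H (K m)" "\<psi> \<in> ann H (K n)"
  note cK = conv_K[OF F]
  have c1: "conv G (hat m \<phi>) (hat n \<psi>) (f u) = hat (m + n) (conv H \<phi> \<psi>) (f u)" if u: "u \<in> carrier ?Q" for u
   using gr_comult(2)[OF fh(2)[OF u] F rep(1)[OF fh(2)[OF u]]] hat_val[OF fh(2)[OF u] cK rep(1)[OF fh(2)[OF u]]] by simp
  have "hat (m + n) (conv H \<phi> \<psi>) (f v) = conv ?Q (%u. hat m \<phi> (f u)) (%u. hat n \<psi> (f u)) v"
  proof (rule Q.cd_eqI[OF hd[OF cK] Q.conv_dual[OF hd[OF F(1)] hd[OF F(2)]] _ v])
   fix s a b
   have "conv ?Q (%u. hat m \<phi> (f u)) (%u. hat n \<psi> (f u)) (Q.mon s a b) =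
    (\<Sum>c\<le>a. \<Sum>d\<le>b. if m + n = a + b then of_nat (a choose c) * of_nat (b choose d) * (\<phi> (mon s c d) * \<psi> (mon s (a - c) (b - d))) else 0)"
    unfolding Q.conv_mon[OF hd[OF F(1)] hd[OF F(2)]] hatf[OF F(1)] hatf[OF F(2)]
   proof (intro sum.cong refl)
    fix c d assume cd: "c \<in> {..a}" "d \<in> {..b}"
    have zc: "\<phi> (mon s c d) = 0" if "c + d < m"
     using annD(2)[OF F(1)] monK[of s c d] K_mono[of "Suc (c + d)" m] that by auto
    have zd: "\<psi> (mon s (a - c) (b - d)) = 0" if "(a - c) + (b - d) < n"
     using annD(2)[OF F(2)] monK[of s "a - c" "b - d"] K_mono[of "Suc ((a - c) + (b - d))" n] that by auto
    show "of_nat (a choose c) * of_nat (b choose d) *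
      ((if m = c + d then \<phi> (mon s c d) else 0) * (if n = a - c + (b - d) then \<psi> (mon s (a - c) (b - d)) else 0)) =
     (if m + n = a + b then of_nat (a choose c) * of_nat (b choose d) * (\<phi> (mon s c d) * \<psi> (mon s (a - c) (b - d))) else 0)"
    proof (cases "m = c + d")
     case True
     then have "n = a - c + (b - d) \<longleftrightarrow> m + n = a + b" using cd by auto
     then show ?thesis using True by auto
    next
     case False
     \<comment> \<open>If \<open>c + d\<close> exceeds \<open>m\<close> while
       \<open>m + n = a + b\<close>, the right factor has degree below \<open>n\<close>.\<close>
     then consider "c + d < m" | "m + n ~= a + b" | "(a - c) + (b - d) < n" using cd by fastforce
     then show ?thesis using False zc zd by cases auto
    qed
   qed
   then show "hat (m + n) (conv H \<phi> \<psi>) (f (Q.mon s a b)) = conv ?Q (%u. hat m \<phi> (f u)) (%u. hat n \<psi> (f u)) (Q.mon s a b)"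
    unfolding hatf[OF cK] conv_mon[OF annD(1)[OF F(1)] annD(1)[OF F(2)]] by simp
  qed
  then show "ev (%a b. hat m \<phi> a * hat n \<psi> b) (comult G (f v)) = ev (%a b. hat m \<phi> a * hat n \<psi> b) (tensor_map G G f f (comult ?Q v))"
   unfolding tm(2)[OF bil_prod[OF hat_dual[OF F(1)] hat_dual[OF F(2)]]] using c1[OF v] by (simp add: conv_def)
 qed
 have "hopf_isomorphic ?Q G"
  unfolding hopf_isomorphic_def using f(1) bij eps cv by blast
 then show ?thesis
  unfolding graded_relators_eq by (rule hopf_iso_sym[OF cQ cG Q.ka k_algebra_gr])
qed

theorem pres_in_family:
 assumes ch: "CHAR('k::field) = p" and p: "p > 0"
 shows "in_family p (pres_hopf (relators p i) :: ('k, (gen list \<Rightarrow>\<^sub>0 'k) set) hopf)" (is "in_family p ?P")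
proof -
 let ?v = "pres_var (relators p i) :: gen => (gen list \<Rightarrow>\<^sub>0 'k) set"
 note mb = pres_mono_basis[OF ch p, of i]
 interpret mono_basis ?P "?v Gen_g" "?v Gen_x" "?v Gen_y" p by (rule mb)
 note h = pres_hopf_algebra[OF ch p, of i]
 have "bialgebra ?P" using h by (simp add: hopf_algebra_def)
 from gr_isomorphic[OF mb this pres_gens(6)[OF ch p]] show ?thesis
  unfolding in_family_def using h pointed fd dim_eq by simp
qed

section \<open>Lifting generators from the associated graded algebra\<close>

lemma (in vspace) span_functional_expansion:
 assumes S: "S <= carrier V" and w: "w \<in> lspan V S"
 obtains I \<mu> where "finite I" "I \<subseteq> S" "!!\<phi>. \<phi> \<in> dual V ==> \<phi> w = (\<Sum>i\<in>I. \<mu> i * \<phi> i)"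
proof -
 obtain \<mu> I where I: "w = lincomb \<mu> I" "finite I" "I \<subseteq> S" using w unfolding span_def by auto
 have ic: "i \<in> carrier V" if "i \<in> I" for i using that I S by blast
 have "\<phi> w = (\<Sum>i\<in>I. \<mu> i * \<phi> i)" if \<phi>: "\<phi> \<in> dual V" for \<phi>
 proof -
  have "\<phi> w = (\<Sum>i\<in>I. \<phi> (\<mu> i \<odot> i))" unfolding I(1) lincomb_def by (rule dual_finsum[OF \<phi>]) (use ic in auto)
  then show ?thesis using ic by (simp add: dual_smult[OF \<phi>])
 qed
 then show ?thesis using that I by blast
qed

text \<open>Grouplike elements are independent, so their number is bounded by the dimension.\<close>

lemma (in prebialg) finite_grouplikes: "finite (grouplikes H)"
proof (rule ccontr)
 assume "infinite (grouplikes H)"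
 then obtain B where B: "finite B" "card B = Suc dim" "B <= grouplikes H" using infinite_arbitrarily_large by blast
 have "indep B (%u. u)" using B by (intro grouplikes_indep) auto
 from indep_card[OF this] B show False by simp
qed

context pointed_bialg
begin

lemma primitive_K1:
 assumes "w \<in> primitives H" "w \<in> K (Suc 0)"
 shows "w = \<zero>"
proof -
 obtain I \<mu> where I: "finite I" "I <= grouplikes H" "!!\<phi>. \<phi> \<in> dual H ==> \<phi> w = (\<Sum>i\<in>I. \<mu> i * \<phi> i)"
  by (rule span_functional_expansion[OF grouplikes_cl assms(2)[unfolded K_1]]) blast
 show ?thesis
  by (rule primitive_span_grouplikes[OF assms(1) I(1), of "%i. i" \<mu>]) (use I in auto)
qed

text \<open>u z v - z is primitive, and it equals (u z - z u) v, which lies in the span of the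
  grouplike elements; hence it is zero. This upgrades commutation in gr H to commutation in
  H.\<close>

lemma commute_lift:
 assumes u: "u \<in> grouplikes H" and v: "v \<in> grouplikes H" "u \<otimes> v = \<one>" "v \<otimes> u = \<one>"
  and z: "z \<in> primitives H" and d: "u \<otimes> z \<ominus> z \<otimes> u \<in> K (Suc 0)"
 shows "u \<otimes> z = z \<otimes> u"
proof -
 note c = grouplike_carrier[OF u] grouplike_carrier[OF v(1)] prim_carrier[OF z]
 let ?c = "u \<otimes> (z \<otimes> v)"
 have "?c \<in> primitives H"
  unfolding primitive_iff[OF one_closed]
 proof (intro conjI ballI)
  fix \<phi> \<psi> assume f: "\<phi> \<in> dual H" "\<psi> \<in> dual H"
  note l = dual_lmult[OF f(1) c(1)] dual_lmult[OF f(2) c(1)]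
  show "conv H \<phi> \<psi> ?c = \<phi> ?c * \<psi> \<one> + \<phi> \<one> * \<psi> ?c"
   unfolding conv_group_mult[OF u m_closed[OF c(3,2)] f] conv_prim_mult[OF z c(2) l]
    conv_group[OF v(1) dual_lmult[OF l(1) c(3)] l(2)] conv_group[OF v(1) l(1) dual_lmult[OF l(2) c(3)]]
   by (simp add: v)
 qed (use c in simp)
 then have p: "?c \<ominus> z \<in> primitives H" by (rule subsp_minus[OF prim_subsp _ z])
 have zu: "z \<otimes> u \<otimes> v = z" using c v by (simp add: m_assoc)
 have "(u \<otimes> z \<ominus> z \<otimes> u) \<otimes> v \<in> K (Suc (0 + 0))" by (rule mult_filtration[OF d]) (use v(1) grouplikes_K1 in auto)
 moreover have "(u \<otimes> z \<ominus> z \<otimes> u) \<otimes> v = ?c \<ominus> z"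
  using c zu by (simp add: a_minus_def l_distr l_minus) (simp add: m_assoc)
 ultimately have "?c \<ominus> z = \<zero>" using primitive_K1[OF p] by simp
 then have e: "?c = z" using c by (metis m_closed a_minus_def add.inv_solve_right' l_zero zero_closed)
 have "u \<otimes> z = ?c \<otimes> u" using c v by (simp add: m_assoc)
 then show ?thesis unfolding e .
qed

end

section \<open>Lifting grouplike and primitive elements of the graded algebra\<close>

context gr_fd
begin

lemma hat_one: "\<phi> \<in> ann H (K i) ==> hat i \<phi> \<one>\<^bsub>G\<^esub> = (if i = 0 then \<phi> \<one> else 0)"
 unfolding gr_one using hat_class[OF one_K] by simp

lemma hat_rep: "F \<in> carrier G ==> \<phi> \<in> ann H (K i) ==> hat i \<phi> F = \<phi> (rep F i)"
 by (rule hat_val[OF _ _ rep(1)])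

text \<open>If the top component of a grouplike element had positive degree \<open>n\<close>, its square would be a component of degree \<open>2n\<close>.\<close>

lemma lift_grouplike:
 assumes F: "F \<in> carrier G" and e: "counit G F = 1"
  and gl: "!!\<Phi> \<Psi>. \<Phi> \<in> dual G ==> \<Psi> \<in> dual G ==> conv G \<Phi> \<Psi> F = \<Phi> F * \<Psi> F"
 obtains u where "u \<in> grouplikes H" "F = gr_class H 0 u"
proof -
 have pr: "conv H \<phi> \<psi> (rep F (i + j)) = \<phi> (rep F i) * \<psi> (rep F j)" if f: "\<phi> \<in> ann H (K i)" "\<psi> \<in> ann H (K j)" for i j \<phi> \<psi>
  using gr_comult(2)[OF F f rep(1)[OF F]] gl[OF hat_dual[OF f(1)] hat_dual[OF f(2)]] by (simp add: hat_rep[OF F] f)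
 let ?S = "{n. \<exists>\<phi>\<in>ann H (K n). \<phi> (rep F n) ~= 0}"
 have "?S \<subseteq> {n. F n ~= K n}" using rep(1)[OF F] annD(2) by force
 then have fin: "finite ?S" using F finite_subset by (auto simp: gr_simps(1))
 have high: "\<phi> (rep F i) = 0" if i: "i > 0" and \<phi>: "\<phi> \<in> ann H (K i)" for i \<phi>
 proof (rule ccontr)
  assume "\<phi> (rep F i) ~= 0"
  then have S: "i \<in> ?S" using \<phi> by blast
  define n where "n = Max ?S"
  have n: "n \<in> ?S" "i \<le> n" unfolding n_def using Max_in[OF fin] Max_ge[OF fin S] S by auto
  obtain \<psi> where \<psi>: "\<psi> \<in> ann H (K n)" "\<psi> (rep F n) ~= 0" using n(1) by blast
  have "conv H \<psi> \<psi> (rep F (n + n)) ~= 0" using pr[OF \<psi>(1) \<psi>(1)] \<psi>(2) by simp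
  then have "n + n \<in> ?S" using conv_K[OF \<psi>(1) \<psi>(1)] by blast
  then have "n + n \<le> n" unfolding n_def by (rule Max_ge[OF fin])
  then show False using n(2) i by simp
 qed
 let ?u = "rep F 0"
 have uK: "?u \<in> K (Suc 0)" by (rule rep(2)[OF F])
 have "F = gr_class H 0 ?u"
 proof (rule gr_eqI[OF F gr_class_cl[OF uK]])
  fix i \<phi> assume \<phi>: "\<phi> \<in> ann H (K i)"
  show "hat i \<phi> F = hat i \<phi> (gr_class H 0 ?u)"
   unfolding hat_rep[OF F \<phi>] hat_class[OF uK \<phi>] using high[of i \<phi>] \<phi> by auto
 qed
 moreover have "?u \<in> grouplikes H"
  unfolding grouplike_iff
  using rep(3)[OF F] counit_gr[OF F rep(1)[OF F]] e pr[of _ 0 _ 0] by (simp add: ann_below_0)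
 ultimately show ?thesis using that by blast
qed

text \<open>A component of degree at least 2 passes the test for the next lower stage, so its class
  is zero; the component of degree 0 is a primitive element in the span of grouplike elements, hence
  zero. The component w of degree 1 is replaced by (id \<otimes> e) \<Delta>(w) - e(w) 1, which
  differs from it by an element of the coradical.\<close>

lemma lift_primitive:
 assumes F: "F \<in> carrier G"
  and pm: "!!\<Phi> \<Psi>. \<Phi> \<in> dual G ==> \<Psi> \<in> dual G ==> conv G \<Phi> \<Psi> F = \<Phi> F * \<Psi> \<one>\<^bsub>G\<^esub> + \<Phi> \<one>\<^bsub>G\<^esub> * \<Psi> F"
 obtains z where "z \<in> primitives H" "z \<in> K (Suc 1)" "F = gr_class H 1 z"
proof -
 have pr: "conv H \<phi> \<psi> (rep F (i + j)) = \<phi> (rep F i) * (if j = 0 then \<psi> \<one> else 0) + (if i = 0 then \<phi> \<one> else 0) * \<psi> (rep F j)"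
  if f: "\<phi> \<in> ann H (K i)" "\<psi> \<in> ann H (K j)" for i j \<phi> \<psi>
  using gr_comult(2)[OF F f rep(1)[OF F]] pm[OF hat_dual[OF f(1)] hat_dual[OF f(2)]] by (simp add: hat_rep[OF F] hat_one f)
 have high: "\<phi> (rep F (Suc (Suc m))) = 0" if \<phi>: "\<phi> \<in> ann H (K (Suc (Suc m)))" for m \<phi>
 proof -
  have "rep F (Suc (Suc m)) \<in> K (Suc (Suc m))"
   unfolding filt_below_Suc corad_filt_Suc_iff
   using rep(3)[OF F] pr[of _ 1 _ "Suc m"] by (simp add: filt_below_Suc)
  then show ?thesis by (rule annD(2)[OF \<phi>])
 qed
 have "rep F 0 \<in> primitives H"
  unfolding primitive_iff[OF one_closed] using rep(3)[OF F] pr[of _ 0 _ 0] by (simp add: ann_below_0)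
 then have z0: "rep F 0 = \<zero>" by (rule primitive_K1[OF _ rep(2)[OF F]])
 define w where "w = rep F 1"
 have wK: "w \<in> K (Suc 1)" and wc: "w \<in> carrier H" unfolding w_def using rep[OF F] by blast+
 have Fw: "F = gr_class H 1 w"
 proof (rule gr_eqI[OF F gr_class_cl[OF wK]])
  fix i \<phi> assume \<phi>: "\<phi> \<in> ann H (K i)"
  consider "i = 0" | "i = 1" | m where "i = Suc (Suc m)" by (cases i; metis One_nat_def not0_implies_Suc)
  then show "hat i \<phi> F = hat i \<phi> (gr_class H 1 w)"
   unfolding hat_rep[OF F \<phi>] hat_class[OF wK \<phi>]
   by cases (use z0 dual_zero[OF annD(1)[OF \<phi>]] high \<phi> in \<open>auto simp: w_def\<close>)
 qed
 have A: "conv H \<phi> \<psi> w = \<phi> w * \<psi> \<one>" if "\<phi> \<in> ann H (K 1)" "\<psi> \<in> dual H" for \<phi> \<psi>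
  using pr[of \<phi> 1 \<psi> 0] that by (simp add: ann_below_0 w_def)
 have B: "conv H \<phi> \<psi> w = \<phi> \<one> * \<psi> w" if "\<phi> \<in> dual H" "\<psi> \<in> ann H (K 1)" for \<phi> \<psi>
  using pr[of \<phi> 0 \<psi> 1] that by (simp add: ann_below_0 w_def)
 obtain e where e: "e \<in> dual H" "e \<one> = 1" "!!u. u \<in> grouplikes H ==> u ~= \<one> ==> e u = 0"
  by (rule grouplike_functional[OF finite_grouplikes order_refl]) blast
 obtain Ew where Ew: "Ew \<in> carrier H" "!!\<phi>. \<phi> \<in> dual H ==> \<phi> Ew = conv H \<phi> e w" by (rule contract[OF wc e(1)]) blast
 define z where "z = Ew \<ominus> e w \<odot> \<one>"
 have zc: "z \<in> carrier H" using Ew(1) by (simp add: z_def)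
 have \<phi>z: "\<phi> z = conv H \<phi> e w - e w * \<phi> \<one>" if "\<phi> \<in> dual H" for \<phi>
  unfolding z_def using Ew that by (simp add: dual_minus[OF that] dual_smult[OF that])
 have one_ann: "\<phi> \<one> = 0" if "\<phi> \<in> ann H (K 1)" for \<phi> using annD(2)[OF that] one_K by simp
 have zw: "\<phi> z = \<phi> w" if "\<phi> \<in> ann H (K 1)" for \<phi>
  using \<phi>z[OF annD(1)[OF that]] A[OF that e(1)] e(2) one_ann[OF that] by simp
 have zK: "z \<in> K (Suc 1)"
  unfolding in_subsp_iff[OF subsp_filt zc]
 proof
  fix \<phi> assume \<phi>: "\<phi> \<in> ann H (K (Suc 1))"
  have "\<phi> \<in> ann H (K 1)" by (rule ann_K_mono[OF _ \<phi>]) simp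
  from zw[OF this] show "\<phi> z = 0" using annD(2)[OF \<phi> wK] by simp
 qed
 have "z \<ominus> w \<in> K 1"
  unfolding in_subsp_iff[OF subsp_filt minus_closed[OF zc wc]]
 proof
  fix \<phi> assume \<phi>: "\<phi> \<in> ann H (K 1)"
  show "\<phi> (z \<ominus> w) = 0" using zw[OF \<phi>] dual_minus[OF annD(1)[OF \<phi>] zc wc] by simp
 qed
 then have "F = gr_class H 1 z" unfolding Fw by (intro gr_class_cong[OF zK wK, symmetric])
 moreover have "z \<in> primitives H"
  unfolding primitive_iff[OF one_closed]
 proof (intro conjI zc ballI)
  fix \<phi> \<psi> assume f: "\<phi> \<in> dual H" "\<psi> \<in> dual H"
  note \<psi>e = conv_dual[OF f(2) e(1)]
  \<comment> \<open>On grouplike elements \<open>e\<close> is supported at the unit, so this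
    difference kills them and fact \<open>B\<close> applies to it.\<close>
  have "(%v. conv H \<psi> e v - \<psi> \<one> * e v) \<in> ann H (K (Suc 0))"
   unfolding ann_K1
  proof (intro conjI ballI dual_closed(2)[OF \<psi>e dual_closed(3)[OF e(1)]])
   fix u assume u: "u \<in> grouplikes H"
   show "conv H \<psi> e u - \<psi> \<one> * e u = 0"
    unfolding conv_group[OF u f(2) e(1)] using e(3)[OF u] by (cases "u = \<one>") simp_all
  qed
  then have "conv H \<phi> (%v. conv H \<psi> e v - \<psi> \<one> * e v) w = \<phi> \<one> * (conv H \<psi> e w - \<psi> \<one> * e w)" using B[OF f(1)] by simp
  then have 1: "conv H \<phi> (conv H \<psi> e) w - \<psi> \<one> * conv H \<phi> e w = \<phi> \<one> * (conv H \<psi> e w - \<psi> \<one> * e w)"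
   unfolding conv_simps(4)[OF wc f(1) \<psi>e dual_closed(3)[OF e(1)]] conv_simps(6)[OF wc f(1) e(1) e(1)] .
  have A': "conv H \<phi> (conv H \<psi> e) w = \<psi> \<one> * conv H \<phi> e w + \<phi> \<one> * (conv H \<psi> e w - \<psi> \<one> * e w)"
   using 1 by (simp add: diff_eq_eq add.commute)
  have "conv H \<phi> \<psi> z = conv H \<phi> (conv H \<psi> e) w - e w * (\<phi> \<one> * \<psi> \<one>)"
   unfolding \<phi>z[OF conv_dual[OF f]] conv_assoc[OF wc f e(1)] conv_one[OF f] ..
  then show "conv H \<phi> \<psi> z = \<phi> z * \<psi> \<one> + \<phi> \<one> * \<psi> z"
   unfolding \<phi>z[OF f(1)] \<phi>z[OF f(2)] A' by (simp add: algebra_simps)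
 qed
 ultimately show ?thesis using that zK by blast
qed

end

lemma (in gxy_free) mono_basisI:
 assumes "dim = p ^ 3"
 shows "mono_basis H g x y p"
proof -
 have "card J = p ^ 3" by (simp add: card_cartesian_product power3_eq_cube)
 then have "lspan H (M ` J) = carrier H" using indep_basis[OF mon_indep] assms by simp
 then show ?thesis by unfold_locales
qed

text \<open>Order of the grouplike, independence of x and y, and commutation are pulled back from
  the presented model through gr H. The dimension \<open>p ^ 3\<close> then turns the independent
  monomials into a basis.\<close>

theorem family_generators:
 fixes H :: "('k::field, 'a, 'm) hopf_scheme" (structure)
 assumes fam: "in_family p H" and cp: "CHAR('k) = p" "p > 0"
 obtains u x y where "mono_basis H u x y p" "!!z. z \<in> primitives H ==> u \<otimes> z = z \<otimes> u"
proof -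
 let ?Q = "pres_hopf (relators p Case_a) :: ('k, (gen list \<Rightarrow>\<^sub>0 'k) set) hopf"
 let ?v = "pres_var (relators p Case_a) :: gen => (gen list \<Rightarrow>\<^sub>0 'k) set"
 have ba: "bialgebra H" and pt: "pointed H" and fdH: "vectorspace.fin_dim class_ring H" and dm: "vectorspace.dim class_ring H = p ^ 3"
  and iso: "hopf_isomorphic (gr_hopf H) ?Q"
  using fam by (simp_all add: in_family_def hopf_algebra_def graded_relators_eq)
 interpret bialg H by (rule bialgI[OF ba fdH])
 interpret pointed_bialg H by unfold_locales (rule pt)
 interpret Q: mono_basis ?Q "?v Gen_g" "?v Gen_x" "?v Gen_y" p by (rule pres_mono_basis[OF cp])
 interpret GA: sep_alg G by (intro sep_alg.intro sep_gr kalg.intro k_algebra_gr)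
 have "GA.fin_dim"
 proof -
  obtain \<theta> where \<theta>: "\<theta> \<in> alg_hom G ?Q" "bij_betw \<theta> (carrier G) (carrier ?Q)" using iso unfolding hopf_isomorphic_def by blast
  define \<xi> where "\<xi> = inv_into (carrier G) \<theta>"
  note \<xi> = lin_maps_inv[OF GA.vs Q.vs alg_homD(1)[OF \<theta>(1)] \<theta>(2), folded \<xi>_def]
  have \<xi>c: "\<xi> w \<in> carrier G" if "w \<in> carrier ?Q" for w using lin_mapsD(1)[OF \<xi>(1) that] .
  have QM: "Q.M ` Q.J <= carrier ?Q" using Q.M_closed by auto
  have fQM: "\<xi> ` Q.M ` Q.J <= carrier G" using QM \<xi>c by auto
  have "F \<in> lspan G (\<xi> ` Q.M ` Q.J)" if F: "F \<in> carrier G" for F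
  proof -
   have "\<xi> (\<theta> F) = F" unfolding \<xi>_def using \<theta>(2) F by (simp add: bij_betw_inv_into_left)
   moreover have "\<theta> F \<in> lspan ?Q (Q.M ` Q.J)" unfolding Q.span by (rule alg_homD(2)[OF \<theta>(1) F])
   from lin_span_image[OF Q.vs GA.vs \<xi>(1) QM GA.subsp_span[OF fQM] GA.span_base[OF fQM, THEN subsetI] this]
   have "\<xi> (\<theta> F) \<in> lspan G (\<xi> ` Q.M ` Q.J)" .
   ultimately show ?thesis by simp
  qed
  then have "carrier G <= lspan G (\<xi> ` Q.M ` Q.J)" by blast
  moreover have "lspan G (\<xi> ` Q.M ` Q.J) <= carrier G" using GA.subsp_span[OF fQM] by (simp add: subsp_def)
  ultimately have "lspan G (\<xi> ` Q.M ` Q.J) = carrier G" by blast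
  then show ?thesis by (intro GA.fin_dim_spanI[OF _ fQM]) auto
 qed
 then interpret gr_fd H by unfold_locales
 have "hopf_isomorphic ?Q G" by (rule hopf_iso_sym[OF cospace_gr Q.cospace_axioms k_algebra_gr Q.ka iso])
 then obtain f where f: "f \<in> alg_hom ?Q G" "bij_betw f (carrier ?Q) (carrier G)"
  "!!v. v \<in> carrier ?Q ==> counit G (f v) = counit ?Q v"
  "!!v \<Phi> \<Psi>. v \<in> carrier ?Q ==> \<Phi> \<in> dual G ==> \<Psi> \<in> dual G ==> conv G \<Phi> \<Psi> (f v) = conv ?Q (%a. \<Phi> (f a)) (%a. \<Psi> (f a)) v"
  unfolding hopf_isomorphic_iff[OF Q.cospace_axioms cospace_gr] by blast
 note fh = alg_homD[OF f(1)]
 have finj: "v = w" if "f v = f w" "v \<in> carrier ?Q" "w \<in> carrier ?Q" for v w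
  using f(2) that by (auto simp: bij_betw_def inj_on_def)
 have dl: "(%a. \<Phi> (f a)) \<in> dual ?Q" if "\<Phi> \<in> dual G" for \<Phi> by (rule dual_lin[OF fh(1) that])
 obtain u where u: "u \<in> grouplikes H" "f (?v Gen_g) = gr_class H 0 u"
 proof (rule lift_grouplike)
  show "f (?v Gen_g) \<in> carrier G" by (rule fh(2)[OF Q.gc])
  show "counit G (f (?v Gen_g)) = 1" using f(3)[OF Q.gc] Q.g by (simp add: grouplikes_def)
  show "conv G \<Phi> \<Psi> (f (?v Gen_g)) = \<Phi> (f (?v Gen_g)) * \<Psi> (f (?v Gen_g))" if "\<Phi> \<in> dual G" "\<Psi> \<in> dual G" for \<Phi> \<Psi>
   unfolding f(4)[OF Q.gc that] by (rule Q.conv_group[OF Q.g dl[OF that(1)] dl[OF that(2)]])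
 qed blast
 have lp: "\<exists>z\<in>primitives H. z \<in> K (Suc 1) & f w = gr_class H 1 z" if w: "w \<in> primitives ?Q" for w
 proof -
  note wc = Q.prim_carrier[OF w]
  obtain z where "z \<in> primitives H" "z \<in> K (Suc 1)" "f w = gr_class H 1 z"
  proof (rule lift_primitive)
   show "f w \<in> carrier G" by (rule fh(2)[OF wc])
   show "conv G \<Phi> \<Psi> (f w) = \<Phi> (f w) * \<Psi> \<one>\<^bsub>G\<^esub> + \<Phi> \<one>\<^bsub>G\<^esub> * \<Psi> (f w)" if "\<Phi> \<in> dual G" "\<Psi> \<in> dual G" for \<Phi> \<Psi>
    unfolding f(4)[OF wc that] Q.conv_prim[OF w dl[OF that(1)] dl[OF that(2)]] fh(3) ..
  qed blast
  then show ?thesis by blast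
 qed
 obtain x where x: "x \<in> primitives H" "x \<in> K (Suc 1)" "f (?v Gen_x) = gr_class H 1 x" using lp[OF Q.x] by blast
 obtain y where y: "y \<in> primitives H" "y \<in> K (Suc 1)" "f (?v Gen_y) = gr_class H 1 y" using lp[OF Q.y] by blast
 have uK: "u \<in> K (Suc 0)" using u(1) grouplikes_K1 by blast
 \<comment> \<open>\<open>K 0\<close> is zero, so passing to the class in degree 0 is
   injective.\<close>
 have c0: "v = w" if e: "gr_class H 0 v = gr_class H 0 w" and K: "v \<in> K (Suc 0)" "w \<in> K (Suc 0)" for v w
 proof (rule sep[OF K_carrier[OF K(1)] K_carrier[OF K(2)]])
  fix \<phi> assume "\<phi> \<in> dual H"
  then have "\<phi> \<in> ann H (K 0)" by (simp add: ann_below_0)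
  then show "\<phi> v = \<phi> w" using hat_class[OF K(1), of \<phi> 0] hat_class[OF K(2), of \<phi> 0] e by simp
 qed
 have pw: "f (?v Gen_g [^]\<^bsub>?Q\<^esub> s) = gr_class H 0 (u [^] s)" for s :: nat
  using alg_hom_pow[OF Q.ka GA.ka f(1) Q.gc, of s] gr_pow[OF uK, of s] by (simp add: u(2))
 have usK: "u [^] (s::nat) \<in> K (Suc 0)" for s using grouplike_pow[OF u(1)] grouplikes_K1 by blast
 have up: "u [^] p = \<one>" using pw[of p] Q.gp fh(3) c0[OF _ usK one_K, of p] by (simp add: gr_one)
 have dis: "inj_on (%s. u [^] (s::nat)) {..<p}"
 proof (rule inj_onI)
  fix s t assume st: "s \<in> {..<p}" "t \<in> {..<p}" "u [^] s = u [^] t"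
  have "?v Gen_g [^]\<^bsub>?Q\<^esub> s = ?v Gen_g [^]\<^bsub>?Q\<^esub> t" by (rule finj) (use pw st(3) Q.gc in auto)
  then show "s = t" using Q.distinct st(1,2) by (auto simp: inj_on_def)
 qed
 note xc = prim_carrier[OF x(1)] and yc = prim_carrier[OF y(1)]
 have fr: "\<alpha> = 0 & \<beta> = 0" if e: "\<alpha> \<odot> x \<oplus> \<beta> \<odot> y = \<zero>" for \<alpha> \<beta>
 proof (rule Q.xy_free, rule finj)
  have cG: "gr_class H 1 x \<in> carrier G" "gr_class H 1 y \<in> carrier G" using gr_class_cl x(2) y(2) by auto
  have "f (\<alpha> \<odot>\<^bsub>?Q\<^esub> ?v Gen_x \<oplus>\<^bsub>?Q\<^esub> \<beta> \<odot>\<^bsub>?Q\<^esub> ?v Gen_y) = \<alpha> \<odot>\<^bsub>G\<^esub> gr_class H 1 x \<oplus>\<^bsub>G\<^esub> \<beta> \<odot>\<^bsub>G\<^esub> gr_class H 1 y"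
   using fh(5,6) Q.xc Q.yc x(3) y(3) by simp
  also have "... = \<zero>\<^bsub>G\<^esub>"
  proof (rule gr_eqI)
   fix i \<phi> assume \<phi>: "\<phi> \<in> ann H (K i)"
   have "\<alpha> * \<phi> x + \<beta> * \<phi> y = 0"
    using e dual_zero[OF annD(1)[OF \<phi>]] dual_add[OF annD(1)[OF \<phi>], of "\<alpha> \<odot> x" "\<beta> \<odot> y"] dual_smult[OF annD(1)[OF \<phi>]] xc yc by simp
   then show "hat i \<phi> (\<alpha> \<odot>\<^bsub>G\<^esub> gr_class H 1 x \<oplus>\<^bsub>G\<^esub> \<beta> \<odot>\<^bsub>G\<^esub> gr_class H 1 y) = hat i \<phi> \<zero>\<^bsub>G\<^esub>"
    using cG gr_zero(2)[OF \<phi>] dual_add[OF hat_dual[OF \<phi>]] dual_smult[OF hat_dual[OF \<phi>]] hat_class[OF x(2) \<phi>] hat_class[OF y(2) \<phi>] by simp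
  qed (use cG in auto)
  finally show "f (\<alpha> \<odot>\<^bsub>?Q\<^esub> ?v Gen_x \<oplus>\<^bsub>?Q\<^esub> \<beta> \<odot>\<^bsub>?Q\<^esub> ?v Gen_y) = f \<zero>\<^bsub>?Q\<^esub>"
   using lin_maps_zero[OF Q.vs GA.vs fh(1)] by simp
 qed (use Q.xc Q.yc in auto)
 interpret N: gxy_free H u x y p
  by unfold_locales (use u(1) up x(1) y(1) cp dis fr in auto)
 have mb: "mono_basis H u x y p" by (rule N.mono_basisI[OF dm])
 interpret N: mono_basis H u x y p by (rule mb)
 have v: "u [^] (p - 1) \<in> grouplikes H" "u \<otimes> u [^] (p - 1) = \<one>" "u [^] (p - 1) \<otimes> u = \<one>"
 proof -
  have s: "p = Suc (p - 1)" using cp(2) by simp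
  show "u [^] (p - 1) \<in> grouplikes H" by (rule grouplike_pow[OF u(1)])
  have e: "u [^] Suc (p - 1) = \<one>" unfolding s[symmetric] by (rule up)
  show "u [^] (p - 1) \<otimes> u = \<one>" "u \<otimes> u [^] (p - 1) = \<one>"
   using e nat_pow_Suc[of u "p - 1"] nat_pow_Suc2[OF N.gc, of "p - 1"] by metis+
 qed
 have cm: "u \<otimes> z = z \<otimes> u" if z: "z \<in> primitives H" "z \<in> K (Suc 1)" "f w = gr_class H 1 z" "w \<in> carrier ?Q"
   "?v Gen_g \<otimes>\<^bsub>?Q\<^esub> w = w \<otimes>\<^bsub>?Q\<^esub> ?v Gen_g" for z w
 proof (rule commute_lift[OF u(1) v z(1)])
  note zc = prim_carrier[OF z(1)]
  have "f (?v Gen_g) \<otimes>\<^bsub>G\<^esub> f w = f w \<otimes>\<^bsub>G\<^esub> f (?v Gen_g)" using fh(4)[OF Q.gc z(4)] fh(4)[OF z(4) Q.gc] z(5) by simp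
  then have "gr_class H (0 + 1) (u \<otimes> z) = gr_class H (1 + 0) (z \<otimes> u)"
   unfolding u(2) z(3) hat_class_mult[OF uK z(2)] hat_class_mult[OF z(2) uK] .
  then have e: "gr_class H 1 (u \<otimes> z) = gr_class H 1 (z \<otimes> u)" by simp
  have K: "u \<otimes> z \<in> K (Suc 1)" "z \<otimes> u \<in> K (Suc 1)" using mult_filtration[OF uK z(2)] mult_filtration[OF z(2) uK] by simp_all
  have uc: "u \<otimes> z \<in> carrier H" "z \<otimes> u \<in> carrier H" using N.gc zc by auto
  have "\<phi> (u \<otimes> z \<ominus> z \<otimes> u) = 0" if \<phi>: "\<phi> \<in> ann H (K 1)" for \<phi>
   using hat_class[OF K(1) \<phi>] hat_class[OF K(2) \<phi>] e dual_minus[OF annD(1)[OF \<phi>] uc] by simp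
  then show "u \<otimes> z \<ominus> z \<otimes> u \<in> K (Suc 0)"
   unfolding in_subsp_iff[OF subsp_filt minus_closed[OF uc]] by simp
 qed
 have rl: "?v Gen_g \<otimes>\<^bsub>?Q\<^esub> ?v Gen_x = ?v Gen_x \<otimes>\<^bsub>?Q\<^esub> ?v Gen_g" "?v Gen_g \<otimes>\<^bsub>?Q\<^esub> ?v Gen_y = ?v Gen_y \<otimes>\<^bsub>?Q\<^esub> ?v Gen_g"
  using pres_gens(6)[OF cp, of Case_a] by (simp_all add: satisfies_def)
 note cx = cm[OF x Q.xc rl(1)] and cy = cm[OF y Q.yc rl(2)]
 have "u \<otimes> z = z \<otimes> u" if z: "z \<in> primitives H" for z
 proof -
  obtain \<alpha> \<beta> where "z = \<alpha> \<odot> x \<oplus> \<beta> \<odot> y" using N.primitives_span[OF z] by blast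
  then show ?thesis using cx cy N.gc xc yc by (simp add: l_distr r_distr smult_mult)
 qed
 with mb show ?thesis by (rule that)
qed

section \<open>Isomorphisms from the relations\<close>

text \<open>Monomials go to monomials with the same exponents, and convolution and counit on
  monomials depend only on the exponents. Bijectivity is seen in coordinates.\<close>

lemma mono_basis_isomorphic:
 assumes P: "mono_basis P g x y p" and H: "mono_basis H g' x' y' p"
  and f: "f \<in> alg_hom P H" "f g = g'" "f x = x'" "f y = y'"
  and e: "counit P x = 0" "counit P y = 0" "counit H x' = 0" "counit H y' = 0"
 shows "hopf_isomorphic P H"
proof -
 interpret P: mono_basis P g x y p by (rule P)
 interpret H: mono_basis H g' x' y' p by (rule H)
 note fh = alg_homD[OF f(1)]
 note pw = alg_hom_pow[OF P.ka H.ka f(1)]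
 have fm: "f (P.mon s a b) = H.mon s a b" for s a b
  using P.gc P.xc P.yc by (simp add: P.mon_def H.mon_def fh(4) pw f(2-4))
 have dl: "(%v. \<phi> (f v)) \<in> dual P" if "\<phi> \<in> dual H" for \<phi> by (rule dual_lin[OF fh(1) that])
 have co: "H.cd k (f v) = P.cd k v" if k: "k \<in> P.J" and v: "v \<in> carrier P" for k v
 proof -
  obtain s a b where e: "k = (s, a, b)" by (cases k) auto
  show ?thesis
   unfolding e by (rule P.cd_eqI[OF dl[OF H.cd_dual] P.cd_dual _ v])
    (use k in \<open>auto simp: e fm P.cd_mon H.cd_mon\<close>)
 qed
 have "inj_on f (carrier P)"
 proof (rule inj_onI)
  fix v w assume vw: "v \<in> carrier P" "w \<in> carrier P" "f v = f w"
  have c: "P.cd k v = P.cd k w" if "k \<in> P.J" for k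
   using co[OF that vw(1)] co[OF that vw(2)] vw(3) by simp
  show "v = w"
  proof (rule P.sep[OF vw(1,2)])
   fix \<psi> assume \<psi>: "\<psi> \<in> dual P"
   show "\<psi> v = \<psi> w" unfolding P.expand[OF vw(1) \<psi>] P.expand[OF vw(2) \<psi>] using c by (intro sum.cong) auto
  qed
 qed
 moreover have "F \<in> f ` carrier P" if F: "F \<in> carrier H" for F
 proof -
  define v where "v = (\<Oplus>\<^bsub>P\<^esub>k\<in>P.J. H.cd k F \<odot>\<^bsub>P\<^esub> P.M k)"
  have vc: "v \<in> carrier P" unfolding v_def using P.M_closed by (intro P.finsum_closed) auto
  have pv: "\<psi> v = (\<Sum>k\<in>P.J. H.cd k F * \<psi> (P.M k))" if \<psi>: "\<psi> \<in> dual P" for \<psi>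
   unfolding v_def using P.M_closed by (subst P.dual_finsum[OF \<psi>]) (auto simp: dual_smult[OF \<psi>])
  have fM: "f (P.M k) = H.M k" for k by (cases k) (simp add: P.M_def H.M_def fm)
  have "f v = F"
  proof (rule H.sep[OF fh(2)[OF vc] F])
   fix \<phi> assume \<phi>: "\<phi> \<in> dual H"
   show "\<phi> (f v) = \<phi> F" unfolding pv[OF dl[OF \<phi>]] fM H.expand[OF F \<phi>] ..
  qed
  then show ?thesis using vc by blast
 qed
 ultimately have "bij_betw f (carrier P) (carrier H)" unfolding bij_betw_def using fh(2) by auto
 moreover have "counit H (f v) = counit P v" if v: "v \<in> carrier P" for v
  by (rule P.cd_eqI[OF dl[OF H.counit_dual] P.counit_dual _ v])
   (simp add: fm P.counit_mon[OF e(1,2)] H.counit_mon[OF e(3,4)])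
 moreover have "conv H \<phi> \<psi> (f v) = conv P (%a. \<phi> (f a)) (%a. \<psi> (f a)) v"
  if v: "v \<in> carrier P" and F: "\<phi> \<in> dual H" "\<psi> \<in> dual H" for v \<phi> \<psi>
  by (rule P.cd_eqI[OF dl[OF H.conv_dual[OF F]] P.conv_dual[OF dl[OF F(1)] dl[OF F(2)]] _ v])
   (simp add: fm H.conv_mon[OF F] P.conv_mon[OF dl[OF F(1)] dl[OF F(2)]])
 ultimately show ?thesis
  unfolding hopf_isomorphic_iff[OF P.cospace_axioms H.cospace_axioms] using f(1) by blast
qed

lemma satisfies_isomorphic:
 fixes H :: "('k::field, 'a, 'm) hopf_scheme"
 assumes mb: "mono_basis H g x y p" and ba: "bialgebra H" and sat: "satisfies p i H g x y"
 shows "hopf_isomorphic H (pres_hopf (relators p i))"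
proof -
 interpret H: mono_basis H g x y p by (rule mb)
 interpret H: bialg H by unfold_locales (rule ba)
 note cp = H.char H.p
 let ?P = "pres_hopf (relators p i) :: ('k, (gen list \<Rightarrow>\<^sub>0 'k) set) hopf"
 let ?v = "pres_var (relators p i) :: gen => (gen list \<Rightarrow>\<^sub>0 'k) set"
 note pm = pres_mono_basis[OF cp, of i]
 interpret P: mono_basis ?P "?v Gen_g" "?v Gen_x" "?v Gen_y" p by (rule pm)
 define \<gamma> where "\<gamma> a = (case a of Gen_g => g | Gen_x => x | Gen_y => y)" for a
 have \<gamma>: "\<gamma> a \<in> carrier H" for a using H.gc H.xc H.yc by (cases a) (auto simp: \<gamma>_def)
 obtain f where f: "f \<in> alg_hom ?P H" "!!a. f (?v a) = \<gamma> a"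
  by (rule pres_hom_lift[OF cp H.sep_alg_axioms, of \<gamma> i]) (use \<gamma> sat in \<open>auto simp: \<gamma>_def\<close>)
 have "hopf_isomorphic ?P H"
  by (rule mono_basis_isomorphic[OF pm mb f(1)])
   (simp_all add: f(2) \<gamma>_def pres_gens[OF cp] H.primitive_counit[OF H.x] H.primitive_counit[OF H.y])
 then show ?thesis by (rule hopf_iso_sym[OF P.cospace_axioms H.cospace_axioms P.ka H.ka])
qed

section \<open>Restricted Lie algebras of dimension two\<close>

text \<open>The scalar that turns an eigenvector of the p-th power map into a fixed vector: if w^p =
  a w, then (c w)^p = c^p a w = c w.\<close>

lemma exists_root_inverse:
 assumes "(a::'k::alg_closed_field) ~= 0" "n > 1"
 obtains c where "c ~= 0" "c ^ n * a = c"
proof -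
 obtain c where c: "c ^ (n - 1) = inverse a" using nth_root_exists[of "n - 1" "inverse a"] assms(2) by auto
 have "c ~= 0" using c assms by (auto simp: power_0_left split: if_splits)
 moreover have "c ^ n = c * c ^ (n - 1)" using assms(2) by (cases n) auto
 ultimately show ?thesis using that c assms(1) by simp
qed

text \<open>Let F be the p-th power map with F(F x) = \<alpha> x + \<beta> F x. Then s x + d F x is
  fixed by F if s = d^p \<alpha> and s^p + d^p \<beta> = d. Divided by d this is a polynomial
  equation with constant term -1, so its roots are nonzero.\<close>

lemma exists_root_semilinear:
 assumes "(\<alpha>::'k::alg_closed_field) ~= 0 | \<beta> ~= 0" "p > 1"
 obtains d where "d ~= 0" "(d ^ p * \<alpha>) ^ p + d ^ p * \<beta> = d"
proof -
 define q where "q = monom (\<alpha> ^ p) (p * p - 1) + monom \<beta> (p - 1) + [:-1:]"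
 have n: "p * p - 1 > p - 1" "p - 1 > 0"
 proof -
  show "p - 1 > 0" using assms(2) by simp
  have "p * 1 < p * p" using assms(2) by (intro mult_strict_left_mono) auto
  then show "p * p - 1 > p - 1" using assms(2) by linarith
 qed
 have m: "coeff [:-1::'k:] m = 0" if "m > 0" for m using that by (cases m) auto
 have "degree q > 0"
 proof (cases "\<alpha> = 0")
  case False
  have "coeff q (p * p - 1) = \<alpha> ^ p" unfolding q_def using n m[of "p * p - 1"] by simp
  then have "p * p - 1 \<le> degree q" using False by (intro le_degree) simp
  then show ?thesis using n by linarith
 next
  case True
  have "coeff q (p - 1) = \<beta>" unfolding q_def using n m[of "p - 1"] True assms(2) by simp
  then have "p - 1 \<le> degree q" using True assms(1) by (intro le_degree) simp
  then show ?thesis using n by linarith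
 qed
 then obtain d where "poly q d = 0" using alg_closed_imp_poly_has_root by blast
 then have d: "\<alpha> ^ p * d ^ (p * p - 1) + \<beta> * d ^ (p - 1) = 1" by (simp add: q_def poly_monom)
 have d0: "d ~= 0"
 proof
  assume "d = 0"
  then have e: "\<alpha> ^ p * 0 ^ (p * p - 1) + \<beta> * 0 ^ (p - 1) = 1" using d by simp
  have z: "(0::'k) ^ (p * p - 1) = 0" by (rule zero_power) (use n in linarith)
  have z': "(0::'k) ^ (p - 1) = 0" by (rule zero_power[OF n(2)])
  show False using e unfolding z z' by simp
 qed
 have e: "d ^ (p * p) = d * d ^ (p * p - 1)" "d ^ p = d * d ^ (p - 1)"
  using n assms(2) by (simp_all flip: power_Suc)
 have "(d ^ p * \<alpha>) ^ p + d ^ p * \<beta> = d ^ (p * p) * \<alpha> ^ p + d ^ p * \<beta>"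
  by (simp add: power_mult_distrib power_mult)
 also have "... = d * (\<alpha> ^ p * d ^ (p * p - 1) + \<beta> * d ^ (p - 1))" unfolding e by (simp only: distrib_left mult_ac)
 finally show ?thesis using that d0 d by simp
qed

text \<open>An equation of Artin-Schreier type; it gives the multiple of a fixed vector by which a
  second vector has to be corrected to become fixed as well.\<close>

lemma exists_root_artin_schreier:
 assumes "p > 1"
 obtains c where "c ^ p + (a::'k::alg_closed_field) = c"
proof -
 define q where "q = monom 1 p + [:a, -1:]"
 have "coeff [:a, -1:] p = 0" using assms by (cases p; cases "p - 1") auto
 then have "coeff q p = 1" by (simp add: q_def)
 then have "p \<le> degree q" by (intro le_degree) simp
 then have "degree q > 0" using assms by simp
 then obtain c where "poly q c = 0" using alg_closed_imp_poly_has_root by blast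
 then show ?thesis using that[of c] by (simp add: q_def poly_monom algebra_simps)
qed

text \<open>A classification inside the plane of primitive elements with its bracket and its p-th
  power map F. A nonabelian plane leads to case e. On an abelian plane F is additive and semilinear:
  a nonzero kernel leads to a, b or c, while trivial kernel gives a basis of fixed vectors, which is
  case d.\<close>

theorem exists_normal_form:
 fixes H :: "('k::alg_closed_field, 'a, 'm) hopf_scheme" (structure)
 assumes mb: "mono_basis H g x y p" and central: "!!z. z \<in> primitives H ==> g \<otimes> z = z \<otimes> g"
 shows "\<exists>i x' y'. mono_basis H g x' y' p & satisfies p i H g x' y'"
proof -
 interpret mono_basis H g x y p by (rule mb)
 \<comment> \<open>Independence of two vectors in terms of functionals, so that relations can be
   multiplied by elements of H before coefficients are compared.\<close>
 define ind where "ind u v \<longleftrightarrow> (\<forall>s t. (\<forall>\<phi>\<in>dual H. s * \<phi> u + t * \<phi> v = 0) --> s = 0 & t = 0)" for u v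
 note pc = prim_carrier and lin = dual_add dual_smult
 have pcl: "\<alpha> \<odot> u \<oplus> \<beta> \<odot> v \<in> primitives H" "\<alpha> \<odot> u \<in> primitives H" if "u \<in> primitives H" "v \<in> primitives H" for u v \<alpha> \<beta>
  using prim_subsp that by (auto simp: subsp_def)
 have sp: "!!z. z \<in> primitives H ==> \<exists>\<alpha> \<beta>. z = \<alpha> \<odot> u \<oplus> \<beta> \<odot> v" and mbI: "mono_basis H g u v p"
  if uv: "u \<in> primitives H" "v \<in> primitives H" "ind u v" for u v
 proof -
  have "\<alpha> = 0 & \<beta> = 0" if e: "\<alpha> \<odot> u \<oplus> \<beta> \<odot> v = \<zero>" for \<alpha> \<beta>
  proof -
   have "\<alpha> * \<phi> u + \<beta> * \<phi> v = 0" if \<phi>: "\<phi> \<in> dual H" for \<phi>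
    using e dual_zero[OF \<phi>] dual_add[OF \<phi>, of "\<alpha> \<odot> u" "\<beta> \<odot> v"] dual_smult[OF \<phi>] pc[OF uv(1)] pc[OF uv(2)] by simp
   then show ?thesis using uv(3) unfolding ind_def by blast
  qed
  then interpret N: gxy_free H g u v p
   by unfold_locales (use g gp uv char p distinct in auto)
  show m: "mono_basis H g u v p" by (rule N.mono_basisI[OF dim_eq])
  show "\<exists>\<alpha> \<beta>. z = \<alpha> \<odot> u \<oplus> \<beta> \<odot> v" if "z \<in> primitives H" for z by (rule mono_basis.primitives_span[OF m that])
 qed
 have xy: "ind x y"
  unfolding ind_def
 proof (intro allI impI)
  fix s t assume "\<forall>\<phi>\<in>dual H. s * \<phi> x + t * \<phi> y = 0"
  then have "s \<odot> x \<oplus> t \<odot> y = \<zero>" using xc yc by (intro sep) (simp_all add: lin dual_zero)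
  then show "s = 0 & t = 0" by (rule xy_free)
 qed
 have zero: "z = \<zero>" if "z \<in> carrier H" "!!\<phi>. \<phi> \<in> dual H ==> \<phi> z = 0" for z
 proof (rule sep[OF that(1) zero_closed])
  fix \<phi> assume \<phi>: "\<phi> \<in> dual H"
  show "\<phi> z = \<phi> \<zero>" using that(2)[OF \<phi>] dual_zero[OF \<phi>] by simp
 qed
 have swap: "ind v u" if "ind u v" for u v using that unfolding ind_def by (metis add.commute)
 have compl: "\<exists>w\<in>primitives H. ind w z" if z: "z \<in> primitives H" "z ~= \<zero>" for z
 proof -
  obtain \<alpha> \<beta> where e: "z = \<alpha> \<odot> x \<oplus> \<beta> \<odot> y" using sp[OF x y xy z(1)] by blast
  have \<phi>z: "\<phi> z = \<alpha> * \<phi> x + \<beta> * \<phi> y" if "\<phi> \<in> dual H" for \<phi> using that xc yc by (simp add: e lin)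
  show ?thesis
  proof (cases "\<alpha> = 0")
   case False
   have "ind y z"
    unfolding ind_def
   proof (intro allI impI)
    fix s t assume h: "\<forall>\<phi>\<in>dual H. s * \<phi> y + t * \<phi> z = 0"
    have "(t * \<alpha>) * \<phi> x + (s + t * \<beta>) * \<phi> y = 0" if \<phi>: "\<phi> \<in> dual H" for \<phi>
     using bspec[OF h \<phi>] unfolding \<phi>z[OF \<phi>] by (simp add: algebra_simps)
    then have "t * \<alpha> = 0 & s + t * \<beta> = 0" using xy unfolding ind_def by blast
    then show "s = 0 & t = 0" using False by auto
   qed
   then show ?thesis using y by blast
  next
   case True
   have b: "\<beta> ~= 0" using z(2) e True xc yc by auto
   have "ind x z"
    unfolding ind_def
   proof (intro allI impI)
    fix s t assume h: "\<forall>\<phi>\<in>dual H. s * \<phi> x + t * \<phi> z = 0"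
    have "s * \<phi> x + (t * \<beta>) * \<phi> y = 0" if \<phi>: "\<phi> \<in> dual H" for \<phi>
     using bspec[OF h \<phi>] unfolding \<phi>z[OF \<phi>] True by (simp add: algebra_simps)
    then have "s = 0 & t * \<beta> = 0" using xy unfolding ind_def by blast
    then show "s = 0 & t = 0" using b by simp
   qed
   then show ?thesis using x by blast
  qed
 qed
 have fin: ?thesis
  if "u \<in> primitives H" "v \<in> primitives H" "ind u v" "u [^] p = rhs_x i \<zero> u v" "v [^] p = rhs_y i \<zero> v" "u \<otimes> v = v \<otimes> u \<oplus> rhs_c i \<zero> v"
  for u v i
  using mbI[OF that(1-3)] central that gp unfolding satisfies_def by blast
 show ?thesis
 proof (cases "x \<otimes> y = y \<otimes> x")
  case False
  define z where "z = x \<otimes> y \<ominus> y \<otimes> x"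
  have zp: "z \<in> primitives H" unfolding z_def by (rule primitive_commutator[OF x y])
  note zc = pc[OF zp]
  have \<phi>z: "\<phi> z = \<phi> (x \<otimes> y) - \<phi> (y \<otimes> x)" if "\<phi> \<in> dual H" for \<phi> using that xc yc by (simp add: z_def dual_minus)
  have z0: "z ~= \<zero>"
  proof
   assume z: "z = \<zero>"
   have "x \<otimes> y = y \<otimes> x"
   proof (rule sep)
    fix \<phi> assume \<phi>: "\<phi> \<in> dual H"
    show "\<phi> (x \<otimes> y) = \<phi> (y \<otimes> x)" using \<phi>z[OF \<phi>] dual_zero[OF \<phi>] z by simp
   qed (use xc yc in auto)
   then show False using False by simp
  qed
  have znz: "s = 0" if "!!\<phi>. \<phi> \<in> dual H ==> s * \<phi> z = 0" for s
  proof (rule ccontr)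
   assume s: "s ~= 0"
   have "\<phi> z = 0" if \<phi>: "\<phi> \<in> dual H" for \<phi> using that s \<open>!!\<phi>. \<phi> \<in> dual H ==> s * \<phi> z = 0\<close>[OF \<phi>] by simp
   then show False using zero[OF zc] z0 by blast
  qed
  obtain \<alpha> \<beta> where e: "z = \<alpha> \<odot> x \<oplus> \<beta> \<odot> y" using sp[OF x y xy zp] by blast
  \<comment> \<open>The commutator \<open>z\<close> spans the derived algebra; a multiple of
    \<open>y\<close>, or of \<open>x\<close> if \<open>z\<close> is a multiple of \<open>y\<close>,
    satisfies [w, z] = z.\<close>
  have "\<exists>w\<in>primitives H. \<forall>\<phi>\<in>dual H. \<phi> (w \<otimes> z) = \<phi> (z \<otimes> w) + \<phi> z"
  proof (cases "\<alpha> = 0")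
   case F: False
   have "\<phi> (((- 1 / \<alpha>) \<odot> y) \<otimes> z) = \<phi> (z \<otimes> ((- 1 / \<alpha>) \<odot> y)) + \<phi> z" if \<phi>: "\<phi> \<in> dual H" for \<phi>
    unfolding \<phi>z[OF \<phi>] unfolding e using F \<phi> xc yc by (simp add: smult_mult l_distr r_distr lin field_simps)
   then show ?thesis using pcl(2)[OF y y] by blast
  next
   case T: True
   have b: "\<beta> ~= 0" using e T z0 yc xc by auto
   have "\<phi> (((1 / \<beta>) \<odot> x) \<otimes> z) = \<phi> (z \<otimes> ((1 / \<beta>) \<odot> x)) + \<phi> z" if \<phi>: "\<phi> \<in> dual H" for \<phi>
    unfolding \<phi>z[OF \<phi>] unfolding e using T b \<phi> xc yc by (simp add: smult_mult l_distr r_distr lin field_simps)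
   then show ?thesis using pcl(2)[OF x x] by blast
  qed
  then obtain w where w: "w \<in> primitives H" "!!\<phi>. \<phi> \<in> dual H ==> \<phi> (w \<otimes> z) = \<phi> (z \<otimes> w) + \<phi> z" by blast
  note wc = pc[OF w(1)]
  have wz: "w \<otimes> z = z \<otimes> w \<oplus> z"
  proof (rule sep)
   fix \<phi> assume \<phi>: "\<phi> \<in> dual H"
   show "\<phi> (w \<otimes> z) = \<phi> (z \<otimes> w \<oplus> z)" using w(2)[OF \<phi>] dual_add[OF \<phi> m_closed[OF zc wc] zc] by simp
  qed (use wc zc in auto)
  \<comment> \<open>Multiplying a relation s w + t z = 0 by \<open>z\<close> from both sides and
    subtracting gives s [w, z] = s z = 0.\<close>
  have iwz: "ind w z"
   unfolding ind_def
  proof (intro allI impI)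
   fix s t assume a: "\<forall>\<phi>\<in>dual H. s * \<phi> w + t * \<phi> z = 0"
   have "s * \<phi> z = 0" if \<phi>: "\<phi> \<in> dual H" for \<phi>
   proof -
    have "s * \<phi> (w \<otimes> z) + t * \<phi> (z \<otimes> z) = 0" "s * \<phi> (z \<otimes> w) + t * \<phi> (z \<otimes> z) = 0"
     using bspec[OF a dual_rmult[OF \<phi> zc]] bspec[OF a dual_lmult[OF \<phi> zc]] by simp_all
    then have "s * \<phi> (w \<otimes> z) = s * \<phi> (z \<otimes> w)" by (metis add_right_cancel)
    then show ?thesis unfolding w(2)[OF \<phi>] by (simp add: distrib_left)
   qed
   then have s: "s = 0" by (rule znz)
   have "t = 0"
   proof (rule znz)
    fix \<phi> assume \<phi>: "\<phi> \<in> dual H"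
    show "t * \<phi> z = 0" using bspec[OF a \<phi>] s by simp
   qed
   then show "s = 0 & t = 0" using s by simp
  qed
  \<comment> \<open>Iterates w z = z (w + 1). For n = p it yields [w^p, z] = z.\<close>
  have wn: "w [^] n \<otimes> z = z \<otimes> (w \<oplus> \<one>) [^] n" for n :: nat
  proof (induction n)
   case (Suc n)
   have "w [^] Suc n \<otimes> z = w [^] n \<otimes> (z \<otimes> (w \<oplus> \<one>))" using wc zc wz by (simp add: m_assoc r_distr)
   also have "... = (w [^] n \<otimes> z) \<otimes> (w \<oplus> \<one>)" using wc zc by (simp add: m_assoc)
   finally show ?case unfolding Suc using wc zc by (simp add: m_assoc)
  qed (use zc in simp)
  have wp: "w [^] p \<otimes> z = z \<otimes> w [^] p \<oplus> z"
   using wn[of p] freshman[OF char p wc one_closed] wc zc by (simp add: r_distr)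
  \<comment> \<open>In other words [w, z^n] = n z^n, which vanishes for n = p.\<close>
  have zn: "\<phi> (w \<otimes> z [^] n) = \<phi> (z [^] n \<otimes> w) + of_nat n * \<phi> (z [^] n)" if "\<phi> \<in> dual H" for n :: nat and \<phi>
   using that
  proof (induction n arbitrary: \<phi>)
   case (Suc n)
   note f = Suc.prems and zn = nat_pow_closed[OF zc, of n]
   have "\<phi> (w \<otimes> z [^] Suc n) = \<phi> ((w \<otimes> z [^] n) \<otimes> z)" using wc zc by (simp add: m_assoc)
   also have "... = \<phi> ((z [^] n \<otimes> w) \<otimes> z) + of_nat n * \<phi> (z [^] n \<otimes> z)" by (rule Suc.IH[OF dual_rmult[OF f zc]])
   also have "(z [^] n \<otimes> w) \<otimes> z = z [^] n \<otimes> (w \<otimes> z)" using wc zc by (simp add: m_assoc)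
   also have "\<phi> (z [^] n \<otimes> (w \<otimes> z)) = \<phi> (z [^] n \<otimes> (z \<otimes> w)) + \<phi> (z [^] n \<otimes> z)" by (rule w(2)[OF dual_lmult[OF f zn]])
   finally show ?case using wc zc by (simp add: m_assoc algebra_simps)
  qed (use wc in simp)
  have cz: "of_nat p = (0::'k)" using char of_nat_CHAR[where 'a = 'k] by simp
  obtain s t where st: "w [^] p = s \<odot> w \<oplus> t \<odot> z" using sp[OF w(1) zp iwz prim_pow_char[OF char p w(1)]] by blast
  \<comment> \<open>The coefficients of w^p follow from w^p commuting with w and from [w^p, z] = z;
    those of z^p follow from z^p commuting with z and with w.\<close>
  have t: "t = 0"
  proof (rule znz)
   fix \<phi> assume \<phi>: "\<phi> \<in> dual H"
   have "w \<otimes> w [^] p = w [^] p \<otimes> w" using nat_pow_Suc2[OF wc, of p] by simp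
   then have "\<phi> (w \<otimes> (s \<odot> w \<oplus> t \<odot> z)) = \<phi> ((s \<odot> w \<oplus> t \<odot> z) \<otimes> w)" unfolding st by simp
   then show "t * \<phi> z = 0" using \<phi> wc zc w(2)[OF \<phi>] by (simp add: smult_mult l_distr r_distr lin algebra_simps)
  qed
  have s: "s - 1 = 0"
  proof (rule znz)
   fix \<phi> assume \<phi>: "\<phi> \<in> dual H"
   have "\<phi> ((s \<odot> w \<oplus> t \<odot> z) \<otimes> z) = \<phi> (z \<otimes> (s \<odot> w \<oplus> t \<odot> z) \<oplus> z)" using wp unfolding st by simp
   then show "(s - 1) * \<phi> z = 0" using \<phi> wc zc w(2)[OF \<phi>] by (simp add: smult_mult l_distr r_distr lin algebra_simps)
  qed
  have ww: "w [^] p = w" using st s t wc zc by simp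
  obtain s' t' where st': "z [^] p = s' \<odot> w \<oplus> t' \<odot> z" using sp[OF w(1) zp iwz prim_pow_char[OF char p zp]] by blast
  have s': "s' = 0"
  proof (rule znz)
   fix \<phi> assume \<phi>: "\<phi> \<in> dual H"
   have "z \<otimes> z [^] p = z [^] p \<otimes> z" using nat_pow_Suc2[OF zc, of p] by simp
   then have "\<phi> (z \<otimes> (s' \<odot> w \<oplus> t' \<odot> z)) = \<phi> ((s' \<odot> w \<oplus> t' \<odot> z) \<otimes> z)" unfolding st' by simp
   then show "s' * \<phi> z = 0" using \<phi> wc zc w(2)[OF \<phi>] by (simp add: smult_mult l_distr r_distr lin algebra_simps)
  qed
  have t': "t' = 0"
  proof (rule znz)
   fix \<phi> assume \<phi>: "\<phi> \<in> dual H"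
   have "\<phi> (w \<otimes> z [^] p) = \<phi> (z [^] p \<otimes> w)" using zn[OF \<phi>, of p] cz by simp
   then have "\<phi> (w \<otimes> (s' \<odot> w \<oplus> t' \<odot> z)) = \<phi> ((s' \<odot> w \<oplus> t' \<odot> z) \<otimes> w)" unfolding st' .
   then show "t' * \<phi> z = 0" using \<phi> wc zc w(2)[OF \<phi>] by (simp add: smult_mult l_distr r_distr lin algebra_simps)
  qed
  have "z [^] p = \<zero>" using st' s' t' wc zc by simp
  then show ?thesis using fin[OF w(1) zp iwz, of Case_e] ww wz by simp
 next
  case comm: True
  have cm: "u \<otimes> v = v \<otimes> u" if uv: "u \<in> primitives H" "v \<in> primitives H" for u v
  proof -
   obtain \<alpha> \<beta> where u: "u = \<alpha> \<odot> x \<oplus> \<beta> \<odot> y" using sp[OF x y xy uv(1)] by blast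
   obtain \<alpha>' \<beta>' where v: "v = \<alpha>' \<odot> x \<oplus> \<beta>' \<odot> y" using sp[OF x y xy uv(2)] by blast
   show ?thesis
    unfolding u v by (rule sep) (use xc yc comm in \<open>simp_all add: smult_mult l_distr r_distr lin algebra_simps\<close>)
  qed
  have Fl: "(\<alpha> \<odot> u \<oplus> \<beta> \<odot> v) [^] p = (\<alpha> ^ p) \<odot> (u [^] p) \<oplus> (\<beta> ^ p) \<odot> (v [^] p)" if uv: "u \<in> primitives H" "v \<in> primitives H" for u v \<alpha> \<beta>
   using freshman[OF char p _ _ cm[OF pcl(2)[OF uv(1,1)] pcl(2)[OF uv(2,2)]]] pc[OF uv(1)] pc[OF uv(2)] by (simp add: smult_pow)
  have Fs: "(\<alpha> \<odot> u) [^] p = (\<alpha> ^ p) \<odot> (u [^] p)" if "u \<in> primitives H" for u \<alpha> using pc[OF that] by (rule smult_pow)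
  have fin': ?thesis
   if "u \<in> primitives H" "v \<in> primitives H" "ind u v" "u [^] p = rhs_x i \<zero> u v" "v [^] p = rhs_y i \<zero> v" "i ~= Case_e" for u v i
  proof -
   have "rhs_c i \<zero> v = \<zero>" using that(6) by (cases i) auto
   then show ?thesis using fin[OF that(1-5)] cm[OF that(1,2)] pc[OF that(1)] pc[OF that(2)] by simp
  qed
  show ?thesis
  proof (cases "\<exists>z\<in>primitives H. z ~= \<zero> & z [^] p = \<zero>")
   case True
   then obtain z where z: "z \<in> primitives H" "z ~= \<zero>" "z [^] p = \<zero>" by blast
   obtain w where w: "w \<in> primitives H" "ind w z" using compl[OF z(1,2)] by blast
   note zc = pc[OF z(1)] and wc = pc[OF w(1)]
   obtain \<alpha> \<beta> where e: "w [^] p = \<alpha> \<odot> w \<oplus> \<beta> \<odot> z" using sp[OF w(1) z(1) w(2) prim_pow_char[OF char p w(1)]] by blast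
   show ?thesis
   proof (cases "\<alpha> = 0")
    case a0: True
    show ?thesis
    proof (cases "\<beta> = 0")
     case True
     then show ?thesis using fin'[OF w(1) z(1) w(2), of Case_a] e a0 z(3) wc zc by simp
    next
     case False
     have "ind w (\<beta> \<odot> z)"
      unfolding ind_def
     proof (intro allI impI)
      fix s t assume h: "\<forall>\<phi>\<in>dual H. s * \<phi> w + t * \<phi> (\<beta> \<odot> z) = 0"
      have "s * \<phi> w + (t * \<beta>) * \<phi> z = 0" if \<phi>: "\<phi> \<in> dual H" for \<phi>
       using bspec[OF h \<phi>] unfolding dual_smult[OF \<phi> zc] by (simp add: mult.assoc)
      then have "s = 0 & t * \<beta> = 0" using w(2) unfolding ind_def by blast
      then show "s = 0 & t = 0" using False by simp
     qed
     moreover have "(\<beta> \<odot> z) [^] p = \<zero>" using Fs[OF z(1)] z(3) by simp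
     moreover have "w [^] p = \<beta> \<odot> z" using e a0 wc zc by simp
     ultimately show ?thesis using fin'[OF w(1) pcl(2)[OF z(1,1)], of \<beta> Case_c] by simp
    qed
   next
    case False
    then obtain c where c: "c ~= 0" "c ^ p * \<alpha> = c" by (rule exists_root_inverse[OF _ p2])
    \<comment> \<open>As F z = 0, the p-th power of \<open>u\<close> is c^p (\<alpha> w + \<beta>
      z), and c^p \<alpha> = c makes this equal to \<open>u\<close>.\<close>
    define u where "u = c \<odot> w \<oplus> (c ^ p * \<beta>) \<odot> z"
    have up: "u \<in> primitives H" unfolding u_def by (rule pcl(1)[OF w(1) z(1)])
    have "u [^] p = (c ^ p) \<odot> (\<alpha> \<odot> w \<oplus> \<beta> \<odot> z) \<oplus> ((c ^ p * \<beta>) ^ p) \<odot> \<zero>"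
     unfolding u_def Fl[OF w(1) z(1)] e z(3) ..
    also have "... = u" unfolding u_def using c(2) wc zc by (simp add: smult_r_distr smult_assoc1[symmetric])
    finally have "u [^] p = u" .
    moreover have "ind u z"
     unfolding ind_def
    proof (intro allI impI)
     fix s t assume h: "\<forall>\<phi>\<in>dual H. s * \<phi> u + t * \<phi> z = 0"
     have "(s * c) * \<phi> w + (s * (c ^ p * \<beta>) + t) * \<phi> z = 0" if \<phi>: "\<phi> \<in> dual H" for \<phi>
     proof -
      have "\<phi> u = c * \<phi> w + c ^ p * \<beta> * \<phi> z" unfolding u_def using \<phi> wc zc by (simp add: lin)
      then show ?thesis using bspec[OF h \<phi>] by (simp add: algebra_simps)
     qed
     then have "s * c = 0 & s * (c ^ p * \<beta>) + t = 0" using w(2) unfolding ind_def by blast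
     then show "s = 0 & t = 0" using c(1) by auto
    qed
    ultimately show ?thesis using fin'[OF up z(1), of Case_b] z(3) by simp
   qed
  next
   case False
   then have inj: "z = \<zero>" if "z \<in> primitives H" "z [^] p = \<zero>" for z using that by blast
   \<comment> \<open>A fixed vector is found on the line of x if F preserves this line, and
     otherwise in terms of the basis x, F x.\<close>
   have "\<exists>u\<in>primitives H. u ~= \<zero> & u [^] p = u"
   proof -
    let ?Fx = "x [^] p"
    have Fx: "?Fx \<in> primitives H" by (rule prim_pow_char[OF char p x])
    note Fxc = pc[OF Fx]
    obtain a b where ab: "?Fx = a \<odot> x \<oplus> b \<odot> y" using sp[OF x y xy Fx] by blast
    have x0: "x ~= \<zero>"
    proof
     assume "x = \<zero>"
     then have "1 \<odot> x \<oplus> 0 \<odot> y = \<zero>" using yc by simp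
     from xy_free[OF this] show False by simp
    qed
    show ?thesis
    proof (cases "b = 0")
     case True
     then have e: "?Fx = a \<odot> x" using ab xc yc by simp
     have "a ~= 0" using inj[OF x] e x0 xc by auto
     then obtain c where c: "c ~= 0" "c ^ p * a = c" by (rule exists_root_inverse[OF _ p2])
     have "(c \<odot> x) [^] p = c \<odot> x" unfolding Fs[OF x] e using c(2) xc by (simp add: smult_assoc1[symmetric])
     moreover have "c \<odot> x ~= \<zero>"
     proof
      assume "c \<odot> x = \<zero>"
      then have "(1 / c) \<odot> (c \<odot> x) = \<zero>" by simp
      then show False using c(1) x0 xc by (simp add: smult_assoc1[symmetric])
     qed
     ultimately show ?thesis using pcl(2)[OF x x] by blast
    next
     case b: False
     have \<phi>F: "\<phi> ?Fx = a * \<phi> x + b * \<phi> y" if "\<phi> \<in> dual H" for \<phi> unfolding ab using that xc yc by (simp add: lin)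
     have iF: "ind x ?Fx"
      unfolding ind_def
     proof (intro allI impI)
      fix s t assume h: "\<forall>\<phi>\<in>dual H. s * \<phi> x + t * \<phi> ?Fx = 0"
      have "(s + t * a) * \<phi> x + (t * b) * \<phi> y = 0" if \<phi>: "\<phi> \<in> dual H" for \<phi>
       using bspec[OF h \<phi>] unfolding \<phi>F[OF \<phi>] by (simp add: algebra_simps)
      then have "s + t * a = 0 & t * b = 0" using xy unfolding ind_def by blast
      then show "s = 0 & t = 0" using b by auto
     qed
     obtain \<alpha> \<beta> where e: "?Fx [^] p = \<alpha> \<odot> x \<oplus> \<beta> \<odot> ?Fx" using sp[OF x Fx iF prim_pow_char[OF char p Fx]] by blast
     have "\<alpha> ~= 0 | \<beta> ~= 0"
     proof (rule ccontr)
      assume "~ ?thesis"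
      then have "?Fx [^] p = \<zero>" using e xc Fxc by simp
      then show False using inj[OF Fx] inj[OF x] x0 by blast
     qed
     then obtain d where d: "d ~= 0" "(d ^ p * \<alpha>) ^ p + d ^ p * \<beta> = d" by (rule exists_root_semilinear[OF _ p2])
     define u where "u = (d ^ p * \<alpha>) \<odot> x \<oplus> d \<odot> ?Fx"
     have up: "u \<in> primitives H" unfolding u_def by (rule pcl(1)[OF x Fx])
     have "u [^] p = ((d ^ p * \<alpha>) ^ p) \<odot> ?Fx \<oplus> (d ^ p) \<odot> (\<alpha> \<odot> x \<oplus> \<beta> \<odot> ?Fx)"
      unfolding u_def Fl[OF x Fx] e ..
     also have "... = (d ^ p * \<alpha>) \<odot> x \<oplus> ((d ^ p * \<alpha>) ^ p + d ^ p * \<beta>) \<odot> ?Fx"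
      by (rule sep) (use xc Fxc in \<open>simp_all add: lin algebra_simps del: nat_pow_Suc\<close>)
     finally have "u [^] p = u" unfolding d(2) u_def[symmetric] .
     moreover have "u ~= \<zero>"
     proof
      assume u0: "u = \<zero>"
      have "(d ^ p * \<alpha>) * \<phi> x + d * \<phi> ?Fx = 0" if \<phi>: "\<phi> \<in> dual H" for \<phi>
      proof -
       have "\<phi> u = (d ^ p * \<alpha>) * \<phi> x + d * \<phi> ?Fx" unfolding u_def using \<phi> xc Fxc by (simp add: lin)
       then show ?thesis using u0 dual_zero[OF \<phi>] by simp
      qed
      then show False using iF d(1) unfolding ind_def by blast
     qed
     ultimately show ?thesis using up by blast
    qed
   qed
   then obtain u where u: "u \<in> primitives H" "u ~= \<zero>" "u [^] p = u" by blast
   obtain w where w: "w \<in> primitives H" "ind w u" using compl[OF u(1,2)] by blast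
   note uc = pc[OF u(1)] and wc = pc[OF w(1)]
   obtain \<beta> \<alpha> where e: "w [^] p = \<beta> \<odot> w \<oplus> \<alpha> \<odot> u" using sp[OF w(1) u(1) w(2) prim_pow_char[OF char p w(1)]] by blast
   \<comment> \<open>Otherwise w + c u with c^p = - \<alpha> would be a nonzero vector killed by
     F.\<close>
   have "\<beta> ~= 0"
   proof
    assume b: "\<beta> = 0"
    obtain c where c: "c ^ p = - \<alpha>" using nth_root_exists[OF p] by blast
    have "(1 \<odot> w \<oplus> c \<odot> u) [^] p = (1 ^ p) \<odot> (\<beta> \<odot> w \<oplus> \<alpha> \<odot> u) \<oplus> (c ^ p) \<odot> u" unfolding Fl[OF w(1) u(1)] e u(3) ..
    also have "... = \<zero>" by (rule sep) (use wc uc b c in \<open>simp_all add: lin dual_zero\<close>)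
    finally have z: "1 \<odot> w \<oplus> c \<odot> u = \<zero>" by (rule inj[OF pcl(1)[OF w(1) u(1)]])
    have "1 * \<phi> w + c * \<phi> u = 0" if \<phi>: "\<phi> \<in> dual H" for \<phi>
     using dual_add[OF \<phi>, of "1 \<odot> w" "c \<odot> u"] dual_smult[OF \<phi>] dual_zero[OF \<phi>] z wc uc by simp
    then have "(1::'k) = 0 & c = 0" using w(2) unfolding ind_def by blast
    then show False by simp
   qed
   \<comment> \<open>\<open>d\<close> adjusts the coefficient of \<open>w\<close>, and
     \<open>c\<close> then adjusts that of the fixed vector \<open>u\<close>.\<close>
   then obtain d where d: "d ~= 0" "d ^ p * \<beta> = d" by (rule exists_root_inverse[OF _ p2])
   obtain c where c: "c ^ p + d ^ p * \<alpha> = c" by (rule exists_root_artin_schreier[OF p2])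
   define v where "v = d \<odot> w \<oplus> c \<odot> u"
   have vp: "v \<in> primitives H" unfolding v_def by (rule pcl(1)[OF w(1) u(1)])
   have "v [^] p = (d ^ p) \<odot> (\<beta> \<odot> w \<oplus> \<alpha> \<odot> u) \<oplus> (c ^ p) \<odot> u" unfolding v_def Fl[OF w(1) u(1)] e u(3) ..
   also have "... = (d ^ p * \<beta>) \<odot> w \<oplus> (c ^ p + d ^ p * \<alpha>) \<odot> u"
    by (rule sep) (use wc uc in \<open>simp_all add: lin algebra_simps\<close>)
   finally have "v [^] p = v" unfolding d(2) c v_def[symmetric] .
   moreover have "ind u v"
    unfolding ind_def
   proof (intro allI impI)
    fix s t assume h: "\<forall>\<phi>\<in>dual H. s * \<phi> u + t * \<phi> v = 0"
    have "(t * d) * \<phi> w + (s + t * c) * \<phi> u = 0" if \<phi>: "\<phi> \<in> dual H" for \<phi>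
    proof -
     have "\<phi> v = d * \<phi> w + c * \<phi> u" unfolding v_def using \<phi> wc uc by (simp add: lin)
     then show ?thesis using bspec[OF h \<phi>] by (simp add: algebra_simps)
    qed
    then have "t * d = 0 & s + t * c = 0" using w(2) unfolding ind_def by blast
    then show "s = 0 & t = 0" using d(1) by auto
   qed
   ultimately show ?thesis using fin'[OF u(1) vp, of Case_d] u(3) by simp
  qed
 qed
qed

section \<open>Invariants separating the five families\<close>

text \<open>Invariants of the restricted Lie algebra of primitive elements, chosen so that the first
  one singles out case e and the other three take different values on the cases a to d.\<close>

definition prim_type :: "nat => ('k::field, 'a, 'm) hopf_scheme => bool \<times> bool \<times> bool \<times> bool" where
 "prim_type p H =
  ((\<forall>z\<in>primitives H. \<forall>w\<in>primitives H. z \<otimes>\<^bsub>H\<^esub> w = w \<otimes>\<^bsub>H\<^esub> z),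
   (\<forall>z\<in>primitives H. z [^]\<^bsub>H\<^esub> p = \<zero>\<^bsub>H\<^esub>),
   (\<forall>z\<in>primitives H. (z [^]\<^bsub>H\<^esub> p) [^]\<^bsub>H\<^esub> p = \<zero>\<^bsub>H\<^esub>),
   (\<forall>z\<in>primitives H. z [^]\<^bsub>H\<^esub> p = \<zero>\<^bsub>H\<^esub> --> z = \<zero>\<^bsub>H\<^esub>))"

text \<open>Each property is universally quantified over primitive elements, so it can be pulled
  back along the injective map; the other direction comes from the inverse isomorphism.\<close>

lemma primitives_transfer:
 assumes "cospace H" "cospace L" "k_algebra H" "k_algebra L" "hopf_isomorphic H L"
 shows "(fst (prim_type p L) --> fst (prim_type p H)) &
  (fst (snd (prim_type p L)) --> fst (snd (prim_type p H))) &
  (fst (snd (snd (prim_type p L))) --> fst (snd (snd (prim_type p H)))) &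
  (snd (snd (snd (prim_type p L))) --> snd (snd (snd (prim_type p H))))"
proof -
 interpret H: cospace H by fact
 interpret L: cospace L by fact
 interpret HA: kalg H by (rule kalg.intro) fact
 interpret LA: kalg L by (rule kalg.intro) fact
 obtain f where f: "f \<in> alg_hom H L" "bij_betw f (carrier H) (carrier L)"
  "!!x \<phi> \<psi>. x \<in> carrier H ==> \<phi> \<in> dual L ==> \<psi> \<in> dual L ==> conv L \<phi> \<psi> (f x) = conv H (%a. \<phi> (f a)) (%a. \<psi> (f a)) x"
  using assms(5) unfolding hopf_isomorphic_iff[OF assms(1,2)] by blast
 note fh = alg_homD[OF f(1)]
 have eq: "z = w" if "f z = f w" "z \<in> carrier H" "w \<in> carrier H" for z w
  using f(2) that by (auto simp: bij_betw_def inj_on_def)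
 have z0: "f \<zero>\<^bsub>H\<^esub> = \<zero>\<^bsub>L\<^esub>" by (rule lin_maps_zero[OF H.vs L.vs fh(1)])
 have pc: "z \<in> carrier H" if "z \<in> primitives H" for z using that by (simp add: primitives_def)
 have pf: "f z \<in> primitives L" if z: "z \<in> primitives H" for z
  unfolding L.primitive_iff[OF LA.one_closed]
 proof (intro conjI ballI)
  show "f z \<in> carrier L" by (rule fh(2)[OF pc[OF z]])
  fix \<phi> \<psi> assume F: "\<phi> \<in> dual L" "\<psi> \<in> dual L"
  show "conv L \<phi> \<psi> (f z) = \<phi> (f z) * \<psi> \<one>\<^bsub>L\<^esub> + \<phi> \<one>\<^bsub>L\<^esub> * \<psi> (f z)"
   unfolding f(3)[OF pc[OF z] F] fh(3)[symmetric]
   using z dual_lin[OF fh(1) F(1)] dual_lin[OF fh(1) F(2)] unfolding H.primitive_iff[OF HA.one_closed] by blast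
 qed
 have pw: "f (u [^]\<^bsub>H\<^esub> p) = f u [^]\<^bsub>L\<^esub> p" if "u \<in> carrier H" for u
  by (rule alg_hom_pow[OF HA.ka LA.ka f(1) that])
 have c: "z \<otimes>\<^bsub>H\<^esub> w = w \<otimes>\<^bsub>H\<^esub> z" if "f z \<otimes>\<^bsub>L\<^esub> f w = f w \<otimes>\<^bsub>L\<^esub> f z" "z \<in> carrier H" "w \<in> carrier H" for z w
  by (rule eq) (use that fh(4) in simp_all)
 have k: "z [^]\<^bsub>H\<^esub> p = \<zero>\<^bsub>H\<^esub> \<longleftrightarrow> f z [^]\<^bsub>L\<^esub> p = \<zero>\<^bsub>L\<^esub>" if z: "z \<in> carrier H" for z
  using pw[OF z] z0 eq[OF _ HA.nat_pow_closed[OF z] H.zero_closed, of p] by auto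
 have k2: "(z [^]\<^bsub>H\<^esub> p) [^]\<^bsub>H\<^esub> p = \<zero>\<^bsub>H\<^esub> \<longleftrightarrow> (f z [^]\<^bsub>L\<^esub> p) [^]\<^bsub>L\<^esub> p = \<zero>\<^bsub>L\<^esub>" if z: "z \<in> carrier H" for z
  using k[OF HA.nat_pow_closed[OF z, of p]] pw[OF z] by simp
 show ?thesis
  unfolding prim_type_def fst_conv snd_conv
 proof (intro conjI impI ballI)
  fix z w assume "\<forall>z\<in>primitives L. \<forall>w\<in>primitives L. z \<otimes>\<^bsub>L\<^esub> w = w \<otimes>\<^bsub>L\<^esub> z" "z \<in> primitives H" "w \<in> primitives H"
  then show "z \<otimes>\<^bsub>H\<^esub> w = w \<otimes>\<^bsub>H\<^esub> z" using c pc pf by blast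
 next
  fix z assume "\<forall>z\<in>primitives L. z [^]\<^bsub>L\<^esub> p = \<zero>\<^bsub>L\<^esub>" "z \<in> primitives H"
  then show "z [^]\<^bsub>H\<^esub> p = \<zero>\<^bsub>H\<^esub>" using k pc pf by blast
 next
  fix z assume "\<forall>z\<in>primitives L. (z [^]\<^bsub>L\<^esub> p) [^]\<^bsub>L\<^esub> p = \<zero>\<^bsub>L\<^esub>" "z \<in> primitives H"
  then show "(z [^]\<^bsub>H\<^esub> p) [^]\<^bsub>H\<^esub> p = \<zero>\<^bsub>H\<^esub>" using k2 pc pf by blast
 next
  fix z assume a: "\<forall>z\<in>primitives L. z [^]\<^bsub>L\<^esub> p = \<zero>\<^bsub>L\<^esub> --> z = \<zero>\<^bsub>L\<^esub>" "z \<in> primitives H" "z [^]\<^bsub>H\<^esub> p = \<zero>\<^bsub>H\<^esub>"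
  then have "f z = f \<zero>\<^bsub>H\<^esub>" using k[OF pc] pf z0 by metis
  then show "z = \<zero>\<^bsub>H\<^esub>" by (rule eq) (use a(2) pc in auto)
 qed
qed

lemma prim_type_isomorphic:
 assumes "cospace H" "cospace L" "k_algebra H" "k_algebra L" "hopf_isomorphic H L"
 shows "prim_type p H = prim_type p L"
 using primitives_transfer[OF assms, of p] primitives_transfer[OF assms(2,1,4,3) hopf_iso_sym[OF assms], of p]
 by (auto simp: prod_eq_iff)

text \<open>Primitive elements are \<alpha> x + \<beta> y, and in the commutative cases their p-th
  power is \<alpha>^p x^p + \<beta>^p y^p. So the invariants become conditions on the table of right
  hand sides.\<close>

lemma prim_type_pres:
 assumes cp: "CHAR('k::field) = p" "p > 0"
 shows "fst (prim_type p (pres_hopf (relators p i) :: ('k, (gen list \<Rightarrow>\<^sub>0 'k) set) hopf)) \<longleftrightarrow> i ~= Case_e"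
  and "i ~= Case_e ==> snd (prim_type p (pres_hopf (relators p i) :: ('k, (gen list \<Rightarrow>\<^sub>0 'k) set) hopf)) = (i = Case_a, i \<in> {Case_a, Case_c}, i = Case_d)"
proof -
 let ?P = "pres_hopf (relators p i) :: ('k, (gen list \<Rightarrow>\<^sub>0 'k) set) hopf"
 let ?x = "pres_var (relators p i) Gen_x :: (gen list \<Rightarrow>\<^sub>0 'k) set" and ?y = "pres_var (relators p i) Gen_y :: (gen list \<Rightarrow>\<^sub>0 'k) set"
 interpret P: mono_basis ?P "pres_var (relators p i) Gen_g" ?x ?y p by (rule pres_mono_basis[OF cp])
 note sat = pres_gens(6)[OF cp, of i, unfolded satisfies_def]
 have x0: "?x ~= \<zero>\<^bsub>?P\<^esub>" using P.xy_free[of 1 0] P.xc P.yc by auto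
 have y0: "?y ~= \<zero>\<^bsub>?P\<^esub>" using P.xy_free[of 0 1] P.xc P.yc by auto
 have zp: "\<zero>\<^bsub>?P\<^esub> [^]\<^bsub>?P\<^esub> p = \<zero>\<^bsub>?P\<^esub>" using P.smult_pow[OF P.one_closed, of 0 p] cp(2) by (simp add: power_0_left)
 have xy: "?x \<otimes>\<^bsub>?P\<^esub> ?y = ?y \<otimes>\<^bsub>?P\<^esub> ?x" if "i ~= Case_e"
 proof -
  have "rhs_c i \<zero>\<^bsub>?P\<^esub> ?y = \<zero>\<^bsub>?P\<^esub>" using that by (cases i) simp_all
  then show ?thesis using sat P.xc P.yc by simp
 qed
 have ce: "?x \<otimes>\<^bsub>?P\<^esub> ?y ~= ?y \<otimes>\<^bsub>?P\<^esub> ?x" if "i = Case_e"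
 proof
  assume "?x \<otimes>\<^bsub>?P\<^esub> ?y = ?y \<otimes>\<^bsub>?P\<^esub> ?x"
  then have e: "?y \<otimes>\<^bsub>?P\<^esub> ?x = ?y \<otimes>\<^bsub>?P\<^esub> ?x \<oplus>\<^bsub>?P\<^esub> ?y" using sat that by simp
  have "\<phi> ?y = \<phi> \<zero>\<^bsub>?P\<^esub>" if \<phi>: "\<phi> \<in> dual ?P" for \<phi>
   using arg_cong[OF e, of \<phi>] dual_add[OF \<phi> P.m_closed[OF P.yc P.xc] P.yc] P.dual_zero[OF \<phi>] by simp
  then show False using P.sep[OF P.yc P.zero_closed] y0 by blast
 qed
 show "fst (prim_type p ?P) \<longleftrightarrow> i ~= Case_e"
 proof
  assume "fst (prim_type p ?P)"
  then show "i ~= Case_e" using ce P.x P.y unfolding prim_type_def by auto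
 next
  assume i: "i ~= Case_e"
  have "z \<otimes>\<^bsub>?P\<^esub> w = w \<otimes>\<^bsub>?P\<^esub> z" if zw: "z \<in> primitives ?P" "w \<in> primitives ?P" for z w
  proof -
   obtain \<alpha> \<beta> where u: "z = \<alpha> \<odot>\<^bsub>?P\<^esub> ?x \<oplus>\<^bsub>?P\<^esub> \<beta> \<odot>\<^bsub>?P\<^esub> ?y" using P.primitives_span[OF zw(1)] by blast
   obtain \<alpha>' \<beta>' where v: "w = \<alpha>' \<odot>\<^bsub>?P\<^esub> ?x \<oplus>\<^bsub>?P\<^esub> \<beta>' \<odot>\<^bsub>?P\<^esub> ?y" using P.primitives_span[OF zw(2)] by blast
   show ?thesis
    unfolding u v
    by (rule P.sep) (use P.xc P.yc xy[OF i] in \<open>simp_all add: P.smult_mult P.l_distr P.r_distr dual_add dual_smult algebra_simps\<close>)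
  qed
  then show "fst (prim_type p ?P)" by (simp add: prim_type_def)
 qed
 assume i: "i ~= Case_e"
 let ?X = "rhs_x i \<zero>\<^bsub>?P\<^esub> ?x ?y" and ?Y = "rhs_y i \<zero>\<^bsub>?P\<^esub> ?y"
 have XY: "?x [^]\<^bsub>?P\<^esub> p = ?X" "?y [^]\<^bsub>?P\<^esub> p = ?Y" using sat by auto
 have XYp: "?X \<in> primitives ?P" "?Y \<in> primitives ?P"
  using P.prim_pow_char[OF cp P.x] P.prim_pow_char[OF cp P.y] unfolding XY by blast+
 have F: "(\<alpha> \<odot>\<^bsub>?P\<^esub> ?x \<oplus>\<^bsub>?P\<^esub> \<beta> \<odot>\<^bsub>?P\<^esub> ?y) [^]\<^bsub>?P\<^esub> p = (\<alpha> ^ p) \<odot>\<^bsub>?P\<^esub> ?X \<oplus>\<^bsub>?P\<^esub> (\<beta> ^ p) \<odot>\<^bsub>?P\<^esub> ?Y" for \<alpha> \<beta>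
 proof -
  have "(\<alpha> \<odot>\<^bsub>?P\<^esub> ?x) \<otimes>\<^bsub>?P\<^esub> (\<beta> \<odot>\<^bsub>?P\<^esub> ?y) = (\<beta> \<odot>\<^bsub>?P\<^esub> ?y) \<otimes>\<^bsub>?P\<^esub> (\<alpha> \<odot>\<^bsub>?P\<^esub> ?x)"
   by (rule P.sep) (use P.xc P.yc xy[OF i] in \<open>simp_all add: P.smult_mult dual_smult algebra_simps\<close>)
  from P.freshman[OF cp _ _ this] show ?thesis using P.xc P.yc XY by (simp add: P.smult_pow)
 qed
 have all: "(\<forall>z\<in>primitives ?P. Q z) \<longleftrightarrow> (\<forall>\<alpha> \<beta>. Q (\<alpha> \<odot>\<^bsub>?P\<^esub> ?x \<oplus>\<^bsub>?P\<^esub> \<beta> \<odot>\<^bsub>?P\<^esub> ?y))" for Q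
 proof
  assume "\<forall>z\<in>primitives ?P. Q z"
  moreover have "\<alpha> \<odot>\<^bsub>?P\<^esub> ?x \<oplus>\<^bsub>?P\<^esub> \<beta> \<odot>\<^bsub>?P\<^esub> ?y \<in> primitives ?P" for \<alpha> \<beta>
   using P.prim_subsp P.x P.y by (simp add: subsp_def)
  ultimately show "\<forall>\<alpha> \<beta>. Q (\<alpha> \<odot>\<^bsub>?P\<^esub> ?x \<oplus>\<^bsub>?P\<^esub> \<beta> \<odot>\<^bsub>?P\<^esub> ?y)" by blast
 qed (use P.primitives_span in blast)
 have p0: "(0::'k) ^ p = 0" using cp(2) by simp
 have Xy: "(\<gamma> \<odot>\<^bsub>?P\<^esub> ?y) [^]\<^bsub>?P\<^esub> p = (\<gamma> ^ p) \<odot>\<^bsub>?P\<^esub> ?Y" for \<gamma> using P.smult_pow[OF P.yc, of \<gamma> p] XY by simp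
 note s = P.xc P.yc x0 y0 zp p0
 have Z1: "(\<forall>z\<in>primitives ?P. z [^]\<^bsub>?P\<^esub> p = \<zero>\<^bsub>?P\<^esub>) \<longleftrightarrow> i = Case_a"
  unfolding all F
 proof
  assume a: "\<forall>\<alpha> \<beta>. (\<alpha> ^ p) \<odot>\<^bsub>?P\<^esub> ?X \<oplus>\<^bsub>?P\<^esub> (\<beta> ^ p) \<odot>\<^bsub>?P\<^esub> ?Y = \<zero>\<^bsub>?P\<^esub>"
  have "?X = \<zero>\<^bsub>?P\<^esub>" using spec[OF spec[OF a, of 1], of 0] P.prim_carrier[OF XYp(1)] P.prim_carrier[OF XYp(2)] p0 by simp
  then show "i = Case_a" using x0 y0 i by (cases i) auto
 next
  assume "i = Case_a"
  then have "?X = \<zero>\<^bsub>?P\<^esub>" "?Y = \<zero>\<^bsub>?P\<^esub>" by simp_all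
  note XY0 = this
  show "\<forall>\<alpha> \<beta>. (\<alpha> ^ p) \<odot>\<^bsub>?P\<^esub> ?X \<oplus>\<^bsub>?P\<^esub> (\<beta> ^ p) \<odot>\<^bsub>?P\<^esub> ?Y = \<zero>\<^bsub>?P\<^esub>" unfolding XY0 by simp
 qed
 have Z2: "(\<forall>z\<in>primitives ?P. (z [^]\<^bsub>?P\<^esub> p) [^]\<^bsub>?P\<^esub> p = \<zero>\<^bsub>?P\<^esub>) \<longleftrightarrow> i \<in> {Case_a, Case_c}"
  unfolding all F
 proof
  assume a: "\<forall>\<alpha> \<beta>. ((\<alpha> ^ p) \<odot>\<^bsub>?P\<^esub> ?X \<oplus>\<^bsub>?P\<^esub> (\<beta> ^ p) \<odot>\<^bsub>?P\<^esub> ?Y) [^]\<^bsub>?P\<^esub> p = \<zero>\<^bsub>?P\<^esub>"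
  have "?X [^]\<^bsub>?P\<^esub> p = \<zero>\<^bsub>?P\<^esub>" using spec[OF spec[OF a, of 1], of 0] P.prim_carrier[OF XYp(1)] P.prim_carrier[OF XYp(2)] p0 by simp
  then show "i \<in> {Case_a, Case_c}" using x0 i XY by (cases i) auto
 next
  assume "i \<in> {Case_a, Case_c}"
  then have Y0: "?Y = \<zero>\<^bsub>?P\<^esub>" and X: "?X = \<zero>\<^bsub>?P\<^esub> | ?X = ?y" by auto
  show "\<forall>\<alpha> \<beta>. ((\<alpha> ^ p) \<odot>\<^bsub>?P\<^esub> ?X \<oplus>\<^bsub>?P\<^esub> (\<beta> ^ p) \<odot>\<^bsub>?P\<^esub> ?Y) [^]\<^bsub>?P\<^esub> p = \<zero>\<^bsub>?P\<^esub>"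
  proof (intro allI)
   fix \<alpha> \<beta>
   have "(\<alpha> ^ p) \<odot>\<^bsub>?P\<^esub> ?X \<oplus>\<^bsub>?P\<^esub> (\<beta> ^ p) \<odot>\<^bsub>?P\<^esub> ?Y = (\<alpha> ^ p) \<odot>\<^bsub>?P\<^esub> ?X"
    unfolding Y0 using P.prim_carrier[OF XYp(1)] by simp
   moreover have "((\<alpha> ^ p) \<odot>\<^bsub>?P\<^esub> ?X) [^]\<^bsub>?P\<^esub> p = \<zero>\<^bsub>?P\<^esub>"
    using X
   proof
    assume X: "?X = \<zero>\<^bsub>?P\<^esub>"
    show ?thesis unfolding X using zp by simp
   next
    assume X: "?X = ?y"
    show ?thesis unfolding X Xy Y0 by simp
   qed
   ultimately show "((\<alpha> ^ p) \<odot>\<^bsub>?P\<^esub> ?X \<oplus>\<^bsub>?P\<^esub> (\<beta> ^ p) \<odot>\<^bsub>?P\<^esub> ?Y) [^]\<^bsub>?P\<^esub> p = \<zero>\<^bsub>?P\<^esub>" by simp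
  qed
 qed
 have Z3: "(\<forall>z\<in>primitives ?P. z [^]\<^bsub>?P\<^esub> p = \<zero>\<^bsub>?P\<^esub> --> z = \<zero>\<^bsub>?P\<^esub>) \<longleftrightarrow> i = Case_d"
  unfolding all F
 proof
  assume a: "\<forall>\<alpha> \<beta>. (\<alpha> ^ p) \<odot>\<^bsub>?P\<^esub> ?X \<oplus>\<^bsub>?P\<^esub> (\<beta> ^ p) \<odot>\<^bsub>?P\<^esub> ?Y = \<zero>\<^bsub>?P\<^esub> --> \<alpha> \<odot>\<^bsub>?P\<^esub> ?x \<oplus>\<^bsub>?P\<^esub> \<beta> \<odot>\<^bsub>?P\<^esub> ?y = \<zero>\<^bsub>?P\<^esub>"
  have "?Y = \<zero>\<^bsub>?P\<^esub> --> ?y = \<zero>\<^bsub>?P\<^esub>" using spec[OF spec[OF a, of 0], of 1] P.prim_carrier[OF XYp(1)] P.prim_carrier[OF XYp(2)] p0 s by simp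
  then show "i = Case_d" using y0 by (cases i) auto
 next
  assume "i = Case_d"
  then have d: "?X = ?x" "?Y = ?y" by simp_all
  show "\<forall>\<alpha> \<beta>. (\<alpha> ^ p) \<odot>\<^bsub>?P\<^esub> ?X \<oplus>\<^bsub>?P\<^esub> (\<beta> ^ p) \<odot>\<^bsub>?P\<^esub> ?Y = \<zero>\<^bsub>?P\<^esub> --> \<alpha> \<odot>\<^bsub>?P\<^esub> ?x \<oplus>\<^bsub>?P\<^esub> \<beta> \<odot>\<^bsub>?P\<^esub> ?y = \<zero>\<^bsub>?P\<^esub>"
  proof (intro allI impI)
   fix \<alpha> \<beta> assume "(\<alpha> ^ p) \<odot>\<^bsub>?P\<^esub> ?X \<oplus>\<^bsub>?P\<^esub> (\<beta> ^ p) \<odot>\<^bsub>?P\<^esub> ?Y = \<zero>\<^bsub>?P\<^esub>"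
   then have "(\<alpha> ^ p) \<odot>\<^bsub>?P\<^esub> ?x \<oplus>\<^bsub>?P\<^esub> (\<beta> ^ p) \<odot>\<^bsub>?P\<^esub> ?y = \<zero>\<^bsub>?P\<^esub>" unfolding d .
   from P.xy_free[OF this] have "\<alpha> = 0" "\<beta> = 0" by simp_all
   then show "\<alpha> \<odot>\<^bsub>?P\<^esub> ?x \<oplus>\<^bsub>?P\<^esub> \<beta> \<odot>\<^bsub>?P\<^esub> ?y = \<zero>\<^bsub>?P\<^esub>" using P.xc P.yc by simp
  qed
 qed
 show "snd (prim_type p ?P) = (i = Case_a, i \<in> {Case_a, Case_c}, i = Case_d)"
  unfolding prim_type_def snd_conv Z1 Z2 Z3 ..
qed

lemma pres_not_isomorphic:
 assumes cp: "CHAR('k::field) = p" "p > 0" and ij: "i ~= j"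
 shows "~ hopf_isomorphic (pres_hopf (relators p i :: (gen list \<Rightarrow>\<^sub>0 'k) set)) (pres_hopf (relators p j :: (gen list \<Rightarrow>\<^sub>0 'k) set))"
proof
 let ?P = "%i. pres_hopf (relators p i :: (gen list \<Rightarrow>\<^sub>0 'k) set)"
 assume iso: "hopf_isomorphic (?P i) (?P j)"
 interpret Pi: prebialg "?P i" by (rule pres_prebialg[OF cp])
 interpret Pj: prebialg "?P j" by (rule pres_prebialg[OF cp])
 have e: "prim_type p (?P i) = prim_type p (?P j)"
  by (rule prim_type_isomorphic[OF Pi.cospace_axioms Pj.cospace_axioms Pi.ka Pj.ka iso])
 show False
 proof (cases "i = Case_e | j = Case_e")
  case True
  then show False using prim_type_pres(1)[OF cp, of i] prim_type_pres(1)[OF cp, of j] e ij by auto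
 next
  case False
  then have a: "snd (prim_type p (?P i)) = (i = Case_a, i \<in> {Case_a, Case_c}, i = Case_d)"
   and b: "snd (prim_type p (?P j)) = (j = Case_a, j \<in> {Case_a, Case_c}, j = Case_d)"
   using prim_type_pres(2)[OF cp] by blast+
  have "snd (prim_type p (?P i)) = snd (prim_type p (?P j))" unfolding e ..
  from trans[OF trans[OF a[symmetric] this] b]
  have "(i = Case_a, i \<in> {Case_a, Case_c}, i = Case_d) = (j = Case_a, j \<in> {Case_a, Case_c}, j = Case_d)" .
  then show False using False ij by (cases i; cases j) auto
 qed
qed

section \<open>The classification\<close>

theorem mainTheorem2:
  fixes p :: nat
  assumes "CHAR('k::alg_closed_field) = p" and "p > 0"
  shows "(\<forall>i. in_family p (pres_hopf (relators p i) :: ('k, (gen list \<Rightarrow>\<^sub>0 'k) set) hopf)) \<and>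
         (\<forall>i j. i \<noteq> j \<longrightarrow>
            \<not> hopf_isomorphic (pres_hopf (relators p i :: (gen list \<Rightarrow>\<^sub>0 'k) set))
                (pres_hopf (relators p j :: (gen list \<Rightarrow>\<^sub>0 'k) set))) \<and>
         (\<forall>H :: ('k, 'h) hopf. in_family p H \<longrightarrow>
            (\<exists>!i. hopf_isomorphic H (pres_hopf (relators p i))))"
proof (intro conjI allI impI)
 show "in_family p (pres_hopf (relators p i) :: ('k, (gen list \<Rightarrow>\<^sub>0 'k) set) hopf)" for i
  by (rule pres_in_family[OF assms])
 show ni: "~ hopf_isomorphic (pres_hopf (relators p i :: (gen list \<Rightarrow>\<^sub>0 'k) set)) (pres_hopf (relators p j :: (gen list \<Rightarrow>\<^sub>0 'k) set))"
  if "i ~= j" for i j by (rule pres_not_isomorphic[OF assms that])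
 fix H :: "('k, 'h) hopf"
 assume fam: "in_family p H"
 obtain u x y where g: "mono_basis H u x y p" "!!z. z \<in> primitives H ==> u \<otimes>\<^bsub>H\<^esub> z = z \<otimes>\<^bsub>H\<^esub> u"
  by (rule family_generators[OF fam assms]) blast
 obtain i x' y' where i: "mono_basis H u x' y' p" "satisfies p i H u x' y'"
  using exists_normal_form[OF g] by blast
 interpret H: mono_basis H u x' y' p by (rule i(1))
 have ba: "bialgebra H" using fam by (simp add: in_family_def hopf_algebra_def)
 have hi: "hopf_isomorphic H (pres_hopf (relators p i))" by (rule satisfies_isomorphic[OF i(1) ba i(2)])
 show "\<exists>!i. hopf_isomorphic H (pres_hopf (relators p i))"
 proof (rule ex1I[where a = i])
  show "hopf_isomorphic H (pres_hopf (relators p i))" by (rule hi)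
  \<comment> \<open>Two presented algebras isomorphic to the same H are isomorphic to each other,
    which is excluded for different labels.\<close>
  fix j assume hj: "hopf_isomorphic H (pres_hopf (relators p j))"
  interpret Pi: prebialg "pres_hopf (relators p i :: (gen list \<Rightarrow>\<^sub>0 'k) set)" by (rule pres_prebialg[OF assms])
  interpret Pj: prebialg "pres_hopf (relators p j :: (gen list \<Rightarrow>\<^sub>0 'k) set)" by (rule pres_prebialg[OF assms])
  have "hopf_isomorphic (pres_hopf (relators p j)) (pres_hopf (relators p i :: (gen list \<Rightarrow>\<^sub>0 'k) set))"
   by (rule hopf_isomorphic_trans[OF Pj.cospace_axioms H.cospace_axioms Pi.cospace_axioms
    hopf_iso_sym[OF H.cospace_axioms Pj.cospace_axioms H.ka Pj.ka hj] hi])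
  then show "j = i" using ni by blast
 qed
qed

end
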